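(* Let $\Lambda=kQ/(R)$ be a finite dimensional $k$-algebra presented by a quiver $Q=(Q_0,Q_1)$ with a minimal set of relations $R$ (i.e. $r\notin(R\setminus\{r\})$ for all $r\in R$). Let $P$ be a simple projective $\Lambda$-module, associated to a source $i$ of $Q$. Assume that $P$ gives rise to a $2$-APR tilting $\Lambda$-module $T$. Define a quiver $Q'=(Q_0',Q_1')$ by $$Q_0'=Q_0,\qquad Q_1'=\{a\in Q_1\mid \mathfrak s(a)\ne i\}\ \sqcup\ \{r^*\colon\mathfrak e(r)\to i\mid r\in R,\ \mathfrak s(r)=i\},$$ where $r^*$ is a new arrow for each $r\in R$ with $\mathfrak s(r)=i$. Write each $r\in R$ with $\mathfrak s(r)=i$ as $r=\sum_{a\in Q_1,\ \mathfrak s(a)=i}a\,r_a$, and for each $a\in Q_1$ with $\mathfrak s(a)=i$ define $$a^*:=\sum_{r\in R,\ \mathfrak s(r)=i}r_a r^*\in kQ',$$ and put $$R'=\{r\in R\mid\mathfrak s(r)\ne i\}\ \sqcup\ \{a^*\mid a\in Q_1,\ \mathfrak s(a)=i\}.$$ Then $\operatorname{End}_\Lambda(T)^{\mathrm{op}}$ is isomorphic to $kQ'/(R')$.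
   Context: All modules are finite dimensional left modules; $D=\operatorname{Hom}_k(-,k)$. Paths are composed from left to right ($ab$ means first $a$, then $b$), so simple projective modules correspond to sources of $Q$. $\mathfrak s(\cdot)$ and $\mathfrak e(\cdot)$ denote starting and ending vertex of arrows, paths and relations. "Presented by a quiver with relations" has the usual meaning: relations are linear combinations of paths of length at least $2$ with common starting and ending vertex, and $(R)$ is an admissible ideal. "$P$ gives rise to a $2$-APR tilting module" means: $\operatorname{Ext}^j_\Lambda(D\Lambda,P)=0$ for $j=0,1$ and $\operatorname{id}_\Lambda P=2$; then, writing $\Lambda=P\oplus P'$ with $P'$ the sum of the other indecomposable projectives, $T=(\tau_2^-P)\oplus P'$ where $\tau_2^-=\operatorname{Tr}\,\Omega D$ ($\operatorname{Tr}$ the transpose, $\Omega$ the syzygy, computed with minimal projective resolutions). *)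

theory Defs
  imports "HOL-Algebra.QuotRing" "HOL-Algebra.Module" "HOL-Library.Extended_Nat"
begin

text \<open>The ground field is a type \<open>'k\<close> of class \<open>field\<close>. A (noncommutative) \<open>'k\<close>-algebra is a ring
  in the sense of HOL-Algebra whose \<open>smult\<close> field is the action of \<open>'k\<close>; a left module over it is a
  record of the same kind, whose \<open>smult\<close> field is the action of the algebra (as everywhere in
  HOL-Algebra, the fields \<open>mult\<close> and \<open>one\<close> of a module are ignored). The library's locale
  \<open>module\<close> is restricted to commutative rings, hence the following variant. Right modules over
  \<open>A\<close> are left modules over \<open>opp A\<close>.\<close>

locale left_module = A?: ring A + M?: abelian_group M
  for A :: "('a, 'b) ring_scheme" (structure) and M :: "('a, 'm, 'c) module_scheme" (structure) +
  assumes smult_closed: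
      "\<lbrakk>a \<in> carrier A; x \<in> carrier M\<rbrakk> \<Longrightarrow> a \<odot>\<^bsub>M\<^esub> x \<in> carrier M"
    and smult_l_distr:
      "\<lbrakk>a \<in> carrier A; b \<in> carrier A; x \<in> carrier M\<rbrakk> \<Longrightarrow>
        (a \<oplus>\<^bsub>A\<^esub> b) \<odot>\<^bsub>M\<^esub> x = a \<odot>\<^bsub>M\<^esub> x \<oplus>\<^bsub>M\<^esub> b \<odot>\<^bsub>M\<^esub> x"
    and smult_r_distr:
      "\<lbrakk>a \<in> carrier A; x \<in> carrier M; y \<in> carrier M\<rbrakk> \<Longrightarrow>
        a \<odot>\<^bsub>M\<^esub> (x \<oplus>\<^bsub>M\<^esub> y) = a \<odot>\<^bsub>M\<^esub> x \<oplus>\<^bsub>M\<^esub> a \<odot>\<^bsub>M\<^esub> y"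
    and smult_assoc:
      "\<lbrakk>a \<in> carrier A; b \<in> carrier A; x \<in> carrier M\<rbrakk> \<Longrightarrow>
        (a \<otimes>\<^bsub>A\<^esub> b) \<odot>\<^bsub>M\<^esub> x = a \<odot>\<^bsub>M\<^esub> (b \<odot>\<^bsub>M\<^esub> x)"
    and smult_one: "x \<in> carrier M \<Longrightarrow> \<one>\<^bsub>A\<^esub> \<odot>\<^bsub>M\<^esub> x = x"

definition mk_module ::
    "'m set \<Rightarrow> ('m \<Rightarrow> 'm \<Rightarrow> 'm) \<Rightarrow> 'm \<Rightarrow> ('a \<Rightarrow> 'm \<Rightarrow> 'm) \<Rightarrow> ('a, 'm) module" where
  "mk_module C pl z act =
    \<lparr>carrier = C, mult = undefined, one = undefined, zero = z, add = pl, smult = act\<rparr>"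

definition opp :: "('a, 'b) monoid_scheme \<Rightarrow> ('a, 'b) monoid_scheme" where
  "opp A = A\<lparr>mult := \<lambda>x y. y \<otimes>\<^bsub>A\<^esub> x\<rparr>"

definition alg_quot :: "('k, 'a) module \<Rightarrow> 'a set \<Rightarrow> ('k, 'a set) module" where
  "alg_quot A I = \<lparr>carrier = carrier (A Quot I), mult = mult (A Quot I), one = one (A Quot I),
     zero = zero (A Quot I), add = add (A Quot I),
     smult = \<lambda>c X. \<Union>x\<in>X. I +>\<^bsub>A\<^esub> (c \<odot>\<^bsub>A\<^esub> x)\<rparr>"

definition alg_iso :: "('k, 'a) module \<Rightarrow> ('k, 'b) module \<Rightarrow> bool" where
  "alg_iso A B \<longleftrightarrow>
    (\<exists>f \<in> ring_iso A B. \<forall>c. \<forall>x \<in> carrier A. f (c \<odot>\<^bsub>A\<^esub> x) = c \<odot>\<^bsub>B\<^esub> f x)"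

text \<open>\<open>'k\<close> acts on \<open>M\<close> through \<open>c \<mapsto> c \<cdot> 1 \<in> A\<close>.\<close>

definition fdmod :: "('k::field, 'a) module \<Rightarrow> ('a, 'm) module \<Rightarrow> bool" where
  "fdmod A M \<longleftrightarrow> left_module A M \<and>
    (\<exists>B. finite B \<and> B \<subseteq> carrier M \<and>
      (\<forall>x \<in> carrier M. \<exists>c :: 'm \<Rightarrow> 'k. x = (\<Oplus>\<^bsub>M\<^esub>b\<in>B. (c b \<odot>\<^bsub>A\<^esub> \<one>\<^bsub>A\<^esub>) \<odot>\<^bsub>M\<^esub> b)))"

text \<open>Maps between modules are extensional, so that equality of elements of the sets \<open>mhom A M N\<close>
  is equality of homomorphisms.\<close>

definition mhom ::
    "('k, 'a) module \<Rightarrow> ('a, 'm) module \<Rightarrow> ('a, 'n) module \<Rightarrow> ('m \<Rightarrow> 'n) set" where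
  "mhom A M N = {f \<in> carrier M \<rightarrow>\<^sub>E carrier N.
     (\<forall>x \<in> carrier M. \<forall>y \<in> carrier M. f (x \<oplus>\<^bsub>M\<^esub> y) = f x \<oplus>\<^bsub>N\<^esub> f y) \<and>
     (\<forall>a \<in> carrier A. \<forall>x \<in> carrier M. f (a \<odot>\<^bsub>M\<^esub> x) = a \<odot>\<^bsub>N\<^esub> f x)}"

definition mod_iso :: "('k, 'a) module \<Rightarrow> ('a, 'm) module \<Rightarrow> ('a, 'n) module \<Rightarrow> bool" where
  "mod_iso A M N \<longleftrightarrow> (\<exists>f \<in> mhom A M N. bij_betw f (carrier M) (carrier N))"

definition End_alg :: "('k, 'a) module \<Rightarrow> ('a, 'm) module \<Rightarrow> ('k, 'm \<Rightarrow> 'm) module" where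
  "End_alg A M = \<lparr>carrier = mhom A M M,
     mult = \<lambda>g f. compose (carrier M) g f,
     one = (\<lambda>x\<in>carrier M. x),
     zero = (\<lambda>x\<in>carrier M. \<zero>\<^bsub>M\<^esub>),
     add = \<lambda>f g. \<lambda>x\<in>carrier M. f x \<oplus>\<^bsub>M\<^esub> g x,
     smult = \<lambda>c f. \<lambda>x\<in>carrier M. (c \<odot>\<^bsub>A\<^esub> \<one>\<^bsub>A\<^esub>) \<odot>\<^bsub>M\<^esub> f x\<rparr>"

definition reg_mod :: "('k, 'a) module \<Rightarrow> ('a, 'a) module" where
  "reg_mod A = mk_module (carrier A) (add A) \<zero>\<^bsub>A\<^esub> (mult A)"

definition left_ideal_mod :: "('k, 'a) module \<Rightarrow> 'a \<Rightarrow> ('a, 'a) module" where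
  "left_ideal_mod A e =
    mk_module {x \<otimes>\<^bsub>A\<^esub> e | x. x \<in> carrier A} (add A) \<zero>\<^bsub>A\<^esub> (mult A)"

definition dsum :: "('a, 'm) module \<Rightarrow> ('a, 'n) module \<Rightarrow> ('a, 'm \<times> 'n) module" where
  "dsum M N = mk_module (carrier M \<times> carrier N)
     (\<lambda>(x, y) (x', y'). (x \<oplus>\<^bsub>M\<^esub> x', y \<oplus>\<^bsub>N\<^esub> y')) (\<zero>\<^bsub>M\<^esub>, \<zero>\<^bsub>N\<^esub>)
     (\<lambda>a (x, y). (a \<odot>\<^bsub>M\<^esub> x, a \<odot>\<^bsub>N\<^esub> y))"

text \<open>\<open>D M = Hom\<^sub>k(M, k)\<close> for a left \<open>A\<close>-module \<open>M\<close>, as a left \<open>opp A\<close>-module: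
  \<open>(a \<cdot> f)(x) = f(a x)\<close>.\<close>

definition dual_mod :: "('k::field, 'a) module \<Rightarrow> ('a, 'm) module \<Rightarrow> ('a, 'm \<Rightarrow> 'k) module" where
  "dual_mod A M = mk_module
     {f \<in> extensional (carrier M).
        (\<forall>x \<in> carrier M. \<forall>y \<in> carrier M. f (x \<oplus>\<^bsub>M\<^esub> y) = f x + f y) \<and>
        (\<forall>c. \<forall>x \<in> carrier M. f ((c \<odot>\<^bsub>A\<^esub> \<one>\<^bsub>A\<^esub>) \<odot>\<^bsub>M\<^esub> x) = c * f x)}
     (\<lambda>f g. \<lambda>x\<in>carrier M. f x + g x) (\<lambda>x\<in>carrier M. 0)
     (\<lambda>a f. \<lambda>x\<in>carrier M. f (a \<odot>\<^bsub>M\<^esub> x))"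

text \<open>The injective cogenerator \<open>D A\<close>: the dual of \<open>A\<close> as a right module over itself. It is a left
  module over \<open>opp (opp A) = A\<close>.\<close>

definition D_reg :: "('k::field, 'a) module \<Rightarrow> ('a, 'a \<Rightarrow> 'k) module" where
  "D_reg A = dual_mod (opp A) (reg_mod (opp A))"

text \<open>\<open>Hom\<^sub>A(M, A)\<close> as a left \<open>opp A\<close>-module: \<open>(a \<cdot> g)(x) = g(x) a\<close>.\<close>

definition ring_dual :: "('k, 'a) module \<Rightarrow> ('a, 'm) module \<Rightarrow> ('a, 'm \<Rightarrow> 'a) module" where
  "ring_dual A M = mk_module (mhom A M (reg_mod A))
     (\<lambda>f g. \<lambda>x\<in>carrier M. f x \<oplus>\<^bsub>A\<^esub> g x) (\<lambda>x\<in>carrier M. \<zero>\<^bsub>A\<^esub>)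
     (\<lambda>a g. \<lambda>x\<in>carrier M. g x \<otimes>\<^bsub>A\<^esub> a)"

text \<open>A bound or existentially quantified module has elements in \<open>nat \<Rightarrow> 'k\<close>. This type contains
  a copy of \<open>k\<^sup>n\<close> for every \<open>n\<close>, so every finite dimensional module is isomorphic to one with
  carrier in it, and such quantifiers range over all finite dimensional modules up to isomorphism.\<close>

definition projective_mod :: "('k::field, 'a) module \<Rightarrow> ('a, 'm) module \<Rightarrow> bool" where
  "projective_mod A P \<longleftrightarrow> fdmod A P \<and>
    (\<forall>(X :: ('a, nat \<Rightarrow> 'k) module) (Y :: ('a, nat \<Rightarrow> 'k) module) p f.
       fdmod A X \<and> fdmod A Y \<and> p \<in> mhom A X Y \<and> p ` carrier X = carrier Y \<and> f \<in> mhom A P Y \<longrightarrow>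
       (\<exists>h \<in> mhom A P X. compose (carrier P) p h = f))"

definition injective_mod :: "('k::field, 'a) module \<Rightarrow> ('a, 'm) module \<Rightarrow> bool" where
  "injective_mod A I \<longleftrightarrow> fdmod A I \<and>
    (\<forall>(X :: ('a, nat \<Rightarrow> 'k) module) (Y :: ('a, nat \<Rightarrow> 'k) module) j f.
       fdmod A X \<and> fdmod A Y \<and> j \<in> mhom A X Y \<and> inj_on j (carrier X) \<and> f \<in> mhom A X I \<longrightarrow>
       (\<exists>h \<in> mhom A Y I. compose (carrier X) h j = f))"

definition simple_mod :: "('k::field, 'a) module \<Rightarrow> ('a, 'm) module \<Rightarrow> bool" where
  "simple_mod A M \<longleftrightarrow> fdmod A M \<and> carrier M \<noteq> {\<zero>\<^bsub>M\<^esub>} \<and>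
    (\<forall>U. submodule U A M \<longrightarrow> U = {\<zero>\<^bsub>M\<^esub>} \<or> U = carrier M)"

definition proj_resolution ::
    "('k::field, 'a) module \<Rightarrow> (nat \<Rightarrow> ('a, 'p) module) \<Rightarrow> (nat \<Rightarrow> 'p \<Rightarrow> 'p) \<Rightarrow> ('p \<Rightarrow> 'm)
      \<Rightarrow> ('a, 'm) module \<Rightarrow> bool" where
  "proj_resolution A P d \<epsilon> M \<longleftrightarrow>
     (\<forall>j. projective_mod A (P j)) \<and>
     \<epsilon> \<in> mhom A (P 0) M \<and> (\<forall>j. d j \<in> mhom A (P (Suc j)) (P j)) \<and>
     \<epsilon> ` carrier (P 0) = carrier M \<and>
     d 0 ` carrier (P 1) = a_kernel (P 0) M \<epsilon> \<and>
     (\<forall>j. d (Suc j) ` carrier (P (Suc (Suc j))) = a_kernel (P (Suc j)) (P j) (d j))"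

definition cocycles ::
    "('k, 'a) module \<Rightarrow> (nat \<Rightarrow> ('a, 'p) module) \<Rightarrow> (nat \<Rightarrow> 'p \<Rightarrow> 'p) \<Rightarrow> ('a, 'n) module
      \<Rightarrow> nat \<Rightarrow> ('p \<Rightarrow> 'n) set" where
  "cocycles A P d N n = {f \<in> mhom A (P n) N.
     compose (carrier (P (Suc n))) f (d n) = (\<lambda>x\<in>carrier (P (Suc n)). \<zero>\<^bsub>N\<^esub>)}"

fun coboundaries ::
    "('k, 'a) module \<Rightarrow> (nat \<Rightarrow> ('a, 'p) module) \<Rightarrow> (nat \<Rightarrow> 'p \<Rightarrow> 'p) \<Rightarrow> ('a, 'n) module
      \<Rightarrow> nat \<Rightarrow> ('p \<Rightarrow> 'n) set" where
  "coboundaries A P d N 0 = {\<lambda>x\<in>carrier (P 0). \<zero>\<^bsub>N\<^esub>}"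
| "coboundaries A P d N (Suc n) =
     (\<lambda>g. compose (carrier (P (Suc n))) g (d n)) ` mhom A (P n) N"

text \<open>\<open>Ext\<^sup>n\<^sub>A(M, N) = 0\<close>, where \<open>Ext\<close> is the cohomology of \<open>Hom\<^sub>A(P, N)\<close> for a projective
  resolution \<open>P\<close> of \<open>M\<close>. One exists for every finite dimensional module over a finite dimensional
  algebra, and the choice does not matter.\<close>

definition Ext_zero ::
    "('k::field, 'a) module \<Rightarrow> nat \<Rightarrow> ('a, 'm) module \<Rightarrow> ('a, 'n) module \<Rightarrow> bool" where
  "Ext_zero A n M N \<longleftrightarrow> (\<exists>(P :: nat \<Rightarrow> ('a, nat \<Rightarrow> 'k) module) d \<epsilon>.
     proj_resolution A P d \<epsilon> M \<and> cocycles A P d N n = coboundaries A P d N n)"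

definition inj_resolution ::
    "('k::field, 'a) module \<Rightarrow> ('a, 'm) module \<Rightarrow> ('m \<Rightarrow> 'i) \<Rightarrow> (nat \<Rightarrow> ('a, 'i) module)
      \<Rightarrow> (nat \<Rightarrow> 'i \<Rightarrow> 'i) \<Rightarrow> bool" where
  "inj_resolution A M \<eta> I d \<longleftrightarrow>
     (\<forall>j. injective_mod A (I j)) \<and>
     \<eta> \<in> mhom A M (I 0) \<and> (\<forall>j. d j \<in> mhom A (I j) (I (Suc j))) \<and>
     inj_on \<eta> (carrier M) \<and>
     \<eta> ` carrier M = a_kernel (I 0) (I 1) (d 0) \<and>
     (\<forall>j. d j ` carrier (I j) = a_kernel (I (Suc j)) (I (Suc (Suc j))) (d (Suc j)))"

definition inj_dim :: "('k::field, 'a) module \<Rightarrow> ('a, 'm) module \<Rightarrow> enat" where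
  "inj_dim A M = (INF n \<in> {n. \<exists>\<eta> (I :: nat \<Rightarrow> ('a, nat \<Rightarrow> 'k) module) d.
     inj_resolution A M \<eta> I d \<and> (\<forall>j > n. carrier (I j) = {\<zero>\<^bsub>I j\<^esub>})}. enat n)"

definition proj_cover ::
    "('k::field, 'a) module \<Rightarrow> ('a, 'p) module \<Rightarrow> ('p \<Rightarrow> 'm) \<Rightarrow> ('a, 'm) module \<Rightarrow> bool" where
  "proj_cover A P e M \<longleftrightarrow> projective_mod A P \<and> e \<in> mhom A P M \<and> e ` carrier P = carrier M \<and>
     (\<forall>U. submodule U A P \<and> U <+>\<^bsub>P\<^esub> a_kernel P M e = carrier P \<longrightarrow> U = carrier P)"

text \<open>\<open>\<Omega>\<close>, \<open>Tr\<close> and \<open>\<tau>\<^sub>2\<^sup>-\<close> are determined up to isomorphism only, and are rendered as relations: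
  \<open>is_syzygy A M Y\<close> means \<open>Y \<cong> \<Omega> M\<close>, \<open>is_transpose A M X\<close> means \<open>X \<cong> Tr M\<close>.\<close>

definition is_syzygy ::
    "('k::field, 'a) module \<Rightarrow> ('a, 'm) module \<Rightarrow> ('a, 'y) module \<Rightarrow> bool" where
  "is_syzygy A M Y \<longleftrightarrow> (\<exists>(P :: ('a, nat \<Rightarrow> 'k) module) e \<iota>.
     proj_cover A P e M \<and> fdmod A Y \<and>
     \<iota> \<in> mhom A Y P \<and> inj_on \<iota> (carrier Y) \<and> \<iota> ` carrier Y = a_kernel P M e)"

text \<open>\<open>Tr M\<close> is the cokernel of \<open>Hom(P\<^sub>0, A) \<rightarrow> Hom(P\<^sub>1, A)\<close> for a minimal projective presentation
  \<open>P\<^sub>1 \<rightarrow> P\<^sub>0 \<rightarrow> M \<rightarrow> 0\<close>.\<close>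

definition min_proj_presentation ::
    "('k::field, 'a) module \<Rightarrow> ('a, 'q) module \<Rightarrow> ('q \<Rightarrow> 'p) \<Rightarrow> ('a, 'p) module \<Rightarrow> ('p \<Rightarrow> 'm)
      \<Rightarrow> ('a, 'm) module \<Rightarrow> bool" where
  "min_proj_presentation A P1 d P0 e M \<longleftrightarrow>
     proj_cover A P0 e M \<and> proj_cover A P1 d (P0\<lparr>carrier := a_kernel P0 M e\<rparr>)"

definition is_transpose ::
    "('k::field, 'a) module \<Rightarrow> ('a, 'm) module \<Rightarrow> ('a, 'x) module \<Rightarrow> bool" where
  "is_transpose A M X \<longleftrightarrow>
     (\<exists>(P1 :: ('a, nat \<Rightarrow> 'k) module) d (P0 :: ('a, nat \<Rightarrow> 'k) module) e q.
       min_proj_presentation A P1 d P0 e M \<and> fdmod (opp A) X \<and>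
       q \<in> mhom (opp A) (ring_dual A P1) X \<and> q ` carrier (ring_dual A P1) = carrier X \<and>
       a_kernel (ring_dual A P1) X q =
         (\<lambda>g. compose (carrier P1) g d) ` carrier (ring_dual A P0))"

definition is_tau2_minus ::
    "('k::field, 'a) module \<Rightarrow> ('a, 'm) module \<Rightarrow> ('a, 'x) module \<Rightarrow> bool" where
  "is_tau2_minus A M X \<longleftrightarrow> (\<exists>Y :: ('a, nat \<Rightarrow> 'k) module.
     is_syzygy (opp A) (dual_mod A M) Y \<and> is_transpose (opp A) Y X)"

definition gives_2APR :: "('k::field, 'a) module \<Rightarrow> ('a, 'm) module \<Rightarrow> bool" where
  "gives_2APR A P \<longleftrightarrow>
     Ext_zero A 0 (D_reg A) P \<and> Ext_zero A 1 (D_reg A) P \<and> inj_dim A P = 2"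

text \<open>\<open>T \<cong> \<tau>\<^sub>2\<^sup>-P \<oplus> P'\<close> where \<open>A \<cong> P \<oplus> P'\<close>; the complement \<open>P'\<close> is unique up to isomorphism
  (Krull-Schmidt).\<close>

definition is_2APR_module ::
    "('k::field, 'a) module \<Rightarrow> ('a, 'm) module \<Rightarrow> ('a, 't) module \<Rightarrow> bool" where
  "is_2APR_module A P T \<longleftrightarrow> fdmod A T \<and>
     (\<exists>(P' :: ('a, nat \<Rightarrow> 'k) module) (X :: ('a, nat \<Rightarrow> 'k) module).
       fdmod A P' \<and> mod_iso A (reg_mod A) (dsum P P') \<and>
       is_tau2_minus A P X \<and> mod_iso A T (dsum X P'))"

record ('v, 'e) quiver =
  verts :: "'v set"
  arrows :: "'e set"
  src :: "'e \<Rightarrow> 'v"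
  tgt :: "'e \<Rightarrow> 'v"

definition finite_quiver :: "('v, 'e) quiver \<Rightarrow> bool" where
  "finite_quiver Q \<longleftrightarrow> finite (verts Q) \<and> finite (arrows Q) \<and>
     (\<forall>a \<in> arrows Q. src Q a \<in> verts Q \<and> tgt Q a \<in> verts Q)"

text \<open>A path is a pair of its starting vertex and the list of its arrows, composed from left to
  right; \<open>(v, [])\<close> is the trivial path at \<open>v\<close>.\<close>

type_synonym ('v, 'e) path = "'v \<times> 'e list"

fun is_path :: "('v, 'e) quiver \<Rightarrow> ('v, 'e) path \<Rightarrow> bool" where
  "is_path Q (v, []) \<longleftrightarrow> v \<in> verts Q"
| "is_path Q (v, a # as) \<longleftrightarrow> v \<in> verts Q \<and> a \<in> arrows Q \<and> src Q a = v \<and> is_path Q (tgt Q a, as)"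

fun path_end :: "('v, 'e) quiver \<Rightarrow> ('v, 'e) path \<Rightarrow> 'v" where
  "path_end Q (v, as) = (if as = [] then v else tgt Q (last as))"

text \<open>\<open>kQ\<close>: finitely supported functions on the paths. The coefficient of a path \<open>p\<close> in a product
  \<open>x y\<close> is the sum over all factorisations of \<open>p\<close> into an initial and a terminal piece.\<close>

definition path_algebra :: "('v, 'e) quiver \<Rightarrow> ('k::field, ('v, 'e) path \<Rightarrow> 'k) module" where
  "path_algebra Q = \<lparr>carrier = {x. finite {p. x p \<noteq> 0} \<and> (\<forall>p. x p \<noteq> 0 \<longrightarrow> is_path Q p)},
     mult = \<lambda>x y. \<lambda>(v, as). \<Sum>n\<le>length as.
       x (v, take n as) * y (path_end Q (v, take n as), drop n as),
     one = (\<lambda>(v, as). if v \<in> verts Q \<and> as = [] then 1 else 0),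
     zero = (\<lambda>_. 0),
     add = \<lambda>x y p. x p + y p,
     smult = \<lambda>c x p. c * x p\<rparr>"

definition path_elt :: "('v, 'e) path \<Rightarrow> ('v, 'e) path \<Rightarrow> 'k::field" where
  "path_elt p = (\<lambda>q. if q = p then 1 else 0)"

text \<open>The power \<open>J\<^sup>n\<close> of the ideal \<open>J\<close> of \<open>kQ\<close> generated by the arrows.\<close>

definition arrow_ideal_power :: "('v, 'e) quiver \<Rightarrow> nat \<Rightarrow> (('v, 'e) path \<Rightarrow> 'k::field) set" where
  "arrow_ideal_power Q n =
     {x \<in> carrier (path_algebra Q). \<forall>p. x p \<noteq> 0 \<longrightarrow> n \<le> length (snd p)}"

definition admissible :: "('v, 'e) quiver \<Rightarrow> (('v, 'e) path \<Rightarrow> 'k::field) set \<Rightarrow> bool" where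
  "admissible Q I \<longleftrightarrow> ideal I (path_algebra Q) \<and>
     (\<exists>n \<ge> 2. arrow_ideal_power Q n \<subseteq> I \<and> I \<subseteq> arrow_ideal_power Q 2)"

definition is_relation :: "('v, 'e) quiver \<Rightarrow> (('v, 'e) path \<Rightarrow> 'k::field) \<Rightarrow> bool" where
  "is_relation Q r \<longleftrightarrow> r \<in> carrier (path_algebra Q) \<and>
     (\<exists>u v. \<forall>p. r p \<noteq> 0 \<longrightarrow> 2 \<le> length (snd p) \<and> fst p = u \<and> path_end Q p = v)"

definition bound_quiver :: "('v, 'e) quiver \<Rightarrow> (('v, 'e) path \<Rightarrow> 'k::field) set \<Rightarrow> bool" where
  "bound_quiver Q R \<longleftrightarrow> finite_quiver Q \<and> (\<forall>r \<in> R. is_relation Q r) \<and>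
     admissible Q (Idl\<^bsub>path_algebra Q\<^esub> R)"

definition minimal_relations ::
    "('v, 'e) quiver \<Rightarrow> (('v, 'e) path \<Rightarrow> 'k::field) set \<Rightarrow> bool" where
  "minimal_relations Q R \<longleftrightarrow> (\<forall>r \<in> R. r \<notin> Idl\<^bsub>path_algebra Q\<^esub> (R - {r}))"

definition bound_path_algebra ::
    "('v, 'e) quiver \<Rightarrow> (('v, 'e) path \<Rightarrow> 'k::field) set
      \<Rightarrow> ('k, (('v, 'e) path \<Rightarrow> 'k) set) module" where
  "bound_path_algebra Q R = alg_quot (path_algebra Q) (Idl\<^bsub>path_algebra Q\<^esub> R)"

definition is_source :: "('v, 'e) quiver \<Rightarrow> 'v \<Rightarrow> bool" where
  "is_source Q i \<longleftrightarrow> i \<in> verts Q \<and> (\<forall>a \<in> arrows Q. tgt Q a \<noteq> i)"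

text \<open>The indecomposable projective left module at \<open>i\<close> is \<open>\<Lambda> e\<^sub>i\<close>, spanned by the paths ending in
  \<open>i\<close>.\<close>

definition proj_at ::
    "('v, 'e) quiver \<Rightarrow> (('v, 'e) path \<Rightarrow> 'k::field) set \<Rightarrow> 'v
      \<Rightarrow> ((('v, 'e) path \<Rightarrow> 'k) set, (('v, 'e) path \<Rightarrow> 'k) set) module" where
  "proj_at Q R i = left_ideal_mod (bound_path_algebra Q R)
     (Idl\<^bsub>path_algebra Q\<^esub> R +>\<^bsub>path_algebra Q\<^esub> path_elt (i, []))"

text \<open>Well defined for nonzero relations; the zero relation does not occur in a minimal set.\<close>

definition rel_src :: "(('v, 'e) path \<Rightarrow> 'k::field) \<Rightarrow> 'v" where
  "rel_src r = (THE v. \<forall>p. r p \<noteq> 0 \<longrightarrow> fst p = v)"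

definition rel_tgt :: "('v, 'e) quiver \<Rightarrow> (('v, 'e) path \<Rightarrow> 'k::field) \<Rightarrow> 'v" where
  "rel_tgt Q r = (THE v. \<forall>p. r p \<noteq> 0 \<longrightarrow> path_end Q p = v)"

definition rels_from :: "(('v, 'e) path \<Rightarrow> 'k::field) set \<Rightarrow> 'v \<Rightarrow> (('v, 'e) path \<Rightarrow> 'k) set" where
  "rels_from R i = {r \<in> R. rel_src r = i}"

text \<open>In \<open>Q'\<close> the arrow \<open>Inl a\<close> is the old arrow \<open>a\<close> and \<open>Inr r\<close> is the new arrow \<open>r\<^sup>*\<close>.\<close>

type_synonym ('v, 'e, 'k) new_arrow = "'e + (('v, 'e) path \<Rightarrow> 'k)"

definition new_quiver ::
    "('v, 'e) quiver \<Rightarrow> (('v, 'e) path \<Rightarrow> 'k::field) set \<Rightarrow> 'v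
      \<Rightarrow> ('v, ('v, 'e, 'k) new_arrow) quiver" where
  "new_quiver Q R i = \<lparr>verts = verts Q,
     arrows = Inl ` {a \<in> arrows Q. src Q a \<noteq> i} \<union> Inr ` rels_from R i,
     src = case_sum (src Q) (rel_tgt Q),
     tgt = case_sum (tgt Q) (\<lambda>_. i)\<rparr>"

text \<open>Elements of \<open>kQ\<close> supported on paths avoiding the arrows that start in \<open>i\<close>, seen in \<open>kQ'\<close>.\<close>

definition old_elt ::
    "(('v, 'e) path \<Rightarrow> 'k::field) \<Rightarrow> ('v, ('v, 'e, 'k) new_arrow) path \<Rightarrow> 'k" where
  "old_elt x = (\<lambda>(v, bs). if \<forall>b \<in> set bs. isl b then x (v, map projl bs) else 0)"

text \<open>The elements \<open>r\<^sub>a\<close> with \<open>r = \<Sum> a r\<^sub>a\<close>: the coefficient of \<open>r\<^sub>a\<close> at a path \<open>q\<close> starting in the end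
  of \<open>a\<close> is the coefficient of \<open>r\<close> at the path \<open>a q\<close>.\<close>

definition rel_comp ::
    "('v, 'e) quiver \<Rightarrow> (('v, 'e) path \<Rightarrow> 'k::field) \<Rightarrow> 'e \<Rightarrow> ('v, 'e) path \<Rightarrow> 'k" where
  "rel_comp Q r a = (\<lambda>(v, as). if v = tgt Q a then r (src Q a, a # as) else 0)"

text \<open>\<open>a\<^sup>* = \<Sum> r\<^sub>a r\<^sup>*\<close>. The sum is finite: a minimal set of relations generating an admissible ideal
  of the path algebra of a finite quiver is finite.\<close>

definition star_rel ::
    "('v, 'e) quiver \<Rightarrow> (('v, 'e) path \<Rightarrow> 'k::field) set \<Rightarrow> 'v \<Rightarrow> 'e
      \<Rightarrow> ('v, ('v, 'e, 'k) new_arrow) path \<Rightarrow> 'k" where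
  "star_rel Q R i a = (\<Oplus>\<^bsub>path_algebra (new_quiver Q R i)\<^esub> r \<in> rels_from R i.
     old_elt (rel_comp Q r a) \<otimes>\<^bsub>path_algebra (new_quiver Q R i)\<^esub> path_elt (rel_tgt Q r, [Inr r]))"

definition new_relations ::
    "('v, 'e) quiver \<Rightarrow> (('v, 'e) path \<Rightarrow> 'k::field) set \<Rightarrow> 'v
      \<Rightarrow> (('v, ('v, 'e, 'k) new_arrow) path \<Rightarrow> 'k) set" where
  "new_relations Q R i = old_elt ` {r \<in> R. rel_src r \<noteq> i} \<union>
     star_rel Q R i ` {a \<in> arrows Q. src Q a = i}"

end

theory Submission
  imports Defs "HOL-Library.Function_Algebras"
begin

text \<open>The row \<open>\<alpha>\<close> of the arrows starting in \<open>i\<close> and the matrix \<open>\<rho> = (r\<^sub>a)\<close> present the simple right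
  module \<open>D P\<close>: exactness holds because \<open>\<Lambda> = kQ/(R)\<close>, minimality because \<open>R\<close> is minimal. Hence
  \<open>\<tau>\<^sub>2\<^sup>-P\<close> is the cokernel of right multiplication by \<open>\<rho>\<close>, that is, it has generators \<open>g\<^sub>r\<close> with the
  relations \<open>\<Sum>\<^sub>r r\<^sub>a g\<^sub>r = 0\<close>, and \<open>T = \<tau>\<^sub>2\<^sup>-P \<oplus> \<Lambda>(1 - e\<^sub>i)\<close>. From \<open>id P = 2\<close> and \<open>Ext\<^sup>1(D\<Lambda>, P) = 0\<close>
  it follows that \<open>Hom(\<tau>\<^sub>2\<^sup>-P, \<Lambda>) = 0\<close> and \<open>End(\<tau>\<^sub>2\<^sup>-P) = k\<close>. So an endomorphism of \<open>T\<close> is determined by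
  the scalar \<open>c\<close> by which it acts on \<open>\<tau>\<^sub>2\<^sup>-P\<close> and the image \<open>q \<in> (1 - e\<^sub>i)T\<close> of \<open>p = 1 - e\<^sub>i\<close>, and both
  are arbitrary. Since \<open>i\<close> is a sink of \<open>Q'\<close>, an element of \<open>kQ'\<close> is \<open>c e\<^sub>i + o + \<Sum>\<^sub>r w\<^sub>r r\<^sup>*\<close> with \<open>o\<close>
  and \<open>w\<^sub>r\<close> in \<open>(1 - e\<^sub>i)kQ\<close>. Sending it to the endomorphism with scalar \<open>c\<close> and
  \<open>q = o p + \<Sum>\<^sub>r w\<^sub>r g\<^sub>r\<close> reverses products; it is onto, and it vanishes if and only if \<open>c = 0\<close>,
  \<open>o \<in> (R)\<close> and \<open>w\<^sub>r = \<Sum>\<^sub>a y\<^sub>a r\<^sub>a\<close> modulo \<open>(R)\<close> for some \<open>y\<^sub>a\<close>, which is membership in \<open>(R')\<close>.\<close>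

subsection \<open>Algebras and modules\<close>

text \<open>Dualising the presentation of DP gives the start P \<rightarrow> J0 \<rightarrow> J1
  \<rightarrow> J2 of a minimal injective resolution. Comparing it with an injective resolution that
  stops in degree 2 shows that J1 \<rightarrow> J2 is onto, hence that \<rho> z = 0 only for z = 0.
  A row y with y \<rho> = 0 describes a map from D\<Lambda> to J1, and the obstruction to lifting it
  to J0 is a class in Ext^1(D\<Lambda>, P); so y is a scalar multiple of \<alpha>. The vanishing of
  Hom(D\<Lambda>, P) guarantees an arrow starting in i, and from this a relation; then T has a
  generator g_r at which the scalar c is visible. Resolutions, covers and the complement P' are
  supplied by existential quantifiers, so every argument must cope with whichever module is given.
  Covers are made explicit by lifting generators and inverting a matrix that is unitriangular modulo
  a nilpotent radical; P' is located inside \<Lambda> by hand. Minimality of R acts through one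
  ideal, generated by the relations that do not start in i: it contains a y for every arrow a and
  every y in (R). This bounds the number of relations starting in i and puts the entries of a column
  z with \<rho> z = 0 into the radical.\<close>

locale kalg = ring A for A :: "('k::field, 'a) module" (structure) +
  assumes scal_closed [simp, intro]: "x \<in> carrier A \<Longrightarrow> c \<odot> x \<in> carrier A"
    and scal_l_distr: "x \<in> carrier A \<Longrightarrow> (c + d) \<odot> x = c \<odot> x \<oplus> d \<odot> x"
    and scal_r_distr: "\<lbrakk>x \<in> carrier A; y \<in> carrier A\<rbrakk> \<Longrightarrow> c \<odot> (x \<oplus> y) = c \<odot> x \<oplus> c \<odot> y"
    and scal_assoc: "x \<in> carrier A \<Longrightarrow> (c * d) \<odot> x = c \<odot> (d \<odot> x)"
    and scal_one [simp]: "x \<in> carrier A \<Longrightarrow> 1 \<odot> x = x"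
    and scal_mult_l: "\<lbrakk>x \<in> carrier A; y \<in> carrier A\<rbrakk> \<Longrightarrow> (c \<odot> x) \<otimes> y = c \<odot> (x \<otimes> y)"
    and scal_mult_r: "\<lbrakk>x \<in> carrier A; y \<in> carrier A\<rbrakk> \<Longrightarrow> x \<otimes> (c \<odot> y) = c \<odot> (x \<otimes> y)"

lemma (in kalg) is_kalg: "kalg A" ..

lemma (in kalg) scal_zero_r [simp]: "c \<odot> \<zero> = \<zero>"
  by (metis add.l_cancel_one' add.one_closed scal_closed scal_r_distr l_zero)

lemma (in kalg) scal_zero_l [simp]: "x \<in> carrier A \<Longrightarrow> 0 \<odot> x = \<zero>"
  by (metis add.l_cancel_one' add_0 scal_closed scal_l_distr)

lemma (in kalg) scal_eq_zero: "\<lbrakk>x \<in> carrier A; c \<odot> x = \<zero>; c \<noteq> 0\<rbrakk> \<Longrightarrow> x = \<zero>"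
  by (metis left_inverse scal_assoc scal_one scal_zero_r)

lemma opp_simps [simp]:
  "carrier (opp A) = carrier A" "\<one>\<^bsub>opp A\<^esub> = \<one>\<^bsub>A\<^esub>" "x \<otimes>\<^bsub>opp A\<^esub> y = y \<otimes>\<^bsub>A\<^esub> x"
  by (simp_all add: opp_def)

lemma opp_simps2 [simp]:
  fixes A :: "('k, 'a) module"
  shows "zero (opp A) = zero A" "add (opp A) = add A" "smult (opp A) = smult A" "opp (opp A) = A"
  by (simp_all add: opp_def)

lemma opp_finsum [simp]:
  fixes A :: "('k, 'a) module"
  shows "finsum (opp A) = finsum A"
  by (simp add: fun_eq_iff finsum_def finprod_def)

lemma opp_a_inv [simp]:
  fixes A :: "('k, 'a) module"
  shows "a_inv (opp A) = a_inv A" "a_minus (opp A) = a_minus A"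
  by (simp_all add: fun_eq_iff a_inv_def a_minus_def)

lemma (in kalg) kalg_opp: "kalg (opp A)"
proof -
  have "ring (opp A)"
    apply (rule ringI)
    subgoal by (rule abelian_groupI) (auto simp: a_ac intro: l_neg)
    subgoal by (rule monoidI) (auto simp: m_assoc)
    by (auto simp: l_distr r_distr)
  then show ?thesis
    by (intro kalg.intro kalg_axioms.intro)
      (auto simp: scal_l_distr scal_r_distr scal_assoc scal_mult_l scal_mult_r)
qed

text \<open>The field acts through \<open>c \<odot> \<one>\<close>, exactly as in
  \<open>fdmod\<close>. With a name for this action the linear algebra below can be carried out
  inside A-modules, without a second module structure.\<close>

definition ks :: "('k, 'a) module \<Rightarrow> ('a, 'm) module \<Rightarrow> 'k \<Rightarrow> 'm \<Rightarrow> 'm" where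
  "ks A M c x = (c \<odot>\<^bsub>A\<^esub> \<one>\<^bsub>A\<^esub>) \<odot>\<^bsub>M\<^esub> x"

locale kmod = left_module A M + kalg A
  for A :: "('k::field, 'a) module" (structure) and M :: "('a, 'm) module" (structure)
begin

declare smult_closed [simp, intro]
declare smult_one [simp]

lemma is_kmod: "kmod A M" ..

lemma M_minus_self [simp]: "x \<in> carrier M \<Longrightarrow> x \<ominus>\<^bsub>M\<^esub> x = \<zero>\<^bsub>M\<^esub>"
  by (simp add: M.minus_eq M.r_neg)

lemma M_diff_eq: "\<lbrakk>x \<in> carrier M; y \<in> carrier M; z \<in> carrier M\<rbrakk> \<Longrightarrow>
    (x \<ominus>\<^bsub>M\<^esub> y = z) = (x = z \<oplus>\<^bsub>M\<^esub> y)"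
  by (metis M.add.inv_solve_right M.minus_eq)

lemma M_diff_add [simp]: "\<lbrakk>x \<in> carrier M; y \<in> carrier M\<rbrakk> \<Longrightarrow> (x \<ominus>\<^bsub>M\<^esub> y) \<oplus>\<^bsub>M\<^esub> y = x"
  by (metis M_diff_eq M.minus_closed)

lemma smult_zero_r [simp]: "a \<in> carrier A \<Longrightarrow> a \<odot>\<^bsub>M\<^esub> \<zero>\<^bsub>M\<^esub> = \<zero>\<^bsub>M\<^esub>"
  using smult_r_distr[of a "\<zero>\<^bsub>M\<^esub>" "\<zero>\<^bsub>M\<^esub>"] by (simp add: M.add.r_cancel_one')

lemma smult_zero_l [simp]: "x \<in> carrier M \<Longrightarrow> \<zero> \<odot>\<^bsub>M\<^esub> x = \<zero>\<^bsub>M\<^esub>"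
  using smult_l_distr[of \<zero> \<zero> x] by (simp add: M.add.r_cancel_one')

lemma smult_minus_r:
  "\<lbrakk>a \<in> carrier A; x \<in> carrier M\<rbrakk> \<Longrightarrow> a \<odot>\<^bsub>M\<^esub> (\<ominus>\<^bsub>M\<^esub> x) = \<ominus>\<^bsub>M\<^esub> (a \<odot>\<^bsub>M\<^esub> x)"
  using smult_r_distr[of a "\<ominus>\<^bsub>M\<^esub> x" x] by (simp add: M.l_neg M.minus_equality)

lemma smult_minus_l:
  "\<lbrakk>a \<in> carrier A; x \<in> carrier M\<rbrakk> \<Longrightarrow> (\<ominus> a) \<odot>\<^bsub>M\<^esub> x = \<ominus>\<^bsub>M\<^esub> (a \<odot>\<^bsub>M\<^esub> x)"
  using smult_l_distr[of "\<ominus> a" a x] by (simp add: A.l_neg M.minus_equality)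

lemma smult_diff_r: "\<lbrakk>a \<in> carrier A; x \<in> carrier M; y \<in> carrier M\<rbrakk> \<Longrightarrow>
    a \<odot>\<^bsub>M\<^esub> (x \<ominus>\<^bsub>M\<^esub> y) = a \<odot>\<^bsub>M\<^esub> x \<ominus>\<^bsub>M\<^esub> a \<odot>\<^bsub>M\<^esub> y"
  by (simp add: M.minus_eq smult_r_distr smult_minus_r)

lemma smult_diff_l: "\<lbrakk>a \<in> carrier A; b \<in> carrier A; x \<in> carrier M\<rbrakk> \<Longrightarrow>
    (a \<ominus> b) \<odot>\<^bsub>M\<^esub> x = a \<odot>\<^bsub>M\<^esub> x \<ominus>\<^bsub>M\<^esub> b \<odot>\<^bsub>M\<^esub> x"
  by (simp add: A.minus_eq M.minus_eq smult_l_distr smult_minus_l)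

lemma ks_closed [simp, intro]: "x \<in> carrier M \<Longrightarrow> ks A M c x \<in> carrier M"
  by (simp add: ks_def)

lemma ks_l_distr: "x \<in> carrier M \<Longrightarrow> ks A M (c + d) x = ks A M c x \<oplus>\<^bsub>M\<^esub> ks A M d x"
  by (simp add: ks_def scal_l_distr smult_l_distr)

lemma ks_r_distr: "\<lbrakk>x \<in> carrier M; y \<in> carrier M\<rbrakk> \<Longrightarrow>
    ks A M c (x \<oplus>\<^bsub>M\<^esub> y) = ks A M c x \<oplus>\<^bsub>M\<^esub> ks A M c y"
  by (simp add: ks_def smult_r_distr)

lemma ks_smult_l: "\<lbrakk>a \<in> carrier A; x \<in> carrier M\<rbrakk> \<Longrightarrow>
    (c \<odot> a) \<odot>\<^bsub>M\<^esub> x = ks A M c (a \<odot>\<^bsub>M\<^esub> x)"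
  by (simp add: ks_def smult_assoc[symmetric] scal_mult_l)

lemma ks_smult_r: "\<lbrakk>a \<in> carrier A; x \<in> carrier M\<rbrakk> \<Longrightarrow>
    a \<odot>\<^bsub>M\<^esub> ks A M c x = ks A M c (a \<odot>\<^bsub>M\<^esub> x)"
  by (simp add: ks_def smult_assoc[symmetric] scal_mult_l scal_mult_r)

lemma ks_assoc: "x \<in> carrier M \<Longrightarrow> ks A M (c * d) x = ks A M c (ks A M d x)"
  by (metis ks_def ks_smult_l scal_assoc one_closed scal_closed)

lemma ks_one [simp]: "x \<in> carrier M \<Longrightarrow> ks A M 1 x = x"
  by (simp add: ks_def)

lemma ks_zero_l [simp]: "x \<in> carrier M \<Longrightarrow> ks A M 0 x = \<zero>\<^bsub>M\<^esub>"
  by (simp add: ks_def)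

lemma ks_zero_r [simp]: "ks A M c \<zero>\<^bsub>M\<^esub> = \<zero>\<^bsub>M\<^esub>"
  by (simp add: ks_def)

lemma ks_minus: "x \<in> carrier M \<Longrightarrow> ks A M (- c) x = \<ominus>\<^bsub>M\<^esub> ks A M c x"
  using ks_l_distr[of x "- c" c] by (simp add: M.minus_equality)

lemma ks_minus_r: "x \<in> carrier M \<Longrightarrow> ks A M c (\<ominus>\<^bsub>M\<^esub> x) = \<ominus>\<^bsub>M\<^esub> ks A M c x"
  by (simp add: ks_def smult_minus_r)

lemma ks_diff_l: "x \<in> carrier M \<Longrightarrow> ks A M (c - d) x = ks A M c x \<ominus>\<^bsub>M\<^esub> ks A M d x"
  using ks_l_distr[of x c "- d"] by (simp add: ks_minus M.minus_eq)

lemma ks_inverse: "\<lbrakk>x \<in> carrier M; c \<noteq> 0\<rbrakk> \<Longrightarrow> ks A M (inverse c) (ks A M c x) = x"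
  by (simp add: ks_assoc[symmetric])

lemma ks_eq_zero: "\<lbrakk>x \<in> carrier M; ks A M c x = \<zero>\<^bsub>M\<^esub>; c \<noteq> 0\<rbrakk> \<Longrightarrow> x = \<zero>\<^bsub>M\<^esub>"
  using ks_inverse[of x c] by simp

end

lemma mk_module_simps [simp]:
  "carrier (mk_module C pl z act) = C" "add (mk_module C pl z act) = pl"
  "zero (mk_module C pl z act) = z" "smult (mk_module C pl z act) = act"
  by (simp_all add: mk_module_def)

text \<open>Additive inverses need not be supplied: \<open>(\<ominus> \<one>) \<odot> x\<close> is
  one. The argument needs \<open>zero_smult\<close> as a separate condition, because it cannot be
  cancelled out of distributivity before inverses exist.\<close>

lemma (in kalg) kmod_intro:
  assumes "\<zero>\<^bsub>M\<^esub> \<in> carrier M"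
    "\<And>x y. \<lbrakk>x \<in> carrier M; y \<in> carrier M\<rbrakk> \<Longrightarrow> x \<oplus>\<^bsub>M\<^esub> y \<in> carrier M"
    "\<And>x y z. \<lbrakk>x \<in> carrier M; y \<in> carrier M; z \<in> carrier M\<rbrakk> \<Longrightarrow>
        (x \<oplus>\<^bsub>M\<^esub> y) \<oplus>\<^bsub>M\<^esub> z = x \<oplus>\<^bsub>M\<^esub> (y \<oplus>\<^bsub>M\<^esub> z)"
    "\<And>x y. \<lbrakk>x \<in> carrier M; y \<in> carrier M\<rbrakk> \<Longrightarrow> x \<oplus>\<^bsub>M\<^esub> y = y \<oplus>\<^bsub>M\<^esub> x"
    "\<And>x. x \<in> carrier M \<Longrightarrow> \<zero>\<^bsub>M\<^esub> \<oplus>\<^bsub>M\<^esub> x = x"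
    "\<And>a x. \<lbrakk>a \<in> carrier A; x \<in> carrier M\<rbrakk> \<Longrightarrow> a \<odot>\<^bsub>M\<^esub> x \<in> carrier M"
    "\<And>a b x. \<lbrakk>a \<in> carrier A; b \<in> carrier A; x \<in> carrier M\<rbrakk> \<Longrightarrow>
        (a \<oplus> b) \<odot>\<^bsub>M\<^esub> x = a \<odot>\<^bsub>M\<^esub> x \<oplus>\<^bsub>M\<^esub> b \<odot>\<^bsub>M\<^esub> x"
    "\<And>a x y. \<lbrakk>a \<in> carrier A; x \<in> carrier M; y \<in> carrier M\<rbrakk> \<Longrightarrow>
        a \<odot>\<^bsub>M\<^esub> (x \<oplus>\<^bsub>M\<^esub> y) = a \<odot>\<^bsub>M\<^esub> x \<oplus>\<^bsub>M\<^esub> a \<odot>\<^bsub>M\<^esub> y"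
    "\<And>a b x. \<lbrakk>a \<in> carrier A; b \<in> carrier A; x \<in> carrier M\<rbrakk> \<Longrightarrow>
        (a \<otimes> b) \<odot>\<^bsub>M\<^esub> x = a \<odot>\<^bsub>M\<^esub> (b \<odot>\<^bsub>M\<^esub> x)"
    "\<And>x. x \<in> carrier M \<Longrightarrow> \<one> \<odot>\<^bsub>M\<^esub> x = x"
    and zero_smult: "\<And>x. x \<in> carrier M \<Longrightarrow> \<zero> \<odot>\<^bsub>M\<^esub> x = \<zero>\<^bsub>M\<^esub>"
  shows "kmod A M"
proof -
  have "\<exists>y\<in>carrier M. y \<oplus>\<^bsub>M\<^esub> x = \<zero>\<^bsub>M\<^esub>" if x: "x \<in> carrier M" for x
  proof
    show "(\<ominus> \<one>) \<odot>\<^bsub>M\<^esub> x \<in> carrier M" using assms x by simp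
    have "(\<ominus> \<one>) \<odot>\<^bsub>M\<^esub> x \<oplus>\<^bsub>M\<^esub> x = (\<ominus> \<one>) \<odot>\<^bsub>M\<^esub> x \<oplus>\<^bsub>M\<^esub> \<one> \<odot>\<^bsub>M\<^esub> x" using assms(10) x by simp
    also have "\<dots> = (\<ominus> \<one> \<oplus> \<one>) \<odot>\<^bsub>M\<^esub> x" using assms(7)[of "\<ominus> \<one>" \<one> x] x by simp
    also have "\<dots> = \<zero>\<^bsub>M\<^esub>" using x by (simp add: l_neg zero_smult)
    finally show "(\<ominus> \<one>) \<odot>\<^bsub>M\<^esub> x \<oplus>\<^bsub>M\<^esub> x = \<zero>\<^bsub>M\<^esub>" .
  qed
  then have "abelian_group M" using assms by (intro abelian_groupI) auto
  then show ?thesis using assms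
    by (intro kmod.intro left_module.intro left_module_axioms.intro) (auto intro: is_kalg ring_axioms)
qed

lemma (in kalg) fdmod_kmod: "fdmod A M \<Longrightarrow> kmod A M"
  by (simp add: fdmod_def kmod_def is_kalg)

lemma reg_mod_simps [simp]:
  "carrier (reg_mod A) = carrier A" "add (reg_mod A) = add A" "zero (reg_mod A) = zero A"
  "smult (reg_mod A) = mult A"
  by (simp_all add: reg_mod_def)

lemma reg_mod_finsum [simp]: "finsum (reg_mod A) = finsum A"
  by (simp add: fun_eq_iff finsum_def finprod_def)

lemma reg_mod_a_inv [simp]: "a_inv (reg_mod A) = a_inv A" "a_minus (reg_mod A) = a_minus A"
  by (simp_all add: fun_eq_iff a_inv_def a_minus_def m_inv_def)

lemma (in kalg) reg_kmod: "kmod A (reg_mod A)"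
  by (rule kmod_intro) (auto simp: a_ac l_distr r_distr m_assoc)

lemma (in kalg) ks_reg [simp]: "x \<in> carrier A \<Longrightarrow> ks A (reg_mod A) c x = c \<odot> x"
  by (simp add: ks_def scal_mult_l)

lemma ks_opp [simp]:
  fixes A :: "('k, 'a) module"
  shows "ks (opp A) M = ks A M" by (simp add: ks_def fun_eq_iff)

subsection \<open>Homomorphisms\<close>

text \<open>Homomorphisms without the extensionality of \<open>mhom\<close>, so that composites,
  differences and row-times-column maps can be written as plain functions;
  \<open>lin_restrict_mhom\<close> goes back where a definition demands \<open>mhom\<close>.\<close>

definition lin :: "('k, 'a) module \<Rightarrow> ('a, 'm) module \<Rightarrow> ('a, 'n) module \<Rightarrow> ('m \<Rightarrow> 'n) \<Rightarrow> bool" where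
  "lin A M N f \<longleftrightarrow> (\<forall>x\<in>carrier M. f x \<in> carrier N) \<and>
     (\<forall>x\<in>carrier M. \<forall>y\<in>carrier M. f (x \<oplus>\<^bsub>M\<^esub> y) = f x \<oplus>\<^bsub>N\<^esub> f y) \<and>
     (\<forall>a\<in>carrier A. \<forall>x\<in>carrier M. f (a \<odot>\<^bsub>M\<^esub> x) = a \<odot>\<^bsub>N\<^esub> f x)"

lemma mhom_iff: "f \<in> mhom A M N \<longleftrightarrow> lin A M N f \<and> f \<in> extensional (carrier M)"
  by (auto simp: mhom_def lin_def PiE_def Pi_def)

lemma linI:
  assumes "\<And>x. x \<in> carrier M \<Longrightarrow> f x \<in> carrier N"
    "\<And>x y. \<lbrakk>x \<in> carrier M; y \<in> carrier M\<rbrakk> \<Longrightarrow> f (x \<oplus>\<^bsub>M\<^esub> y) = f x \<oplus>\<^bsub>N\<^esub> f y"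
    "\<And>a x. \<lbrakk>a \<in> carrier A; x \<in> carrier M\<rbrakk> \<Longrightarrow> f (a \<odot>\<^bsub>M\<^esub> x) = a \<odot>\<^bsub>N\<^esub> f x"
  shows "lin A M N f"
  using assms by (auto simp: lin_def)

lemma linD:
  assumes "lin A M N f"
  shows "x \<in> carrier M \<Longrightarrow> f x \<in> carrier N"
    "\<lbrakk>x \<in> carrier M; y \<in> carrier M\<rbrakk> \<Longrightarrow> f (x \<oplus>\<^bsub>M\<^esub> y) = f x \<oplus>\<^bsub>N\<^esub> f y"
    "\<lbrakk>a \<in> carrier A; x \<in> carrier M\<rbrakk> \<Longrightarrow> f (a \<odot>\<^bsub>M\<^esub> x) = a \<odot>\<^bsub>N\<^esub> f x"
  using assms by (auto simp: lin_def)

lemma lin_cong: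
  assumes "lin A M N f" "\<And>x. x \<in> carrier M \<Longrightarrow> f x = g x" "kmod A M"
  shows "lin A M N g"
proof -
  interpret kmod A M by fact
  show ?thesis using assms(1) by (intro linI) (auto simp: linD assms(2)[symmetric])
qed

lemma lin_restrict_mhom:
  assumes "kmod A M" "lin A M N f"
  shows "restrict f (carrier M) \<in> mhom A M N"
  using lin_cong[OF assms(2) _ assms(1), of "restrict f (carrier M)"] by (simp add: mhom_iff)

lemma lin_comp: "lin A M N f \<Longrightarrow> lin A N K g \<Longrightarrow> lin A M K (\<lambda>x. g (f x))"
  by (auto simp: lin_def)

lemma lin_id: "lin A M M (\<lambda>x. x)"
  by (auto simp: lin_def)

lemma lin_zero:
  assumes "kmod A M" "kmod A N" "lin A M N f"
  shows "f \<zero>\<^bsub>M\<^esub> = \<zero>\<^bsub>N\<^esub>"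
proof -
  interpret M: kmod A M by fact
  interpret N: kmod A N by fact
  have "f (\<zero>\<^bsub>A\<^esub> \<odot>\<^bsub>M\<^esub> \<zero>\<^bsub>M\<^esub>) = \<zero>\<^bsub>A\<^esub> \<odot>\<^bsub>N\<^esub> f \<zero>\<^bsub>M\<^esub>" using linD[OF assms(3)] by blast
  then show ?thesis using linD(1)[OF assms(3)] by simp
qed

lemma lin_minus:
  assumes "kmod A M" "kmod A N" "lin A M N f" "x \<in> carrier M"
  shows "f (\<ominus>\<^bsub>M\<^esub> x) = \<ominus>\<^bsub>N\<^esub> f x"
proof -
  interpret M: kmod A M by fact
  interpret N: kmod A N by fact
  have "f (\<ominus>\<^bsub>M\<^esub> x) \<oplus>\<^bsub>N\<^esub> f x = \<zero>\<^bsub>N\<^esub>"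
    using linD(2)[OF assms(3), of "\<ominus>\<^bsub>M\<^esub> x" x] assms(4) lin_zero[OF assms(1-3)] by (simp add: M.M.l_neg)
  then show ?thesis using linD(1)[OF assms(3)] assms(4) N.M.minus_equality by auto
qed

lemma lin_diff:
  assumes "kmod A M" "kmod A N" "lin A M N f" "x \<in> carrier M" "y \<in> carrier M"
  shows "f (x \<ominus>\<^bsub>M\<^esub> y) = f x \<ominus>\<^bsub>N\<^esub> f y"
proof -
  interpret M: kmod A M by fact
  interpret N: kmod A N by fact
  show ?thesis using linD[OF assms(3)] lin_minus[OF assms(1-3)] assms(4,5) by (simp add: M.M.minus_eq N.M.minus_eq)
qed

lemma lin_ks:
  assumes "kmod A M" "lin A M N f" "x \<in> carrier M"
  shows "f (ks A M c x) = ks A N c (f x)"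
proof -
  interpret M: kmod A M by fact
  show ?thesis using assms by (simp add: ks_def linD)
qed

lemma lin_diff_fun:
  assumes "kmod A N" "lin A M N f" "lin A M N g"
  shows "lin A M N (\<lambda>x. f x \<ominus>\<^bsub>N\<^esub> g x)"
proof -
  interpret N: kmod A N by fact
  show ?thesis using assms
    by (intro linI) (auto simp: linD N.M.a_ac N.smult_r_distr N.smult_minus_r N.M.minus_eq N.M.minus_add)
qed

lemma lin_finsum:
  assumes "kmod A M" "kmod A N" "lin A M N f" "finite S" "\<And>s. s \<in> S \<Longrightarrow> g s \<in> carrier M"
  shows "f (\<Oplus>\<^bsub>M\<^esub>s\<in>S. g s) = (\<Oplus>\<^bsub>N\<^esub>s\<in>S. f (g s))"
proof -
  interpret M: kmod A M by fact
  interpret N: kmod A N by fact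
  show ?thesis using assms(4,5)
    by (induction S rule: finite_induct)
      (auto simp: lin_zero[OF assms(1-3)] linD[OF assms(3)] Pi_def)
qed

lemma a_kernel_eq: "a_kernel M N f = {x \<in> carrier M. f x = \<zero>\<^bsub>N\<^esub>}"
  by (auto simp: a_kernel_def kernel_def)

lemma kmod_sub:
  assumes "kmod A M" "C \<subseteq> carrier M" "\<zero>\<^bsub>M\<^esub> \<in> C"
    "\<And>x y. \<lbrakk>x \<in> C; y \<in> C\<rbrakk> \<Longrightarrow> x \<oplus>\<^bsub>M\<^esub> y \<in> C" "\<And>a x. \<lbrakk>a \<in> carrier A; x \<in> C\<rbrakk> \<Longrightarrow> a \<odot>\<^bsub>M\<^esub> x \<in> C"
  shows "kmod A (M\<lparr>carrier := C\<rparr>)"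
proof -
  interpret kmod A M by fact
  show ?thesis using assms(2-)
    by (intro kmod_intro) (auto simp: subset_eq M.a_ac smult_l_distr smult_r_distr smult_assoc)
qed

lemma kmod_kernel:
  assumes "kmod A M" "kmod A N" "lin A M N f"
  shows "kmod A (M\<lparr>carrier := a_kernel M N f\<rparr>)"
proof -
  interpret M: kmod A M by fact
  interpret N: kmod A N by fact
  show ?thesis by (rule kmod_sub) (auto simp: a_kernel_eq linD[OF assms(3)] lin_zero[OF assms] intro: assms)
qed

lemma kmod_image:
  assumes "kmod A M" "kmod A N" "lin A M N f"
  shows "kmod A (N\<lparr>carrier := f ` carrier M\<rparr>)"
proof -
  interpret M: kmod A M by fact
  interpret N: kmod A N by fact
  show ?thesis
  proof (rule kmod_sub)
    show "\<zero>\<^bsub>N\<^esub> \<in> f ` carrier M" using lin_zero[OF assms] by force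
    fix x y assume "x \<in> f ` carrier M" "y \<in> f ` carrier M"
    then show "x \<oplus>\<^bsub>N\<^esub> y \<in> f ` carrier M" by (auto simp: linD(2)[OF assms(3), symmetric])
  next
    fix a x assume "a \<in> carrier A" "x \<in> f ` carrier M"
    then show "a \<odot>\<^bsub>N\<^esub> x \<in> f ` carrier M" by (auto simp: linD(3)[OF assms(3), symmetric])
  qed (auto simp: linD[OF assms(3)] intro: assms)
qed

subsection \<open>Finite dimensional modules\<close>

text \<open>Vector subspaces for the action \<open>ks\<close>, in general not submodules. The
  functionals of \<open>klin\<close> are likewise required to be linear only on the given set, so
  that they can be extended step by step.\<close>

definition ksub :: "('k, 'a) module \<Rightarrow> ('a, 'm) module \<Rightarrow> 'm set \<Rightarrow> bool" where
  "ksub A M U \<longleftrightarrow> U \<subseteq> carrier M \<and> \<zero>\<^bsub>M\<^esub> \<in> U \<and>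
     (\<forall>x\<in>U. \<forall>y\<in>U. x \<oplus>\<^bsub>M\<^esub> y \<in> U) \<and> (\<forall>c. \<forall>x\<in>U. ks A M c x \<in> U)"

definition klin :: "('k::field, 'a) module \<Rightarrow> ('a, 'm) module \<Rightarrow> 'm set \<Rightarrow> ('m \<Rightarrow> 'k) \<Rightarrow> bool" where
  "klin A M U f \<longleftrightarrow> (\<forall>x\<in>U. \<forall>y\<in>U. f (x \<oplus>\<^bsub>M\<^esub> y) = f x + f y) \<and>
     (\<forall>c. \<forall>x\<in>U. f (ks A M c x) = c * f x)"

text \<open>The span starts from a subspace U instead of zero, so that a functional on U can be
  extended by one vector at a time.\<close>

inductive_set kspan :: "('k, 'a) module \<Rightarrow> ('a, 'm) module \<Rightarrow> 'm set \<Rightarrow> 'm set \<Rightarrow> 'm set"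
  for A :: "('k, 'a) module" and M :: "('a, 'm) module" and U B :: "'m set" where
  kspan_base: "u \<in> U \<Longrightarrow> u \<in> kspan A M U B"
| kspan_step: "x \<in> kspan A M U B \<Longrightarrow> b \<in> B \<Longrightarrow> x \<oplus>\<^bsub>M\<^esub> ks A M c b \<in> kspan A M U B"

lemma klinD:
  assumes "klin A M U f"
  shows "\<lbrakk>x \<in> U; y \<in> U\<rbrakk> \<Longrightarrow> f (x \<oplus>\<^bsub>M\<^esub> y) = f x + f y" "x \<in> U \<Longrightarrow> f (ks A M c x) = c * f x"
  using assms by (auto simp: klin_def)

lemma ksubD:
  assumes "ksub A M U"
  shows "x \<in> U \<Longrightarrow> x \<in> carrier M" "\<zero>\<^bsub>M\<^esub> \<in> U" "\<lbrakk>x \<in> U; y \<in> U\<rbrakk> \<Longrightarrow> x \<oplus>\<^bsub>M\<^esub> y \<in> U"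
    "x \<in> U \<Longrightarrow> ks A M c x \<in> U"
  using assms by (auto simp: ksub_def)

lemma klin_subset: "klin A M W f \<Longrightarrow> U \<subseteq> W \<Longrightarrow> klin A M U f"
  unfolding klin_def by blast

context kmod
begin

lemma ksub_diff: "\<lbrakk>ksub A M U; x \<in> U; y \<in> U\<rbrakk> \<Longrightarrow> x \<ominus>\<^bsub>M\<^esub> y \<in> U"
  using ksubD[of A M U] ks_minus[of y 1] by (metis M.minus_eq ks_one)

lemma ksub_carrier: "ksub A M (carrier M)"
  by (simp add: ksub_def)

lemma ksub_zero: "ksub A M {\<zero>\<^bsub>M\<^esub>}"
  by (simp add: ksub_def)

lemma klin_zero: "klin A M U f \<Longrightarrow> ksub A M U \<Longrightarrow> f \<zero>\<^bsub>M\<^esub> = 0"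
  using klinD(2)[of A M U f "\<zero>\<^bsub>M\<^esub>" 0] ksubD[of A M U] by auto

lemma klin_diff: "\<lbrakk>klin A M U f; ksub A M U; x \<in> U; y \<in> U\<rbrakk> \<Longrightarrow> f (x \<ominus>\<^bsub>M\<^esub> y) = f x - f y"
  using ksub_diff[of U x y] klinD(1)[of A M U f "x \<ominus>\<^bsub>M\<^esub> y" y] ksubD(1)[of A M U] by auto

lemma klin_finsum:
  assumes "klin A M (carrier M) f" "finite S" "\<And>s. s \<in> S \<Longrightarrow> g s \<in> carrier M"
  shows "f (\<Oplus>\<^bsub>M\<^esub>s\<in>S. g s) = (\<Sum>s\<in>S. f (g s))"
  using assms(2,3) by (induction S rule: finite_induct)
    (auto simp: klin_zero[OF assms(1) ksub_carrier] klinD[OF assms(1)] Pi_def)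

lemma ksub_finsum:
  assumes "ksub A M U" "finite S" "\<And>s. s \<in> S \<Longrightarrow> g s \<in> U"
  shows "(\<Oplus>\<^bsub>M\<^esub>s\<in>S. g s) \<in> U"
  using assms(2,3) ksubD[OF assms(1)] by (induction S rule: finite_induct) (auto simp: Pi_def)

lemma kspan_closed:
  assumes "ksub A M U" "B \<subseteq> carrier M" "x \<in> kspan A M U B" shows "x \<in> carrier M"
  using assms(3) by induction (use assms ksubD in auto)

lemma ksub_kspan:
  assumes U: "ksub A M U" and B: "B \<subseteq> carrier M"
  shows "ksub A M (kspan A M U B)"
proof -
  note cl = kspan_closed[OF assms]
  have add: "x \<oplus>\<^bsub>M\<^esub> y \<in> kspan A M U B" if "x \<in> kspan A M U B" "y \<in> kspan A M U B" for x y
    using that(2)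
  proof induction
    case (kspan_base u)
    show ?case using that(1)
    proof induction
      case (kspan_base v) then show ?case
        using ksubD[OF U] \<open>u \<in> U\<close> by (auto intro: kspan.intros)
    next
      case (kspan_step z b c)
      have "(z \<oplus>\<^bsub>M\<^esub> ks A M c b) \<oplus>\<^bsub>M\<^esub> u = (z \<oplus>\<^bsub>M\<^esub> u) \<oplus>\<^bsub>M\<^esub> ks A M c b"
        using cl[OF kspan_step(1)] kspan_step(2) B ksubD(1)[OF U \<open>u \<in> U\<close>] by (auto simp: M.a_ac)
      then show ?case using kspan_step by (auto intro: kspan.intros)
    qed
  next
    case (kspan_step z b c)
    have "x \<oplus>\<^bsub>M\<^esub> (z \<oplus>\<^bsub>M\<^esub> ks A M c b) = (x \<oplus>\<^bsub>M\<^esub> z) \<oplus>\<^bsub>M\<^esub> ks A M c b"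
      using cl[OF kspan_step(1)] cl[OF that(1)] kspan_step(2) B by (auto simp: M.a_assoc)
    then show ?case using kspan_step by (auto intro: kspan.intros)
  qed
  have "ks A M d x \<in> kspan A M U B" if "x \<in> kspan A M U B" for d x
    using that
  proof induction
    case (kspan_base u) then show ?case using ksubD[OF U] by (auto intro: kspan.intros)
  next
    case (kspan_step z b c)
    have "ks A M d (z \<oplus>\<^bsub>M\<^esub> ks A M c b) = ks A M d z \<oplus>\<^bsub>M\<^esub> ks A M (d * c) b"
      using cl[OF kspan_step(1)] kspan_step(2) B by (auto simp: ks_r_distr ks_assoc)
    then show ?case using kspan_step by (auto intro: kspan.intros)
  qed
  with add show ?thesis using cl ksubD(2)[OF U] by (auto simp: ksub_def intro: kspan.intros)
qed

lemma kspan_sup: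
  assumes "ksub A M U" "B \<subseteq> carrier M"
  shows "U \<subseteq> kspan A M U B" "B \<subseteq> kspan A M U B"
proof -
  show "U \<subseteq> kspan A M U B" by (auto intro: kspan.intros)
  show "B \<subseteq> kspan A M U B"
  proof
    fix b assume "b \<in> B"
    then have "\<zero>\<^bsub>M\<^esub> \<oplus>\<^bsub>M\<^esub> ks A M 1 b \<in> kspan A M U B"
      using ksubD(2)[OF assms(1)] by (intro kspan.intros)
    then show "b \<in> kspan A M U B" using \<open>b \<in> B\<close> assms(2) by auto
  qed
qed

lemma kspan_least:
  assumes "ksub A M W" "U \<subseteq> W" "B \<subseteq> W" "x \<in> kspan A M U B" shows "x \<in> W"
  using assms(4) by induction (use assms(2,3) ksubD[OF assms(1)] in auto)

text \<open>Translates between the inductive span and the sums over a finite set that occur in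
  \<open>fdmod\<close>.\<close>

lemma kspan_finsum:
  assumes "finite B" "B \<subseteq> carrier M"
  shows "x \<in> kspan A M {\<zero>\<^bsub>M\<^esub>} B \<longleftrightarrow> (\<exists>c. x = (\<Oplus>\<^bsub>M\<^esub>b\<in>B. ks A M (c b) b))"
proof
  have cl: "ks A M c b \<in> carrier M" if "b \<in> B" for b c using that assms by auto
  assume "x \<in> kspan A M {\<zero>\<^bsub>M\<^esub>} B"
  then show "\<exists>c. x = (\<Oplus>\<^bsub>M\<^esub>b\<in>B. ks A M (c b) b)"
  proof induction
    case (kspan_base u)
    have "(\<Oplus>\<^bsub>M\<^esub>b\<in>B. ks A M 0 b) = (\<Oplus>\<^bsub>M\<^esub>b\<in>B. \<zero>\<^bsub>M\<^esub>)"
      by (rule M.finsum_cong') (use assms(2) in auto)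
    then show ?case using kspan_base by (intro exI[of _ "\<lambda>_. 0"]) auto
  next
    case (kspan_step z b d)
    then obtain c where z: "z = (\<Oplus>\<^bsub>M\<^esub>b\<in>B. ks A M (c b) b)" by auto
    have "(\<Oplus>\<^bsub>M\<^esub>b'\<in>B. ks A M (c b' + (if b' = b then d else 0)) b') =
        (\<Oplus>\<^bsub>M\<^esub>b'\<in>B. ks A M (c b') b' \<oplus>\<^bsub>M\<^esub> (if b = b' then ks A M d b' else \<zero>\<^bsub>M\<^esub>))"
      by (rule M.finsum_cong') (use assms(2) in \<open>auto simp: ks_l_distr subset_eq\<close>)
    also have "\<dots> = z \<oplus>\<^bsub>M\<^esub> (\<Oplus>\<^bsub>M\<^esub>b'\<in>B. if b = b' then ks A M d b' else \<zero>\<^bsub>M\<^esub>)"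
      unfolding z by (rule M.finsum_addf) (use cl in auto)
    also have "(\<Oplus>\<^bsub>M\<^esub>b'\<in>B. if b = b' then ks A M d b' else \<zero>\<^bsub>M\<^esub>) = ks A M d b"
      by (rule M.finsum_singleton) (use cl kspan_step assms in auto)
    finally show ?case by (intro exI[of _ "\<lambda>b'. c b' + (if b' = b then d else 0)"]) (rule sym)
  qed
next
  assume "\<exists>c. x = (\<Oplus>\<^bsub>M\<^esub>b\<in>B. ks A M (c b) b)"
  then obtain c where "x = (\<Oplus>\<^bsub>M\<^esub>b\<in>B. ks A M (c b) b)" by auto
  moreover have "ksub A M (kspan A M {\<zero>\<^bsub>M\<^esub>} B)" using ksub_kspan ksub_zero assms by blast
  ultimately show "x \<in> kspan A M {\<zero>\<^bsub>M\<^esub>} B"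
    using kspan_sup[OF ksub_zero assms(2)] by (auto intro!: ksub_finsum assms ksubD(4))
qed

lemma fdmod_iff:
  "fdmod A M \<longleftrightarrow> (\<exists>B. finite B \<and> B \<subseteq> carrier M \<and> carrier M \<subseteq> kspan A M {\<zero>\<^bsub>M\<^esub>} B)"
proof -
  have lm: "left_module A M" ..
  have eq: "(\<forall>x\<in>carrier M. \<exists>c. x = (\<Oplus>\<^bsub>M\<^esub>b\<in>B. ks A M (c b) b)) \<longleftrightarrow>
      carrier M \<subseteq> kspan A M {\<zero>\<^bsub>M\<^esub>} B" if "finite B" "B \<subseteq> carrier M" for B
    unfolding subset_eq[of "carrier M"] kspan_finsum[OF that] by (rule refl)
  have "(\<exists>B. finite B \<and> B \<subseteq> carrier M \<and> (\<forall>x\<in>carrier M. \<exists>c. x = (\<Oplus>\<^bsub>M\<^esub>b\<in>B. ks A M (c b) b))) \<longleftrightarrow>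
      (\<exists>B. finite B \<and> B \<subseteq> carrier M \<and> carrier M \<subseteq> kspan A M {\<zero>\<^bsub>M\<^esub>} B)"
    by (intro ex_cong1 conj_cong refl eq)
  then show ?thesis
    unfolding fdmod_def ks_def[symmetric] by (simp only: lm simp_thms)
qed

text \<open>As b lies outside U, an element of the larger subspace is u + c b for exactly one u and
  one c; the extension takes it to f u + c v.\<close>

lemma klin_extend1:
  assumes U: "ksub A M U" and b: "b \<in> carrier M" "b \<notin> U" and f: "klin A M U f"
  shows "\<exists>g. klin A M (kspan A M U {b}) g \<and> (\<forall>u\<in>U. g u = f u) \<and> g b = v"
proof -
  have rep: "\<exists>u\<in>U. \<exists>c. x = u \<oplus>\<^bsub>M\<^esub> ks A M c b" if "x \<in> kspan A M U {b}" for x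
    using that
  proof induction
    case (kspan_base u)
    have "u = u \<oplus>\<^bsub>M\<^esub> ks A M 0 b" using b ksubD(1)[OF U kspan_base] by simp
    then show ?case using kspan_base by blast
  next
    case (kspan_step x b' d)
    then obtain u c where uc: "u \<in> U" "x = u \<oplus>\<^bsub>M\<^esub> ks A M c b" by blast
    then have "x \<oplus>\<^bsub>M\<^esub> ks A M d b' = u \<oplus>\<^bsub>M\<^esub> ks A M (c + d) b"
      using b ksubD(1)[OF U uc(1)] kspan_step(2) by (simp add: ks_l_distr M.a_assoc)
    then show ?case using uc(1) by blast
  qed
  \<comment> \<open>If c and d differed, dividing by c - d would put b into U. This also makes the
    choice in the definition of \<open>g\<close> harmless.\<close>
  have uniq: "c = d" if "u \<in> U" "w \<in> U" "u \<oplus>\<^bsub>M\<^esub> ks A M c b = w \<oplus>\<^bsub>M\<^esub> ks A M d b" for u w c d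
  proof (rule ccontr)
    assume "c \<noteq> d"
    have car: "u \<in> carrier M" "w \<in> carrier M" using that ksubD(1)[OF U] by auto
    have "ks A M (c - d) b = w \<ominus>\<^bsub>M\<^esub> u"
    proof -
      have "u \<oplus>\<^bsub>M\<^esub> ks A M (c - d) b \<oplus>\<^bsub>M\<^esub> ks A M d b = w \<oplus>\<^bsub>M\<^esub> ks A M d b"
        using that(3) b car by (simp add: M.a_assoc ks_l_distr[symmetric])
      then have "u \<oplus>\<^bsub>M\<^esub> ks A M (c - d) b = w" using car b by simp
      then show ?thesis using car b M_diff_eq[of w u "ks A M (c - d) b"] by (simp add: M.a_comm)
    qed
    then have "ks A M (inverse (c - d)) (ks A M (c - d) b) \<in> U"
      using ksub_diff[OF U that(2,1)] ksubD(4)[OF U] by simp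
    then show False using \<open>c \<noteq> d\<close> b by (simp add: ks_inverse)
  qed
  define g where "g x = (SOME y. \<exists>u\<in>U. \<exists>c. x = u \<oplus>\<^bsub>M\<^esub> ks A M c b \<and> y = f u + c * v)" for x
  have g: "g (u \<oplus>\<^bsub>M\<^esub> ks A M c b) = f u + c * v" if u: "u \<in> U" for u c
  proof -
    have "\<exists>y. \<exists>u'\<in>U. \<exists>c'. u \<oplus>\<^bsub>M\<^esub> ks A M c b = u' \<oplus>\<^bsub>M\<^esub> ks A M c' b \<and> y = f u' + c' * v" using u by blast
    from someI_ex[OF this] obtain u' c' where
      u': "u' \<in> U" "u \<oplus>\<^bsub>M\<^esub> ks A M c b = u' \<oplus>\<^bsub>M\<^esub> ks A M c' b"
        "g (u \<oplus>\<^bsub>M\<^esub> ks A M c b) = f u' + c' * v" unfolding g_def by blast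
    then have "c = c'" using uniq u by blast
    then have "u = u'" using u' u b ksubD(1)[OF U] by simp
    then show ?thesis using u' \<open>c = c'\<close> by simp
  qed
  show ?thesis
  proof (intro exI conjI ballI)
    show "g u = f u" if "u \<in> U" for u using g[OF that, of 0] that b ksubD(1)[OF U that] by simp
    show "g b = v" using g[OF ksubD(2)[OF U], of 1] b klin_zero[OF f U] by simp
    show "klin A M (kspan A M U {b}) g"
      unfolding klin_def
    proof (intro conjI ballI allI)
      fix x y assume "x \<in> kspan A M U {b}" "y \<in> kspan A M U {b}"
      then obtain u c w d where u: "u \<in> U" "x = u \<oplus>\<^bsub>M\<^esub> ks A M c b" "w \<in> U" "y = w \<oplus>\<^bsub>M\<^esub> ks A M d b"
        using rep by meson
      have car: "u \<in> carrier M" "w \<in> carrier M" using u ksubD(1)[OF U] by auto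
      have "x \<oplus>\<^bsub>M\<^esub> y = (u \<oplus>\<^bsub>M\<^esub> w) \<oplus>\<^bsub>M\<^esub> ks A M (c + d) b"
        unfolding u ks_l_distr[OF b(1)] using car b by (simp add: M.a_ac)
      then show "g (x \<oplus>\<^bsub>M\<^esub> y) = g x + g y"
        using g u ksubD(3)[OF U u(1,3)] klinD(1)[OF f u(1,3)] by (simp add: algebra_simps)
    next
      fix x d assume "x \<in> kspan A M U {b}"
      then obtain u c where u: "u \<in> U" "x = u \<oplus>\<^bsub>M\<^esub> ks A M c b" using rep by meson
      have car: "u \<in> carrier M" using u ksubD(1)[OF U] by auto
      have "ks A M d x = ks A M d u \<oplus>\<^bsub>M\<^esub> ks A M (d * c) b"
        unfolding u using car b by (simp add: ks_r_distr ks_assoc)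
      then show "g (ks A M d x) = d * g x"
        using g u ksubD(4)[OF U u(1)] klinD(2)[OF f u(1)] by (simp add: algebra_simps)
    qed
  qed
qed

text \<open>A finite generating set is added to the subspace one vector at a time; a vector that
  already lies in the subspace reached so far is skipped.\<close>

lemma klin_extend:
  assumes "fdmod A M" and U: "ksub A M U" and f: "klin A M U f"
  shows "\<exists>g. klin A M (carrier M) g \<and> (\<forall>u\<in>U. g u = f u)"
proof -
  obtain B where B: "finite B" "B \<subseteq> carrier M" "carrier M \<subseteq> kspan A M {\<zero>\<^bsub>M\<^esub>} B"
    using assms(1) fdmod_iff by auto
  have "\<exists>W g. ksub A M W \<and> U \<subseteq> W \<and> B \<subseteq> W \<and> klin A M W g \<and> (\<forall>u\<in>U. g u = f u)"
    using B(1,2)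
  proof (induction B rule: finite_induct)
    case empty then show ?case using U f by blast
  next
    case (insert b B)
    then obtain W g where W: "ksub A M W" "U \<subseteq> W" "B \<subseteq> W" "klin A M W g" "\<forall>u\<in>U. g u = f u" by auto
    show ?case
    proof (cases "b \<in> W")
      case True then show ?thesis using W by blast
    next
      case False
      have b: "b \<in> carrier M" using insert by auto
      obtain g' where g': "klin A M (kspan A M W {b}) g'" "\<forall>u\<in>W. g' u = g u"
        using klin_extend1[OF W(1) b False W(4)] by blast
      show ?thesis
      proof (intro exI conjI)
        show "ksub A M (kspan A M W {b})" using ksub_kspan[OF W(1)] b by simp
        show "U \<subseteq> kspan A M W {b}" "insert b B \<subseteq> kspan A M W {b}"
          using kspan_sup[OF W(1), of "{b}"] b W(2,3) by auto
        show "klin A M (kspan A M W {b}) g'" by fact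
        show "\<forall>u\<in>U. g' u = f u" using g'(2) W(2,5) by auto
      qed
    qed
  qed
  then obtain W g where W: "ksub A M W" "B \<subseteq> W" "klin A M W g" "\<forall>u\<in>U. g u = f u" by blast
  have "carrier M \<subseteq> W" using B(3) kspan_least[OF W(1) _ W(2)] ksubD(2)[OF W(1)] by blast
  then show ?thesis using W(3,4) klin_subset by blast
qed

text \<open>The functional is prescribed to be 1 at x on the line through x and extended from
  there.\<close>

lemma klin_separates:
  assumes "fdmod A M" "x \<in> carrier M" "x \<noteq> \<zero>\<^bsub>M\<^esub>"
  shows "\<exists>g. klin A M (carrier M) g \<and> g x \<noteq> 0"
proof -
  have "klin A M {\<zero>\<^bsub>M\<^esub>} (\<lambda>_. 0)" by (simp add: klin_def)
  then obtain g where g: "klin A M (kspan A M {\<zero>\<^bsub>M\<^esub>} {x}) g" "g x = 1"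
    using klin_extend1[OF ksub_zero assms(2), of "\<lambda>_. 0" 1] assms(3) by auto
  have x: "{x} \<subseteq> carrier M" using assms by simp
  then obtain g' where "klin A M (carrier M) g'" "\<forall>u\<in>kspan A M {\<zero>\<^bsub>M\<^esub>} {x}. g' u = g u"
    using klin_extend[OF assms(1) ksub_kspan[OF ksub_zero x] g(1)] by blast
  then show ?thesis using g(2) kspan_sup(2)[OF ksub_zero x] by (intro exI[of _ g']) auto
qed

text \<open>A spanning set of least cardinality is a basis: each b lies outside the span of the
  others, so some functional is 1 at b and 0 on the others. These functionals are the
  coordinates.\<close>

lemma coordinates:
  assumes "fdmod A M"
  obtains B \<kappa> where "finite B" "B \<subseteq> carrier M" "\<And>b. b \<in> B \<Longrightarrow> klin A M (carrier M) (\<kappa> b)"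
    "\<And>x. x \<in> carrier M \<Longrightarrow> (\<Oplus>\<^bsub>M\<^esub>b\<in>B. ks A M (\<kappa> b x) b) = x"
proof -
  let ?P = "\<lambda>B. finite B \<and> B \<subseteq> carrier M \<and> carrier M \<subseteq> kspan A M {\<zero>\<^bsub>M\<^esub>} B"
  obtain B0 where "?P B0" using assms fdmod_iff by auto
  then have "\<exists>B. ?P B \<and> (\<forall>B'. ?P B' \<longrightarrow> card B \<le> card B')" by (rule ex_has_least_nat)
  then obtain B where B: "?P B" and min: "\<And>B'. ?P B' \<Longrightarrow> card B \<le> card B'" by (elim exE conjE) blast
  have "\<exists>g. klin A M (carrier M) g \<and> (\<forall>b'\<in>B. g b' = (if b' = b then 1 else 0))" if b: "b \<in> B" for b
  proof -
    let ?U = "kspan A M {\<zero>\<^bsub>M\<^esub>} (B - {b})"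
    have sub: "B - {b} \<subseteq> carrier M" and bM: "b \<in> carrier M" using B b by auto
    have U: "ksub A M ?U" using ksub_kspan[OF ksub_zero sub] .
    have nb: "b \<notin> ?U"
    proof
      assume "b \<in> ?U"
      then have "B \<subseteq> ?U" using kspan_sup(2)[OF ksub_zero sub] by auto
      then have "carrier M \<subseteq> ?U" using B kspan_least[OF U, of "{\<zero>\<^bsub>M\<^esub>}" B] ksubD(2)[OF U] by auto
      then have "card B \<le> card (B - {b})" using B by (intro min) auto
      then show False using B b card_Diff1_less[of B b] by auto
    qed
    have "klin A M ?U (\<lambda>_. 0)" by (simp add: klin_def)
    from klin_extend1[OF U bM nb this, of 1] obtain g where g: "klin A M (kspan A M ?U {b}) g"
      "\<forall>u\<in>?U. g u = 0" "g b = 1" by auto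
    have b1: "{b} \<subseteq> carrier M" using bM by simp
    obtain g' where g': "klin A M (carrier M) g'" "\<forall>u\<in>kspan A M ?U {b}. g' u = g u"
      using klin_extend[OF assms ksub_kspan[OF U b1] g(1)] by blast
    have "g' b' = (if b' = b then 1 else 0)" if "b' \<in> B" for b'
    proof (cases "b' = b")
      case True then show ?thesis using g'(2) g(3) kspan_sup(2)[OF U b1] by auto
    next
      case False
      then have "b' \<in> ?U" using kspan_sup(2)[OF ksub_zero sub] that by auto
      then show ?thesis using False g'(2) g(2) kspan_sup(1)[OF U b1] by auto
    qed
    then show ?thesis using g'(1) by blast
  qed
  then obtain \<kappa> where \<kappa>: "\<And>b. b \<in> B \<Longrightarrow> klin A M (carrier M) (\<kappa> b)"
    "\<And>b b'. b \<in> B \<Longrightarrow> b' \<in> B \<Longrightarrow> \<kappa> b b' = (if b' = b then 1 else 0)" by metis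
  have eq: "(\<Oplus>\<^bsub>M\<^esub>b\<in>B. ks A M (\<kappa> b x) b) = x" if x: "x \<in> carrier M" for x
  proof -
    have "x \<in> kspan A M {\<zero>\<^bsub>M\<^esub>} B" using x B by auto
    then have "\<exists>c. x = (\<Oplus>\<^bsub>M\<^esub>b\<in>B. ks A M (c b) b)" using B kspan_finsum[of B] by simp
    then obtain c where c: "x = (\<Oplus>\<^bsub>M\<^esub>b\<in>B. ks A M (c b) b)" by (elim exE)
    have "\<kappa> b x = c b" if "b \<in> B" for b
    proof -
      have "\<kappa> b x = (\<Sum>b'\<in>B. \<kappa> b (ks A M (c b') b'))"
        unfolding c using B by (intro klin_finsum \<kappa> that) auto
      also have "\<dots> = (\<Sum>b'\<in>B. c b' * \<kappa> b b')"
        using B by (intro sum.cong refl klinD(2)[OF \<kappa>(1)[OF that]]) auto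
      also have "\<dots> = (\<Sum>b'\<in>B. if b' = b then c b' else 0)"
        by (intro sum.cong) (auto simp: \<kappa>(2)[OF that])
      also have "\<dots> = c b" using B that by simp
      finally show ?thesis .
    qed
    then have "(\<Oplus>\<^bsub>M\<^esub>b\<in>B. ks A M (\<kappa> b x) b) = (\<Oplus>\<^bsub>M\<^esub>b\<in>B. ks A M (c b) b)"
      using B by (intro M.finsum_cong') auto
    then show ?thesis using c by simp
  qed
  show thesis
    by (rule that[OF _ _ \<kappa>(1) eq]) (use B in simp_all)
qed

end

lemma kspan_image:
  assumes "kmod A M" "kmod A N" "lin A M N f" "ksub A M U" "B \<subseteq> carrier M" "x \<in> kspan A M U B"
  shows "f x \<in> kspan A N (f ` U) (f ` B)"
  using assms(6)
proof induction
  case (kspan_base u) then show ?case by (auto intro: kspan.intros)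
next
  case (kspan_step x b c)
  interpret M: kmod A M by fact
  have "x \<in> carrier M" using M.kspan_closed assms kspan_step by blast
  then have "f (x \<oplus>\<^bsub>M\<^esub> ks A M c b) = f x \<oplus>\<^bsub>N\<^esub> ks A N c (f b)"
    using assms kspan_step by (simp add: linD[OF assms(3)] lin_ks[OF assms(1,3)] subset_eq)
  then show ?case using kspan_step by (auto intro: kspan.intros)
qed

lemma fdmod_surj:
  assumes "fdmod A M" "kmod A M" "kmod A N" "lin A M N f" "carrier N \<subseteq> f ` carrier M"
  shows "fdmod A N"
proof -
  interpret M: kmod A M by fact
  interpret N: kmod A N by fact
  obtain B where B: "finite B" "B \<subseteq> carrier M" "carrier M \<subseteq> kspan A M {\<zero>\<^bsub>M\<^esub>} B"
    using assms(1) M.fdmod_iff by auto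
  have "y \<in> kspan A N {\<zero>\<^bsub>N\<^esub>} (f ` B)" if yN: "y \<in> carrier N" for y
  proof -
    obtain x where x: "x \<in> carrier M" "y = f x" using assms(5) yN by blast
    then have "f x \<in> kspan A N (f ` {\<zero>\<^bsub>M\<^esub>}) (f ` B)"
      using kspan_image[OF assms(2,3,4) M.ksub_zero B(2)] B(3) by blast
    then show ?thesis using x lin_zero[OF assms(2-4)] by simp
  qed
  moreover have "f ` B \<subseteq> carrier N" using B linD[OF assms(4)] by auto
  ultimately show ?thesis unfolding N.fdmod_iff using B(1) by blast
qed

text \<open>The sum is internal: the images of finitely many modules under maps into N generate N.
  This covers \<open>fam\<close>, where the s-th map multiplies an element of the algebra with the
  s-th generator.\<close>

lemma fdmod_sum:
  assumes N: "kmod A N" and fin: "finite S" and M: "\<And>s. s \<in> S \<Longrightarrow> fdmod A (M s)"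
    and f: "\<And>s. s \<in> S \<Longrightarrow> lin A (M s) N (f s)"
    and gen: "\<And>x. x \<in> carrier N \<Longrightarrow> \<exists>y. (\<forall>s\<in>S. y s \<in> carrier (M s)) \<and> x = (\<Oplus>\<^bsub>N\<^esub>s\<in>S. f s (y s))"
  shows "fdmod A N"
proof -
  interpret N: kmod A N by fact
  have km: "kmod A (M s)" if "s \<in> S" for s using M[OF that] N.fdmod_kmod by blast
  have "\<exists>B. finite B \<and> B \<subseteq> carrier N \<and> f s ` carrier (M s) \<subseteq> kspan A N {\<zero>\<^bsub>N\<^esub>} B" if s: "s \<in> S" for s
  proof -
    interpret Ms: kmod A "M s" using km[OF s] .
    obtain B where B: "finite B" "B \<subseteq> carrier (M s)" "carrier (M s) \<subseteq> kspan A (M s) {\<zero>\<^bsub>M s\<^esub>} B"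
      using M[OF s] Ms.fdmod_iff by auto
    have "f s x \<in> kspan A N {\<zero>\<^bsub>N\<^esub>} (f s ` B)" if "x \<in> carrier (M s)" for x
      using kspan_image[OF km[OF s] N f[OF s] Ms.ksub_zero B(2), of x] that B(3)
        lin_zero[OF km[OF s] N f[OF s]] by auto
    moreover have "f s ` B \<subseteq> carrier N" using B linD[OF f[OF s]] by auto
    ultimately show ?thesis using B(1) by (intro exI[of _ "f s ` B"]) auto
  qed
  then obtain B where B: "\<And>s. s \<in> S \<Longrightarrow> finite (B s)" "\<And>s. s \<in> S \<Longrightarrow> B s \<subseteq> carrier N"
    "\<And>s. s \<in> S \<Longrightarrow> f s ` carrier (M s) \<subseteq> kspan A N {\<zero>\<^bsub>N\<^esub>} (B s)" by metis
  let ?B = "\<Union>s\<in>S. B s"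
  have sub: "?B \<subseteq> carrier N" using B(2) by auto
  have W: "ksub A N (kspan A N {\<zero>\<^bsub>N\<^esub>} ?B)" using N.ksub_kspan[OF N.ksub_zero sub] .
  have "x \<in> kspan A N {\<zero>\<^bsub>N\<^esub>} ?B" if xN: "x \<in> carrier N" for x
  proof -
    obtain y where y: "\<And>s. s \<in> S \<Longrightarrow> y s \<in> carrier (M s)" "x = (\<Oplus>\<^bsub>N\<^esub>s\<in>S. f s (y s))"
      using gen[OF xN] by blast
    have "f s (y s) \<in> kspan A N {\<zero>\<^bsub>N\<^esub>} ?B" if s: "s \<in> S" for s
    proof -
      have "f s (y s) \<in> kspan A N {\<zero>\<^bsub>N\<^esub>} (B s)" using B(3)[OF s] y(1)[OF s] by auto
      then show ?thesis
        by (rule N.kspan_least[OF W, rotated 2]) (use ksubD(2)[OF W] N.kspan_sup(2)[OF N.ksub_zero sub] s in auto)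
    qed
    then show ?thesis unfolding y(2) by (intro N.ksub_finsum[OF W fin])
  qed
  then show ?thesis unfolding N.fdmod_iff using fin B(1) sub by (intro exI[of _ ?B]) auto
qed

text \<open>The module quantifiers in the definitions range over modules with elements in \<open>nat \<Rightarrow> 'k\<close>
  only; this is how the modules constructed here are moved into that type.\<close>

definition transp :: "('m \<Rightarrow> 'n) \<Rightarrow> ('a, 'm) module \<Rightarrow> ('a, 'n) module" where
  "transp j M = mk_module (j ` carrier M)
     (\<lambda>x y. j (inv_into (carrier M) j x \<oplus>\<^bsub>M\<^esub> inv_into (carrier M) j y)) (j \<zero>\<^bsub>M\<^esub>)
     (\<lambda>a x. j (a \<odot>\<^bsub>M\<^esub> inv_into (carrier M) j x))"

lemma transp:
  assumes "kmod A M" "inj_on j (carrier M)"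
  shows "kmod A (transp j M)" "lin A M (transp j M) j"
    "lin A (transp j M) M (inv_into (carrier M) j)"
proof -
  interpret kmod A M by fact
  show "kmod A (transp j M)"
    by (rule kmod_intro) (auto simp: transp_def assms(2) smult_l_distr smult_r_distr smult_assoc M.a_ac)
  show "lin A M (transp j M) j" "lin A (transp j M) M (inv_into (carrier M) j)"
    by (auto simp: lin_def transp_def assms(2))
qed

text \<open>Coordinates with respect to a finite basis, numbered by an injection of the basis into
  \<open>nat\<close>, embed the carrier into \<open>nat \<Rightarrow> 'k\<close>; the structure is
  carried over to the image.\<close>

lemma transport_nat:
  fixes A :: "('k::field, 'a) module" and M :: "('a, 'm) module"
  assumes "kalg A" "fdmod A M"
  shows "\<exists>(M' :: ('a, nat \<Rightarrow> 'k) module) f g. fdmod A M' \<and> lin A M M' f \<and> lin A M' M g \<and>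
    (\<forall>x\<in>carrier M. g (f x) = x) \<and> (\<forall>y\<in>carrier M'. f (g y) = y)"
proof -
  interpret kmod A M using kalg.fdmod_kmod[OF assms] .
  obtain B \<kappa> where B: "finite B" "B \<subseteq> carrier M" "\<And>b. b \<in> B \<Longrightarrow> klin A M (carrier M) (\<kappa> b)"
    "\<And>x. x \<in> carrier M \<Longrightarrow> (\<Oplus>\<^bsub>M\<^esub>b\<in>B. ks A M (\<kappa> b x) b) = x"
    by (rule coordinates[OF assms(2)], rule that) simp_all
  have "\<exists>h :: 'm \<Rightarrow> nat. inj_on h B"
    using finite_imp_inj_to_nat_seg[OF B(1)] by (elim exE conjE) (rule exI)
  then obtain h :: "'m \<Rightarrow> nat" where h: "inj_on h B" by (elim exE)
  \<comment> \<open>At numbers that \<open>h\<close> does not take, \<open>inv_into\<close> returns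
    an unspecified vector. The corresponding coordinates are arbitrary, but \<open>j\<close> is
    injective because of the others.\<close>
  define j where "j x = (\<lambda>n. \<kappa> (inv_into B h n) x)" for x
  have inj: "inj_on j (carrier M)"
  proof (rule inj_onI)
    fix x y assume xy: "x \<in> carrier M" "y \<in> carrier M" "j x = j y"
    have "\<kappa> b x = \<kappa> b y" if "b \<in> B" for b
      using fun_cong[OF xy(3), of "h b"] h that by (simp add: j_def)
    then have "(\<Oplus>\<^bsub>M\<^esub>b\<in>B. ks A M (\<kappa> b x) b) = (\<Oplus>\<^bsub>M\<^esub>b\<in>B. ks A M (\<kappa> b y) b)"
      using B(2) by (intro M.finsum_cong') auto
    then show "x = y" using B(4)[OF xy(1)] B(4)[OF xy(2)] by simp
  qed
  note t = transp[OF is_kmod inj]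
  have "fdmod A (transp j M)"
    by (rule fdmod_surj[OF assms(2) is_kmod t(1,2)]) (auto simp: transp_def)
  then show ?thesis using t inj
    by (intro exI[of _ "transp j M"] exI[of _ j] exI[of _ "inv_into (carrier M) j"])
      (auto simp: transp_def f_inv_into_f)
qed

subsection \<open>Linear combinations\<close>

text \<open>A row of coefficients times a column of module elements. For
  \<open>M = reg_mod A\<close> it is the product of a row and a column over A; over
  \<open>opp A\<close> the factors are multiplied in the reverse order.\<close>

definition dot :: "('a, 'm) module \<Rightarrow> 's set \<Rightarrow> ('s \<Rightarrow> 'a) \<Rightarrow> ('s \<Rightarrow> 'm) \<Rightarrow> 'm" where
  "dot M S x g = (\<Oplus>\<^bsub>M\<^esub>s\<in>S. x s \<odot>\<^bsub>M\<^esub> g s)"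

lemma (in abelian_monoid) finsum_swap:
  assumes "finite S" "finite T" "\<And>s t. s \<in> S \<Longrightarrow> t \<in> T \<Longrightarrow> f s t \<in> carrier G"
  shows "(\<Oplus>s\<in>S. \<Oplus>t\<in>T. f s t) = (\<Oplus>t\<in>T. \<Oplus>s\<in>S. f s t)"
  using assms(1,3)
proof (induction S rule: finite_induct)
  case empty
  show ?case by (simp add: finsum_zero)
next
  case (insert s S)
  have "(\<Oplus>t\<in>T. \<Oplus>s\<in>insert s S. f s t) = (\<Oplus>t\<in>T. f s t \<oplus> (\<Oplus>s\<in>S. f s t))"
    by (rule finsum_cong') (use insert in \<open>auto simp: Pi_def\<close>)
  also have "\<dots> = (\<Oplus>t\<in>T. f s t) \<oplus> (\<Oplus>t\<in>T. \<Oplus>s\<in>S. f s t)"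
    by (rule finsum_addf) (use insert in \<open>auto simp: Pi_def\<close>)
  also have "\<dots> = (\<Oplus>s\<in>insert s S. \<Oplus>t\<in>T. f s t)"
    using insert by (subst finsum_insert) (auto simp: Pi_def)
  finally show ?case by (rule sym)
qed

context kmod
begin

lemma dot_closed [simp, intro]:
  "\<lbrakk>\<And>s. s \<in> S \<Longrightarrow> x s \<in> carrier A; \<And>s. s \<in> S \<Longrightarrow> g s \<in> carrier M\<rbrakk> \<Longrightarrow> dot M S x g \<in> carrier M"
  unfolding dot_def by (rule M.finsum_closed) auto

lemma dot_cong:
  assumes "\<And>s. s \<in> S \<Longrightarrow> x s = y s" "\<And>s. s \<in> S \<Longrightarrow> g s = h s"
    "\<And>s. s \<in> S \<Longrightarrow> y s \<in> carrier A" "\<And>s. s \<in> S \<Longrightarrow> h s \<in> carrier M"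
  shows "dot M S x g = dot M S y h"
  unfolding dot_def by (rule M.finsum_cong') (use assms in auto)

lemma dot_add_l:
  assumes "\<And>s. s \<in> S \<Longrightarrow> x s \<in> carrier A" "\<And>s. s \<in> S \<Longrightarrow> y s \<in> carrier A" "\<And>s. s \<in> S \<Longrightarrow> g s \<in> carrier M"
  shows "dot M S (\<lambda>s. x s \<oplus> y s) g = dot M S x g \<oplus>\<^bsub>M\<^esub> dot M S y g"
proof -
  have "dot M S (\<lambda>s. x s \<oplus> y s) g = (\<Oplus>\<^bsub>M\<^esub>s\<in>S. x s \<odot>\<^bsub>M\<^esub> g s \<oplus>\<^bsub>M\<^esub> y s \<odot>\<^bsub>M\<^esub> g s)"
    unfolding dot_def by (rule M.finsum_cong') (use assms in \<open>auto simp: smult_l_distr\<close>)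
  also have "\<dots> = dot M S x g \<oplus>\<^bsub>M\<^esub> dot M S y g"
    unfolding dot_def by (rule M.finsum_addf) (use assms in auto)
  finally show ?thesis .
qed

lemma dot_add_r:
  assumes "\<And>s. s \<in> S \<Longrightarrow> x s \<in> carrier A" "\<And>s. s \<in> S \<Longrightarrow> g s \<in> carrier M" "\<And>s. s \<in> S \<Longrightarrow> h s \<in> carrier M"
  shows "dot M S x (\<lambda>s. g s \<oplus>\<^bsub>M\<^esub> h s) = dot M S x g \<oplus>\<^bsub>M\<^esub> dot M S x h"
proof -
  have "dot M S x (\<lambda>s. g s \<oplus>\<^bsub>M\<^esub> h s) = (\<Oplus>\<^bsub>M\<^esub>s\<in>S. x s \<odot>\<^bsub>M\<^esub> g s \<oplus>\<^bsub>M\<^esub> x s \<odot>\<^bsub>M\<^esub> h s)"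
    unfolding dot_def by (rule M.finsum_cong') (use assms in \<open>auto simp: smult_r_distr\<close>)
  also have "\<dots> = dot M S x g \<oplus>\<^bsub>M\<^esub> dot M S x h"
    unfolding dot_def by (rule M.finsum_addf) (use assms in auto)
  finally show ?thesis .
qed

lemma finsum_smult:
  assumes "finite S" "a \<in> carrier A" "\<And>s. s \<in> S \<Longrightarrow> g s \<in> carrier M"
  shows "a \<odot>\<^bsub>M\<^esub> (\<Oplus>\<^bsub>M\<^esub>s\<in>S. g s) = (\<Oplus>\<^bsub>M\<^esub>s\<in>S. a \<odot>\<^bsub>M\<^esub> g s)"
  using assms(1,3) by (induction S rule: finite_induct) (auto simp: assms(2) Pi_def smult_r_distr)

lemma dot_smult:
  assumes "finite S" "a \<in> carrier A" "\<And>s. s \<in> S \<Longrightarrow> x s \<in> carrier A" "\<And>s. s \<in> S \<Longrightarrow> g s \<in> carrier M"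
  shows "a \<odot>\<^bsub>M\<^esub> dot M S x g = dot M S (\<lambda>s. a \<otimes> x s) g"
proof -
  have "a \<odot>\<^bsub>M\<^esub> dot M S x g = (\<Oplus>\<^bsub>M\<^esub>s\<in>S. a \<odot>\<^bsub>M\<^esub> (x s \<odot>\<^bsub>M\<^esub> g s))"
    unfolding dot_def by (rule finsum_smult) (use assms in auto)
  also have "\<dots> = dot M S (\<lambda>s. a \<otimes> x s) g"
    unfolding dot_def by (rule M.finsum_cong') (use assms in \<open>auto simp: smult_assoc\<close>)
  finally show ?thesis .
qed

lemma dot_zero_l:
  assumes "\<And>s. s \<in> S \<Longrightarrow> x s = \<zero>" "\<And>s. s \<in> S \<Longrightarrow> g s \<in> carrier M"
  shows "dot M S x g = \<zero>\<^bsub>M\<^esub>"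
  unfolding dot_def by (rule M.add.finprod_one_eqI) (use assms in auto)

lemma dot_zero_r:
  assumes "\<And>s. s \<in> S \<Longrightarrow> g s = \<zero>\<^bsub>M\<^esub>" "\<And>s. s \<in> S \<Longrightarrow> x s \<in> carrier A"
  shows "dot M S x g = \<zero>\<^bsub>M\<^esub>"
  unfolding dot_def by (rule M.add.finprod_one_eqI) (use assms in auto)

lemma dot_ks:
  assumes "finite S" "\<And>s. s \<in> S \<Longrightarrow> x s \<in> carrier A" "\<And>s. s \<in> S \<Longrightarrow> g s \<in> carrier M"
  shows "dot M S x (\<lambda>s. ks A M c (g s)) = ks A M c (dot M S x g)"
    "dot M S (\<lambda>s. c \<odot> x s) g = ks A M c (dot M S x g)"
proof -
  show 2: "dot M S (\<lambda>s. c \<odot> x s) g = ks A M c (dot M S x g)"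
    unfolding ks_def using assms
    by (subst dot_smult) (auto intro!: dot_cong simp: scal_mult_l)
  have "dot M S x (\<lambda>s. ks A M c (g s)) = dot M S (\<lambda>s. c \<odot> x s) g"
    unfolding dot_def by (rule M.finsum_cong') (use assms in \<open>auto simp: ks_smult_l ks_smult_r\<close>)
  with 2 show "dot M S x (\<lambda>s. ks A M c (g s)) = ks A M c (dot M S x g)" by simp
qed

lemma lin_smult_right: "m \<in> carrier M \<Longrightarrow> lin A (reg_mod A) M (\<lambda>a. a \<odot>\<^bsub>M\<^esub> m)"
  by (rule linI) (auto simp: smult_l_distr smult_assoc)

text \<open>Associativity (x X) g = x (X g) for a row x, a matrix X and a column g, on which all
  matrix computations with \<alpha> and \<rho> rest.\<close>

lemma dot_assoc:
  assumes fin: "finite S" "finite T" and x: "\<And>t. t \<in> T \<Longrightarrow> x t \<in> carrier A"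
    and X: "\<And>t s. t \<in> T \<Longrightarrow> s \<in> S \<Longrightarrow> X t s \<in> carrier A" and g: "\<And>s. s \<in> S \<Longrightarrow> g s \<in> carrier M"
  shows "dot M S (\<lambda>s. dot (reg_mod A) T x (\<lambda>t. X t s)) g = dot M T x (\<lambda>t. dot M S (X t) g)"
proof -
  have "dot M S (\<lambda>s. dot (reg_mod A) T x (\<lambda>t. X t s)) g =
      (\<Oplus>\<^bsub>M\<^esub>s\<in>S. \<Oplus>\<^bsub>M\<^esub>t\<in>T. (x t \<otimes> X t s) \<odot>\<^bsub>M\<^esub> g s)"
    unfolding dot_def[of M]
  proof (rule M.finsum_cong')
    fix s assume s: "s \<in> S"
    show "dot (reg_mod A) T x (\<lambda>t. X t s) \<odot>\<^bsub>M\<^esub> g s = (\<Oplus>\<^bsub>M\<^esub>t\<in>T. (x t \<otimes> X t s) \<odot>\<^bsub>M\<^esub> g s)"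
      using lin_finsum[OF reg_kmod is_kmod lin_smult_right[OF g[OF s]] fin(2), of "\<lambda>t. x t \<otimes> X t s"] x X s
      by (simp add: dot_def)
  qed (use assms in \<open>auto intro!: M.finsum_closed\<close>)
  also have "\<dots> = (\<Oplus>\<^bsub>M\<^esub>t\<in>T. \<Oplus>\<^bsub>M\<^esub>s\<in>S. (x t \<otimes> X t s) \<odot>\<^bsub>M\<^esub> g s)"
    by (rule M.finsum_swap) (use assms in auto)
  also have "\<dots> = dot M T x (\<lambda>t. dot M S (X t) g)"
    unfolding dot_def[of M T]
  proof (rule M.finsum_cong')
    fix t assume t: "t \<in> T"
    show "(\<Oplus>\<^bsub>M\<^esub>s\<in>S. (x t \<otimes> X t s) \<odot>\<^bsub>M\<^esub> g s) = x t \<odot>\<^bsub>M\<^esub> dot M S (X t) g"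
      using dot_smult[of S "x t" "X t" g] assms t by (simp add: dot_def)
  qed (use assms in auto)
  finally show ?thesis .
qed

lemma dot_single:
  assumes "finite S" "s \<in> S" "a \<in> carrier A" "\<And>s. s \<in> S \<Longrightarrow> g s \<in> carrier M"
  shows "dot M S (\<lambda>t. if t = s then a else \<zero>) g = a \<odot>\<^bsub>M\<^esub> g s"
proof -
  have "dot M S (\<lambda>t. if t = s then a else \<zero>) g = (\<Oplus>\<^bsub>M\<^esub>t\<in>S. if s = t then a \<odot>\<^bsub>M\<^esub> g t else \<zero>\<^bsub>M\<^esub>)"
    unfolding dot_def by (rule M.finsum_cong') (use assms in auto)
  also have "\<dots> = a \<odot>\<^bsub>M\<^esub> g s" by (rule M.finsum_singleton) (use assms in auto)
  finally show ?thesis .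
qed

end

lemma lin_dot:
  assumes "kmod A M" "kmod A N" "lin A M N f" "finite S"
    "\<And>s. s \<in> S \<Longrightarrow> x s \<in> carrier A" "\<And>s. s \<in> S \<Longrightarrow> g s \<in> carrier M"
  shows "f (dot M S x g) = dot N S x (\<lambda>s. f (g s))"
proof -
  interpret M: kmod A M by fact
  interpret N: kmod A N by fact
  have "f (dot M S x g) = (\<Oplus>\<^bsub>N\<^esub>s\<in>S. f (x s \<odot>\<^bsub>M\<^esub> g s))"
    unfolding dot_def by (rule lin_finsum[OF assms(1-4)]) (use assms in auto)
  also have "\<dots> = dot N S x (\<lambda>s. f (g s))"
    unfolding dot_def by (rule N.M.finsum_cong') (use assms in \<open>auto simp: linD\<close>)
  finally show ?thesis .
qed

subsection \<open>Sums of the modules generated by idempotents\<close>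

definition idem :: "('k, 'a) module \<Rightarrow> 's set \<Rightarrow> ('s \<Rightarrow> 'a) \<Rightarrow> bool" where
  "idem A S \<epsilon> \<longleftrightarrow> (\<forall>s\<in>S. \<epsilon> s \<in> carrier A \<and> \<epsilon> s \<otimes>\<^bsub>A\<^esub> \<epsilon> s = \<epsilon> s)"

lemma idemD: "idem A S \<epsilon> \<Longrightarrow> s \<in> S \<Longrightarrow> \<epsilon> s \<in> carrier A" "idem A S \<epsilon> \<Longrightarrow> s \<in> S \<Longrightarrow> \<epsilon> s \<otimes>\<^bsub>A\<^esub> \<epsilon> s = \<epsilon> s"
  by (auto simp: idem_def)

lemma idem_opp [simp]: "idem (opp A) = (idem A :: 's set \<Rightarrow> _)"
  by (simp add: idem_def fun_eq_iff)

text \<open>The direct sum of the left ideals generated by the idempotents, as rows: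
  \<open>x s \<otimes> \<epsilon> s = x s\<close> says that the entry lies in the s-th left ideal.
  Over \<open>opp A\<close> it is the direct sum of the right ideals.\<close>

definition fam :: "('k, 'a) module \<Rightarrow> 's set \<Rightarrow> ('s \<Rightarrow> 'a) \<Rightarrow> ('a, 's \<Rightarrow> 'a) module" where
  "fam A S \<epsilon> = mk_module {x \<in> S \<rightarrow>\<^sub>E carrier A. \<forall>s\<in>S. x s \<otimes>\<^bsub>A\<^esub> \<epsilon> s = x s}
     (\<lambda>x y. \<lambda>s\<in>S. x s \<oplus>\<^bsub>A\<^esub> y s) (\<lambda>s\<in>S. \<zero>\<^bsub>A\<^esub>) (\<lambda>a x. \<lambda>s\<in>S. a \<otimes>\<^bsub>A\<^esub> x s)"

text \<open>The generator of the s-th summand. Its entry is \<open>\<epsilon> s\<close>, since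
  \<one> need not lie in that summand.\<close>

definition fam_unit :: "('k, 'a) module \<Rightarrow> 's set \<Rightarrow> ('s \<Rightarrow> 'a) \<Rightarrow> 's \<Rightarrow> 's \<Rightarrow> 'a" where
  "fam_unit A S \<epsilon> s = (\<lambda>t\<in>S. if t = s then \<epsilon> s else \<zero>\<^bsub>A\<^esub>)"

lemma fam_simps [simp]:
  "x \<in> carrier (fam A S \<epsilon>) \<longleftrightarrow> x \<in> S \<rightarrow>\<^sub>E carrier A \<and> (\<forall>s\<in>S. x s \<otimes>\<^bsub>A\<^esub> \<epsilon> s = x s)"
  "x \<oplus>\<^bsub>fam A S \<epsilon>\<^esub> y = (\<lambda>s\<in>S. x s \<oplus>\<^bsub>A\<^esub> y s)" "\<zero>\<^bsub>fam A S \<epsilon>\<^esub> = (\<lambda>s\<in>S. \<zero>\<^bsub>A\<^esub>)"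
  "a \<odot>\<^bsub>fam A S \<epsilon>\<^esub> x = (\<lambda>s\<in>S. a \<otimes>\<^bsub>A\<^esub> x s)"
  by (simp_all add: fam_def)

context kalg
begin

lemma fam_kmod:
  assumes "idem A S \<epsilon>" shows "kmod A (fam A S \<epsilon>)"
  by (rule kmod_intro)
    (auto simp: fun_eq_iff PiE_iff extensional_def a_ac l_distr r_distr m_assoc idemD[OF assms])

lemma fam_finsum:
  assumes "idem A S \<epsilon>" "finite T" "\<And>t. t \<in> T \<Longrightarrow> F t \<in> carrier (fam A S \<epsilon>)"
  shows "(\<Oplus>\<^bsub>fam A S \<epsilon>\<^esub>t\<in>T. F t) = (\<lambda>s\<in>S. \<Oplus>t\<in>T. F t s)"
proof -
  interpret F: kmod A "fam A S \<epsilon>" by (rule fam_kmod[OF assms(1)])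
  show ?thesis using assms(2,3)
  proof (induction T rule: finite_induct)
    case empty then show ?case by simp
  next
    case (insert t T)
    then have "(\<Oplus>\<^bsub>fam A S \<epsilon>\<^esub>t\<in>insert t T. F t) = F t \<oplus>\<^bsub>fam A S \<epsilon>\<^esub> (\<lambda>s\<in>S. \<Oplus>t\<in>T. F t s)"
      by (subst F.M.finsum_insert) (auto simp: restrict_def simp del: fam_simps(2))
    also have "\<dots> = (\<lambda>s\<in>S. \<Oplus>t\<in>insert t T. F t s)"
    proof -
      have "F t s \<oplus> (\<Oplus>t\<in>T. F t s) = (\<Oplus>t\<in>insert t T. F t s)" if "s \<in> S" for s
        using insert that by (subst finsum_insert) (auto simp: PiE_iff)
      then show ?thesis by (auto simp: fun_eq_iff)
    qed
    finally show ?case .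
  qed
qed

lemma fam_dot:
  assumes "idem A S \<epsilon>" "finite T" "\<And>t. t \<in> T \<Longrightarrow> H t \<in> carrier (fam A S \<epsilon>)" "\<And>t. t \<in> T \<Longrightarrow> x t \<in> carrier A"
  shows "dot (fam A S \<epsilon>) T x H = (\<lambda>s\<in>S. dot (reg_mod A) T x (\<lambda>t. H t s))"
proof -
  interpret F: kmod A "fam A S \<epsilon>" by (rule fam_kmod[OF assms(1)])
  have "(\<Oplus>\<^bsub>fam A S \<epsilon>\<^esub>t\<in>T. x t \<odot>\<^bsub>fam A S \<epsilon>\<^esub> H t) = (\<lambda>s\<in>S. \<Oplus>t\<in>T. (x t \<odot>\<^bsub>fam A S \<epsilon>\<^esub> H t) s)"
    by (rule fam_finsum[OF assms(1,2)]) (use assms in \<open>blast intro: F.smult_closed\<close>)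
  then show ?thesis unfolding dot_def by (auto simp: fun_eq_iff)
qed

lemma fam_unit_closed:
  assumes "idem A S \<epsilon>" "s \<in> S" shows "fam_unit A S \<epsilon> s \<in> carrier (fam A S \<epsilon>)"
  using idemD[OF assms] idemD[OF assms(1)] by (auto simp: fam_unit_def)

lemma fam_expand:
  assumes "idem A S \<epsilon>" "finite S" "x \<in> carrier (fam A S \<epsilon>)"
  shows "dot (fam A S \<epsilon>) S x (fam_unit A S \<epsilon>) = x"
proof -
  have x: "x s \<in> carrier A" "x s \<otimes> \<epsilon> s = x s" if "s \<in> S" for s using assms(3) that by auto
  have "dot (reg_mod A) S x (\<lambda>t. fam_unit A S \<epsilon> t s) = x s" if s: "s \<in> S" for s
  proof -
    have "dot (reg_mod A) S x (\<lambda>t. fam_unit A S \<epsilon> t s) = (\<Oplus>t\<in>S. if s = t then x t else \<zero>)"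
      unfolding dot_def reg_mod_finsum
      by (rule finsum_cong') (use x s in \<open>auto simp: fam_unit_def\<close>)
    also have "\<dots> = x s" by (rule finsum_singleton) (use x s assms in auto)
    finally show ?thesis .
  qed
  moreover have "dot (fam A S \<epsilon>) S x (fam_unit A S \<epsilon>) =
      (\<lambda>s\<in>S. dot (reg_mod A) S x (\<lambda>t. fam_unit A S \<epsilon> t s))"
    by (rule fam_dot[OF assms(1,2) fam_unit_closed[OF assms(1)] x(1)])
  ultimately show ?thesis using assms(3) by (auto simp: fun_eq_iff PiE_iff extensional_def)
qed

lemma fam_lin:
  assumes "kmod A M" "idem A S \<epsilon>" "finite S" "\<And>s. s \<in> S \<Longrightarrow> g s \<in> carrier M"
  shows "lin A (fam A S \<epsilon>) M (\<lambda>x. dot M S x g)"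
proof -
  interpret kmod A M by fact
  have r: "dot M S (restrict x S) g = dot M S x g" if "\<And>s. s \<in> S \<Longrightarrow> x s \<in> carrier A" for x
    by (rule dot_cong) (use that assms in auto)
  show ?thesis
    by (rule linI) (auto simp: r PiE_iff assms dot_add_l dot_smult)
qed

lemma fam_fdmod:
  assumes "idem A S \<epsilon>" "finite S" "fdmod A (reg_mod A)"
  shows "fdmod A (fam A S \<epsilon>)"
proof (rule fdmod_sum[OF fam_kmod[OF assms(1)] assms(2) assms(3)])
  fix s assume s: "s \<in> S"
  interpret F: kmod A "fam A S \<epsilon>" by (rule fam_kmod[OF assms(1)])
  show "lin A (reg_mod A) (fam A S \<epsilon>) (\<lambda>a. a \<odot>\<^bsub>fam A S \<epsilon>\<^esub> fam_unit A S \<epsilon> s)"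
    by (rule F.lin_smult_right[OF fam_unit_closed[OF assms(1) s]])
next
  fix x assume x: "x \<in> carrier (fam A S \<epsilon>)"
  then have c: "\<forall>s\<in>S. x s \<in> carrier (reg_mod A)" by auto
  have "x = (\<Oplus>\<^bsub>fam A S \<epsilon>\<^esub>s\<in>S. x s \<odot>\<^bsub>fam A S \<epsilon>\<^esub> fam_unit A S \<epsilon> s)"
    using fam_expand[OF assms(1,2) x] unfolding dot_def by (rule sym)
  with c show "\<exists>y. (\<forall>s\<in>S. y s \<in> carrier (reg_mod A)) \<and>
      x = (\<Oplus>\<^bsub>fam A S \<epsilon>\<^esub>s\<in>S. y s \<odot>\<^bsub>fam A S \<epsilon>\<^esub> fam_unit A S \<epsilon> s)"
    by (intro exI[of _ x] conjI)
qed

end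

subsection \<open>Duals\<close>

lemma dual_carrier [simp]:
  "f \<in> carrier (dual_mod A M) \<longleftrightarrow> klin A M (carrier M) f \<and> f \<in> extensional (carrier M)"
  by (auto simp: dual_mod_def klin_def ks_def)

lemma dual_simps [simp]:
  "f \<oplus>\<^bsub>dual_mod A M\<^esub> g = (\<lambda>x\<in>carrier M. f x + g x)" "\<zero>\<^bsub>dual_mod A M\<^esub> = (\<lambda>x\<in>carrier M. 0)"
  "a \<odot>\<^bsub>dual_mod A M\<^esub> f = (\<lambda>x\<in>carrier M. f (a \<odot>\<^bsub>M\<^esub> x))"
  by (simp_all add: dual_mod_def)

lemma (in kmod) klin_restrict:
  "klin A M (carrier M) f \<Longrightarrow> klin A M (carrier M) (restrict f (carrier M))"
  by (auto simp: klin_def)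

lemma (in kmod) dual_kmod: "kmod (opp A) (dual_mod A M)"
proof -
  interpret B: kalg "opp A" by (rule kalg_opp)
  show ?thesis
    by (rule B.kmod_intro)
      (auto simp: klin_def fun_eq_iff extensional_def smult_l_distr smult_r_distr smult_assoc
        distrib_left ks_smult_r klin_zero[OF _ ksub_carrier, unfolded klin_def])
qed

lemma (in kmod) ks_dual:
  assumes "f \<in> carrier (dual_mod A M)"
  shows "ks A (dual_mod A M) c f = (\<lambda>x\<in>carrier M. c * f x)"
  using assms by (auto simp: ks_def fun_eq_iff klin_def)

lemma (in kmod) dual_finsum:
  assumes "finite T" "\<And>t. t \<in> T \<Longrightarrow> F t \<in> carrier (dual_mod A M)"
  shows "(\<Oplus>\<^bsub>dual_mod A M\<^esub>t\<in>T. F t) = (\<lambda>x\<in>carrier M. \<Sum>t\<in>T. F t x)"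
proof -
  interpret D: kmod "opp A" "dual_mod A M" by (rule dual_kmod)
  show ?thesis using assms
  proof (induction T rule: finite_induct)
    case empty then show ?case by simp
  next
    case (insert t T)
    then have "(\<Oplus>\<^bsub>dual_mod A M\<^esub>t\<in>insert t T. F t) = F t \<oplus>\<^bsub>dual_mod A M\<^esub> (\<lambda>x\<in>carrier M. \<Sum>t\<in>T. F t x)"
      by (subst D.M.finsum_insert) (auto simp: restrict_def simp del: dual_simps(1))
    then show ?case using insert by (auto simp: fun_eq_iff)
  qed
qed

text \<open>The coordinate functionals of a basis B form the dual basis, and the coefficient of f at
  the functional belonging to b is f b.\<close>

lemma (in kmod) dual_coordinates:
  assumes "fdmod A M"
  obtains B \<beta> where "finite B" "B \<subseteq> carrier M" "\<And>b. b \<in> B \<Longrightarrow> \<beta> b \<in> carrier (dual_mod A M)"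
    "\<And>f. f \<in> carrier (dual_mod A M) \<Longrightarrow>
      (\<Oplus>\<^bsub>dual_mod A M\<^esub>b\<in>B. ks (opp A) (dual_mod A M) (f b) (\<beta> b)) = f"
proof -
  interpret D: kmod "opp A" "dual_mod A M" by (rule dual_kmod)
  obtain B \<kappa> where B: "finite B" "B \<subseteq> carrier M" "\<And>b. b \<in> B \<Longrightarrow> klin A M (carrier M) (\<kappa> b)"
    "\<And>x. x \<in> carrier M \<Longrightarrow> (\<Oplus>\<^bsub>M\<^esub>b\<in>B. ks A M (\<kappa> b x) b) = x"
    by (rule coordinates[OF assms(1)], rule that) simp_all
  define \<beta> where "\<beta> b = restrict (\<kappa> b) (carrier M)" for b
  have \<beta>: "\<beta> b \<in> carrier (dual_mod A M)" if "b \<in> B" for b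
    using klin_restrict[OF B(3)[OF that]] by (simp add: \<beta>_def)
  have eq: "(\<Oplus>\<^bsub>dual_mod A M\<^esub>b\<in>B. ks (opp A) (dual_mod A M) (f b) (\<beta> b)) = f"
    if f: "f \<in> carrier (dual_mod A M)" for f
  proof -
    have fl: "klin A M (carrier M) f" "f \<in> extensional (carrier M)" using f by auto
    have k: "ks (opp A) (dual_mod A M) (f b) (\<beta> b) x = f b * \<kappa> b x" if "b \<in> B" "x \<in> carrier M" for b x
      using ks_dual[OF \<beta>[OF that(1)]] that(2) by (simp add: \<beta>_def)
    have "(\<Oplus>\<^bsub>dual_mod A M\<^esub>b\<in>B. ks (opp A) (dual_mod A M) (f b) (\<beta> b)) =
        (\<lambda>x\<in>carrier M. \<Sum>b\<in>B. ks (opp A) (dual_mod A M) (f b) (\<beta> b) x)"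
      by (rule dual_finsum[OF B(1)]) (rule D.ks_closed[OF \<beta>])
    also have "\<dots> = f"
    proof
      fix x
      show "(\<lambda>x\<in>carrier M. \<Sum>b\<in>B. ks (opp A) (dual_mod A M) (f b) (\<beta> b) x) x = f x"
      proof (cases "x \<in> carrier M")
        case True
        have "f x = f (\<Oplus>\<^bsub>M\<^esub>b\<in>B. ks A M (\<kappa> b x) b)" using B(4)[OF True] by simp
        also have "\<dots> = (\<Sum>b\<in>B. f (ks A M (\<kappa> b x) b))"
          using B(2) by (intro klin_finsum[OF fl(1) B(1)]) auto
        also have "\<dots> = (\<Sum>b\<in>B. ks (opp A) (dual_mod A M) (f b) (\<beta> b) x)"
          using B(2) by (intro sum.cong refl) (simp only: k[OF _ True] klinD(2)[OF fl(1)] mult.commute subset_eq)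
        finally show ?thesis using True by simp
      next
        case False then show ?thesis using fl by (auto simp: extensional_def)
      qed
    qed
    finally show ?thesis .
  qed
  show thesis by (rule that[OF B(1,2) \<beta> eq])
qed

lemma (in kmod) dual_fdmod:
  assumes "fdmod A M" shows "fdmod (opp A) (dual_mod A M)"
proof -
  interpret D: kmod "opp A" "dual_mod A M" by (rule dual_kmod)
  obtain B \<beta> where B: "finite B" "B \<subseteq> carrier M" "\<And>b. b \<in> B \<Longrightarrow> \<beta> b \<in> carrier (dual_mod A M)"
    "\<And>f. f \<in> carrier (dual_mod A M) \<Longrightarrow>
      (\<Oplus>\<^bsub>dual_mod A M\<^esub>b\<in>B. ks (opp A) (dual_mod A M) (f b) (\<beta> b)) = f"
    by (rule dual_coordinates[OF assms], rule that) (simp_all del: dual_carrier)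
  have sub: "\<beta> ` B \<subseteq> carrier (dual_mod A M)" using B(3) by blast
  note W = D.ksub_kspan[OF D.ksub_zero sub]
  have "f \<in> kspan (opp A) (dual_mod A M) {\<zero>\<^bsub>dual_mod A M\<^esub>} (\<beta> ` B)" if f: "f \<in> carrier (dual_mod A M)" for f
  proof -
    have "(\<Oplus>\<^bsub>dual_mod A M\<^esub>b\<in>B. ks (opp A) (dual_mod A M) (f b) (\<beta> b))
        \<in> kspan (opp A) (dual_mod A M) {\<zero>\<^bsub>dual_mod A M\<^esub>} (\<beta> ` B)"
      using D.kspan_sup(2)[OF D.ksub_zero sub] by (intro D.ksub_finsum[OF W B(1)] ksubD(4)[OF W]) auto
    then show ?thesis unfolding B(4)[OF f] .
  qed
  then show ?thesis unfolding D.fdmod_iff using B(1) sub by (intro exI[of _ "\<beta> ` B"]) blast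
qed

text \<open>Expanding f in the dual basis \<beta> gives l f as the sum of the f b times l (\<beta>
  b). This is the value of f at the combination of the vectors b with coefficients l (\<beta>
  b).\<close>

lemma (in kmod) dual_reflexive:
  assumes "fdmod A M" "klin (opp A) (dual_mod A M) (carrier (dual_mod A M)) l"
  shows "\<exists>x\<in>carrier M. \<forall>f\<in>carrier (dual_mod A M). l f = f x"
proof -
  interpret D: kmod "opp A" "dual_mod A M" by (rule dual_kmod)
  obtain B \<beta> where B: "finite B" "B \<subseteq> carrier M" "\<And>b. b \<in> B \<Longrightarrow> \<beta> b \<in> carrier (dual_mod A M)"
    "\<And>f. f \<in> carrier (dual_mod A M) \<Longrightarrow>
      (\<Oplus>\<^bsub>dual_mod A M\<^esub>b\<in>B. ks (opp A) (dual_mod A M) (f b) (\<beta> b)) = f"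
    by (rule dual_coordinates[OF assms(1)], rule that) (simp_all del: dual_carrier)
  define x where "x = (\<Oplus>\<^bsub>M\<^esub>b\<in>B. ks A M (l (\<beta> b)) b)"
  have x: "x \<in> carrier M" unfolding x_def using B(2) by (intro M.finsum_closed) auto
  have "l f = f x" if f: "f \<in> carrier (dual_mod A M)" for f
  proof -
    have fl: "klin A M (carrier M) f" using f by auto
    have "l f = l (\<Oplus>\<^bsub>dual_mod A M\<^esub>b\<in>B. ks (opp A) (dual_mod A M) (f b) (\<beta> b))" by (simp only: B(4)[OF f])
    also have "\<dots> = (\<Sum>b\<in>B. l (ks (opp A) (dual_mod A M) (f b) (\<beta> b)))"
      by (rule D.klin_finsum[OF assms(2) B(1)]) (rule D.ks_closed[OF B(3)])
    also have "\<dots> = (\<Sum>b\<in>B. f b * l (\<beta> b))"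
      by (intro sum.cong refl klinD(2)[OF assms(2)] B(3))
    also have "\<dots> = (\<Sum>b\<in>B. f (ks A M (l (\<beta> b)) b))"
      using B(2) klinD(2)[OF fl] by (intro sum.cong refl) (auto simp: mult.commute subset_eq)
    also have "\<dots> = f x"
      unfolding x_def using B(1,2) by (intro klin_finsum[OF fl, symmetric]) auto
    finally show ?thesis .
  qed
  then show ?thesis using x by blast
qed

definition dmap :: "('a, 'm) module \<Rightarrow> ('m \<Rightarrow> 'n) \<Rightarrow> ('n \<Rightarrow> 'k) \<Rightarrow> 'm \<Rightarrow> 'k" where
  "dmap M h \<phi> = (\<lambda>x\<in>carrier M. \<phi> (h x))"

lemma dmap_lin:
  assumes "kmod A M" "kmod A N" "lin A M N h"
  shows "lin (opp A) (dual_mod A N) (dual_mod A M) (dmap M h)"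
proof -
  interpret M: kmod A M by fact
  interpret N: kmod A N by fact
  show ?thesis
    by (rule linI) (auto simp: dmap_def klin_def linD[OF assms(3)] lin_ks[OF assms(1,3)] fun_eq_iff)
qed

subsection \<open>Lifting and extension of homomorphisms\<close>

text \<open>The condition on kernels makes g constant on the fibres of f. The factor is defined on
  the image of f only, expressed by replacing the carrier of Y.\<close>

lemma lin_factor:
  assumes X: "kmod A X" and Y: "kmod A Y" and Z: "kmod A Z" and f: "lin A X Y f" and g: "lin A X Z g"
    and ker: "\<And>x. x \<in> carrier X \<Longrightarrow> f x = \<zero>\<^bsub>Y\<^esub> \<Longrightarrow> g x = \<zero>\<^bsub>Z\<^esub>"
  obtains h where "lin A (Y\<lparr>carrier := f ` carrier X\<rparr>) Z h" "\<And>x. x \<in> carrier X \<Longrightarrow> h (f x) = g x"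
proof -
  interpret X: kmod A X by fact
  interpret Z: kmod A Z by fact
  interpret Y: kmod A Y by fact
  define h where "h y = g (SOME x. x \<in> carrier X \<and> f x = y)" for y
  have h: "h (f x) = g x" if x: "x \<in> carrier X" for x
  proof -
    let ?x = "SOME x'. x' \<in> carrier X \<and> f x' = f x"
    have x': "?x \<in> carrier X \<and> f ?x = f x" by (rule someI[of _ x]) (use x in simp)
    then have "f (?x \<ominus>\<^bsub>X\<^esub> x) = \<zero>\<^bsub>Y\<^esub>" using lin_diff[OF X Y f] x linD(1)[OF f] by simp
    then have "g ?x \<ominus>\<^bsub>Z\<^esub> g x = \<zero>\<^bsub>Z\<^esub>" using ker[of "?x \<ominus>\<^bsub>X\<^esub> x"] x x' lin_diff[OF X Z g] by simp
    then show ?thesis using Z.M_diff_eq x x' linD(1)[OF g] by (simp add: h_def)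
  qed
  have "lin A (Y\<lparr>carrier := f ` carrier X\<rparr>) Z h"
    by (rule linI) (auto simp: h linD[OF g] linD(2,3)[OF f, symmetric])
  then show thesis using h by (rule that)
qed

text \<open>The definition of projectivity tests only extensional surjections between modules with
  elements in \<open>nat \<Rightarrow> 'k\<close>. Hence Y is cut down to the image of p, and X and
  this image are transported into that type; \<open>im\<close> says that f takes its values
  there.\<close>

lemma projective_lift:
  fixes A :: "('k::field, 'a) module"
  assumes A: "kalg A" and P: "projective_mod A P" and X: "fdmod A X" and Y: "kmod A Y"
    and p: "lin A X Y p" and f: "lin A P Y f" and im: "\<And>w. w \<in> carrier P \<Longrightarrow> f w \<in> p ` carrier X"
  obtains h where "lin A P X h" "\<And>w. w \<in> carrier P \<Longrightarrow> p (h w) = f w"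
proof -
  interpret kalg A by fact
  have kX: "kmod A X" using X fdmod_kmod by blast
  have kP: "kmod A P" using P fdmod_kmod unfolding projective_mod_def by blast
  let ?Y = "Y\<lparr>carrier := p ` carrier X\<rparr>"
  have kY: "kmod A ?Y" by (rule kmod_image[OF kX Y p])
  have pY: "lin A X ?Y p" using p by (auto simp: lin_def)
  have fY: "lin A P ?Y f" using f im by (auto simp: lin_def)
  have fdY: "fdmod A ?Y" by (rule fdmod_surj[OF X kX kY pY]) simp
  obtain X' :: "('a, nat \<Rightarrow> 'k) module" and u u' where X': "fdmod A X'" "lin A X X' u" "lin A X' X u'"
    "\<forall>x\<in>carrier X. u' (u x) = x" "\<forall>x\<in>carrier X'. u (u' x) = x"
    using transport_nat[OF A X] by blast
  obtain Y' :: "('a, nat \<Rightarrow> 'k) module" and v v' where Y': "fdmod A Y'" "lin A ?Y Y' v" "lin A Y' ?Y v'"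
    "\<forall>x\<in>carrier ?Y. v' (v x) = x" "\<forall>x\<in>carrier Y'. v (v' x) = x"
    using transport_nat[OF A fdY] by blast
  have kX': "kmod A X'" using X'(1) fdmod_kmod by blast
  define p' where "p' = restrict (\<lambda>x. v (p (u' x))) (carrier X')"
  define f' where "f' = restrict (\<lambda>x. v (f x)) (carrier P)"
  have p': "p' \<in> mhom A X' Y'" unfolding p'_def
    by (rule lin_restrict_mhom[OF kX' lin_comp[OF lin_comp[OF X'(3) pY] Y'(2)]])
  have f': "f' \<in> mhom A P Y'" unfolding f'_def
    by (rule lin_restrict_mhom[OF kP lin_comp[OF fY Y'(2)]])
  have "p' ` carrier X' = carrier Y'"
  proof
    show "p' ` carrier X' \<subseteq> carrier Y'" using p' by (auto simp: mhom_iff linD)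
    show "carrier Y' \<subseteq> p' ` carrier X'"
    proof
      fix y assume y: "y \<in> carrier Y'"
      then have "v' y \<in> p ` carrier X" using linD(1)[OF Y'(3)] by auto
      then obtain x where x: "x \<in> carrier X" "v' y = p x" by blast
      have "p' (u x) = y" using x X' y Y'(5) linD(1)[OF X'(2)] by (simp add: p'_def x(2)[symmetric])
      then show "y \<in> p' ` carrier X'" using linD(1)[OF X'(2) x(1)] by blast
    qed
  qed
  then obtain h where h: "h \<in> mhom A P X'" "compose (carrier P) p' h = f'"
    using P X'(1) Y'(1) p' f' unfolding projective_mod_def by blast
  have hl: "lin A P X' h" using h(1) by (simp add: mhom_iff)
  show thesis
  proof (rule that)
    show "lin A P X (\<lambda>w. u' (h w))" by (rule lin_comp[OF hl X'(3)])
    fix w assume w: "w \<in> carrier P"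
    have "v (p (u' (h w))) = v (f w)"
      using fun_cong[OF h(2), of w] w linD(1)[OF hl w] by (simp add: compose_def p'_def f'_def)
    then have "v' (v (p (u' (h w)))) = v' (v (f w))" by simp
    then show "p (u' (h w)) = f w"
      using Y'(4) im[OF w] linD(1)[OF X'(3) linD(1)[OF hl w]] by auto
  qed
qed

text \<open>The definition of injectivity speaks of injective maps, which f need not be. By
  \<open>ker\<close> the map g factors over the image of f, and after transport the definition
  applies to the inclusion of this image into Y.\<close>

lemma injective_extend:
  fixes A :: "('k::field, 'a) module"
  assumes A: "kalg A" and I: "injective_mod A I" and X: "fdmod A X" and Y: "fdmod A Y"
    and f: "lin A X Y f" and g: "lin A X I g"
    and ker: "\<And>x. x \<in> carrier X \<Longrightarrow> f x = \<zero>\<^bsub>Y\<^esub> \<Longrightarrow> g x = \<zero>\<^bsub>I\<^esub>"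
  obtains h where "lin A Y I h" "\<And>x. x \<in> carrier X \<Longrightarrow> h (f x) = g x"
proof -
  interpret kalg A by fact
  have kX: "kmod A X" using X fdmod_kmod by blast
  have kY: "kmod A Y" using Y fdmod_kmod by blast
  have kI: "kmod A I" using I fdmod_kmod unfolding injective_mod_def by blast
  let ?X = "Y\<lparr>carrier := f ` carrier X\<rparr>"
  obtain g0 where g0: "lin A ?X I g0" "\<And>x. x \<in> carrier X \<Longrightarrow> g0 (f x) = g x"
    using lin_factor[OF kX kY kI f g ker] by metis
  have kX0: "kmod A ?X" by (rule kmod_image[OF kX kY f])
  have "lin A X ?X f" using f by (auto simp: lin_def)
  then have fdX: "fdmod A ?X" by (rule fdmod_surj[OF X kX kX0]) simp
  have inc: "lin A ?X Y (\<lambda>x. x)" using linD(1)[OF f] by (auto simp: lin_def)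
  obtain X' :: "('a, nat \<Rightarrow> 'k) module" and u u' where X': "fdmod A X'" "lin A ?X X' u" "lin A X' ?X u'"
    "\<forall>x\<in>carrier ?X. u' (u x) = x" "\<forall>x\<in>carrier X'. u (u' x) = x"
    using transport_nat[OF A fdX] by blast
  obtain Y' :: "('a, nat \<Rightarrow> 'k) module" and v v' where Y': "fdmod A Y'" "lin A Y Y' v" "lin A Y' Y v'"
    "\<forall>x\<in>carrier Y. v' (v x) = x" "\<forall>x\<in>carrier Y'. v (v' x) = x"
    using transport_nat[OF A Y] by blast
  have kX': "kmod A X'" using X'(1) fdmod_kmod by blast
  define j where "j = restrict (\<lambda>x. v (u' x)) (carrier X')"
  define f' where "f' = restrict (\<lambda>x. g0 (u' x)) (carrier X')"
  have j: "j \<in> mhom A X' Y'" unfolding j_def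
    by (rule lin_restrict_mhom[OF kX' lin_comp[OF lin_comp[OF X'(3) inc] Y'(2)]])
  have f': "f' \<in> mhom A X' I" unfolding f'_def
    by (rule lin_restrict_mhom[OF kX' lin_comp[OF X'(3) g0(1)]])
  have "inj_on j (carrier X')"
  proof (rule inj_onI)
    fix x y assume xy: "x \<in> carrier X'" "y \<in> carrier X'" "j x = j y"
    have "u' x \<in> carrier Y" "u' y \<in> carrier Y"
      using linD(1)[OF inc linD(1)[OF X'(3)]] xy by auto
    then have "u' x = u' y" using xy Y'(4) by (metis j_def restrict_apply')
    then show "x = y" using xy X'(5) by metis
  qed
  then obtain h where h: "h \<in> mhom A Y' I" "compose (carrier X') h j = f'"
    using I X'(1) Y'(1) j f' unfolding injective_mod_def by blast
  have hl: "lin A Y' I h" using h(1) by (simp add: mhom_iff)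
  show thesis
  proof (rule that)
    show "lin A Y I (\<lambda>y. h (v y))" by (rule lin_comp[OF Y'(2) hl])
    fix x assume x: "x \<in> carrier X"
    then have fx: "f x \<in> carrier ?X" by simp
    have "h (j (u (f x))) = f' (u (f x))"
      using fun_cong[OF h(2), of "u (f x)"] linD(1)[OF X'(2) fx] by (simp add: compose_def)
    then show "h (v (f x)) = g x"
      using linD(1)[OF X'(2) fx] X'(4) x g0(2)[OF x] by (simp add: j_def f'_def)
  qed
qed

text \<open>A homomorphism into the dual of a sum of modules \<open>\<epsilon>\<^sub>s A\<close> is a family of linear functionals, which can
  be extended.\<close>

lemma dual_fam_extend:
  fixes A :: "('k::field, 'a) module" (structure)
  assumes A: "kalg A" and id: "idem A S \<epsilon>" and fin: "finite S" and X: "kmod A X" and Y: "fdmod A Y"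
    and f: "lin A X Y f" and g: "lin A X (dual_mod (opp A) (fam (opp A) S \<epsilon>)) g"
    and ker: "\<And>x. x \<in> carrier X \<Longrightarrow> f x = \<zero>\<^bsub>Y\<^esub> \<Longrightarrow> g x = \<zero>\<^bsub>dual_mod (opp A) (fam (opp A) S \<epsilon>)\<^esub>"
  obtains h where "lin A Y (dual_mod (opp A) (fam (opp A) S \<epsilon>)) h" "\<And>x. x \<in> carrier X \<Longrightarrow> h (f x) = g x"
proof -
  interpret kalg A by fact
  interpret B: kalg "opp A" by (rule kalg_opp)
  let ?F = "fam (opp A) S \<epsilon>"
  let ?J = "dual_mod (opp A) ?F"
  have id': "idem (opp A) S \<epsilon>" using id by simp
  interpret F: kmod "opp A" ?F by (rule B.fam_kmod[OF id'])
  interpret X: kmod A X by fact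
  have kY: "kmod A Y" using Y fdmod_kmod by blast
  interpret Y: kmod A Y by (rule kY)
  have kJ: "kmod A ?J" using F.dual_kmod by simp
  obtain g0 where g0: "lin A (Y\<lparr>carrier := f ` carrier X\<rparr>) ?J g0" "\<And>x. x \<in> carrier X \<Longrightarrow> g0 (f x) = g x"
    using lin_factor[OF X kY kJ f g ker] by metis
  define e where "e = fam_unit (opp A) S \<epsilon>"
  have e: "e s \<in> carrier ?F" if "s \<in> S" for s
    unfolding e_def by (rule B.fam_unit_closed[OF id' that])
  have U: "ksub A Y (f ` carrier X)"
  proof -
    interpret U: kmod A "Y\<lparr>carrier := f ` carrier X\<rparr>" by (rule kmod_image[OF X kY f])
    show ?thesis using U.M.zero_closed U.M.a_closed U.ks_closed linD(1)[OF f]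
      by (auto simp: ksub_def ks_def)
  qed
  \<comment> \<open>Evaluation of \<open>g0\<close> at the generator \<open>e s\<close> is a
    functional on the image of f; as the generators generate, these functionals determine
    \<open>g0\<close>.\<close>
  have klin0: "klin A Y (f ` carrier X) (\<lambda>y. g0 y (e s))" if s: "s \<in> S" for s
    unfolding klin_def
  proof (intro conjI ballI allI)
    fix x y assume "x \<in> f ` carrier X" "y \<in> f ` carrier X"
    then show "g0 (x \<oplus>\<^bsub>Y\<^esub> y) (e s) = g0 x (e s) + g0 y (e s)"
      using linD(2)[OF g0(1), of x y] e[OF s] by (simp del: fam_simps)
  next
    fix c x assume x: "x \<in> f ` carrier X"
    have "g0 (ks A Y c x) = ks A ?J c (g0 x)"
      using linD(3)[OF g0(1), of "c \<odot> \<one>" x] x by (simp add: ks_def)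
    then show "g0 (ks A Y c x) (e s) = c * g0 x (e s)"
      using F.ks_dual[of "g0 x" c] linD(1)[OF g0(1), of x] x e[OF s] by (simp del: fam_simps dual_carrier)
  qed
  have "\<exists>q. klin A Y (carrier Y) q \<and> (\<forall>y\<in>f ` carrier X. q y = g0 y (e s))" if s: "s \<in> S" for s
    by (rule Y.klin_extend[OF Y U klin0[OF s]])
  then obtain q where q: "\<And>s. s \<in> S \<Longrightarrow> klin A Y (carrier Y) (q s)"
    "\<And>s x. s \<in> S \<Longrightarrow> x \<in> carrier X \<Longrightarrow> q s (f x) = g0 (f x) (e s)"
    by (metis imageI)
  \<comment> \<open>From functionals on Y to a homomorphism into the dual: \<open>q s\<close> is
    evaluated at the s-th entry of x times y. Linearity over A is then automatic, so extending
    functionals suffices.\<close>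
  define h where "h y = (\<lambda>x\<in>carrier ?F. \<Sum>s\<in>S. q s (x s \<odot>\<^bsub>Y\<^esub> y))" for y
  have ks_fam: "ks (opp A) ?F c x s = c \<odot> x s" if "x \<in> carrier ?F" "s \<in> S" for c x s
  proof -
    have "x s \<in> carrier A" using that by auto
    then show ?thesis using that(2) by (simp add: ks_def scal_mult_r)
  qed
  have hl: "lin A Y ?J h"
  proof (rule linI)
    fix y assume y: "y \<in> carrier Y"
    have "klin (opp A) ?F (carrier ?F) (h y)"
      unfolding klin_def
    proof (intro conjI ballI allI)
      fix x x' assume x: "x \<in> carrier ?F" "x' \<in> carrier ?F"
      then have xs: "x s \<in> carrier A" "x' s \<in> carrier A" if "s \<in> S" for s using that by auto
      have "q s ((x \<oplus>\<^bsub>?F\<^esub> x') s \<odot>\<^bsub>Y\<^esub> y) = q s (x s \<odot>\<^bsub>Y\<^esub> y) + q s (x' s \<odot>\<^bsub>Y\<^esub> y)" if s: "s \<in> S" for s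
        using xs[OF s] y s by (simp add: Y.smult_l_distr klinD(1)[OF q(1)[OF s]])
      then show "h y (x \<oplus>\<^bsub>?F\<^esub> x') = h y x + h y x'"
        using x F.M.a_closed[OF x] by (simp add: h_def sum.distrib del: fam_simps)
    next
      fix c x assume x: "x \<in> carrier ?F"
      then have xs: "x s \<in> carrier A" if "s \<in> S" for s using that by auto
      have "q s (ks (opp A) ?F c x s \<odot>\<^bsub>Y\<^esub> y) = c * q s (x s \<odot>\<^bsub>Y\<^esub> y)" if s: "s \<in> S" for s
        unfolding ks_fam[OF x s] using xs[OF s] y s by (simp add: Y.ks_smult_l klinD(2)[OF q(1)[OF s]])
      then show "h y (ks (opp A) ?F c x) = c * h y x"
        using x F.ks_closed[OF x, of c] by (simp add: h_def sum_distrib_left del: fam_simps ks_opp)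
    qed
    then show "h y \<in> carrier ?J" by (simp add: h_def)
  next
    fix y y' assume y: "y \<in> carrier Y" "y' \<in> carrier Y"
    have "q s (x s \<odot>\<^bsub>Y\<^esub> (y \<oplus>\<^bsub>Y\<^esub> y')) = q s (x s \<odot>\<^bsub>Y\<^esub> y) + q s (x s \<odot>\<^bsub>Y\<^esub> y')"
      if "s \<in> S" "x \<in> carrier ?F" for s x
    proof -
      have "x s \<in> carrier A" using that by auto
      then show ?thesis using y that by (simp add: Y.smult_r_distr klinD(1)[OF q(1)[OF that(1)]])
    qed
    then show "h (y \<oplus>\<^bsub>Y\<^esub> y') = h y \<oplus>\<^bsub>?J\<^esub> h y'"
      by (auto simp: h_def sum.distrib fun_eq_iff simp del: fam_simps)
  next
    fix a y assume a: "a \<in> carrier A" and y: "y \<in> carrier Y"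
    have "h (a \<odot>\<^bsub>Y\<^esub> y) x = (a \<odot>\<^bsub>?J\<^esub> h y) x" for x
    proof (cases "x \<in> carrier ?F")
      case True
      then have xs: "x s \<in> carrier A" if "s \<in> S" for s using that by auto
      have "q s (x s \<odot>\<^bsub>Y\<^esub> (a \<odot>\<^bsub>Y\<^esub> y)) = q s ((a \<odot>\<^bsub>?F\<^esub> x) s \<odot>\<^bsub>Y\<^esub> y)" if "s \<in> S" for s
        using xs[OF that] a y that by (simp add: Y.smult_assoc)
      then show ?thesis using True F.smult_closed[of a x] a by (simp add: h_def del: fam_simps)
    next
      case False then show ?thesis by (simp add: h_def del: fam_simps)
    qed
    then show "h (a \<odot>\<^bsub>Y\<^esub> y) = a \<odot>\<^bsub>?J\<^esub> h y" by blast
  qed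
  show thesis
  proof (rule that[OF hl])
    fix z assume z: "z \<in> carrier X"
    have gz: "klin (opp A) ?F (carrier ?F) (g z)" "g z \<in> extensional (carrier ?F)"
      using linD(1)[OF g z] by auto
    show "h (f z) = g z"
    proof
      fix x
      show "h (f z) x = g z x"
      proof (cases "x \<in> carrier ?F")
        case True
        then have xs: "x s \<in> carrier A" if "s \<in> S" for s using that by auto
        have "q s (x s \<odot>\<^bsub>Y\<^esub> f z) = g z (x s \<odot>\<^bsub>?F\<^esub> e s)" if s: "s \<in> S" for s
        proof -
          have "q s (x s \<odot>\<^bsub>Y\<^esub> f z) = q s (f (x s \<odot>\<^bsub>X\<^esub> z))" using linD(3)[OF f xs[OF s] z] by simp
          also have "\<dots> = g (x s \<odot>\<^bsub>X\<^esub> z) (e s)" using q(2)[OF s] g0(2) xs[OF s] z by simp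
          also have "\<dots> = g z (x s \<odot>\<^bsub>?F\<^esub> e s)"
            using linD(3)[OF g xs[OF s] z] e[OF s] by (simp del: fam_simps)
          finally show ?thesis .
        qed
        then have "h (f z) x = (\<Sum>s\<in>S. g z (x s \<odot>\<^bsub>?F\<^esub> e s))"
          using True by (simp add: h_def del: fam_simps)
        also have "\<dots> = g z (dot ?F S x e)"
          unfolding dot_def using xs e
          by (intro F.klin_finsum[OF gz(1) fin, symmetric] F.smult_closed) (simp_all del: fam_simps)
        also have "\<dots> = g z x" unfolding e_def using B.fam_expand[OF id' fin True] by simp
        finally show ?thesis .
      next
        case False then show ?thesis using gz(2) by (simp add: h_def extensional_def del: fam_simps)
      qed
    qed
  qed
qed

section \<open>Projective covers in the presence of a nilpotent radical\<close>

text \<open>A nilpotent filtration, standing for the powers of the radical.\<close>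

definition nil_filt :: "('k, 'a) module \<Rightarrow> (nat \<Rightarrow> 'a set) \<Rightarrow> bool" where
  "nil_filt A N \<longleftrightarrow> N 0 = carrier A \<and> (\<forall>m. additive_subgroup (N m) A) \<and>
     (\<forall>m n. \<forall>x\<in>N m. \<forall>y\<in>N n. x \<otimes>\<^bsub>A\<^esub> y \<in> N (m + n)) \<and> (\<exists>n. N n = {\<zero>\<^bsub>A\<^esub>})"

lemma nil_filt_opp:
  fixes A :: "('k, 'a) module"
  assumes "nil_filt A N" shows "nil_filt (opp A) N"
proof -
  have "add_monoid (opp A) = add_monoid A" by simp
  then have "additive_subgroup H (opp A) = additive_subgroup H A" for H
    unfolding additive_subgroup_def by simp
  moreover have "y \<otimes>\<^bsub>A\<^esub> x \<in> N (m + n)" if "x \<in> N m" "y \<in> N n" for m n x y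
    using assms that unfolding nil_filt_def by (metis add.commute)
  ultimately show ?thesis using assms by (auto simp: nil_filt_def)
qed

text \<open>Projective covers are determined by minimal generators: the lift to the sum of the \<open>A \<epsilon>\<^sub>s\<close> is
  unitriangular modulo the radical.\<close>

lemma proj_cover_basis:
  fixes A :: "('k::field, 'a) module" (structure)
  assumes A: "kalg A" and fdA: "fdmod A (reg_mod A)" and N: "nil_filt A N"
    and id: "idem A S \<epsilon>" and fin: "finite S" and cov: "proj_cover A F e M" and M: "kmod A M"
    and m: "\<And>s. s \<in> S \<Longrightarrow> m s \<in> carrier M" "\<And>s. s \<in> S \<Longrightarrow> \<epsilon> s \<odot>\<^bsub>M\<^esub> m s = m s"
    and gen: "\<And>y. y \<in> carrier M \<Longrightarrow> \<exists>x\<in>carrier (fam A S \<epsilon>). y = dot M S x m"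
    and min: "\<And>x s. x \<in> carrier (fam A S \<epsilon>) \<Longrightarrow> dot M S x m = \<zero>\<^bsub>M\<^esub> \<Longrightarrow> s \<in> S \<Longrightarrow> x s \<in> N 1"
  shows "\<exists>u. (\<forall>s\<in>S. u s \<in> carrier F \<and> \<epsilon> s \<odot>\<^bsub>F\<^esub> u s = u s \<and> e (u s) = m s) \<and>
    (\<forall>w\<in>carrier F. \<exists>x\<in>carrier (fam A S \<epsilon>). w = dot F S x u) \<and>
    (\<forall>x\<in>carrier (fam A S \<epsilon>). dot F S x u = \<zero>\<^bsub>F\<^esub> \<longrightarrow> (\<forall>s\<in>S. x s = \<zero>))"
proof -
  interpret kalg A by fact
  interpret M: kmod A M by fact
  have pF: "projective_mod A F" and em: "e \<in> mhom A F M" and es: "e ` carrier F = carrier M"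
    and sup: "\<And>U. submodule U A F \<Longrightarrow> U <+>\<^bsub>F\<^esub> a_kernel F M e = carrier F \<Longrightarrow> U = carrier F"
    using cov by (auto simp: proj_cover_def)
  have el: "lin A F M e" using em by (simp add: mhom_iff)
  have kF: "kmod A F" using pF fdmod_kmod unfolding projective_mod_def by blast
  interpret F: kmod A F by (rule kF)
  interpret E: kmod A "fam A S \<epsilon>" by (rule fam_kmod[OF id])
  have \<epsilon>: "\<epsilon> s \<in> carrier A" "\<epsilon> s \<otimes> \<epsilon> s = \<epsilon> s" if "s \<in> S" for s using idemD[OF id that] by auto
  \<comment> \<open>A preimage of \<open>m s\<close> under e, multiplied by
    \<open>\<epsilon> s\<close> so that it is fixed by this idempotent.\<close>
  have "\<exists>u\<in>carrier F. \<epsilon> s \<odot>\<^bsub>F\<^esub> u = u \<and> e u = m s" if s: "s \<in> S" for s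
  proof -
    obtain w where w: "w \<in> carrier F" "m s = e w" using m(1)[OF s] es by blast
    show ?thesis
    proof (intro bexI conjI)
      show "\<epsilon> s \<odot>\<^bsub>F\<^esub> (\<epsilon> s \<odot>\<^bsub>F\<^esub> w) = \<epsilon> s \<odot>\<^bsub>F\<^esub> w" using \<epsilon>[OF s] w by (simp add: F.smult_assoc[symmetric])
      show "e (\<epsilon> s \<odot>\<^bsub>F\<^esub> w) = m s" using linD(3)[OF el \<epsilon>(1)[OF s] w(1)] w m(2)[OF s] by simp
      show "\<epsilon> s \<odot>\<^bsub>F\<^esub> w \<in> carrier F" using \<epsilon>[OF s] w by simp
    qed
  qed
  then obtain u where u: "\<And>s. s \<in> S \<Longrightarrow> u s \<in> carrier F" "\<And>s. s \<in> S \<Longrightarrow> \<epsilon> s \<odot>\<^bsub>F\<^esub> u s = u s"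
    "\<And>s. s \<in> S \<Longrightarrow> e (u s) = m s" by metis
  have xA: "x s \<in> carrier A" if "x \<in> carrier (fam A S \<epsilon>)" "s \<in> S" for x s using that by auto
  have ed: "e (dot F S x u) = dot M S x m" if "x \<in> carrier (fam A S \<epsilon>)" for x
  proof -
    have "e (dot F S x u) = dot M S x (\<lambda>s. e (u s))"
      by (rule lin_dot[OF kF M el fin xA[OF that] u(1)])
    also have "\<dots> = dot M S x m" by (rule M.dot_cong) (use u(3) m xA[OF that] in auto)
    finally show ?thesis .
  qed
  let ?U = "(\<lambda>x. dot F S x u) ` carrier (fam A S \<epsilon>)"
  have ul: "lin A (fam A S \<epsilon>) F (\<lambda>x. dot F S x u)" by (rule fam_lin[OF kF id fin u(1)])
  have dc: "dot F S x u \<in> carrier F" if "x \<in> carrier (fam A S \<epsilon>)" for x using linD(1)[OF ul that] .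
  \<comment> \<open>The combinations of the \<open>u s\<close> reach everything modulo the kernel of
    e, because the \<open>m s\<close> generate M; the kernel of a projective cover can be discarded
    from such a sum.\<close>
  have UF: "?U = carrier F"
  proof (rule sup)
    interpret U: kmod A "F\<lparr>carrier := ?U\<rparr>" by (rule kmod_image[OF E.is_kmod kF ul])
    have sU: "?U \<subseteq> carrier F" using dc by blast
    show "submodule ?U A F"
    proof (intro submodule.intro subgroup.intro submodule_axioms.intro)
      show "?U \<subseteq> carrier (add_monoid F)" using sU by simp
      show "x \<otimes>\<^bsub>add_monoid F\<^esub> y \<in> ?U" if "x \<in> ?U" "y \<in> ?U" for x y
        using U.M.a_closed[of x y] that by simp
      show "\<one>\<^bsub>add_monoid F\<^esub> \<in> ?U" using U.M.zero_closed by simp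
      show "a \<odot>\<^bsub>F\<^esub> x \<in> ?U" if "a \<in> carrier A" "x \<in> ?U" for a x using U.smult_closed[of a x] that by simp
      show "inv\<^bsub>add_monoid F\<^esub> x \<in> ?U" if x: "x \<in> ?U" for x
      proof -
        have "inv\<^bsub>add_monoid F\<^esub> x = (\<ominus> \<one>) \<odot>\<^bsub>F\<^esub> x"
          using x sU F.smult_minus_l[of \<one> x] by (auto simp: a_inv_def)
        then show ?thesis using U.smult_closed[of "\<ominus> \<one>" x] x by simp
      qed
    qed
    show "?U <+>\<^bsub>F\<^esub> a_kernel F M e = carrier F"
    proof
      show "?U <+>\<^bsub>F\<^esub> a_kernel F M e \<subseteq> carrier F"
        using sU by (auto simp: set_add_def set_mult_def a_kernel_eq)
      show "carrier F \<subseteq> ?U <+>\<^bsub>F\<^esub> a_kernel F M e"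
      proof
        fix w assume w: "w \<in> carrier F"
        obtain x where x: "x \<in> carrier (fam A S \<epsilon>)" "e w = dot M S x m"
          using gen[OF linD(1)[OF el w]] by blast
        have "e (w \<ominus>\<^bsub>F\<^esub> dot F S x u) = \<zero>\<^bsub>M\<^esub>"
          using lin_diff[OF kF M el w dc[OF x(1)]] ed[OF x(1)] x(2) linD(1)[OF el w] M.M_minus_self by simp
        then have "w \<ominus>\<^bsub>F\<^esub> dot F S x u \<in> a_kernel F M e" using w dc[OF x(1)] by (simp add: a_kernel_eq)
        moreover have "w = dot F S x u \<oplus>\<^bsub>F\<^esub> (w \<ominus>\<^bsub>F\<^esub> dot F S x u)"
          using F.M_diff_add[OF w dc[OF x(1)]] w dc[OF x(1)] by (simp add: F.M.a_comm)
        ultimately show "w \<in> ?U <+>\<^bsub>F\<^esub> a_kernel F M e"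
          using x(1) unfolding set_add_def set_mult_def by auto
      qed
    qed
  qed
  have ml: "lin A (fam A S \<epsilon>) M (\<lambda>x. dot M S x m)" by (rule fam_lin[OF M id fin m(1)])
  have "e w \<in> (\<lambda>x. dot M S x m) ` carrier (fam A S \<epsilon>)" if "w \<in> carrier F" for w
    using gen[OF linD(1)[OF el that]] by blast
  \<comment> \<open>The way back: F is projective, so e lifts along the map that sends a row x to
    the combination of the \<open>m s\<close>.\<close>
  then obtain h where h: "lin A F (fam A S \<epsilon>) h" "\<And>w. w \<in> carrier F \<Longrightarrow> dot M S (h w) m = e w"
    using projective_lift[OF A pF fam_fdmod[OF id fin fdA] M ml el] by metis
  have N0: "N 0 = carrier A" and Nsub: "\<And>k. additive_subgroup (N k) A"
    and Nm: "\<And>k l x y. x \<in> N k \<Longrightarrow> y \<in> N l \<Longrightarrow> x \<otimes> y \<in> N (k + l)" and Nnil: "\<exists>k. N k = {\<zero>}"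
    using N by (auto simp: nil_filt_def)
  \<comment> \<open>The row \<open>h (u s)\<close> and the s-th unit row have the same image
    \<open>m s\<close> in M, so by \<open>min\<close> the entries of their difference lie in
    \<open>N 1\<close>.\<close>
  define n where "n s t = h (u s) t \<ominus> fam_unit A S \<epsilon> s t" for s t
  have hu: "h (u s) \<in> carrier (fam A S \<epsilon>)" if "s \<in> S" for s using linD(1)[OF h(1) u(1)[OF that]] .
  have fu: "fam_unit A S \<epsilon> s \<in> carrier (fam A S \<epsilon>)" if "s \<in> S" for s by (rule fam_unit_closed[OF id that])
  have nN: "n s t \<in> N 1" if s: "s \<in> S" and t: "t \<in> S" for s t
  proof -
    let ?d = "h (u s) \<ominus>\<^bsub>fam A S \<epsilon>\<^esub> fam_unit A S \<epsilon> s"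
    have d: "?d \<in> carrier (fam A S \<epsilon>)" using hu[OF s] fu[OF s] E.M.minus_closed by blast
    have "dot M S (fam_unit A S \<epsilon> s) m = dot M S (\<lambda>t. if t = s then \<epsilon> s else \<zero>) m"
      by (rule M.dot_cong) (use m(1) \<epsilon>(1) s in \<open>auto simp: fam_unit_def\<close>)
    also have "\<dots> = m s" using M.dot_single[OF fin s \<epsilon>(1)[OF s] m(1)] m(2)[OF s] by simp
    finally have "dot M S (fam_unit A S \<epsilon> s) m = m s" .
    then have "dot M S ?d m = \<zero>\<^bsub>M\<^esub>"
      using lin_diff[OF E.is_kmod M ml hu[OF s] fu[OF s]] h(2)[OF u(1)[OF s]] u(3)[OF s] m(1)[OF s]
      by simp
    then have "?d t \<in> N 1" using min[OF d _ t] by simp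
    moreover have "?d t = n s t"
    proof -
      have "?d \<oplus>\<^bsub>fam A S \<epsilon>\<^esub> fam_unit A S \<epsilon> s = h (u s)"
        by (rule E.M_diff_add[OF hu[OF s] fu[OF s]])
      from fun_cong[OF this, of t] have "?d t \<oplus> fam_unit A S \<epsilon> s t = h (u s) t"
        using t by (simp only: fam_simps(2) restrict_apply')
      moreover have "?d t \<in> carrier A" "fam_unit A S \<epsilon> s t \<in> carrier A" "h (u s) t \<in> carrier A"
        using xA[OF d t] xA[OF fu[OF s] t] xA[OF hu[OF s] t] by auto
      ultimately show ?thesis unfolding n_def
        by (simp add: a_minus_def add.inv_solve_right)
    qed
    ultimately show ?thesis by simp
  qed
  have nA: "n s t \<in> carrier A" if "s \<in> S" "t \<in> S" for s t
    using nN[OF that] additive_subgroup.a_subset[OF Nsub] by blast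
  have inj: "x s = \<zero>" if x: "x \<in> carrier (fam A S \<epsilon>)" and x0: "dot F S x u = \<zero>\<^bsub>F\<^esub>" and s: "s \<in> S" for x s
  proof -
    have "h (dot F S x u) = dot (fam A S \<epsilon>) S x (\<lambda>s. h (u s))"
      by (rule lin_dot[OF kF E.is_kmod h(1) fin xA[OF x] u(1)])
    then have "dot (fam A S \<epsilon>) S x (\<lambda>s. h (u s)) = \<zero>\<^bsub>fam A S \<epsilon>\<^esub>"
      using x0 lin_zero[OF kF E.is_kmod h(1)] by (simp del: fam_simps)
    moreover have "dot (fam A S \<epsilon>) S x (\<lambda>s. h (u s)) = (\<lambda>t\<in>S. dot (reg_mod A) S x (\<lambda>s. h (u s) t))"
      by (rule fam_dot[OF id fin hu xA[OF x]])
    ultimately have H0: "dot (reg_mod A) S x (\<lambda>s. h (u s) t) = \<zero>" if "t \<in> S" for t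
      using that by (metis fam_simps(3) restrict_apply')
    interpret R: kmod A "reg_mod A" by (rule reg_kmod)
    have E1: "dot (reg_mod A) S x (\<lambda>s. fam_unit A S \<epsilon> s t) = x t" if "t \<in> S" for t
    proof -
      have "dot (fam A S \<epsilon>) S x (fam_unit A S \<epsilon>) t = x t" using fam_expand[OF id fin x] by simp
      then show ?thesis
        using fam_dot[OF id fin fu xA[OF x]] that by simp
    qed
    \<comment> \<open>Applying h to the relation x u = 0 gives x (1 + n) = 0. If x has entries in
      \<open>N k\<close>, then x n has entries in \<open>N (Suc k)\<close>; hence x lies in every
      step of the filtration, one of which is zero.\<close>
    have key: "x t = \<ominus> dot (reg_mod A) S x (\<lambda>s. n s t)" if t: "t \<in> S" for t
    proof -
      have "dot (reg_mod A) S x (\<lambda>s. h (u s) t) =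
          dot (reg_mod A) S x (\<lambda>s. fam_unit A S \<epsilon> s t \<oplus>\<^bsub>reg_mod A\<^esub> n s t)"
      proof (rule R.dot_cong)
        fix s assume s: "s \<in> S"
        show "h (u s) t = fam_unit A S \<epsilon> s t \<oplus>\<^bsub>reg_mod A\<^esub> n s t"
          unfolding n_def using xA[OF hu[OF s] t] xA[OF fu[OF s] t]
            a_comm[of "fam_unit A S \<epsilon> s t" "h (u s) t \<ominus> fam_unit A S \<epsilon> s t"]
          by (simp add: a_minus_def a_assoc l_neg)
      qed (use xA[OF x] xA[OF fu _] t nA in auto)
      also have "\<dots> = x t \<oplus> dot (reg_mod A) S x (\<lambda>s. n s t)"
        using R.dot_add_r[of S x "\<lambda>s. fam_unit A S \<epsilon> s t" "\<lambda>s. n s t"] xA[OF x] xA[OF fu _] t nA E1[OF t]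
        by simp
      finally have "x t \<oplus> dot (reg_mod A) S x (\<lambda>s. n s t) = \<zero>" using H0[OF t] by simp
      then show ?thesis
        using R.dot_closed[of S x "\<lambda>s. n s t"] xA[OF x] t nA minus_equality[of "x t"] by (simp add: minus_equality)
    qed
    have "\<forall>t\<in>S. x t \<in> N k" for k
    proof (induction k)
      case 0 then show ?case using N0 xA[OF x] by auto
    next
      case (Suc k)
      interpret NS: additive_subgroup "N (Suc k)" A by (rule Nsub)
      have "dot (reg_mod A) S x (\<lambda>s. n s t) \<in> N (Suc k)" if t: "t \<in> S" for t
      proof -
        have xn: "x s \<otimes> n s t \<in> N (Suc k)" if "s \<in> S" for s using Nm[of "x s" k "n s t" 1] Suc nN that t by simp
        have "(\<Oplus>s\<in>S'. x s \<otimes> n s t) \<in> N (Suc k)" if "S' \<subseteq> S" for S'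
          using finite_subset[OF that fin] that
        proof (induction S' rule: finite_induct)
          case empty then show ?case using NS.zero_closed by simp
        next
          case (insert s S')
          then show ?case using xA[OF x] nA t xn by (subst finsum_insert) (auto simp: Pi_def subset_eq)
        qed
        from this[of S] show ?thesis by (simp add: dot_def)
      qed
      then show ?case using key NS.a_inv_closed by (metis additive_subgroup.a_inv_closed)
    qed
    then show ?thesis using Nnil s by blast
  qed
  have "\<exists>x\<in>carrier (fam A S \<epsilon>). w = dot F S x u" if "w \<in> carrier F" for w using UF that by blast
  then show ?thesis using u inj by (intro exI[of _ u]) blast
qed

lemma (in kmod) M_diff_diff: "\<lbrakk>x \<in> carrier M; y \<in> carrier M\<rbrakk> \<Longrightarrow> x \<ominus>\<^bsub>M\<^esub> (x \<ominus>\<^bsub>M\<^esub> y) = y"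
  by (simp add: M_diff_eq M.a_comm[of y])

lemma (in kmod) M_diff_zero [simp]: "x \<in> carrier M \<Longrightarrow> x \<ominus>\<^bsub>M\<^esub> \<zero>\<^bsub>M\<^esub> = x"
  by (simp add: M.minus_eq)

lemma (in kmod) M_eqI: "\<lbrakk>x \<in> carrier M; y \<in> carrier M; x \<ominus>\<^bsub>M\<^esub> y = \<zero>\<^bsub>M\<^esub>\<rbrakk> \<Longrightarrow> x = y"
  by (simp add: M_diff_eq)

text \<open>The factor is first defined on the image of f, which is a subspace of N, and then
  extended to all of N.\<close>

lemma klin_factor:
  assumes M: "kmod A M" and N: "fdmod A N" and f: "lin A M N f" and \<phi>: "klin A M (carrier M) \<phi>"
    and ker: "\<And>x. x \<in> carrier M \<Longrightarrow> f x = \<zero>\<^bsub>N\<^esub> \<Longrightarrow> \<phi> x = 0"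
  obtains \<psi> where "klin A N (carrier N) \<psi>" "\<And>x. x \<in> carrier M \<Longrightarrow> \<psi> (f x) = \<phi> x"
proof -
  interpret M: kmod A M by fact
  interpret N: kmod A N using N M.fdmod_kmod by blast
  define h where "h y = \<phi> (SOME x. x \<in> carrier M \<and> f x = y)" for y
  have h: "h (f x) = \<phi> x" if x: "x \<in> carrier M" for x
  proof -
    let ?x = "SOME x'. x' \<in> carrier M \<and> f x' = f x"
    have x': "?x \<in> carrier M \<and> f ?x = f x" by (rule someI[of _ x]) (use x in simp)
    then have "f (?x \<ominus>\<^bsub>M\<^esub> x) = \<zero>\<^bsub>N\<^esub>" using lin_diff[OF M N.is_kmod f] x linD(1)[OF f] by simp
    then have "\<phi> ?x - \<phi> x = 0"
      using ker[of "?x \<ominus>\<^bsub>M\<^esub> x"] x x' M.klin_diff[OF \<phi> M.ksub_carrier] by simp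
    then show ?thesis by (simp add: h_def)
  qed
  interpret U: kmod A "N\<lparr>carrier := f ` carrier M\<rparr>" by (rule kmod_image[OF M N.is_kmod f])
  have U: "ksub A N (f ` carrier M)"
    using U.M.zero_closed U.M.a_closed U.ks_closed linD(1)[OF f] by (auto simp: ksub_def ks_def)
  have "klin A N (f ` carrier M) h"
    by (auto simp: klin_def h linD(2)[OF f, symmetric] lin_ks[OF M f, symmetric] klinD[OF \<phi>])
  from N.klin_extend[OF N U this] show thesis using h that by (metis imageI)
qed

text \<open>The scalars \<open>c \<odot> \<one>\<close> are central, so a finite set that spans A
  from the left also spans it from the right.\<close>

lemma (in kalg) fdmod_opp_reg:
  assumes "fdmod A (reg_mod A)" shows "fdmod (opp A) (reg_mod (opp A))"
proof -
  interpret B: kalg "opp A" by (rule kalg_opp)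
  interpret R: kmod "opp A" "reg_mod (opp A)" by (rule B.reg_kmod)
  have "left_module (opp A) (reg_mod (opp A))" ..
  moreover have "(\<Oplus>b\<in>B. (c b \<odot> \<one>) \<otimes> b) = (\<Oplus>b\<in>B. b \<otimes> (c b \<odot> \<one>))" if "B \<subseteq> carrier A" for B c
    by (rule finsum_cong') (use that in \<open>auto simp: scal_mult_l scal_mult_r subset_eq\<close>)
  ultimately show ?thesis using assms unfolding fdmod_def by auto
qed

text \<open>The algebra with the beginning \<open>Q\<^sub>2 \<rightarrow> Q\<^sub>1 \<rightarrow> Q\<^sub>0\<close> of the minimal projective resolution of the simple
  right module at the source \<open>i\<close>: the first map is given by the matrix \<open>\<rho>\<close> of the elements \<open>r\<^sub>a\<close>, the
  second one by the row \<open>\<alpha>\<close> of the arrows starting in \<open>i\<close>. The filtration \<open>N\<close> consists of the powers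
  of the radical.\<close>

locale apr = kalg A for A :: "('k::field, 'a) module" (structure) +
  fixes ei :: 'a and Sa :: "'e set" and Sr :: "'r set" and \<epsilon>a :: "'e \<Rightarrow> 'a" and \<epsilon>r :: "'r \<Rightarrow> 'a"
    and \<alpha> :: "'e \<Rightarrow> 'a" and \<rho> :: "'e \<Rightarrow> 'r \<Rightarrow> 'a" and N :: "nat \<Rightarrow> 'a set"
  assumes fdA: "fdmod A (reg_mod A)" and nil: "nil_filt A N"
    and fin_Sa: "finite Sa" and fin_Sr: "finite Sr"
    and ei: "ei \<in> carrier A" "ei \<otimes> ei = ei" "ei \<notin> N 1"
    and A_ei: "\<And>x. x \<in> carrier A \<Longrightarrow> \<exists>c. x \<otimes> ei = c \<odot> ei"
    and idem_a: "idem A Sa \<epsilon>a" and idem_r: "idem A Sr \<epsilon>r"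
    and \<epsilon>a_notin: "\<And>a. a \<in> Sa \<Longrightarrow> \<epsilon>a a \<notin> N 1" and \<epsilon>r_notin: "\<And>r. r \<in> Sr \<Longrightarrow> \<epsilon>r r \<notin> N 1"
    and \<alpha>: "\<And>a. a \<in> Sa \<Longrightarrow> \<alpha> a \<in> N 1" "\<And>a. a \<in> Sa \<Longrightarrow> ei \<otimes> \<alpha> a = \<alpha> a"
      "\<And>a. a \<in> Sa \<Longrightarrow> \<alpha> a \<otimes> \<epsilon>a a = \<alpha> a"
    and \<rho>: "\<And>a r. a \<in> Sa \<Longrightarrow> r \<in> Sr \<Longrightarrow> \<rho> a r \<in> N 1"
      "\<And>a r. a \<in> Sa \<Longrightarrow> r \<in> Sr \<Longrightarrow> \<epsilon>a a \<otimes> \<rho> a r = \<rho> a r"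
      "\<And>a r. a \<in> Sa \<Longrightarrow> r \<in> Sr \<Longrightarrow> \<rho> a r \<otimes> \<epsilon>r r = \<rho> a r"
    and \<alpha>\<rho>: "\<And>r. r \<in> Sr \<Longrightarrow> (\<Oplus>a\<in>Sa. \<alpha> a \<otimes> \<rho> a r) = \<zero>"
    and exact: "\<And>x. \<lbrakk>\<And>a. a \<in> Sa \<Longrightarrow> x a \<in> carrier A; \<And>a. a \<in> Sa \<Longrightarrow> \<epsilon>a a \<otimes> x a = x a;
        (\<Oplus>a\<in>Sa. \<alpha> a \<otimes> x a) = \<zero>\<rbrakk> \<Longrightarrow>
        \<exists>z. (\<forall>r\<in>Sr. z r \<in> carrier A \<and> \<epsilon>r r \<otimes> z r = z r) \<and> (\<forall>a\<in>Sa. x a = (\<Oplus>r\<in>Sr. \<rho> a r \<otimes> z r))"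
    and minim: "\<And>z r. \<lbrakk>\<And>r. r \<in> Sr \<Longrightarrow> z r \<in> carrier A; \<And>r. r \<in> Sr \<Longrightarrow> \<epsilon>r r \<otimes> z r = z r;
        \<And>a. a \<in> Sa \<Longrightarrow> (\<Oplus>r\<in>Sr. \<rho> a r \<otimes> z r) = \<zero>; r \<in> Sr\<rbrakk> \<Longrightarrow> z r \<in> N 1"
    and span: "\<And>x. \<lbrakk>x \<in> carrier A; ei \<otimes> x = x\<rbrakk> \<Longrightarrow>
        \<exists>c y. (\<forall>a\<in>Sa. y a \<in> carrier A \<and> \<epsilon>a a \<otimes> y a = y a) \<and> x = c \<odot> ei \<oplus> (\<Oplus>a\<in>Sa. \<alpha> a \<otimes> y a)"
begin

abbreviation "B \<equiv> opp A"
text \<open>Over \<open>B\<close> these families are sums of right ideals of A; \<open>Q0\<close> is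
  indexed by a one-element set to give all three the same shape. The duals are left A-modules again,
  and \<open>dual_fam_extend\<close> is their injectivity.\<close>

abbreviation "Q0 \<equiv> fam B {()} (\<lambda>_. ei)"
abbreviation "Q1 \<equiv> fam B Sa \<epsilon>a"
abbreviation "Q2 \<equiv> fam B Sr \<epsilon>r"
abbreviation "J0 \<equiv> dual_mod B Q0"
abbreviation "J1 \<equiv> dual_mod B Q1"
abbreviation "J2 \<equiv> dual_mod B Q2"

lemma N_sub: "additive_subgroup (N m) A"
  using nil by (auto simp: nil_filt_def)

lemma N_carr: "x \<in> N m \<Longrightarrow> x \<in> carrier A"
  using additive_subgroup.a_subset[OF N_sub] by blast

lemma N_mult_l: "x \<in> carrier A \<Longrightarrow> y \<in> N m \<Longrightarrow> x \<otimes> y \<in> N m"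
  using nil unfolding nil_filt_def by (metis add_0)

lemma N_mult_r: "x \<in> N m \<Longrightarrow> y \<in> carrier A \<Longrightarrow> x \<otimes> y \<in> N m"
  using nil unfolding nil_filt_def by (metis add_0_right)

lemma N_mult: "x \<in> N m \<Longrightarrow> y \<in> N n \<Longrightarrow> x \<otimes> y \<in> N (m + n)"
  using nil unfolding nil_filt_def by blast

lemma N_scal: "x \<in> N m \<Longrightarrow> c \<odot> x \<in> N m"
  using N_mult_l[of "c \<odot> \<one>" x m] N_carr[of x m] by (simp add: scal_mult_l)

lemma N_zero: "\<zero> \<in> N m"
  using additive_subgroup.zero_closed[OF N_sub] .

lemma N_finsum:
  assumes "finite S" "\<And>s. s \<in> S \<Longrightarrow> f s \<in> N m" shows "(\<Oplus>s\<in>S. f s) \<in> N m"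
  using assms
proof (induction S rule: finite_induct)
  case empty then show ?case by (simp add: N_zero)
next
  case (insert s S)
  have "f t \<in> carrier A" if "t \<in> insert s S" for t using insert.prems that N_carr by metis
  then show ?case
    using additive_subgroup.a_closed[OF N_sub] insert by (subst finsum_insert) (auto simp: Pi_def)
qed

lemma ei_nz: "ei \<noteq> \<zero>" using ei N_zero by auto

lemma \<alpha>c: "a \<in> Sa \<Longrightarrow> \<alpha> a \<in> carrier A" by (rule N_carr[OF \<alpha>(1)])
lemma \<rho>c: "a \<in> Sa \<Longrightarrow> r \<in> Sr \<Longrightarrow> \<rho> a r \<in> carrier A" by (rule N_carr[OF \<rho>(1)])
lemma \<epsilon>ac: "a \<in> Sa \<Longrightarrow> \<epsilon>a a \<in> carrier A" by (rule idemD(1)[OF idem_a])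
lemma \<epsilon>rc: "r \<in> Sr \<Longrightarrow> \<epsilon>r r \<in> carrier A" by (rule idemD(1)[OF idem_r])

text \<open>By \<open>A_ei\<close> the left ideal A \<open>ei\<close> is one-dimensional. The factor
  is an algebra homomorphism from A to k, the character by which A acts on the simple module at
  i.\<close>

definition co :: "'a \<Rightarrow> 'k" where "co x = (THE c. x \<otimes> ei = c \<odot> ei)"

lemma scal_ei_inj: "c \<odot> ei = d \<odot> ei \<Longrightarrow> c = d"
proof (rule ccontr)
  assume a: "c \<odot> ei = d \<odot> ei" "c \<noteq> d"
  have "(c - d) \<odot> ei \<oplus> d \<odot> ei = d \<odot> ei"
    using scal_l_distr[OF ei(1), of "c - d" d] a(1) by simp
  then have "(c - d) \<odot> ei = \<zero>" using ei by simp
  then show False using scal_eq_zero[of ei "c - d"] ei(1) a(2) ei_nz by auto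
qed

lemma co: "x \<in> carrier A \<Longrightarrow> x \<otimes> ei = co x \<odot> ei"
  unfolding co_def by (rule theI') (use A_ei scal_ei_inj in metis)

lemma co_eqI: "x \<in> carrier A \<Longrightarrow> x \<otimes> ei = c \<odot> ei \<Longrightarrow> co x = c"
  using co scal_ei_inj by metis

lemma co_add: "\<lbrakk>x \<in> carrier A; y \<in> carrier A\<rbrakk> \<Longrightarrow> co (x \<oplus> y) = co x + co y"
  by (rule co_eqI) (auto simp: l_distr ei co[of x] co[of y] scal_l_distr)

lemma co_scal: "x \<in> carrier A \<Longrightarrow> co (c \<odot> x) = c * co x"
  by (rule co_eqI) (auto simp: scal_mult_l ei co[of x] scal_assoc)

lemma co_mult: "\<lbrakk>x \<in> carrier A; y \<in> carrier A\<rbrakk> \<Longrightarrow> co (x \<otimes> y) = co x * co y"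
  by (rule co_eqI) (auto simp: m_assoc ei co[of x] co[of y] scal_mult_r mult.commute simp flip: scal_assoc)

lemma co_ei: "co ei = 1"
  by (rule co_eqI) (auto simp: ei)

text \<open>Otherwise dividing x \<open>ei\<close> by the factor would put \<open>ei\<close> into
  \<open>N 1\<close>.\<close>

lemma co_N: assumes "x \<in> N 1" shows "co x = 0"
proof (rule ccontr)
  assume "co x \<noteq> 0"
  have "co x \<odot> ei \<in> N 1" using N_mult_r[OF assms ei(1)] co N_carr[OF assms] by simp
  then have "inverse (co x) \<odot> (co x \<odot> ei) \<in> N 1" by (rule N_scal)
  then show False using ei \<open>co x \<noteq> 0\<close> by (simp flip: scal_assoc)
qed

text \<open>In the decomposition \<open>span\<close> the second summand lies in \<open>N 1\<close>,
  where \<open>co\<close> vanishes, so the coefficient of \<open>ei\<close> is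
  \<open>co x\<close>.\<close>

lemma co_zero_N: assumes "x \<in> carrier A" "ei \<otimes> x = x" "co x = 0"
  shows "\<exists>y. (\<forall>a\<in>Sa. y a \<in> carrier A \<and> \<epsilon>a a \<otimes> y a = y a) \<and> x = (\<Oplus>a\<in>Sa. \<alpha> a \<otimes> y a)" "x \<in> N 1"
proof -
  obtain c y where y: "\<And>a. a \<in> Sa \<Longrightarrow> y a \<in> carrier A \<and> \<epsilon>a a \<otimes> y a = y a"
    "x = c \<odot> ei \<oplus> (\<Oplus>a\<in>Sa. \<alpha> a \<otimes> y a)" using span[OF assms(1,2)] by blast
  have n: "(\<Oplus>a\<in>Sa. \<alpha> a \<otimes> y a) \<in> N 1" using y \<alpha> N_mult_r by (intro N_finsum fin_Sa) auto
  then have "co x = c" unfolding y(2) using ei N_carr[OF n]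
    by (simp add: co_add co_scal co_ei co_N)
  then have c: "x = (\<Oplus>a\<in>Sa. \<alpha> a \<otimes> y a)" using y(2) assms N_carr[OF n] ei by simp
  then show "\<exists>y. (\<forall>a\<in>Sa. y a \<in> carrier A \<and> \<epsilon>a a \<otimes> y a = y a) \<and> x = (\<Oplus>a\<in>Sa. \<alpha> a \<otimes> y a)" using y(1) by blast
  show "x \<in> N 1" using n c by simp
qed

lemma kB: "kalg B" by (rule kalg_opp)
lemma fdB: "fdmod B (reg_mod B)" by (rule fdmod_opp_reg[OF fdA])
lemma id0: "idem B {()} (\<lambda>_. ei)" using ei by (auto simp: idem_def)
lemma id1: "idem B Sa \<epsilon>a" using idem_a by simp
lemma id2: "idem B Sr \<epsilon>r" using idem_r by simp
lemma kQ0: "kmod B Q0" by (rule kalg.fam_kmod[OF kB id0])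
lemma kQ1: "kmod B Q1" by (rule kalg.fam_kmod[OF kB id1])
lemma kQ2: "kmod B Q2" by (rule kalg.fam_kmod[OF kB id2])
lemma fQ0: "fdmod B Q0" by (rule kalg.fam_fdmod[OF kB id0 _ fdB]) simp
lemma fQ1: "fdmod B Q1" by (rule kalg.fam_fdmod[OF kB id1 fin_Sa fdB])
lemma fQ2: "fdmod B Q2" by (rule kalg.fam_fdmod[OF kB id2 fin_Sr fdB])
lemma kJ: "kmod A J0" "kmod A J1" "kmod A J2"
  using kmod.dual_kmod[OF kQ0] kmod.dual_kmod[OF kQ1] kmod.dual_kmod[OF kQ2] by simp_all
lemma fJ: "fdmod A J0" "fdmod A J1" "fdmod A J2"
  using kmod.dual_fdmod[OF kQ0 fQ0] kmod.dual_fdmod[OF kQ1 fQ1] kmod.dual_fdmod[OF kQ2 fQ2] by simp_all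

text \<open>The images of the generators: \<open>col0 a\<close> is the entry
  \<open>\<alpha> a\<close> of the row, \<open>col1 r\<close> the r-th column of \<rho>. Over
  \<open>B\<close> the combinations \<open>D1\<close> and \<open>D2\<close> are therefore left
  multiplications with \<alpha> and \<rho>, as \<open>D1_val\<close> and \<open>D2_val\<close> make
  explicit.\<close>

definition col0 where "col0 a = (\<lambda>_\<in>{()}. \<alpha> a)"
definition col1 where "col1 r = (\<lambda>a\<in>Sa. \<rho> a r)"
definition D1 where "D1 x = dot Q0 Sa x col0"
definition D2 where "D2 z = dot Q1 Sr z col1"

lemma col0: "a \<in> Sa \<Longrightarrow> col0 a \<in> carrier Q0"
  using \<alpha> \<alpha>c by (auto simp: col0_def)
lemma col1: "r \<in> Sr \<Longrightarrow> col1 r \<in> carrier Q1"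
  using \<rho> \<rho>c by (auto simp: col1_def)

lemma D1_lin: "lin B Q1 Q0 D1"
  unfolding D1_def by (rule kalg.fam_lin[OF kB kQ0 id1 fin_Sa col0])
lemma D2_lin: "lin B Q2 Q1 D2"
  unfolding D2_def by (rule kalg.fam_lin[OF kB kQ1 id2 fin_Sr col1])

lemma D1_val: "(\<And>a. a \<in> Sa \<Longrightarrow> x a \<in> carrier A) \<Longrightarrow> D1 x = (\<lambda>_\<in>{()}. \<Oplus>a\<in>Sa. \<alpha> a \<otimes> x a)"
  unfolding D1_def using kalg.fam_dot[OF kB id0 fin_Sa col0, where x = x]
  by (simp add: dot_def col0_def)
lemma D2_val: "(\<And>r. r \<in> Sr \<Longrightarrow> z r \<in> carrier A) \<Longrightarrow> D2 z = (\<lambda>a\<in>Sa. \<Oplus>r\<in>Sr. \<rho> a r \<otimes> z r)"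
  unfolding D2_def using kalg.fam_dot[OF kB id1 fin_Sr col1, where x = z]
  by (simp add: dot_def col1_def cong: restrict_cong)

lemma Q0_car: "w \<in> carrier Q0 \<Longrightarrow> w () \<in> carrier A" "w \<in> carrier Q0 \<Longrightarrow> ei \<otimes> w () = w ()"
  by auto
lemma Q1_car: "x \<in> carrier Q1 \<Longrightarrow> a \<in> Sa \<Longrightarrow> x a \<in> carrier A" "x \<in> carrier Q1 \<Longrightarrow> a \<in> Sa \<Longrightarrow> \<epsilon>a a \<otimes> x a = x a"
  by auto
lemma Q2_car: "z \<in> carrier Q2 \<Longrightarrow> r \<in> Sr \<Longrightarrow> z r \<in> carrier A" "z \<in> carrier Q2 \<Longrightarrow> r \<in> Sr \<Longrightarrow> \<epsilon>r r \<otimes> z r = z r"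
  by auto

lemma D1D2: "z \<in> carrier Q2 \<Longrightarrow> D1 (D2 z) = \<zero>\<^bsub>Q0\<^esub>"
proof -
  assume z: "z \<in> carrier Q2"
  interpret Q0: kmod B Q0 by (rule kQ0)
  have "D1 (D2 z) = dot Q0 Sr z (\<lambda>r. D1 (col1 r))"
    unfolding D2_def using Q2_car[OF z] z
    by (intro lin_dot[OF kQ1 kQ0 D1_lin fin_Sr] col1) auto
  also have "\<dots> = \<zero>\<^bsub>Q0\<^esub>"
  proof (rule Q0.dot_zero_r)
    fix r assume r: "r \<in> Sr"
    have "(\<Oplus>a\<in>Sa. \<alpha> a \<otimes> col1 r a) = (\<Oplus>a\<in>Sa. \<alpha> a \<otimes> \<rho> a r)"
      by (rule finsum_cong') (use r \<alpha>c \<rho>c in \<open>auto simp: col1_def\<close>)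
    then show "D1 (col1 r) = \<zero>\<^bsub>Q0\<^esub>"
      using r \<rho>c \<alpha>\<rho> by (subst D1_val) (auto simp: col1_def)
  qed (use Q2_car z in auto)
  finally show ?thesis .
qed

lemma D1_exact:
  assumes x: "x \<in> carrier Q1" "D1 x = \<zero>\<^bsub>Q0\<^esub>"
  obtains z where "z \<in> carrier Q2" "x = D2 z"
proof -
  have "D1 x () = \<zero>" using x(2) by simp
  then have "(\<Oplus>a\<in>Sa. \<alpha> a \<otimes> x a) = \<zero>" using D1_val[of x] Q1_car[OF x(1)] by simp
  then obtain z where z: "\<And>r. r \<in> Sr \<Longrightarrow> z r \<in> carrier A \<and> \<epsilon>r r \<otimes> z r = z r"
    "\<And>a. a \<in> Sa \<Longrightarrow> x a = (\<Oplus>r\<in>Sr. \<rho> a r \<otimes> z r)" using exact[of x] Q1_car[OF x(1)] by blast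
  have eq: "(\<Oplus>r\<in>Sr. \<rho> a r \<otimes> restrict z Sr r) = x a" if "a \<in> Sa" for a
    unfolding z(2)[OF that] by (rule finsum_cong') (use that z(1) \<rho>c in auto)
  show thesis
  proof (rule that)
    show "restrict z Sr \<in> carrier Q2" using z(1) by auto
    show "x = D2 (restrict z Sr)" using x(1) z(1) eq
      by (subst D2_val) (auto simp: fun_eq_iff PiE_iff extensional_def)
  qed
qed

lemma D2_min: "z \<in> carrier Q2 \<Longrightarrow> D2 z = \<zero>\<^bsub>Q1\<^esub> \<Longrightarrow> r \<in> Sr \<Longrightarrow> z r \<in> N 1"
proof -
  assume z: "z \<in> carrier Q2" "D2 z = \<zero>\<^bsub>Q1\<^esub>" and r: "r \<in> Sr"
  have "(\<Oplus>r\<in>Sr. \<rho> a r \<otimes> z r) = \<zero>" if "a \<in> Sa" for a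
    using z(2) D2_val[of z] Q2_car[OF z(1)] that by (auto simp: fun_eq_iff) metis
  then show ?thesis using minim[of z r] Q2_car z r by blast
qed

end

section \<open>The injective resolution of P and the condition id P = 2\<close>

locale apr_mod = apr A ei Sa Sr \<epsilon>a \<epsilon>r \<alpha> \<rho> N
  for A :: "('k::field, 'a) module" (structure) and ei Sa and Sr :: "'r set" and \<epsilon>a :: "'e \<Rightarrow> 'a" and \<epsilon>r \<alpha> \<rho> N +
  fixes P :: "('a, 'p) module" and \<pi> :: 'p
  assumes fdP: "fdmod A P" and \<pi>: "\<pi> \<in> carrier P" "\<pi> \<noteq> \<zero>\<^bsub>P\<^esub>" "ei \<odot>\<^bsub>P\<^esub> \<pi> = \<pi>"
    and P_span: "\<And>p. p \<in> carrier P \<Longrightarrow> \<exists>c. p = ks A P c \<pi>"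
begin

lemma kP: "kmod A P" by (rule fdmod_kmod[OF fdP])

sublocale P: kmod A P by (rule kP)

text \<open>Since \<open>ei\<close> fixes \<pi>, an element a acts on \<pi> like a
  \<open>ei\<close>, which is a scalar multiple of \<open>ei\<close>.\<close>

lemma smult_\<pi>: "a \<in> carrier A \<Longrightarrow> a \<odot>\<^bsub>P\<^esub> \<pi> = ks A P (co a) \<pi>"
proof -
  assume a: "a \<in> carrier A"
  have "a \<odot>\<^bsub>P\<^esub> \<pi> = (a \<otimes> ei) \<odot>\<^bsub>P\<^esub> \<pi>" using a ei \<pi> by (simp add: P.smult_assoc)
  also have "\<dots> = ks A P (co a) \<pi>" using a ei \<pi> by (simp add: co P.ks_smult_l)
  finally show ?thesis .
qed

definition kc :: "'p \<Rightarrow> 'k" where "kc p = (THE c. p = ks A P c \<pi>)"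

lemma ks_\<pi>_inj: "ks A P c \<pi> = ks A P d \<pi> \<Longrightarrow> c = d"
  using P.ks_eq_zero[OF \<pi>(1), of "c - d"] \<pi> P.ks_diff_l[OF \<pi>(1), of c d] by auto

lemma kc_ks [simp]: "kc (ks A P c \<pi>) = c"
  unfolding kc_def by (rule the_equality) (auto dest: ks_\<pi>_inj)

lemma ks_kc: "p \<in> carrier P \<Longrightarrow> ks A P (kc p) \<pi> = p"
  using P_span[of p] by auto

lemma kc_\<pi>: "kc \<pi> = 1"
  using kc_ks[of 1] \<pi> by simp

lemma kc_add: "p \<in> carrier P \<Longrightarrow> q \<in> carrier P \<Longrightarrow> kc (p \<oplus>\<^bsub>P\<^esub> q) = kc p + kc q"
  using P_span[of p] P_span[of q] \<pi> by (auto simp flip: P.ks_l_distr)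

lemma kc_smult: "p \<in> carrier P \<Longrightarrow> a \<in> carrier A \<Longrightarrow> kc (a \<odot>\<^bsub>P\<^esub> p) = co a * kc p"
  using P_span[of p] \<pi> by (auto simp: P.ks_smult_r smult_\<pi> mult.commute simp flip: P.ks_assoc)

definition ev :: "(unit \<Rightarrow> 'a) \<Rightarrow> 'k" where "ev = (\<lambda>x\<in>carrier Q0. co (x ()))"
text \<open>The embedding of P into the dual of the right ideal \<open>ei\<close> A: it takes \<pi>
  to the functional \<open>co\<close>.\<close>

definition etaJ where "etaJ p = (\<lambda>x\<in>carrier Q0. kc p * co (x ()))"
abbreviation "un0 \<equiv> (\<lambda>_\<in>{()}. ei)"

lemma un0: "un0 \<in> carrier Q0" using ei by auto

lemma Q0_simps: "\<lbrakk>x \<in> carrier Q0; y \<in> carrier Q0\<rbrakk> \<Longrightarrow> (x \<oplus>\<^bsub>Q0\<^esub> y) () = x () \<oplus> y ()"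
  "\<lbrakk>x \<in> carrier Q0; a \<in> carrier A\<rbrakk> \<Longrightarrow> (a \<odot>\<^bsub>Q0\<^esub> x) () = x () \<otimes> a"
  "x \<in> carrier Q0 \<Longrightarrow> (ks A Q0 c x) () = c \<odot> x ()"
  by (auto simp: ks_def scal_mult_r)

lemma klin_etaJ: "klin B Q0 (carrier Q0) (etaJ p)"
proof -
  interpret Q0: kmod B Q0 by (rule kQ0)
  show ?thesis unfolding klin_def
  proof (intro conjI ballI allI)
    fix x y assume xy: "x \<in> carrier Q0" "y \<in> carrier Q0"
    then show "etaJ p (x \<oplus>\<^bsub>Q0\<^esub> y) = etaJ p x + etaJ p y"
      using Q0.M.a_closed[OF xy] Q0_simps(1)[OF xy] Q0_car(1)[OF xy(1)] Q0_car(1)[OF xy(2)]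
      by (simp add: etaJ_def co_add algebra_simps del: fam_simps)
  next
    fix c x assume x: "x \<in> carrier Q0"
    then show "etaJ p (ks B Q0 c x) = c * etaJ p x"
      using Q0.ks_closed[OF x, of c] Q0_simps(3)[OF x] Q0_car(1)[OF x]
      by (simp add: etaJ_def co_scal algebra_simps del: fam_simps)
  qed
qed

lemma etaJ_lin: "lin A P J0 etaJ"
proof (rule linI)
  interpret Q0: kmod B Q0 by (rule kQ0)
  show "etaJ p \<in> carrier J0" for p using klin_etaJ by (simp add: etaJ_def)
  show "etaJ (p \<oplus>\<^bsub>P\<^esub> q) = etaJ p \<oplus>\<^bsub>J0\<^esub> etaJ q" if "p \<in> carrier P" "q \<in> carrier P" for p q
    using that by (simp add: etaJ_def kc_add algebra_simps fun_eq_iff del: fam_simps)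
  show "etaJ (a \<odot>\<^bsub>P\<^esub> p) = a \<odot>\<^bsub>J0\<^esub> etaJ p" if p: "p \<in> carrier P" and a: "a \<in> carrier A" for a p
  proof
    fix x
    show "etaJ (a \<odot>\<^bsub>P\<^esub> p) x = (a \<odot>\<^bsub>J0\<^esub> etaJ p) x"
    proof (cases "x \<in> carrier Q0")
      case True
      then show ?thesis
        using p a Q0.smult_closed[of a x] Q0_simps(2)[OF True a] Q0_car(1)[OF True]
        by (simp add: etaJ_def kc_smult co_mult algebra_simps del: fam_simps)
    next
      case False then show ?thesis by (simp add: etaJ_def del: fam_simps)
    qed
  qed
qed

lemma etaJ_un0: "etaJ p un0 = kc p"
  using un0 by (simp add: etaJ_def co_ei del: fam_simps)

lemma etaJ_inj: "p \<in> carrier P \<Longrightarrow> q \<in> carrier P \<Longrightarrow> etaJ p = etaJ q \<Longrightarrow> p = q"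
  using etaJ_un0 ks_kc by metis

text \<open>The duals of \<open>D1\<close> and \<open>D2\<close>. Together with the injective map
  \<open>etaJ\<close> they form an exact sequence from P through J0 and J1 to J2, as the following
  lemmas show.\<close>

definition d0 where "d0 = dmap Q1 D1"
definition d1 where "d1 = dmap Q2 D2"

lemma d0_lin: "lin A J0 J1 d0" unfolding d0_def using dmap_lin[OF kQ1 kQ0 D1_lin] by simp
lemma d1_lin: "lin A J1 J2 d1" unfolding d1_def using dmap_lin[OF kQ2 kQ1 D2_lin] by simp

lemma d0_val: "x \<in> carrier Q1 \<Longrightarrow> d0 \<psi> x = \<psi> (D1 x)"
  by (simp add: d0_def dmap_def)
lemma d1_val: "z \<in> carrier Q2 \<Longrightarrow> d1 \<phi> z = \<phi> (D2 z)"
  by (simp add: d1_def dmap_def)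

lemma J_zero: "klin B Q0 (carrier Q0) \<psi> \<Longrightarrow> \<psi> \<zero>\<^bsub>Q0\<^esub> = 0" "klin B Q1 (carrier Q1) \<phi> \<Longrightarrow> \<phi> \<zero>\<^bsub>Q1\<^esub> = 0"
  "klin B Q2 (carrier Q2) \<chi> \<Longrightarrow> \<chi> \<zero>\<^bsub>Q2\<^esub> = 0"
  using kmod.klin_zero[OF kQ0 _ kmod.ksub_carrier[OF kQ0]] kmod.klin_zero[OF kQ1 _ kmod.ksub_carrier[OF kQ1]]
    kmod.klin_zero[OF kQ2 _ kmod.ksub_carrier[OF kQ2]] by blast+

lemma d0_etaJ: "d0 (etaJ p) = \<zero>\<^bsub>J1\<^esub>"
proof -
  have "etaJ p (D1 x) = 0" if x: "x \<in> carrier Q1" for x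
  proof -
    have "D1 x () \<in> N 1"
      using D1_val[of x] Q1_car[OF x] N_mult_r[OF \<alpha>(1)] by (auto intro!: N_finsum fin_Sa)
    then show ?thesis using linD(1)[OF D1_lin x] by (simp add: etaJ_def co_N del: fam_simps)
  qed
  then show ?thesis by (auto simp: d0_def dmap_def fun_eq_iff simp del: fam_simps)
qed

text \<open>By \<open>span\<close> the module \<open>Q0\<close> is spanned by \<open>ei\<close> and
  the image of \<open>D1\<close>. A functional that vanishes on this image is determined by its
  value at \<open>ei\<close>, and this value is the coordinate of p.\<close>

lemma d0_kernel:
  assumes \<psi>: "\<psi> \<in> carrier J0" "d0 \<psi> = \<zero>\<^bsub>J1\<^esub>"
  obtains p where "p \<in> carrier P" "\<psi> = etaJ p"
proof
  interpret Q0: kmod B Q0 by (rule kQ0)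
  show "ks A P (\<psi> un0) \<pi> \<in> carrier P" using \<pi> by simp
  have l: "klin B Q0 (carrier Q0) \<psi>" "\<psi> \<in> extensional (carrier Q0)" using \<psi>(1) by auto
  show "\<psi> = etaJ (ks A P (\<psi> un0) \<pi>)"
  proof
    fix x
    show "\<psi> x = etaJ (ks A P (\<psi> un0) \<pi>) x"
    proof (cases "x \<in> carrier Q0")
      case True
      note x = Q0_car[OF True]
      obtain c y where y: "\<And>a. a \<in> Sa \<Longrightarrow> y a \<in> carrier A \<and> \<epsilon>a a \<otimes> y a = y a"
        "x () = c \<odot> ei \<oplus> (\<Oplus>a\<in>Sa. \<alpha> a \<otimes> y a)" using span[OF x] by blast
      let ?y = "restrict y Sa"
      have yQ: "?y \<in> carrier Q1" using y(1) by auto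
      have "(\<Oplus>a\<in>Sa. \<alpha> a \<otimes> ?y a) = (\<Oplus>a\<in>Sa. \<alpha> a \<otimes> y a)"
        by (rule finsum_cong') (use y(1) \<alpha>c in auto)
      then have D1y: "D1 ?y () = (\<Oplus>a\<in>Sa. \<alpha> a \<otimes> y a)" using D1_val[of ?y] y(1) by simp
      note Dc = linD(1)[OF D1_lin yQ]
      have xeq: "x = ks A Q0 c un0 \<oplus>\<^bsub>Q0\<^esub> D1 ?y"
      proof (rule extensionalityI[of _ "{()}"])
        show "x u = (ks A Q0 c un0 \<oplus>\<^bsub>Q0\<^esub> D1 ?y) u" for u
          using Q0_simps(1)[OF Q0.ks_closed[OF un0, of c, simplified ks_opp] Dc] Q0_simps(3)[OF un0] D1y y(2)
          by (cases u) (simp del: fam_simps)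
      qed (use True in \<open>auto simp: PiE_iff extensional_def\<close>)
      have "\<psi> (D1 ?y) = 0" using fun_cong[OF \<psi>(2), of ?y] yQ d0_val[OF yQ, of \<psi>] by (simp del: fam_simps)
      then have "\<psi> x = c * \<psi> un0"
        unfolding xeq using klinD(1)[OF l(1) Q0.ks_closed[OF un0, of c] Dc] klinD(2)[OF l(1) un0, of c]
        by (simp del: fam_simps)
      moreover have "co (x ()) = c"
      proof -
        have n: "(\<Oplus>a\<in>Sa. \<alpha> a \<otimes> y a) \<in> N 1" using y(1) N_mult_r[OF \<alpha>(1)] by (intro N_finsum fin_Sa) auto
        then show ?thesis unfolding y(2) using ei N_carr[OF n] by (simp add: co_add co_scal co_ei co_N)
      qed
      ultimately show ?thesis using True by (simp add: etaJ_def del: fam_simps)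
    next
      case False then show ?thesis using l(2) by (simp add: etaJ_def extensional_def del: fam_simps)
    qed
  qed
qed

lemma d1_d0: "\<psi> \<in> carrier J0 \<Longrightarrow> d1 (d0 \<psi>) = \<zero>\<^bsub>J2\<^esub>"
proof -
  assume \<psi>: "\<psi> \<in> carrier J0"
  have "\<psi> (D1 (D2 x)) = 0" if x: "x \<in> carrier Q2" for x
    unfolding D1D2[OF x] by (rule J_zero(1)) (use \<psi> in simp)
  then show ?thesis using linD(1)[OF D2_lin]
    by (auto simp: d0_def d1_def dmap_def fun_eq_iff simp del: fam_simps)
qed

text \<open>Such a functional vanishes on the image of \<open>D2\<close>, which is the kernel of
  \<open>D1\<close>; so it factors over \<open>D1\<close> and extends to \<open>Q0\<close>.\<close>

lemma d1_kernel:
  assumes \<phi>: "\<phi> \<in> carrier J1" "d1 \<phi> = \<zero>\<^bsub>J2\<^esub>"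
  obtains \<psi> where "\<psi> \<in> carrier J0" "\<phi> = d0 \<psi>"
proof -
  interpret Q0: kmod B Q0 by (rule kQ0)
  have l: "klin B Q1 (carrier Q1) \<phi>" "\<phi> \<in> extensional (carrier Q1)" using \<phi>(1) by auto
  have "\<phi> x = 0" if x: "x \<in> carrier Q1" "D1 x = \<zero>\<^bsub>Q0\<^esub>" for x
  proof -
    obtain z where z: "z \<in> carrier Q2" "x = D2 z" using D1_exact[OF x] by blast
    then show ?thesis using fun_cong[OF \<phi>(2), of z] d1_val[OF z(1), of \<phi>] by (simp del: fam_simps)
  qed
  then obtain \<psi> where \<psi>: "klin B Q0 (carrier Q0) \<psi>" "\<And>x. x \<in> carrier Q1 \<Longrightarrow> \<psi> (D1 x) = \<phi> x"
    using klin_factor[OF kQ1 fQ0 D1_lin l(1)] by metis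
  show thesis
  proof (rule that)
    show "restrict \<psi> (carrier Q0) \<in> carrier J0" using Q0.klin_restrict[OF \<psi>(1)] by simp
    show "\<phi> = d0 (restrict \<psi> (carrier Q0))"
      using \<psi>(2) l(2) linD(1)[OF D1_lin]
      by (auto simp: d0_def dmap_def fun_eq_iff extensional_def simp del: fam_simps)
  qed
qed

text \<open>The kernel of \<open>D\<^sub>2\<close> lies in the radical of \<open>Q\<^sub>2\<close> (minimality), where \<open>\<chi>\<close> vanishes.\<close>

lemma socle_in_image:
  assumes \<chi>: "\<chi> \<in> carrier J2" and kill: "\<And>a. a \<in> N 1 \<Longrightarrow> a \<odot>\<^bsub>J2\<^esub> \<chi> = \<zero>\<^bsub>J2\<^esub>"
  obtains \<phi> where "\<phi> \<in> carrier J1" "\<chi> = d1 \<phi>"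
proof -
  interpret Q1: kmod B Q1 by (rule kQ1)
  interpret Q2: kmod B Q2 by (rule kQ2)
  have l: "klin B Q2 (carrier Q2) \<chi>" "\<chi> \<in> extensional (carrier Q2)" using \<chi> by auto
  have "\<chi> z = 0" if z: "z \<in> carrier Q2" "D2 z = \<zero>\<^bsub>Q1\<^esub>" for z
  proof -
    have u: "fam_unit B Sr \<epsilon>r r \<in> carrier Q2" if "r \<in> Sr" for r
      by (rule kalg.fam_unit_closed[OF kB id2 that])
    have "\<chi> z = \<chi> (dot Q2 Sr z (fam_unit B Sr \<epsilon>r))"
      using kalg.fam_expand[OF kB id2 fin_Sr z(1)] by simp
    also have "\<dots> = (\<Sum>r\<in>Sr. \<chi> (z r \<odot>\<^bsub>Q2\<^esub> fam_unit B Sr \<epsilon>r r))"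
      unfolding dot_def using u Q2_car(1)[OF z(1)]
      by (intro Q2.klin_finsum[OF l(1) fin_Sr] Q2.smult_closed) (simp_all del: fam_simps)
    also have "\<dots> = 0"
    proof (intro sum.neutral ballI)
      fix r assume r: "r \<in> Sr"
      have "(z r \<odot>\<^bsub>J2\<^esub> \<chi>) (fam_unit B Sr \<epsilon>r r) = 0"
        using kill[OF D2_min[OF z r]] u[OF r] by (simp del: fam_simps)
      then show "\<chi> (z r \<odot>\<^bsub>Q2\<^esub> fam_unit B Sr \<epsilon>r r) = 0" using u[OF r] by (simp del: fam_simps)
    qed
    finally show ?thesis .
  qed
  then obtain \<phi> where \<phi>: "klin B Q1 (carrier Q1) \<phi>" "\<And>x. x \<in> carrier Q2 \<Longrightarrow> \<phi> (D2 x) = \<chi> x"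
    using klin_factor[OF kQ2 fQ1 D2_lin l(1)] by metis
  show thesis
  proof (rule that)
    show "restrict \<phi> (carrier Q1) \<in> carrier J1" using Q1.klin_restrict[OF \<phi>(1)] by simp
    show "\<chi> = d1 (restrict \<phi> (carrier Q1))"
      using \<phi>(2) l(2) linD(1)[OF D2_lin]
      by (auto simp: d1_def dmap_def fun_eq_iff extensional_def simp del: fam_simps)
  qed
qed

text \<open>As the infimum is finite, the set of possible lengths is nonempty, and then the infimum
  is attained.\<close>

lemma inj_dim_resolution:
  fixes M :: "('a, 'm) module"
  assumes "inj_dim A M = 2"
  obtains \<eta> I d where "inj_resolution A M \<eta> (I :: nat \<Rightarrow> ('a, nat \<Rightarrow> 'k) module) d" "carrier (I 3) = {\<zero>\<^bsub>I 3\<^esub>}"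
proof -
  define S where "S = {n. \<exists>\<eta> (I :: nat \<Rightarrow> ('a, nat \<Rightarrow> 'k) module) d.
     inj_resolution A M \<eta> I d \<and> (\<forall>j > n. carrier (I j) = {\<zero>\<^bsub>I j\<^esub>})}"
  have inf: "Inf (enat ` S) = 2" using assms by (simp add: inj_dim_def S_def)
  have "enat ` S \<noteq> {}"
  proof
    assume "enat ` S = {}"
    then show False using inf by (simp add: Inf_enat_def)
  qed
  then have "Inf (enat ` S) \<in> enat ` S" unfolding Inf_enat_def using LeastI_ex[of "\<lambda>x. x \<in> enat ` S"] by auto
  then obtain n where "n \<in> S" "enat n = 2" using inf by auto
  then have "2 \<in> S" by (metis enat.inject numeral_eq_enat)
  then show thesis using that by (auto simp: S_def)
qed

text \<open>The sequence J is compared with an injective resolution I that ends in degree 2. This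
  yields an endomorphism \<open>ret\<close> of \<open>J2\<close> that is the identity on the image
  of \<open>d1\<close> and takes all its values there. Minimality makes it injective, so it is the
  identity and \<open>d1\<close> is onto. Every functional on \<open>Q2\<close> then vanishes on the
  kernel of \<open>D2\<close>, which must be zero.\<close>

lemma D2_injective:
  assumes "inj_dim A P = 2" and z: "z \<in> carrier Q2" "D2 z = \<zero>\<^bsub>Q1\<^esub>"
  shows "z = \<zero>\<^bsub>Q2\<^esub>"
proof (rule ccontr)
  assume nz: "z \<noteq> \<zero>\<^bsub>Q2\<^esub>"
  obtain \<eta> and I :: "nat \<Rightarrow> ('a, nat \<Rightarrow> 'k) module" and d where
    res: "inj_resolution A P \<eta> I d" and I3: "carrier (I 3) = {\<zero>\<^bsub>I 3\<^esub>}"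
    using inj_dim_resolution[OF assms(1)] by blast
  have inj: "injective_mod A (I j)" for j using res by (simp add: inj_resolution_def)
  have fI: "fdmod A (I j)" for j using inj by (simp add: injective_mod_def)
  have kI: "kmod A (I j)" for j by (rule fdmod_kmod[OF fI])
  have \<eta>: "lin A P (I 0) \<eta>" and \<eta>inj: "inj_on \<eta> (carrier P)"
    using res by (auto simp: inj_resolution_def mhom_iff)
  have dl: "lin A (I j) (I (Suc j)) (d j)" for j using res by (simp add: inj_resolution_def mhom_iff)
  have ex0: "y \<in> carrier (I 0) \<Longrightarrow> d 0 y = \<zero>\<^bsub>I 1\<^esub> \<longleftrightarrow> y \<in> \<eta> ` carrier P" for y
    using res by (simp add: inj_resolution_def a_kernel_eq)
  have ex: "d j ` carrier (I j) = {y \<in> carrier (I (Suc j)). d (Suc j) y = \<zero>\<^bsub>I (Suc (Suc j))\<^esub>}" for j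
    using res by (simp add: inj_resolution_def a_kernel_eq)
  have dl0: "lin A (I 0) (I 1) (d 0)" using dl[of 0] by simp
  have dl1: "lin A (I 1) (I 2) (d 1)" using dl[of 1] by (simp add: numeral_2_eq_2)
  have dd: "d 1 (d 0 y) = \<zero>\<^bsub>I 2\<^esub>" if "y \<in> carrier (I 0)" for y
    using ex[of 0] that by (auto simp: numeral_2_eq_2)
  \<comment> \<open>The term in degree 3 is zero, so exactness in degree 2 makes the preceding map
    onto.\<close>
  have surj: "\<exists>w\<in>carrier (I 1). y = d 1 w" if y: "y \<in> carrier (I 2)" for y
  proof -
    have "d 2 y \<in> carrier (I 3)" using linD(1)[OF dl[of 2], of y] y by simp
    then have "d 2 y = \<zero>\<^bsub>I 3\<^esub>" using I3 by simp
    then have "y \<in> d 1 ` carrier (I 1)" using ex[of 1] y by (simp add: numeral_2_eq_2 numeral_3_eq_3)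
    then show ?thesis by blast
  qed
  interpret J0: kmod A J0 by (rule kJ)
  interpret J1: kmod A J1 by (rule kJ)
  interpret J2: kmod A J2 by (rule kJ)
  have id0': "idem A {()} (\<lambda>_. ei)" using id0 by simp
  have eta0: "etaJ p = \<zero>\<^bsub>J0\<^esub> \<Longrightarrow> p \<in> carrier P \<Longrightarrow> p = \<zero>\<^bsub>P\<^esub>" for p
    using etaJ_inj[of p "\<zero>\<^bsub>P\<^esub>"] lin_zero[OF kP kJ(1) etaJ_lin] by simp
  have \<eta>0: "\<eta> p = \<zero>\<^bsub>I 0\<^esub> \<Longrightarrow> p \<in> carrier P \<Longrightarrow> p = \<zero>\<^bsub>P\<^esub>" for p
    using inj_onD[OF \<eta>inj, of p "\<zero>\<^bsub>P\<^esub>"] lin_zero[OF kP kI \<eta>] by simp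
  have d\<eta>: "d 0 (\<eta> p) = \<zero>\<^bsub>I 1\<^esub>" if "p \<in> carrier P" for p
    using ex0[of "\<eta> p"] linD(1)[OF \<eta> that] that by blast
  \<comment> \<open>The maps \<open>b0\<close>, \<open>b1\<close>, \<open>b2\<close> from J to I,
    and after them \<open>a0\<close>, \<open>a1\<close>, \<open>a2\<close> from I to J, extend the
    identity of P. The former exist because the terms of I are injective, the latter by extension of
    functionals.\<close>
  obtain b0 where b0: "lin A J0 (I 0) b0" "\<And>p. p \<in> carrier P \<Longrightarrow> b0 (etaJ p) = \<eta> p"
    using injective_extend[OF is_kalg inj fdP fJ(1) etaJ_lin \<eta>] eta0 lin_zero[OF kP kI \<eta>] by metis
  have "d 0 (b0 \<psi>) = \<zero>\<^bsub>I 1\<^esub>" if "\<psi> \<in> carrier J0" "d0 \<psi> = \<zero>\<^bsub>J1\<^esub>" for \<psi>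
    using d0_kernel[OF that] b0(2) d\<eta> by metis
  then obtain b1 where b1: "lin A J1 (I 1) b1" "\<And>\<psi>. \<psi> \<in> carrier J0 \<Longrightarrow> b1 (d0 \<psi>) = d 0 (b0 \<psi>)"
    using injective_extend[OF is_kalg inj fJ(1) fJ(2) d0_lin lin_comp[OF b0(1) dl0]] by metis
  have "d 1 (b1 \<phi>) = \<zero>\<^bsub>I 2\<^esub>" if "\<phi> \<in> carrier J1" "d1 \<phi> = \<zero>\<^bsub>J2\<^esub>" for \<phi>
    using d1_kernel[OF that] b1(2) dd linD(1)[OF b0(1)] by metis
  then obtain b2 where b2: "lin A J2 (I 2) b2" "\<And>\<phi>. \<phi> \<in> carrier J1 \<Longrightarrow> b2 (d1 \<phi>) = d 1 (b1 \<phi>)"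
    using injective_extend[OF is_kalg inj fJ(2) fJ(3) d1_lin lin_comp[OF b1(1) dl1]] by metis
  obtain a0 where a0: "lin A (I 0) J0 a0" "\<And>p. p \<in> carrier P \<Longrightarrow> a0 (\<eta> p) = etaJ p"
    using dual_fam_extend[OF is_kalg id0' _ kP fI \<eta> etaJ_lin] \<eta>0 lin_zero[OF kP kJ(1) etaJ_lin] by (metis finite.emptyI finite.insertI)
  have "d0 (a0 y) = \<zero>\<^bsub>J1\<^esub>" if "y \<in> carrier (I 0)" "d 0 y = \<zero>\<^bsub>I 1\<^esub>" for y
    using ex0[OF that(1)] that(2) a0(2) d0_etaJ by auto
  then obtain a1 where a1: "lin A (I 1) J1 a1" "\<And>y. y \<in> carrier (I 0) \<Longrightarrow> a1 (d 0 y) = d0 (a0 y)"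
    using dual_fam_extend[OF is_kalg idem_a fin_Sa kI fI dl0 lin_comp[OF a0(1) d0_lin]] by metis
  have "d1 (a1 y) = \<zero>\<^bsub>J2\<^esub>" if "y \<in> carrier (I 1)" "d 1 y = \<zero>\<^bsub>I 2\<^esub>" for y
  proof -
    have "y \<in> d 0 ` carrier (I 0)" using ex[of 0] that by (simp add: numeral_2_eq_2)
    then show ?thesis using a1(2) d1_d0 linD(1)[OF a0(1)] by auto
  qed
  then obtain a2 where a2: "lin A (I 2) J2 a2" "\<And>y. y \<in> carrier (I 1) \<Longrightarrow> a2 (d 1 y) = d1 (a1 y)"
    using dual_fam_extend[OF is_kalg idem_r fin_Sr kI fI dl1 lin_comp[OF a1(1) d1_lin]] by metis
  \<comment> \<open>A homotopy between a b and the identity: \<open>s1\<close> with a0 b0 - 1 = s1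
    d0, then \<open>s2\<close> with a1 b1 - 1 - d0 s1 = s2 d1.\<close>
  have l1: "lin A J0 J0 (\<lambda>\<psi>. a0 (b0 \<psi>) \<ominus>\<^bsub>J0\<^esub> \<psi>)"
    by (rule lin_diff_fun[OF kJ(1) lin_comp[OF b0(1) a0(1)] lin_id])
  have "a0 (b0 \<psi>) \<ominus>\<^bsub>J0\<^esub> \<psi> = \<zero>\<^bsub>J0\<^esub>" if \<psi>: "\<psi> \<in> carrier J0" "d0 \<psi> = \<zero>\<^bsub>J1\<^esub>" for \<psi>
  proof -
    obtain p where p: "p \<in> carrier P" "\<psi> = etaJ p" using d0_kernel[OF \<psi>] by metis
    then show ?thesis using a0(2) b0(2) J0.M_minus_self[OF \<psi>(1)] by simp
  qed
  then obtain s1 where s1: "lin A J1 J0 s1" "\<And>\<psi>. \<psi> \<in> carrier J0 \<Longrightarrow> s1 (d0 \<psi>) = a0 (b0 \<psi>) \<ominus>\<^bsub>J0\<^esub> \<psi>"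
    using dual_fam_extend[OF is_kalg id0' _ kJ(1) fJ(2) d0_lin l1] by (metis finite.emptyI finite.insertI)
  have l2: "lin A J1 J1 (\<lambda>\<phi>. a1 (b1 \<phi>) \<ominus>\<^bsub>J1\<^esub> \<phi> \<ominus>\<^bsub>J1\<^esub> d0 (s1 \<phi>))"
    by (rule lin_diff_fun[OF kJ(2) lin_diff_fun[OF kJ(2) lin_comp[OF b1(1) a1(1)] lin_id] lin_comp[OF s1(1) d0_lin]])
  have "a1 (b1 \<phi>) \<ominus>\<^bsub>J1\<^esub> \<phi> \<ominus>\<^bsub>J1\<^esub> d0 (s1 \<phi>) = \<zero>\<^bsub>J1\<^esub>" if \<phi>: "\<phi> \<in> carrier J1" "d1 \<phi> = \<zero>\<^bsub>J2\<^esub>" for \<phi>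
  proof -
    obtain \<psi> where \<psi>: "\<psi> \<in> carrier J0" "\<phi> = d0 \<psi>" using d1_kernel[OF \<phi>] by metis
    have c: "a0 (b0 \<psi>) \<in> carrier J0" using linD(1)[OF a0(1) linD(1)[OF b0(1) \<psi>(1)]] .
    have "a1 (b1 \<phi>) = d0 (a0 (b0 \<psi>))" using b1(2) a1(2) \<psi> linD(1)[OF b0(1) \<psi>(1)] by simp
    moreover have "d0 (s1 \<phi>) = d0 (a0 (b0 \<psi>)) \<ominus>\<^bsub>J1\<^esub> \<phi>"
      using s1(2) \<psi> lin_diff[OF kJ(1,2) d0_lin c \<psi>(1)] by simp
    ultimately show ?thesis
      using J1.M_minus_self J1.M.minus_closed linD(1)[OF d0_lin c] \<phi>(1) by metis
  qed
  then obtain s2 where s2: "lin A J2 J1 s2"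
    "\<And>\<phi>. \<phi> \<in> carrier J1 \<Longrightarrow> s2 (d1 \<phi>) = a1 (b1 \<phi>) \<ominus>\<^bsub>J1\<^esub> \<phi> \<ominus>\<^bsub>J1\<^esub> d0 (s1 \<phi>)"
    using dual_fam_extend[OF is_kalg idem_a fin_Sa kJ(2) fJ(3) d1_lin l2] by metis
  \<comment> \<open>J is not continued beyond degree 2, so the homotopy stops here: what remains of
    a2 b2 after subtracting d1 s2 is known to be the identity on the image of
    \<open>d1\<close>.\<close>
  define ret where "ret \<phi> = a2 (b2 \<phi>) \<ominus>\<^bsub>J2\<^esub> d1 (s2 \<phi>)" for \<phi>
  have ret_lin: "lin A J2 J2 ret" unfolding ret_def
    by (rule lin_diff_fun[OF kJ(3) lin_comp[OF b2(1) a2(1)] lin_comp[OF s2(1) d1_lin]])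
  have ret_d1: "ret (d1 \<phi>) = d1 \<phi>" if \<phi>: "\<phi> \<in> carrier J1" for \<phi>
  proof -
    let ?x = "a1 (b1 \<phi>)"
    have c: "?x \<in> carrier J1" "s1 \<phi> \<in> carrier J0" "d0 (s1 \<phi>) \<in> carrier J1" "d1 ?x \<in> carrier J2" "d1 \<phi> \<in> carrier J2"
      using linD(1)[OF a1(1) linD(1)[OF b1(1) \<phi>]] linD(1)[OF s1(1) \<phi>] linD(1)[OF d0_lin linD(1)[OF s1(1) \<phi>]]
        linD(1)[OF d1_lin linD(1)[OF a1(1) linD(1)[OF b1(1) \<phi>]]] linD(1)[OF d1_lin \<phi>] by simp_all
    have "d1 (s2 (d1 \<phi>)) = d1 ?x \<ominus>\<^bsub>J2\<^esub> d1 \<phi> \<ominus>\<^bsub>J2\<^esub> d1 (d0 (s1 \<phi>))"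
      unfolding s2(2)[OF \<phi>] using lin_diff[OF kJ(2,3) d1_lin J1.M.minus_closed[OF c(1) \<phi>] c(3)]
        lin_diff[OF kJ(2,3) d1_lin c(1) \<phi>] by simp
    also have "\<dots> = d1 ?x \<ominus>\<^bsub>J2\<^esub> d1 \<phi>"
      unfolding d1_d0[OF c(2)] by (rule J2.M_diff_zero[OF J2.M.minus_closed[OF c(4,5)]])
    finally have "d1 (s2 (d1 \<phi>)) = d1 ?x \<ominus>\<^bsub>J2\<^esub> d1 \<phi>" .
    moreover have "a2 (b2 (d1 \<phi>)) = d1 ?x" using b2(2)[OF \<phi>] a2(2) linD(1)[OF b1(1) \<phi>] by simp
    ultimately show ?thesis unfolding ret_def using J2.M_diff_diff[OF c(4,5)] by simp
  qed
  \<comment> \<open>Here id P = 2 is used: b2 \<chi> comes from \<open>I 1\<close>, so a2 b2 \<chi>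
    comes from \<open>J1\<close>.\<close>
  have ret_im: "\<exists>\<phi>\<in>carrier J1. ret \<chi> = d1 \<phi>" if \<chi>: "\<chi> \<in> carrier J2" for \<chi>
  proof -
    obtain w where w: "w \<in> carrier (I 1)" "b2 \<chi> = d 1 w" using surj[OF linD(1)[OF b2(1) \<chi>]] by blast
    have c: "a1 w \<in> carrier J1" "s2 \<chi> \<in> carrier J1" using linD(1)[OF a1(1) w(1)] linD(1)[OF s2(1) \<chi>] .
    have "ret \<chi> = d1 (a1 w \<ominus>\<^bsub>J1\<^esub> s2 \<chi>)"
      unfolding ret_def w(2) a2(2)[OF w(1)] lin_diff[OF kJ(2,3) d1_lin c] by simp
    then show ?thesis using J1.M.minus_closed[OF c] by blast
  qed
  \<comment> \<open>Descending induction on the filtration. If \<open>N (Suc m)\<close> kills \<psi>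
    and l lies in \<open>N m\<close>, then l \<psi> is killed by \<open>N 1\<close>, hence lies in
    the image of \<open>d1\<close>, where \<open>ret\<close> is the identity; so l \<psi> = l (ret
    \<psi>) = 0.\<close>
  have ret_inj: "\<psi> = \<zero>\<^bsub>J2\<^esub>" if \<psi>: "\<psi> \<in> carrier J2" "ret \<psi> = \<zero>\<^bsub>J2\<^esub>" for \<psi>
  proof -
    have step: "\<forall>l\<in>N m. l \<odot>\<^bsub>J2\<^esub> \<psi> = \<zero>\<^bsub>J2\<^esub>" if H: "\<forall>l\<in>N (Suc m). l \<odot>\<^bsub>J2\<^esub> \<psi> = \<zero>\<^bsub>J2\<^esub>" for m
    proof
      fix l assume l: "l \<in> N m"
      note lc = N_carr[OF l]
      let ?\<chi> = "l \<odot>\<^bsub>J2\<^esub> \<psi>"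
      have \<chi>: "?\<chi> \<in> carrier J2" by (rule J2.smult_closed[OF lc \<psi>(1)])
      have "a \<odot>\<^bsub>J2\<^esub> ?\<chi> = \<zero>\<^bsub>J2\<^esub>" if a: "a \<in> N 1" for a
      proof -
        have "a \<otimes> l \<in> N (Suc m)" using N_mult[OF a l] by simp
        then have "(a \<otimes> l) \<odot>\<^bsub>J2\<^esub> \<psi> = \<zero>\<^bsub>J2\<^esub>" using H by blast
        then show ?thesis by (simp only: J2.smult_assoc[OF N_carr[OF a] lc \<psi>(1)])
      qed
      then obtain \<phi> where \<phi>: "\<phi> \<in> carrier J1" "?\<chi> = d1 \<phi>" using socle_in_image[OF \<chi>] by blast
      have "?\<chi> = ret ?\<chi>" using ret_d1[OF \<phi>(1)] \<phi>(2) by (simp only:)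
      also have "\<dots> = l \<odot>\<^bsub>J2\<^esub> ret \<psi>" by (rule linD(3)[OF ret_lin lc \<psi>(1)])
      also have "\<dots> = \<zero>\<^bsub>J2\<^esub>" unfolding \<psi>(2) by (rule J2.smult_zero_r[OF lc])
      finally show "?\<chi> = \<zero>\<^bsub>J2\<^esub>" .
    qed
    obtain n where n: "N n = {\<zero>}" using nil by (auto simp: nil_filt_def)
    have "\<forall>l\<in>N n. l \<odot>\<^bsub>J2\<^esub> \<psi> = \<zero>\<^bsub>J2\<^esub>" unfolding n using J2.smult_zero_l[OF \<psi>(1)] by blast
    then have "\<forall>l\<in>N 0. l \<odot>\<^bsub>J2\<^esub> \<psi> = \<zero>\<^bsub>J2\<^esub>"
      by (induction n) (use step in blast)+
    then have "\<one> \<odot>\<^bsub>J2\<^esub> \<psi> = \<zero>\<^bsub>J2\<^esub>" using nil by (simp add: nil_filt_def del: dual_simps)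
    then show ?thesis using J2.smult_one[OF \<psi>(1)] by (simp only:)
  qed
  \<comment> \<open>The values of \<open>ret\<close> lie where it is the identity, so it is
    idempotent; an injective idempotent is the identity.\<close>
  have ret_id: "ret \<chi> = \<chi>" if \<chi>: "\<chi> \<in> carrier J2" for \<chi>
  proof -
    note rc = linD(1)[OF ret_lin \<chi>]
    obtain \<phi> where \<phi>: "\<phi> \<in> carrier J1" "ret \<chi> = d1 \<phi>" using ret_im[OF \<chi>] by blast
    have "ret (\<chi> \<ominus>\<^bsub>J2\<^esub> ret \<chi>) = ret \<chi> \<ominus>\<^bsub>J2\<^esub> ret (ret \<chi>)" by (rule lin_diff[OF kJ(3,3) ret_lin \<chi> rc])
    also have "ret (ret \<chi>) = ret \<chi>" unfolding \<phi>(2) by (rule ret_d1[OF \<phi>(1)])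
    also have "ret \<chi> \<ominus>\<^bsub>J2\<^esub> ret \<chi> = \<zero>\<^bsub>J2\<^esub>" by (rule J2.M_minus_self[OF rc])
    finally have "\<chi> \<ominus>\<^bsub>J2\<^esub> ret \<chi> = \<zero>\<^bsub>J2\<^esub>" using ret_inj[OF J2.M.minus_closed[OF \<chi> rc]] by blast
    then show ?thesis using J2.M_eqI[OF \<chi> rc] by simp
  qed
  interpret Q2: kmod B Q2 by (rule kQ2)
  obtain g where g: "klin B Q2 (carrier Q2) g" "g z \<noteq> 0" using Q2.klin_separates[OF fQ2 z(1) nz] by blast
  let ?g = "restrict g (carrier Q2)"
  have gJ: "?g \<in> carrier J2" using Q2.klin_restrict[OF g(1)] by simp
  obtain \<phi> where \<phi>: "\<phi> \<in> carrier J1" "ret ?g = d1 \<phi>" using ret_im[OF gJ] by blast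
  have "g z = d1 \<phi> z" using ret_id[OF gJ] \<phi>(2) z(1) by (metis restrict_apply')
  also have "\<dots> = \<phi> \<zero>\<^bsub>Q1\<^esub>" by (simp only: d1_val[OF z(1)] z(2))
  also have "\<dots> = 0" by (rule J_zero(2)) (use \<phi>(1) in simp)
  finally show False using g(2) by simp
qed

end

section \<open>Homomorphisms into the algebra, and the conditions on Ext\<close>

lemma ring_dual_simps [simp]:
  "f \<in> carrier (ring_dual A M) \<longleftrightarrow> f \<in> mhom A M (reg_mod A)"
  "f \<oplus>\<^bsub>ring_dual A M\<^esub> g = (\<lambda>x\<in>carrier M. f x \<oplus>\<^bsub>A\<^esub> g x)"
  "\<zero>\<^bsub>ring_dual A M\<^esub> = (\<lambda>x\<in>carrier M. \<zero>\<^bsub>A\<^esub>)"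
  "a \<odot>\<^bsub>ring_dual A M\<^esub> f = (\<lambda>x\<in>carrier M. f x \<otimes>\<^bsub>A\<^esub> a)"
  by (simp_all add: ring_dual_def)

lemma (in kmod) ring_dual_kmod: "kmod (opp A) (ring_dual A M)"
proof -
  interpret B: kalg "opp A" by (rule kalg_opp)
  have v: "f x \<in> carrier A" if "lin A M (reg_mod A) f" "x \<in> carrier M" for f x
    using linD(1)[OF that] by simp
  show ?thesis
    by (rule B.kmod_intro)
      (auto simp: mhom_iff lin_def fun_eq_iff extensional_def A.a_ac A.l_distr A.r_distr A.m_assoc)
qed

lemma (in kmod) ring_dual_finsum:
  assumes "finite T" "\<And>t. t \<in> T \<Longrightarrow> F t \<in> carrier (ring_dual A M)"
  shows "(\<Oplus>\<^bsub>ring_dual A M\<^esub>t\<in>T. F t) = (\<lambda>x\<in>carrier M. \<Oplus>t\<in>T. F t x)"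
proof -
  interpret D: kmod "opp A" "ring_dual A M" by (rule ring_dual_kmod)
  show ?thesis using assms
  proof (induction T rule: finite_induct)
    case empty then show ?case by simp
  next
    case (insert t T)
    have v: "F s x \<in> carrier A" if "s \<in> insert t T" "x \<in> carrier M" for s x
      using insert.prems[OF that(1)] that(2) linD(1)[of A M "reg_mod A" "F s" x] by (simp add: mhom_iff)
    have "(\<Oplus>\<^bsub>ring_dual A M\<^esub>t\<in>insert t T. F t) = F t \<oplus>\<^bsub>ring_dual A M\<^esub> (\<lambda>x\<in>carrier M. \<Oplus>t\<in>T. F t x)"
      using insert by (subst D.M.finsum_insert) (auto simp: restrict_def simp del: ring_dual_simps(2))
    also have "\<dots> = (\<lambda>x\<in>carrier M. \<Oplus>t\<in>insert t T. F t x)"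
    proof -
      have "F t x \<oplus> (\<Oplus>t\<in>T. F t x) = (\<Oplus>t\<in>insert t T. F t x)" if "x \<in> carrier M" for x
        using insert v[OF _ that] by (subst A.finsum_insert) (auto simp: Pi_def)
      then show ?thesis by (auto simp: fun_eq_iff)
    qed
    finally show ?case .
  qed
qed

context apr_mod
begin

text \<open>The matrix form of \<open>D2_injective\<close>. A homomorphism from the cokernel of
  right multiplication by \<rho> to A is a column z with \<rho> z = 0, so this is the vanishing of
  Hom(\<open>\<tau>\<^sub>2\<^sup>-P\<close>, A).\<close>

lemma \<rho>_injective:
  assumes "inj_dim A P = 2"
    and z: "\<And>r. r \<in> Sr \<Longrightarrow> z r \<in> carrier A" "\<And>r. r \<in> Sr \<Longrightarrow> \<epsilon>r r \<otimes> z r = z r"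
      "\<And>a. a \<in> Sa \<Longrightarrow> (\<Oplus>r\<in>Sr. \<rho> a r \<otimes> z r) = \<zero>" and r: "r \<in> Sr"
  shows "z r = \<zero>"
proof -
  have zQ: "restrict z Sr \<in> carrier Q2" using z by auto
  have "(\<Oplus>r\<in>Sr. \<rho> a r \<otimes> restrict z Sr r) = \<zero>" if "a \<in> Sa" for a
    unfolding z(3)[OF that, symmetric] by (rule finsum_cong') (use that z(1) \<rho>c in auto)
  then have "D2 (restrict z Sr) = \<zero>\<^bsub>Q1\<^esub>" using z(1) by (subst D2_val) auto
  then have "restrict z Sr = \<zero>\<^bsub>Q2\<^esub>" by (rule D2_injective[OF assms(1) zQ])
  from fun_cong[OF this, of r] show ?thesis using r by simp
qed

lemma kR: "kmod B (reg_mod B)" by (rule kalg.reg_kmod[OF kB])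
lemma kD: "kmod A (D_reg A)" unfolding D_reg_def using kmod.dual_kmod[OF kR] by simp

text \<open>A row y with y \<rho> = 0 gives a map \<open>Y\<close> from \<open>Q1\<close> to A that
  vanishes on the image of \<open>D2\<close>. Its dual \<tau> sends DA into the kernel of
  \<open>d1\<close>, the image of \<open>d0\<close>. The obstruction to lifting \<tau> along
  \<open>d0\<close> is an element of Ext^1(DA, P), and a lift from DA to J0 is given by an element l
  of A. Comparison gives y = l \<alpha>, and l acts on \<alpha> through the scalar
  \<open>co l\<close>.\<close>

lemma Ext1_zero_kernel:
  assumes "Ext_zero A 1 (D_reg A) P"
    and y: "\<And>a. a \<in> Sa \<Longrightarrow> y a \<in> carrier A" "\<And>a. a \<in> Sa \<Longrightarrow> y a \<otimes> \<epsilon>a a = y a"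
      "\<And>r. r \<in> Sr \<Longrightarrow> (\<Oplus>a\<in>Sa. y a \<otimes> \<rho> a r) = \<zero>"
  shows "\<exists>c. \<forall>a\<in>Sa. y a = c \<odot> \<alpha> a"
proof -
  obtain F :: "nat \<Rightarrow> ('a, nat \<Rightarrow> 'k) module" and d \<epsilon> where
    res: "proj_resolution A F d \<epsilon> (D_reg A)" and coc: "cocycles A F d P 1 = coboundaries A F d P 1"
    using assms(1) by (auto simp: Ext_zero_def)
  have proj: "projective_mod A (F j)" for j using res by (simp add: proj_resolution_def)
  have kF: "kmod A (F j)" for j
    using proj[of j] fdmod_kmod unfolding projective_mod_def by blast
  have \<epsilon>: "lin A (F 0) (D_reg A) \<epsilon>" and \<epsilon>s: "\<epsilon> ` carrier (F 0) = carrier (D_reg A)"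
    using res by (auto simp: proj_resolution_def mhom_iff)
  have dl: "lin A (F (Suc j)) (F j) (d j)" for j using res by (simp add: proj_resolution_def mhom_iff)
  have ex0: "d 0 ` carrier (F 1) = a_kernel (F 0) (D_reg A) \<epsilon>" using res by (simp add: proj_resolution_def)
  have ex1: "d 1 ` carrier (F 2) = a_kernel (F 1) (F 0) (d 0)"
    using res unfolding proj_resolution_def by (auto simp: numeral_2_eq_2)
  have dl0: "lin A (F 1) (F 0) (d 0)" and dl1: "lin A (F 2) (F 1) (d 1)"
    using dl[of 0] dl[of 1] by (simp_all add: numeral_2_eq_2)
  interpret R: kmod B "reg_mod B" by (rule kR)
  interpret J0: kmod A J0 by (rule kJ)
  interpret J1: kmod A J1 by (rule kJ)
  define Y where "Y x = dot (reg_mod B) Sa x y" for x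
  have Yl: "lin B Q1 (reg_mod B) Y" unfolding Y_def
    by (rule kalg.fam_lin[OF kB kR id1 fin_Sa]) (use y in simp)
  have YD2: "Y (D2 z) = \<zero>" if z: "z \<in> carrier Q2" for z
  proof -
    have "Y (D2 z) = dot (reg_mod B) Sr z (\<lambda>r. Y (col1 r))"
      unfolding D2_def by (rule lin_dot[OF kQ1 kR Yl fin_Sr]) (use Q2_car(1)[OF z] col1 in simp_all)
    also have "\<dots> = \<zero>\<^bsub>reg_mod B\<^esub>"
    proof (rule R.dot_zero_r)
      fix r assume r: "r \<in> Sr"
      have "(\<Oplus>a\<in>Sa. y a \<otimes> col1 r a) = (\<Oplus>a\<in>Sa. y a \<otimes> \<rho> a r)"
        by (rule finsum_cong') (use y(1) \<rho>c r in \<open>auto simp: col1_def\<close>)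
      then show "Y (col1 r) = \<zero>\<^bsub>reg_mod B\<^esub>" using y(3)[OF r] by (simp add: Y_def dot_def)
    qed (use Q2_car(1)[OF z] in simp)
    finally show ?thesis by simp
  qed
  define \<tau> :: "('a \<Rightarrow> 'k) \<Rightarrow> ('e \<Rightarrow> 'a) \<Rightarrow> 'k" where "\<tau> = dmap Q1 Y"
  have \<tau>: "lin A (D_reg A) J1 \<tau>"
    unfolding \<tau>_def D_reg_def using dmap_lin[OF kQ1 kR Yl] by simp
  have Dc: "klin B (reg_mod B) (carrier A) f" if "f \<in> carrier (D_reg A)" for f
    using that by (simp add: D_reg_def)
  have \<tau>d: "\<tau> f \<in> d0 ` carrier J0" if f: "f \<in> carrier (D_reg A)" for f
  proof -
    have f0: "f \<zero> = 0" using R.klin_zero[OF Dc[OF f]] R.ksub_carrier by simp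
    have "d1 (\<tau> f) = \<zero>\<^bsub>J2\<^esub>"
      using YD2 f0 linD(1)[OF D2_lin] by (auto simp: d1_def \<tau>_def dmap_def fun_eq_iff simp del: fam_simps)
    then show ?thesis using d1_kernel[OF linD(1)[OF \<tau> f]] by (metis imageI)
  qed
  have "\<tau> (\<epsilon> w) \<in> d0 ` carrier J0" if "w \<in> carrier (F 0)" for w using \<tau>d linD(1)[OF \<epsilon> that] by blast
  \<comment> \<open>On the first projective the map lifts. The lift need not vanish on the image of
    \<open>d 0\<close>, but there it takes its values in P.\<close>
  then obtain g0 where g0: "lin A (F 0) J0 g0" "\<And>w. w \<in> carrier (F 0) \<Longrightarrow> d0 (g0 w) = \<tau> (\<epsilon> w)"
    using projective_lift[OF is_kalg proj fJ(1) kJ(2) d0_lin lin_comp[OF \<epsilon> \<tau>]] by metis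
  have \<epsilon>d: "\<epsilon> (d 0 w) = \<zero>\<^bsub>D_reg A\<^esub>" if "w \<in> carrier (F 1)" for w
    using ex0 that by (auto simp: a_kernel_eq)
  have "g0 (d 0 w) \<in> etaJ ` carrier P" if w: "w \<in> carrier (F 1)" for w
  proof -
    have "d0 (g0 (d 0 w)) = \<zero>\<^bsub>J1\<^esub>"
      using g0(2)[OF linD(1)[OF dl0 w]] \<epsilon>d[OF w] lin_zero[OF kD kJ(2) \<tau>] by simp
    then show ?thesis using d0_kernel[OF linD(1)[OF g0(1) linD(1)[OF dl0 w]]] by (metis imageI)
  qed
  \<comment> \<open>The defect of \<open>g0\<close> as a map to P: the cocycle that represents the
    obstruction.\<close>
  then obtain c where c: "lin A (F 1) P c" "\<And>w. w \<in> carrier (F 1) \<Longrightarrow> etaJ (c w) = g0 (d 0 w)"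
    using projective_lift[OF is_kalg proj fdP kJ(1) etaJ_lin lin_comp[OF dl0 g0(1)]] by metis
  have "c (d 1 w) = \<zero>\<^bsub>P\<^esub>" if w: "w \<in> carrier (F 2)" for w
  proof -
    have "d 0 (d 1 w) = \<zero>\<^bsub>F 0\<^esub>" using ex1 w by (auto simp: a_kernel_eq)
    then have "etaJ (c (d 1 w)) = etaJ \<zero>\<^bsub>P\<^esub>"
      using c(2)[OF linD(1)[OF dl1 w]] lin_zero[OF kF kJ(1) g0(1)] lin_zero[OF kP kJ(1) etaJ_lin] by simp
    then show ?thesis using etaJ_inj[OF linD(1)[OF c(1) linD(1)[OF dl1 w]]] by simp
  qed
  then have "restrict c (carrier (F 1)) \<in> cocycles A F d P 1"
    using lin_restrict_mhom[OF kF c(1)] linD(1)[OF dl1]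
    by (auto simp: cocycles_def compose_def fun_eq_iff numeral_2_eq_2)
  then have "restrict c (carrier (F 1)) \<in> coboundaries A F d P (Suc 0)" using coc by simp
  then obtain b where b: "b \<in> mhom A (F 0) P" "restrict c (carrier (F 1)) = compose (carrier (F 1)) b (d 0)"
    by auto
  have bl: "lin A (F 0) P b" using b(1) by (simp add: mhom_iff)
  have bd: "b (d 0 w) = c w" if "w \<in> carrier (F 1)" for w
    using fun_cong[OF b(2), of w] that by (simp add: compose_def)
  \<comment> \<open>The cocycle is the coboundary of \<open>b\<close>; after subtracting
    \<open>b\<close> the lift vanishes on the kernel of \<epsilon> and descends to DA.\<close>
  define g1 where "g1 w = g0 w \<ominus>\<^bsub>J0\<^esub> etaJ (b w)" for w
  have g1: "lin A (F 0) J0 g1" unfolding g1_def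
    by (rule lin_diff_fun[OF kJ(1) g0(1) lin_comp[OF bl etaJ_lin]])
  have "g1 w = \<zero>\<^bsub>J0\<^esub>" if w: "w \<in> carrier (F 0)" "\<epsilon> w = \<zero>\<^bsub>D_reg A\<^esub>" for w
  proof -
    have "w \<in> d 0 ` carrier (F 1)" using ex0 w by (simp add: a_kernel_eq)
    then obtain v where v: "v \<in> carrier (F 1)" "w = d 0 v" by blast
    have "g0 w = etaJ (b w)" using c(2)[OF v(1)] bd[OF v(1)] v(2) by simp
    then show ?thesis unfolding g1_def using J0.M_minus_self[OF linD(1)[OF g0(1) w(1)]] by simp
  qed
  then obtain h where h0: "lin A (D_reg A\<lparr>carrier := \<epsilon> ` carrier (F 0)\<rparr>) J0 h"
    and h\<epsilon>: "\<And>w. w \<in> carrier (F 0) \<Longrightarrow> h (\<epsilon> w) = g1 w"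
    using lin_factor[OF kF kD kJ(1) \<epsilon> g1] by metis
  have h: "lin A (D_reg A) J0 h" using h0 unfolding \<epsilon>s by simp
  have dh: "d0 (h f) = \<tau> f" if f: "f \<in> carrier (D_reg A)" for f
  proof -
    obtain w where w: "w \<in> carrier (F 0)" "f = \<epsilon> w" using f \<epsilon>s by blast
    have bw: "etaJ (b w) \<in> carrier J0" using linD(1)[OF etaJ_lin linD(1)[OF bl w(1)]] .
    have "d0 (h f) = d0 (g0 w) \<ominus>\<^bsub>J1\<^esub> d0 (etaJ (b w))"
      unfolding w(2) h\<epsilon>[OF w(1)] g1_def by (rule lin_diff[OF kJ(1,2) d0_lin linD(1)[OF g0(1) w(1)] bw])
    also have "\<dots> = \<tau> f"
      unfolding d0_etaJ g0(2)[OF w(1)] w(2) by (rule J1.M_diff_zero[OF linD(1)[OF \<tau> linD(1)[OF \<epsilon> w(1)]]])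
    finally show ?thesis .
  qed
  \<comment> \<open>The value of h f at \<open>ei\<close> depends linearly on f in DA; by
    reflexivity it is the evaluation of f at an element l.\<close>
  have "klin A (D_reg A) (carrier (D_reg A)) (\<lambda>f. h f un0)"
    unfolding klin_def
  proof (intro conjI ballI allI)
    fix f g assume "f \<in> carrier (D_reg A)" "g \<in> carrier (D_reg A)"
    then show "h (f \<oplus>\<^bsub>D_reg A\<^esub> g) un0 = h f un0 + h g un0"
      using linD(2)[OF h] un0 by (simp del: fam_simps)
  next
    fix e f assume f: "f \<in> carrier (D_reg A)"
    show "h (ks A (D_reg A) e f) un0 = e * h f un0"
      unfolding lin_ks[OF kD h f] using kmod.ks_dual[OF kQ0 linD(1)[OF h f], of e] un0
      by (simp del: fam_simps)
  qed
  then have "\<exists>l\<in>carrier (reg_mod B). \<forall>f\<in>carrier (D_reg A). h f un0 = f l"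
    using R.dual_reflexive[OF fdB, of "\<lambda>f. h f un0"] by (simp add: D_reg_def)
  then obtain l where l: "l \<in> carrier A" "\<And>f. f \<in> carrier (D_reg A) \<Longrightarrow> h f un0 = f l" by auto
  \<comment> \<open>If the two elements differed, a functional f would separate them; but evaluating
    d0 (h f) = \<tau> f at the a-th generator gives f (y a) = f (l \<alpha> a).\<close>
  have yl: "y a = l \<otimes> \<alpha> a" if a: "a \<in> Sa" for a
  proof (rule ccontr)
    assume ne: "y a \<noteq> l \<otimes> \<alpha> a"
    let ?x = "y a \<ominus> l \<otimes> \<alpha> a"
    have la: "l \<otimes> \<alpha> a \<in> carrier A" using l(1) \<alpha>c[OF a] by simp
    have "?x \<noteq> \<zero>" using ne R.M_eqI[of "y a" "l \<otimes> \<alpha> a"] y(1)[OF a] la by auto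
    then obtain g where g: "klin B (reg_mod B) (carrier (reg_mod B)) g" "g ?x \<noteq> 0"
      using R.klin_separates[OF fdB, of ?x] y(1)[OF a] la by auto
    define f where "f = restrict g (carrier A)"
    have f: "f \<in> carrier (D_reg A)" using R.klin_restrict[OF g(1)] by (simp add: D_reg_def f_def)
    define u where "u = fam_unit B Sa \<epsilon>a a"
    have u: "u \<in> carrier Q1" unfolding u_def by (rule kalg.fam_unit_closed[OF kB id1 a])
    have uv: "u b = (if b = a then \<epsilon>a a else \<zero>)" if "b \<in> Sa" for b using that by (simp add: u_def fam_unit_def)
    have Yu: "Y u = y a"
    proof -
      have "Y u = dot (reg_mod B) Sa (\<lambda>b. if b = a then \<epsilon>a a else \<zero>\<^bsub>B\<^esub>) y"
        unfolding Y_def by (rule R.dot_cong) (use uv y \<epsilon>ac in auto)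
      also have "\<dots> = y a" using R.dot_single[OF fin_Sa a, of "\<epsilon>a a" y] y \<epsilon>ac a by simp
      finally show ?thesis .
    qed
    interpret Q0: kmod B Q0 by (rule kQ0)
    have D1u: "D1 u = \<alpha> a \<odot>\<^bsub>Q0\<^esub> un0"
    proof -
      have "D1 u = dot Q0 Sa (\<lambda>b. if b = a then \<epsilon>a a else \<zero>\<^bsub>B\<^esub>) col0"
        unfolding D1_def by (rule Q0.dot_cong) (use uv col0 \<epsilon>ac a in \<open>auto simp del: fam_simps\<close>)
      also have "\<dots> = \<epsilon>a a \<odot>\<^bsub>Q0\<^esub> col0 a" by (rule Q0.dot_single[OF fin_Sa a _ col0]) (use \<epsilon>ac a in simp)
      also have "\<dots> = \<alpha> a \<odot>\<^bsub>Q0\<^esub> un0" using \<alpha>[OF a] by (simp add: col0_def fun_eq_iff)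
      finally show ?thesis .
    qed
    have af: "\<alpha> a \<odot>\<^bsub>D_reg A\<^esub> f \<in> carrier (D_reg A)"
      using kmod.axioms(1)[OF kD] left_module.smult_closed \<alpha>c[OF a] f by metis
    have "f (y a) = \<tau> f u" using u Yu by (simp add: \<tau>_def dmap_def del: fam_simps)
    also have "\<dots> = h f (D1 u)" using dh[OF f] d0_val[OF u, of "h f"] by simp
    also have "\<dots> = (\<alpha> a \<odot>\<^bsub>J0\<^esub> h f) un0" unfolding D1u using un0 by (simp del: fam_simps)
    also have "\<dots> = h (\<alpha> a \<odot>\<^bsub>D_reg A\<^esub> f) un0" using linD(3)[OF h \<alpha>c[OF a] f] by (simp only:)
    also have "\<dots> = (\<alpha> a \<odot>\<^bsub>D_reg A\<^esub> f) l" by (rule l(2)[OF af])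
    also have "\<dots> = f (l \<otimes> \<alpha> a)" using l(1) by (simp add: D_reg_def)
    finally have "g (y a) = g (l \<otimes> \<alpha> a)" using y(1)[OF a] la by (simp add: f_def)
    then show False
      using g(2) R.klin_diff[OF g(1) R.ksub_carrier, of "y a" "l \<otimes> \<alpha> a"] y(1)[OF a] la by simp
  qed
  have "y a = co l \<odot> \<alpha> a" if a: "a \<in> Sa" for a
  proof -
    have "l \<otimes> \<alpha> a = (l \<otimes> ei) \<otimes> \<alpha> a" using l(1) ei \<alpha>c[OF a] \<alpha>(2)[OF a] by (simp add: m_assoc)
    also have "\<dots> = co l \<odot> \<alpha> a" using co[OF l(1)] ei \<alpha>c[OF a] \<alpha>(2)[OF a] by (simp add: scal_mult_l)
    finally show ?thesis using yl[OF a] by simp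
  qed
  then show ?thesis by blast
qed

text \<open>Without an arrow starting in i the right ideal \<open>ei\<close> A is spanned by
  \<open>ei\<close>. Then f \<mapsto> f(ei) \<pi> is a homomorphism from DA to P, and it is nonzero
  since some functional does not vanish at \<open>ei\<close>; but Ext^0 is Hom.\<close>

lemma Ext0_zero_nonempty:
  assumes "Ext_zero A 0 (D_reg A) P" shows "Sa \<noteq> {}"
proof
  assume emp: "Sa = {}"
  obtain F :: "nat \<Rightarrow> ('a, nat \<Rightarrow> 'k) module" and d \<epsilon> where
    res: "proj_resolution A F d \<epsilon> (D_reg A)" and coc: "cocycles A F d P 0 = coboundaries A F d P 0"
    using assms(1) by (auto simp: Ext_zero_def)
  have kF: "kmod A (F j)" for j using res fdmod_kmod by (auto simp: projective_mod_def proj_resolution_def)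
  have \<epsilon>: "lin A (F 0) (D_reg A) \<epsilon>" and \<epsilon>s: "\<epsilon> ` carrier (F 0) = carrier (D_reg A)"
    using res by (auto simp: proj_resolution_def mhom_iff)
  have ex0: "d 0 ` carrier (F 1) = a_kernel (F 0) (D_reg A) \<epsilon>" using res by (simp add: proj_resolution_def)
  have dl0: "lin A (F 1) (F 0) (d 0)" using res by (simp add: proj_resolution_def mhom_iff)
  interpret R: kmod B "reg_mod B" by (rule kR)
  have Dc: "klin B (reg_mod B) (carrier A) f" if "f \<in> carrier (D_reg A)" for f
    using that by (simp add: D_reg_def)
  have kfun: "f (c \<odot> x) = c * f x" if "f \<in> carrier (D_reg A)" "x \<in> carrier A" for f c x
    using klinD(2)[OF Dc[OF that(1)] that(2), of c] kalg.ks_reg[OF kB, of x c] that(2) by simp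
  have eix: "ei \<otimes> x = co x \<odot> ei" if x: "x \<in> carrier A" for x
  proof -
    have "ei \<otimes> (ei \<otimes> x) = ei \<otimes> x" using ei x by (simp add: m_assoc[symmetric])
    then obtain c where c: "ei \<otimes> x = c \<odot> ei" using span[of "ei \<otimes> x"] ei x emp by auto
    have "co (ei \<otimes> x) = c" using c ei co_scal[OF ei(1), of c] co_ei by simp
    then show ?thesis using co_mult[OF ei(1) x] co_ei c by simp
  qed
  define \<theta> where "\<theta> f = ks A P (f ei) \<pi>" for f
  have \<theta>: "lin A (D_reg A) P \<theta>"
  proof (rule linI)
    show "\<theta> f \<in> carrier P" for f using \<pi> by (simp add: \<theta>_def)
    show "\<theta> (f \<oplus>\<^bsub>D_reg A\<^esub> g) = \<theta> f \<oplus>\<^bsub>P\<^esub> \<theta> g" for f g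
      using \<pi> ei by (simp add: \<theta>_def D_reg_def P.ks_l_distr)
    show "\<theta> (a \<odot>\<^bsub>D_reg A\<^esub> f) = a \<odot>\<^bsub>P\<^esub> \<theta> f" if a: "a \<in> carrier A" "f \<in> carrier (D_reg A)" for a f
    proof -
      have "(a \<odot>\<^bsub>D_reg A\<^esub> f) ei = f (ei \<otimes> a)" using ei by (simp add: D_reg_def)
      also have "\<dots> = co a * f ei" using eix[OF a(1)] kfun[OF a(2) ei(1)] by simp
      finally have e: "(a \<odot>\<^bsub>D_reg A\<^esub> f) ei = co a * f ei" .
      have "\<theta> (a \<odot>\<^bsub>D_reg A\<^esub> f) = ks A P (f ei) (ks A P (co a) \<pi>)"
        unfolding \<theta>_def e using \<pi> by (simp add: mult.commute[of "co a"] P.ks_assoc)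
      then show ?thesis unfolding \<theta>_def smult_\<pi>[OF a(1), symmetric] using a(1) \<pi> by (simp add: P.ks_smult_r)
    qed
  qed
  have "\<theta> (\<epsilon> (d 0 w)) = \<zero>\<^bsub>P\<^esub>" if "w \<in> carrier (F 1)" for w
  proof -
    have "\<epsilon> (d 0 w) = \<zero>\<^bsub>D_reg A\<^esub>" using ex0 that by (auto simp: a_kernel_eq)
    then show ?thesis using lin_zero[OF kD kP \<theta>] by simp
  qed
  then have "restrict (\<lambda>w. \<theta> (\<epsilon> w)) (carrier (F 0)) \<in> cocycles A F d P 0"
    using lin_restrict_mhom[OF kF lin_comp[OF \<epsilon> \<theta>]] linD(1)[OF dl0]
    by (auto simp: cocycles_def compose_def fun_eq_iff)
  then have z: "restrict (\<lambda>w. \<theta> (\<epsilon> w)) (carrier (F 0)) = (\<lambda>x\<in>carrier (F 0). \<zero>\<^bsub>P\<^esub>)" using coc by simp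
  obtain g where g: "klin B (reg_mod B) (carrier (reg_mod B)) g" "g ei \<noteq> 0"
    using R.klin_separates[OF fdB, of ei] ei ei_nz by auto
  define f where "f = restrict g (carrier A)"
  have f: "f \<in> carrier (D_reg A)" using R.klin_restrict[OF g(1)] by (simp add: D_reg_def f_def)
  then obtain w where w: "w \<in> carrier (F 0)" "f = \<epsilon> w" using \<epsilon>s by blast
  have "\<theta> f = \<zero>\<^bsub>P\<^esub>" using fun_cong[OF z, of w] w by simp
  then have "f ei = 0" unfolding \<theta>_def using P.ks_eq_zero[OF \<pi>(1)] \<pi>(2) by blast
  then show False using g(2) ei by (simp add: f_def)
qed

text \<open>With no relation the condition y \<rho> = 0 is empty, so it holds for the row of the
  idempotents \<open>\<epsilon>a\<close>. By \<open>Ext1_zero_kernel\<close> these would be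
  multiples of the arrows, hence elements of \<open>N 1\<close>.\<close>

lemma Sr_nonempty:
  assumes "gives_2APR A P" shows "Sr \<noteq> {}"
proof
  assume emp: "Sr = {}"
  have "Sa \<noteq> {}" using Ext0_zero_nonempty assms by (simp add: gives_2APR_def)
  then obtain a where a: "a \<in> Sa" by blast
  obtain c where "\<forall>a\<in>Sa. \<epsilon>a a = c \<odot> \<alpha> a"
    using Ext1_zero_kernel[of \<epsilon>a] assms idem_a emp \<epsilon>ac by (auto simp: gives_2APR_def idem_def)
  then have "\<epsilon>a a \<in> N 1" using N_scal[OF \<alpha>(1)[OF a]] a by simp
  then show False using \<epsilon>a_notin[OF a] by simp
qed

end

section \<open>Generators and relations of \<open>\<tau>\<^sub>2\<^sup>-P\<close>\<close>

definition is_basis :: "('k, 'a) module \<Rightarrow> 's set \<Rightarrow> ('s \<Rightarrow> 'a) \<Rightarrow> ('a, 'm) module \<Rightarrow> ('s \<Rightarrow> 'm) \<Rightarrow> bool" where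
  "is_basis A S \<epsilon> F u \<longleftrightarrow> (\<forall>s\<in>S. u s \<in> carrier F \<and> \<epsilon> s \<odot>\<^bsub>F\<^esub> u s = u s) \<and>
    (\<forall>w\<in>carrier F. \<exists>x\<in>carrier (fam A S \<epsilon>). w = dot F S x u) \<and>
    (\<forall>x\<in>carrier (fam A S \<epsilon>). dot F S x u = \<zero>\<^bsub>F\<^esub> \<longrightarrow> (\<forall>s\<in>S. x s = \<zero>\<^bsub>A\<^esub>))"

lemma is_basisD:
  assumes "is_basis A S \<epsilon> F u"
  shows "s \<in> S \<Longrightarrow> u s \<in> carrier F" "s \<in> S \<Longrightarrow> \<epsilon> s \<odot>\<^bsub>F\<^esub> u s = u s"
    "w \<in> carrier F \<Longrightarrow> \<exists>x\<in>carrier (fam A S \<epsilon>). w = dot F S x u"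
    "x \<in> carrier (fam A S \<epsilon>) \<Longrightarrow> dot F S x u = \<zero>\<^bsub>F\<^esub> \<Longrightarrow> s \<in> S \<Longrightarrow> x s = \<zero>\<^bsub>A\<^esub>"
  using assms unfolding is_basis_def by blast+

lemma proj_cover_is_basis:
  fixes A :: "('k::field, 'a) module" (structure)
  assumes "kalg A" "fdmod A (reg_mod A)" "nil_filt A N" "idem A S \<epsilon>" "finite S" "proj_cover A F e M" "kmod A M"
    and "\<And>s. s \<in> S \<Longrightarrow> m s \<in> carrier M" "\<And>s. s \<in> S \<Longrightarrow> \<epsilon> s \<odot>\<^bsub>M\<^esub> m s = m s"
    and "\<And>y. y \<in> carrier M \<Longrightarrow> \<exists>x\<in>carrier (fam A S \<epsilon>). y = dot M S x m"
    and "\<And>x s. x \<in> carrier (fam A S \<epsilon>) \<Longrightarrow> dot M S x m = \<zero>\<^bsub>M\<^esub> \<Longrightarrow> s \<in> S \<Longrightarrow> x s \<in> N 1"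
  shows "\<exists>u. is_basis A S \<epsilon> F u \<and> (\<forall>s\<in>S. e (u s) = m s)"
proof (rule exE[OF proj_cover_basis[where A = A and S = S and \<epsilon> = \<epsilon> and F = F and e = e and M = M and m = m and N = N]])
  fix u
  assume "(\<forall>s\<in>S. u s \<in> carrier F \<and> \<epsilon> s \<odot>\<^bsub>F\<^esub> u s = u s \<and> e (u s) = m s) \<and>
    (\<forall>w\<in>carrier F. \<exists>x\<in>carrier (fam A S \<epsilon>). w = dot F S x u) \<and>
    (\<forall>x\<in>carrier (fam A S \<epsilon>). dot F S x u = \<zero>\<^bsub>F\<^esub> \<longrightarrow> (\<forall>s\<in>S. x s = \<zero>))"
  then show ?thesis unfolding is_basis_def by blast
qed (fact assms)+

context apr_mod
begin

text \<open>The definition supplies unspecified covers, and \<open>proj_cover_is_basis\<close> gives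
  each of them a basis: \<open>u0\<close> for the cover F of DP, a family p over the elements
  \<alpha> a for the cover \<open>P0\<close> of the syzygy Y, and a family \<open>qq\<close> over
  the columns of \<rho> for \<open>P1\<close>. After applying Hom into A, the images of the
  coordinate forms of \<open>P1\<close> generate X, and the forms coming from \<open>P0\<close>
  contribute the rows of \<rho> as relations.\<close>

lemma tau2_structure:
  assumes "is_tau2_minus A P X"
  obtains g where "\<And>r. r \<in> Sr \<Longrightarrow> g r \<in> carrier X" "\<And>r. r \<in> Sr \<Longrightarrow> \<epsilon>r r \<odot>\<^bsub>X\<^esub> g r = g r"
    "\<And>x. x \<in> carrier X \<Longrightarrow> \<exists>l\<in>carrier (fam A Sr \<epsilon>r). x = dot X Sr l g"
    "\<And>l. l \<in> carrier (fam A Sr \<epsilon>r) \<Longrightarrow> dot X Sr l g = \<zero>\<^bsub>X\<^esub> \<Longrightarrow>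
      \<exists>y\<in>carrier (fam A Sa \<epsilon>a). \<forall>r\<in>Sr. l r = (\<Oplus>a\<in>Sa. y a \<otimes> \<rho> a r)"
    "\<And>a. a \<in> Sa \<Longrightarrow> dot X Sr (\<rho> a) g = \<zero>\<^bsub>X\<^esub>"
proof -
  interpret B: kalg B by (rule kB)
  obtain Y :: "('a, nat \<Rightarrow> 'k) module" where syz: "is_syzygy B (dual_mod A P) Y" and tr: "is_transpose B Y X"
    using assms by (auto simp: is_tau2_minus_def)
  obtain F :: "('a, nat \<Rightarrow> 'k) module" and e \<iota> where covF: "proj_cover B F e (dual_mod A P)" and fY: "fdmod B Y"
    and \<iota>: "\<iota> \<in> mhom B Y F" "inj_on \<iota> (carrier Y)" "\<iota> ` carrier Y = a_kernel F (dual_mod A P) e"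
    using syz by (auto simp: is_syzygy_def)
  obtain P1 P0 :: "('a, nat \<Rightarrow> 'k) module" and d e' q where
    cov0: "proj_cover B P0 e' Y" and cov1: "proj_cover B P1 d (P0\<lparr>carrier := a_kernel P0 Y e'\<rparr>)"
    and fX: "fdmod A X" and q: "q \<in> mhom A (ring_dual B P1) X" "q ` carrier (ring_dual B P1) = carrier X"
      "a_kernel (ring_dual B P1) X q = (\<lambda>g. compose (carrier P1) g d) ` carrier (ring_dual B P0)"
    using tr by (auto simp: is_transpose_def min_proj_presentation_def)
  have kX: "kmod A X" by (rule fdmod_kmod[OF fX])
  have kY: "kmod B Y" by (rule B.fdmod_kmod[OF fY])
  have kDP: "kmod B (dual_mod A P)" by (rule P.dual_kmod)
  have kF: "kmod B F" and eF: "lin B F (dual_mod A P) e"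
    using covF B.fdmod_kmod by (auto simp: proj_cover_def projective_mod_def mhom_iff)
  have kP0: "kmod B P0" and e'l: "lin B P0 Y e'"
    using cov0 B.fdmod_kmod by (auto simp: proj_cover_def projective_mod_def mhom_iff)
  let ?K = "P0\<lparr>carrier := a_kernel P0 Y e'\<rparr>"
  have kK: "kmod B ?K" by (rule kmod_kernel[OF kP0 kY e'l])
  have kP1: "kmod B P1" and dl: "lin B P1 ?K d"
    using cov1 B.fdmod_kmod by (auto simp: proj_cover_def projective_mod_def mhom_iff)
  have \<iota>l: "lin B Y F \<iota>" using \<iota>(1) by (simp add: mhom_iff)
  interpret DP: kmod B "dual_mod A P" by (rule kDP)
  interpret F: kmod B F by (rule kF)
  interpret Y: kmod B Y by (rule kY)
  interpret P0: kmod B P0 by (rule kP0)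
  interpret K: kmod B ?K by (rule kK)
  interpret P1: kmod B P1 by (rule kP1)
  interpret X: kmod A X by (rule kX)
  interpret R: kmod B "reg_mod B" by (rule kR)
  have nilB: "nil_filt B N" by (rule nil_filt_opp[OF nil])

  \<comment> \<open>The functional dual to \<pi>; it spans DP.\<close>
  define \<xi> where "\<xi> = restrict kc (carrier P)"
  have \<xi>: "\<xi> \<in> carrier (dual_mod A P)"
    using kc_add kc_smult co_scal[OF one_closed] co_mult[OF one_closed] P.ks_closed
    by (auto simp: \<xi>_def klin_def ks_def co_scal)
      (metis co_ei co_mult ei(1) l_one mult.right_neutral mult_cancel_right1 one_closed one_neq_zero)
  have \<xi>ei: "ei \<odot>\<^bsub>dual_mod A P\<^esub> \<xi> = \<xi>"
    using ei by (auto simp: \<xi>_def fun_eq_iff kc_smult co_ei)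
  have x\<xi>: "(x \<odot>\<^bsub>dual_mod A P\<^esub> \<xi>) p = co x * kc p" if "x \<in> carrier A" "p \<in> carrier P" for x p
    using that by (simp add: \<xi>_def kc_smult)
  have x\<xi>0: "x \<odot>\<^bsub>dual_mod A P\<^esub> \<xi> = \<zero>\<^bsub>dual_mod A P\<^esub> \<longleftrightarrow> co x = 0" if x: "x \<in> carrier A" for x
  proof
    assume "x \<odot>\<^bsub>dual_mod A P\<^esub> \<xi> = \<zero>\<^bsub>dual_mod A P\<^esub>"
    then show "co x = 0" using x\<xi>[OF x \<pi>(1)] \<pi>(1) kc_\<pi> by simp
  next
    assume "co x = 0"
    then show "x \<odot>\<^bsub>dual_mod A P\<^esub> \<xi> = \<zero>\<^bsub>dual_mod A P\<^esub>" using x\<xi>[OF x] by (auto simp: fun_eq_iff)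
  qed
  have dot1: "dot M {()} x m = x () \<odot>\<^bsub>M\<^esub> m ()" if "kmod B M" "x () \<in> carrier A" "m () \<in> carrier M"
    for M :: "('a, 'z) module" and x :: "unit \<Rightarrow> 'a" and m
  proof -
    interpret M: kmod B M by (rule that(1))
    show ?thesis using that by (simp add: dot_def)
  qed
  obtain u0 where u0: "u0 \<in> carrier F" "ei \<odot>\<^bsub>F\<^esub> u0 = u0" "e u0 = \<xi>"
    "\<And>w. w \<in> carrier F \<Longrightarrow> \<exists>x\<in>carrier A. ei \<otimes> x = x \<and> w = x \<odot>\<^bsub>F\<^esub> u0"
    "\<And>x. x \<in> carrier A \<Longrightarrow> ei \<otimes> x = x \<Longrightarrow> x \<odot>\<^bsub>F\<^esub> u0 = \<zero>\<^bsub>F\<^esub> \<Longrightarrow> x = \<zero>"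
  proof -
    have gen: "\<exists>x\<in>carrier Q0. y = dot (dual_mod A P) {()} x (\<lambda>_. \<xi>)" if y: "y \<in> carrier (dual_mod A P)" for y
    proof
      let ?x = "\<lambda>_\<in>{()}. y \<pi> \<odot> ei"
      show "?x \<in> carrier Q0" using ei by (auto simp: scal_mult_r)
      have "y p = (?x () \<odot>\<^bsub>dual_mod A P\<^esub> \<xi>) p" for p
      proof (cases "p \<in> carrier P")
        case True
        have "y p = y (ks A P (kc p) \<pi>)" using ks_kc[OF True] by simp
        also have "\<dots> = kc p * y \<pi>" using y \<pi>(1) by (simp add: klin_def)
        finally show ?thesis using x\<xi>[of "y \<pi> \<odot> ei" p] True ei co_ei by (simp add: co_scal)
      next
        case False then show ?thesis using y by (simp add: extensional_def)
      qed
      then have "y = ?x () \<odot>\<^bsub>dual_mod A P\<^esub> \<xi>" by blast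
      then show "y = dot (dual_mod A P) {()} ?x (\<lambda>_. \<xi>)"
        using dot1[OF kDP, of ?x "\<lambda>_. \<xi>"] \<xi> ei by (simp del: dual_simps dual_carrier)
    qed
    have min: "x s \<in> N 1" if x: "x \<in> carrier Q0" "dot (dual_mod A P) {()} x (\<lambda>_. \<xi>) = \<zero>\<^bsub>dual_mod A P\<^esub>" "s \<in> {()}" for x s
    proof -
      have "co (x ()) = 0"
        using x\<xi>0[OF Q0_car(1)[OF x(1)]] x(2) dot1[OF kDP, of x "\<lambda>_. \<xi>"] Q0_car(1)[OF x(1)] \<xi>
        by (simp del: dual_simps dual_carrier)
      then show ?thesis using co_zero_N(2)[OF Q0_car[OF x(1)]] by simp
    qed
    have "\<exists>u. is_basis B {()} (\<lambda>_. ei) F u \<and> (\<forall>s\<in>{()}. e (u s) = \<xi>)"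
      by (rule proj_cover_is_basis[where A = B and S = "{()}" and F = F and e = e and M = "dual_mod A P"
            and N = N and m = "\<lambda>_. \<xi>" and \<epsilon> = "\<lambda>_. ei"])
        (rule kB fdB nilB id0 covF kDP | erule gen | erule (2) min |
          simp add: \<xi> \<xi>ei del: dual_simps dual_carrier)+
    then obtain u where ub: "is_basis B {()} (\<lambda>_. ei) F u" and u3: "\<And>s. s \<in> {()} \<Longrightarrow> e (u s) = \<xi>" by blast
    note u = is_basisD(1,2)[OF ub] u3 is_basisD(3,4)[OF ub]
    show thesis
    proof (rule that[of "u ()"])
      show "\<exists>x\<in>carrier A. ei \<otimes> x = x \<and> w = x \<odot>\<^bsub>F\<^esub> u ()" if w: "w \<in> carrier F" for w
      proof -
        obtain x where x: "x \<in> carrier Q0" "w = dot F {()} x u" using u(4)[OF w] by blast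
        then have "w = x () \<odot>\<^bsub>F\<^esub> u ()" using dot1[OF kF, of x u] Q0_car(1)[OF x(1)] u(1) by simp
        then show ?thesis using Q0_car[OF x(1)] by blast
      qed
      show "x = \<zero>" if x: "x \<in> carrier A" "ei \<otimes> x = x" "x \<odot>\<^bsub>F\<^esub> u () = \<zero>\<^bsub>F\<^esub>" for x
        using u(5)[of "\<lambda>_\<in>{()}. x" "()"] x dot1[OF kF, of "\<lambda>_\<in>{()}. x" u] u(1) by simp
    qed (use u in simp_all)
  qed
  \<comment> \<open>The element \<alpha> a u0 is killed by the cover map because \<open>co\<close>
    vanishes on the radical; so it comes from the syzygy.\<close>
  have "\<exists>y\<in>carrier Y. \<iota> y = \<alpha> a \<odot>\<^bsub>F\<^esub> u0" if a: "a \<in> Sa" for a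
  proof -
    have "e (\<alpha> a \<odot>\<^bsub>F\<^esub> u0) = \<zero>\<^bsub>dual_mod A P\<^esub>"
      using linD(3)[OF eF _ u0(1), of "\<alpha> a"] \<alpha>c[OF a] u0(3) x\<xi>0[OF \<alpha>c[OF a]] co_N[OF \<alpha>(1)[OF a]] by simp
    then have "\<alpha> a \<odot>\<^bsub>F\<^esub> u0 \<in> \<iota> ` carrier Y" using \<iota>(3) \<alpha>c[OF a] u0(1) by (simp add: a_kernel_eq)
    then show ?thesis by force
  qed
  then obtain y where y: "\<And>a. a \<in> Sa \<Longrightarrow> y a \<in> carrier Y" "\<And>a. a \<in> Sa \<Longrightarrow> \<iota> (y a) = \<alpha> a \<odot>\<^bsub>F\<^esub> u0" by metis
  have y\<epsilon>: "\<epsilon>a a \<odot>\<^bsub>Y\<^esub> y a = y a" if a: "a \<in> Sa" for a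
  proof (rule inj_onD[OF \<iota>(2)])
    have "\<iota> (\<epsilon>a a \<odot>\<^bsub>Y\<^esub> y a) = \<epsilon>a a \<odot>\<^bsub>F\<^esub> (\<alpha> a \<odot>\<^bsub>F\<^esub> u0)"
      using linD(3)[OF \<iota>l _ y(1)[OF a], of "\<epsilon>a a"] \<epsilon>ac[OF a] y(2)[OF a] by simp
    also have "\<dots> = \<alpha> a \<odot>\<^bsub>F\<^esub> u0"
      using F.smult_assoc[of "\<epsilon>a a" "\<alpha> a" u0] \<epsilon>ac[OF a] \<alpha>c[OF a] u0(1) \<alpha>(3)[OF a] by simp
    finally show "\<iota> (\<epsilon>a a \<odot>\<^bsub>Y\<^esub> y a) = \<iota> (y a)" using y(2)[OF a] by simp
  qed (use y(1)[OF a] \<epsilon>ac[OF a] in simp_all)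
  have \<iota>dot: "\<iota> (dot Y Sa x y) = (\<Oplus>a\<in>Sa. \<alpha> a \<otimes> x a) \<odot>\<^bsub>F\<^esub> u0" if x: "\<And>a. a \<in> Sa \<Longrightarrow> x a \<in> carrier A" for x
  proof -
    have "\<iota> (dot Y Sa x y) = dot F Sa x (\<lambda>a. \<iota> (y a))"
      by (rule lin_dot[OF kY kF \<iota>l fin_Sa]) (use x y in simp_all)
    also have "\<dots> = dot F Sa x (\<lambda>a. \<alpha> a \<odot>\<^bsub>F\<^esub> u0)"
      by (rule F.dot_cong) (use x y \<alpha>c u0 in simp_all)
    also have "\<dots> = dot (reg_mod B) Sa x \<alpha> \<odot>\<^bsub>F\<^esub> u0"
      by (rule lin_dot[OF kR kF F.lin_smult_right[OF u0(1)] fin_Sa, symmetric]) (use x \<alpha>c in simp_all)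
    finally show ?thesis by (simp add: dot_def)
  qed
  have ei_sum: "ei \<otimes> (\<Oplus>a\<in>Sa. \<alpha> a \<otimes> x a) = (\<Oplus>a\<in>Sa. \<alpha> a \<otimes> x a)" "(\<Oplus>a\<in>Sa. \<alpha> a \<otimes> x a) \<in> carrier A"
    if x: "\<And>a. a \<in> Sa \<Longrightarrow> x a \<in> carrier A" for x
  proof -
    have "ei \<otimes> (\<Oplus>a\<in>Sa. \<alpha> a \<otimes> x a) = (\<Oplus>a\<in>Sa. ei \<otimes> (\<alpha> a \<otimes> x a))"
      by (rule finsum_rdistr[OF fin_Sa ei(1)]) (use x \<alpha>c in auto)
    also have "\<dots> = (\<Oplus>a\<in>Sa. \<alpha> a \<otimes> x a)"
      by (rule finsum_cong') (use x \<alpha>c \<alpha>(2) ei in \<open>auto simp: m_assoc[symmetric]\<close>)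
    finally show "ei \<otimes> (\<Oplus>a\<in>Sa. \<alpha> a \<otimes> x a) = (\<Oplus>a\<in>Sa. \<alpha> a \<otimes> x a)" .
    show "(\<Oplus>a\<in>Sa. \<alpha> a \<otimes> x a) \<in> carrier A" by (rule finsum_closed) (use x \<alpha>c in auto)
  qed
  \<comment> \<open>Inside F a combination of the \<open>y a\<close> is a multiple of the single
    basis element \<open>u0\<close>, so it vanishes only if the coefficient \<alpha> x does.\<close>
  have ydot0: "(\<Oplus>a\<in>Sa. \<alpha> a \<otimes> x a) = \<zero>" if x: "\<And>a. a \<in> Sa \<Longrightarrow> x a \<in> carrier A" "dot Y Sa x y = \<zero>\<^bsub>Y\<^esub>" for x
    by (rule u0(5)[OF ei_sum(2,1)[OF x(1)]])
      (use \<iota>dot[of x] x lin_zero[OF kY kF \<iota>l] in simp_all)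
  obtain p where pb: "is_basis B Sa \<epsilon>a P0 p" and p3: "\<And>a. a \<in> Sa \<Longrightarrow> e' (p a) = y a"
  proof -
    have gen: "\<exists>x\<in>carrier Q1. v = dot Y Sa x y" if v: "v \<in> carrier Y" for v
    proof -
      have "\<iota> v \<in> a_kernel F (dual_mod A P) e" using \<iota>(3) v by blast
      then have k: "\<iota> v \<in> carrier F" "e (\<iota> v) = \<zero>\<^bsub>dual_mod A P\<^esub>" by (auto simp: a_kernel_eq)
      obtain w where w: "w \<in> carrier A" "ei \<otimes> w = w" "\<iota> v = w \<odot>\<^bsub>F\<^esub> u0" using u0(4)[OF k(1)] by blast
      have "w \<odot>\<^bsub>dual_mod A P\<^esub> \<xi> = \<zero>\<^bsub>dual_mod A P\<^esub>"
        using k(2) linD(3)[OF eF _ u0(1), of w] w u0(3) by simp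
      then have "co w = 0" using x\<xi>0[OF w(1)] by simp
      then obtain x where x: "\<And>a. a \<in> Sa \<Longrightarrow> x a \<in> carrier A \<and> \<epsilon>a a \<otimes> x a = x a" "w = (\<Oplus>a\<in>Sa. \<alpha> a \<otimes> x a)"
        using co_zero_N(1)[OF w(1,2)] by blast
      have "dot Y Sa (restrict x Sa) y = dot Y Sa x y" by (rule Y.dot_cong) (use x(1) y(1) in simp_all)
      moreover have "v = dot Y Sa x y"
        by (rule inj_onD[OF \<iota>(2)]) (use \<iota>dot[of x] x w v y(1) in simp_all)
      moreover have "restrict x Sa \<in> carrier Q1" using x(1) by auto
      ultimately show ?thesis by metis
    qed
    \<comment> \<open>By exactness a relation among the \<open>y a\<close> is a combination of the
      columns of \<rho>, whose entries lie in \<open>N 1\<close>.\<close>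
    have min: "x a \<in> N 1" if x: "x \<in> carrier Q1" "dot Y Sa x y = \<zero>\<^bsub>Y\<^esub>" "a \<in> Sa" for x a
    proof -
      have "D1 x = \<zero>\<^bsub>Q0\<^esub>" using ydot0[OF Q1_car(1)[OF x(1)] x(2)] D1_val[of x] Q1_car(1)[OF x(1)] by simp
      then obtain z where z: "z \<in> carrier Q2" "x = D2 z" using D1_exact[OF x(1)] by blast
      have "x a = (\<Oplus>r\<in>Sr. \<rho> a r \<otimes> z r)" unfolding z(2) using D2_val[of z] Q2_car(1)[OF z(1)] x(3) by simp
      also have "\<dots> \<in> N 1" using \<rho>(1)[OF x(3)] N_mult_r Q2_car(1)[OF z(1)] by (intro N_finsum fin_Sr) auto
      finally show ?thesis .
    qed
    have "\<exists>u. is_basis B Sa \<epsilon>a P0 u \<and> (\<forall>a\<in>Sa. e' (u a) = y a)"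
      by (rule proj_cover_is_basis[where M = Y and N = N])
        (fact kB fdB nilB id1 fin_Sa cov0 kY y(1) y\<epsilon> gen min)+
    then show thesis using that by blast
  qed
  note p = is_basisD(1,2)[OF pb] p3 is_basisD(3,4)[OF pb]
  \<comment> \<open>The r-th column of \<rho> in the basis p; as \<alpha> \<rho> = 0, it lies in the
    kernel of \<open>e'\<close>.\<close>
  define \<kappa> where "\<kappa> r = dot P0 Sa (\<lambda>a. \<rho> a r) p" for r
  have \<kappa>P0: "\<kappa> r \<in> carrier P0" if r: "r \<in> Sr" for r
    unfolding \<kappa>_def by (rule P0.dot_closed) (use p(1) \<rho>c[OF _ r] in simp_all)
  have e'dot: "e' (dot P0 Sa x p) = dot Y Sa x y" if x: "\<And>a. a \<in> Sa \<Longrightarrow> x a \<in> carrier A" for x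
  proof -
    have "e' (dot P0 Sa x p) = dot Y Sa x (\<lambda>a. e' (p a))"
      by (rule lin_dot[OF kP0 kY e'l fin_Sa]) (use x p(1) in simp_all)
    also have "\<dots> = dot Y Sa x y" by (rule Y.dot_cong) (use x y(1) p(3) in simp_all)
    finally show ?thesis .
  qed
  have \<kappa>: "\<kappa> r \<in> carrier ?K" if r: "r \<in> Sr" for r
  proof -
    have "\<iota> (e' (\<kappa> r)) = \<iota> \<zero>\<^bsub>Y\<^esub>"
      unfolding \<kappa>_def using e'dot[of "\<lambda>a. \<rho> a r"] \<iota>dot[of "\<lambda>a. \<rho> a r"] \<rho>c[OF _ r] \<alpha>\<rho>[OF r]
        F.smult_zero_l[OF u0(1)] lin_zero[OF kY kF \<iota>l] by simp
    then have "e' (\<kappa> r) = \<zero>\<^bsub>Y\<^esub>"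
      by (rule inj_onD[OF \<iota>(2)]) (use linD(1)[OF e'l \<kappa>P0[OF r]] in simp_all)
    then show ?thesis using \<kappa>P0[OF r] by (simp add: a_kernel_eq)
  qed
  have inc: "lin B ?K P0 (\<lambda>x. x)" by (auto simp: lin_def a_kernel_eq)
  have Kdot: "dot ?K Sr z \<kappa> = dot P0 Sr z \<kappa>" if z: "\<And>r. r \<in> Sr \<Longrightarrow> z r \<in> carrier A" for z
    by (rule lin_dot[OF kK kP0 inc fin_Sr]) (use z \<kappa> in simp_all)
  have \<kappa>dot: "dot P0 Sr z \<kappa> = dot P0 Sa (D2 z) p" if z: "\<And>r. r \<in> Sr \<Longrightarrow> z r \<in> carrier A" for z
  proof -
    have "dot P0 Sr z \<kappa> = dot P0 Sr z (\<lambda>r. dot P0 Sa (\<lambda>a. \<rho> a r) p)" unfolding \<kappa>_def ..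
    also have "\<dots> = dot P0 Sa (\<lambda>a. dot (reg_mod B) Sr z (\<lambda>r. \<rho> a r)) p"
      by (rule P0.dot_assoc[OF fin_Sa fin_Sr, symmetric]) (use z \<rho>c p(1) in simp_all)
    also have "\<dots> = dot P0 Sa (D2 z) p"
      by (rule P0.dot_cong) (use D2_val[OF z] z \<rho>c p(1) in \<open>auto simp: dot_def intro!: finsum_closed\<close>)
    finally show ?thesis .
  qed
  have \<kappa>\<epsilon>: "\<epsilon>r r \<odot>\<^bsub>?K\<^esub> \<kappa> r = \<kappa> r" if r: "r \<in> Sr" for r
  proof -
    have "\<epsilon>r r \<odot>\<^bsub>P0\<^esub> \<kappa> r = dot P0 Sa (\<lambda>a. \<epsilon>r r \<otimes>\<^bsub>B\<^esub> \<rho> a r) p"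
      unfolding \<kappa>_def by (rule P0.dot_smult[OF fin_Sa]) (use \<epsilon>rc[OF r] \<rho>c[OF _ r] p(1) in simp_all)
    also have "\<dots> = \<kappa> r"
      unfolding \<kappa>_def by (rule P0.dot_cong) (use \<rho>(3)[OF _ r] \<rho>c[OF _ r] p(1) in simp_all)
    finally show ?thesis by simp
  qed
  obtain qq where qb: "is_basis B Sr \<epsilon>r P1 qq" and q3: "\<And>r. r \<in> Sr \<Longrightarrow> d (qq r) = \<kappa> r"
  proof -
    have gen: "\<exists>z\<in>carrier Q2. v = dot ?K Sr z \<kappa>" if v: "v \<in> carrier ?K" for v
    proof -
      have v0: "v \<in> carrier P0" "e' v = \<zero>\<^bsub>Y\<^esub>" using v by (auto simp: a_kernel_eq)
      obtain x where x: "x \<in> carrier Q1" "v = dot P0 Sa x p" using p(4)[OF v0(1)] by blast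
      have "D1 x = \<zero>\<^bsub>Q0\<^esub>"
        using ydot0[OF Q1_car(1)[OF x(1)]] e'dot[OF Q1_car(1)[OF x(1)]] v0(2) x(2) D1_val[of x] Q1_car(1)[OF x(1)]
        by simp
      then obtain z where z: "z \<in> carrier Q2" "x = D2 z" using D1_exact[OF x(1)] by blast
      have "v = dot ?K Sr z \<kappa>" using Kdot[OF Q2_car(1)[OF z(1)]] \<kappa>dot[OF Q2_car(1)[OF z(1)]] x(2) z(2) by simp
      then show ?thesis using z(1) by blast
    qed
    have min: "z r \<in> N 1" if z: "z \<in> carrier Q2" "dot ?K Sr z \<kappa> = \<zero>\<^bsub>?K\<^esub>" "r \<in> Sr" for z r
    proof -
      have "dot P0 Sa (D2 z) p = \<zero>\<^bsub>P0\<^esub>" using z(2) Kdot[OF Q2_car(1)[OF z(1)]] \<kappa>dot[OF Q2_car(1)[OF z(1)]] by simp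
      then have "D2 z a = \<zero>" if "a \<in> Sa" for a using p(5)[OF linD(1)[OF D2_lin z(1)]] that by simp
      then have "D2 z = \<zero>\<^bsub>Q1\<^esub>" using linD(1)[OF D2_lin z(1)] by (auto simp: fun_eq_iff PiE_iff extensional_def)
      then show ?thesis by (rule D2_min[OF z(1) _ z(3)])
    qed
    have "\<exists>u. is_basis B Sr \<epsilon>r P1 u \<and> (\<forall>r\<in>Sr. d (u r) = \<kappa> r)"
      by (rule proj_cover_is_basis[where M = ?K and N = N])
        (fact kB fdB nilB id2 fin_Sr cov1 kK \<kappa> \<kappa>\<epsilon> gen min)+
    then show thesis using that by blast
  qed
  note qq = is_basisD(1,2)[OF qb] q3 is_basisD(3,4)[OF qb]
  have qd: "dot P1 Sr z qq \<in> carrier P1" if "z \<in> carrier Q2" for z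
    by (rule P1.dot_closed) (use Q2_car(1)[OF that] qq(1) in simp_all)
  have pd: "dot P0 Sa x p \<in> carrier P0" if "x \<in> carrier Q1" for x
    by (rule P0.dot_closed) (use Q1_car(1)[OF that] p(1) in simp_all)
  have ql: "lin B Q2 P1 (\<lambda>z. dot P1 Sr z qq)" by (rule B.fam_lin[OF kP1 id2 fin_Sr qq(1)])
  have pl: "lin B Q1 P0 (\<lambda>x. dot P0 Sa x p)" by (rule B.fam_lin[OF kP0 id1 fin_Sa p(1)])
  have z0: "z = \<zero>\<^bsub>Q2\<^esub>" if "z \<in> carrier Q2" "dot P1 Sr z qq = \<zero>\<^bsub>P1\<^esub>" for z
    using qq(5)[OF that] that(1) by (auto simp: fun_eq_iff PiE_iff extensional_def)
  have x0: "x = \<zero>\<^bsub>Q1\<^esub>" if "x \<in> carrier Q1" "dot P0 Sa x p = \<zero>\<^bsub>P0\<^esub>" for x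
    using p(5)[OF that] that(1) by (auto simp: fun_eq_iff PiE_iff extensional_def)
  \<comment> \<open>H and, below, G read off coordinates in \<open>P1\<close> and \<open>P0\<close>:
    they invert the maps that form combinations of the bases \<open>qq\<close> and p.\<close>
  obtain H where H0: "lin B (P1\<lparr>carrier := (\<lambda>z. dot P1 Sr z qq) ` carrier Q2\<rparr>) Q2 H"
    "\<And>z. z \<in> carrier Q2 \<Longrightarrow> H (dot P1 Sr z qq) = z"
    using lin_factor[OF kQ2 kP1 kQ2 ql lin_id] z0 by metis
  have "(\<lambda>z. dot P1 Sr z qq) ` carrier Q2 = carrier P1" using qq(4) qd by blast
  then have H: "lin B P1 Q2 H" using H0(1) by simp
  obtain G where G0: "lin B (P0\<lparr>carrier := (\<lambda>x. dot P0 Sa x p) ` carrier Q1\<rparr>) Q1 G"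
    "\<And>x. x \<in> carrier Q1 \<Longrightarrow> G (dot P0 Sa x p) = x"
    using lin_factor[OF kQ1 kP0 kQ1 pl lin_id] x0 by metis
  have "(\<lambda>x. dot P0 Sa x p) ` carrier Q1 = carrier P0" using p(4) pd by blast
  then have G: "lin B P0 Q1 G" using G0(1) by simp
  have ev2: "lin B Q2 (reg_mod B) (\<lambda>z. z r)" if "r \<in> Sr" for r using that by (auto simp: lin_def)
  have ev1: "lin B Q1 (reg_mod B) (\<lambda>x. x a)" if "a \<in> Sa" for a using that by (auto simp: lin_def)
  \<comment> \<open>The r-th coordinate form of \<open>P1\<close>; by \<open>fexp\<close> these
    forms generate Hom(P1, A).\<close>
  define \<gamma> where "\<gamma> r = restrict (\<lambda>w. H w r) (carrier P1)" for r
  have \<gamma>: "\<gamma> r \<in> carrier (ring_dual B P1)" if "r \<in> Sr" for r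
    using lin_restrict_mhom[OF kP1 lin_comp[OF H ev2[OF that]]] by (simp add: \<gamma>_def)
  have kRD: "kmod A (ring_dual B P1)" using P1.ring_dual_kmod by simp
  interpret RD: kmod A "ring_dual B P1" by (rule kRD)
  have qlin: "lin A (ring_dual B P1) X q" using q(1) by (simp add: mhom_iff)
  define g where "g r = q (\<gamma> r)" for r
  have \<gamma>dot: "dot (ring_dual B P1) Sr l \<gamma> w = (\<Oplus>r\<in>Sr. l r \<otimes> H w r)"
    if l: "\<And>r. r \<in> Sr \<Longrightarrow> l r \<in> carrier A" and w: "w \<in> carrier P1" for l w
  proof -
    have Hc: "H w r \<in> carrier A" if "r \<in> Sr" for r using Q2_car(1)[OF linD(1)[OF H w] that] .
    have "l r \<odot>\<^bsub>ring_dual B P1\<^esub> \<gamma> r \<in> carrier (ring_dual B P1)" if "r \<in> Sr" for r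
      using RD.smult_closed[OF l[OF that] \<gamma>[OF that]] .
    then have "dot (ring_dual B P1) Sr l \<gamma> w = (\<Oplus>\<^bsub>B\<^esub>r\<in>Sr. (l r \<odot>\<^bsub>ring_dual B P1\<^esub> \<gamma> r) w)"
      unfolding dot_def using P1.ring_dual_finsum[OF fin_Sr, of "\<lambda>r. l r \<odot>\<^bsub>ring_dual B P1\<^esub> \<gamma> r"] w
      by (simp del: ring_dual_simps opp_finsum)
    also have "\<dots> = (\<Oplus>r\<in>Sr. (l r \<odot>\<^bsub>ring_dual B P1\<^esub> \<gamma> r) w)" by simp
    also have "\<dots> = (\<Oplus>r\<in>Sr. l r \<otimes> H w r)"
      by (rule finsum_cong') (use w Hc l in \<open>auto simp: \<gamma>_def\<close>)
    finally show ?thesis .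
  qed
  have fexp: "f w = (\<Oplus>r\<in>Sr. f (qq r) \<otimes> H w r)" if f: "lin B P1 (reg_mod B) f" and w: "w \<in> carrier P1" for f w
  proof -
    obtain z where z: "z \<in> carrier Q2" "w = dot P1 Sr z qq" using qq(4)[OF w] by blast
    have "f w = dot (reg_mod B) Sr z (\<lambda>r. f (qq r))"
      unfolding z(2) by (rule lin_dot[OF kP1 kR f fin_Sr]) (use Q2_car(1)[OF z(1)] qq(1) in simp_all)
    then show ?thesis using H0(2)[OF z(1)] z(2) by (simp add: dot_def)
  qed
  have dotX: "dot X Sr l g = q (dot (ring_dual B P1) Sr l \<gamma>)" if "\<And>r. r \<in> Sr \<Longrightarrow> l r \<in> carrier A" for l
    unfolding g_def by (rule lin_dot[OF kRD kX qlin fin_Sr, symmetric]) (use that \<gamma> in \<open>simp_all del: ring_dual_simps\<close>)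
  have qq\<epsilon>: "f (qq r) \<in> carrier A" "f (qq r) \<otimes> \<epsilon>r r = f (qq r)" if f: "lin B P1 (reg_mod B) f" and r: "r \<in> Sr" for f r
    using linD(1)[OF f qq(1)[OF r]] linD(3)[OF f _ qq(1)[OF r], of "\<epsilon>r r"] qq(2)[OF r] \<epsilon>rc[OF r] by simp_all
  have ext_eq: "f = f'" if "f \<in> carrier (ring_dual B P1)" "f' \<in> carrier (ring_dual B P1)"
    "\<And>w. w \<in> carrier P1 \<Longrightarrow> f w = f' w" for f f'
    using that by (auto simp: mhom_iff intro: extensionalityI)
  show thesis
  proof (rule that)
    fix r assume r: "r \<in> Sr"
    show "g r \<in> carrier X" unfolding g_def using linD(1)[OF qlin \<gamma>[OF r]] .
    have "\<epsilon>r r \<odot>\<^bsub>ring_dual B P1\<^esub> \<gamma> r = \<gamma> r"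
    proof (rule ext_eq[OF RD.smult_closed[OF \<epsilon>rc[OF r] \<gamma>[OF r]] \<gamma>[OF r]])
      fix w assume w: "w \<in> carrier P1"
      show "(\<epsilon>r r \<odot>\<^bsub>ring_dual B P1\<^esub> \<gamma> r) w = \<gamma> r w"
        using w Q2_car(2)[OF linD(1)[OF H w] r] by (simp add: \<gamma>_def)
    qed
    then show "\<epsilon>r r \<odot>\<^bsub>X\<^esub> g r = g r" unfolding g_def using linD(3)[OF qlin \<epsilon>rc[OF r] \<gamma>[OF r]] by (simp only:)
  next
    fix x assume x: "x \<in> carrier X"
    obtain f where f: "f \<in> carrier (ring_dual B P1)" "x = q f" using q(2) x by blast
    have fl: "lin B P1 (reg_mod B) f" using f(1) by (simp add: mhom_iff)
    let ?l = "\<lambda>r\<in>Sr. f (qq r)"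
    have l: "?l \<in> carrier (fam A Sr \<epsilon>r)" using qq\<epsilon>[OF fl] by auto
    have lc: "?l r \<in> carrier A" if "r \<in> Sr" for r using qq\<epsilon>[OF fl that] that by simp
    have "dot (ring_dual B P1) Sr ?l \<gamma> = f"
    proof (rule ext_eq[OF _ f(1)])
      show "dot (ring_dual B P1) Sr ?l \<gamma> \<in> carrier (ring_dual B P1)"
        by (rule RD.dot_closed) (use lc \<gamma> in \<open>simp_all del: ring_dual_simps\<close>)
      fix w assume w: "w \<in> carrier P1"
      have 1: "dot (ring_dual B P1) Sr ?l \<gamma> w = (\<Oplus>r\<in>Sr. ?l r \<otimes> H w r)"
        by (rule \<gamma>dot) (use lc w in simp_all)
      have 2: "(\<Oplus>r\<in>Sr. ?l r \<otimes> H w r) = (\<Oplus>r\<in>Sr. f (qq r) \<otimes> H w r)"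
        by (rule finsum_cong') (use qq\<epsilon>(1)[OF fl] Q2_car(1)[OF linD(1)[OF H w]] in auto)
      show "dot (ring_dual B P1) Sr ?l \<gamma> w = f w" by (rule trans[OF trans[OF 1 2] fexp[OF fl w, symmetric]])
    qed
    moreover have "dot X Sr ?l g = q (dot (ring_dual B P1) Sr ?l \<gamma>)" by (rule dotX) (use lc in simp_all)
    ultimately have "x = dot X Sr ?l g" using f(2) by (simp only:)
    then show "\<exists>l\<in>carrier (fam A Sr \<epsilon>r). x = dot X Sr l g" using l by blast
  next
    fix l assume l: "l \<in> carrier (fam A Sr \<epsilon>r)" and l0: "dot X Sr l g = \<zero>\<^bsub>X\<^esub>"
    have lc: "l r \<in> carrier A" "l r \<otimes> \<epsilon>r r = l r" if "r \<in> Sr" for r using l that by auto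
    let ?f = "dot (ring_dual B P1) Sr l \<gamma>"
    have fc: "?f \<in> carrier (ring_dual B P1)"
      by (rule RD.dot_closed) (use lc \<gamma> in \<open>simp_all del: ring_dual_simps\<close>)
    \<comment> \<open>A combination of the forms \<gamma> that dies in X is induced by a form g' on
      \<open>P0\<close>. Its value at \<open>qq r\<close> is l r on one side, and on the other the
      row of the g' (p a) times the r-th column of \<rho>.\<close>
    have "?f \<in> a_kernel (ring_dual B P1) X q" using fc l0 dotX[of l] lc(1) by (simp add: a_kernel_eq)
    then obtain g' where g': "g' \<in> carrier (ring_dual B P0)" "?f = compose (carrier P1) g' d" using q(3) by auto
    have g'l: "lin B P0 (reg_mod B) g'" using g'(1) by (simp add: mhom_iff)
    have "l r = (\<Oplus>a\<in>Sa. (\<lambda>a\<in>Sa. g' (p a)) a \<otimes> \<rho> a r)" if r: "r \<in> Sr" for r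
    proof -
      have uQ: "fam_unit B Sr \<epsilon>r r \<in> carrier Q2" by (rule B.fam_unit_closed[OF id2 r])
      have "dot P1 Sr (fam_unit B Sr \<epsilon>r r) qq = dot P1 Sr (\<lambda>t. if t = r then \<epsilon>r r else \<zero>\<^bsub>B\<^esub>) qq"
        by (rule P1.dot_cong) (use qq(1) \<epsilon>rc[OF r] in \<open>auto simp: fam_unit_def\<close>)
      also have "\<dots> = qq r" using P1.dot_single[OF fin_Sr r, of "\<epsilon>r r" qq] \<epsilon>rc[OF r] qq(1,2) r by simp
      finally have Hq: "H (qq r) = fam_unit B Sr \<epsilon>r r" using H0(2)[OF uQ] by simp
      have "?f (qq r) = (\<Oplus>s\<in>Sr. l s \<otimes> fam_unit B Sr \<epsilon>r r s)" unfolding Hq[symmetric] by (rule \<gamma>dot) (use lc(1) qq(1)[OF r] in simp_all)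
      also have "\<dots> = (\<Oplus>s\<in>Sr. if r = s then l s \<otimes> \<epsilon>r r else \<zero>)"
        by (rule finsum_cong') (use lc \<epsilon>rc r in \<open>auto simp: fam_unit_def\<close>)
      also have "\<dots> = l r \<otimes> \<epsilon>r r" by (rule finsum_singleton) (use lc \<epsilon>rc r fin_Sr in auto)
      finally have "l r = ?f (qq r)" using lc(2)[OF r] by simp
      also have "\<dots> = g' (\<kappa> r)" unfolding g'(2) using qq(1,3)[OF r] by (simp add: compose_def)
      also have "\<dots> = dot (reg_mod B) Sa (\<lambda>a. \<rho> a r) (\<lambda>a. g' (p a))"
        unfolding \<kappa>_def by (rule lin_dot[OF kP0 kR g'l fin_Sa]) (use \<rho>c[OF _ r] p(1) in simp_all)
      also have "\<dots> = (\<Oplus>a\<in>Sa. g' (p a) \<otimes> \<rho> a r)" by (simp add: dot_def)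
      also have "\<dots> = (\<Oplus>a\<in>Sa. (\<lambda>a\<in>Sa. g' (p a)) a \<otimes> \<rho> a r)"
        by (rule finsum_cong') (use \<rho>c[OF _ r] linD(1)[OF g'l p(1)] in auto)
      finally show ?thesis .
    qed
    moreover have "g' (p a) \<in> carrier A \<and> g' (p a) \<otimes> \<epsilon>a a = g' (p a)" if a: "a \<in> Sa" for a
      using linD(1)[OF g'l p(1)[OF a]] linD(3)[OF g'l _ p(1)[OF a], of "\<epsilon>a a"] p(2)[OF a] \<epsilon>ac[OF a] by simp
    then have "(\<lambda>a\<in>Sa. g' (p a)) \<in> carrier (fam A Sa \<epsilon>a)" by auto
    ultimately show "\<exists>y\<in>carrier (fam A Sa \<epsilon>a). \<forall>r\<in>Sr. l r = (\<Oplus>a\<in>Sa. y a \<otimes> \<rho> a r)" by blast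
  next
    fix a assume a: "a \<in> Sa"
    let ?f = "dot (ring_dual B P1) Sr (\<rho> a) \<gamma>"
    \<comment> \<open>The a-th coordinate form of \<open>P0\<close>; composed with d it becomes the
      a-th row of \<rho> in the forms \<gamma>, so q kills this row.\<close>
    let ?g = "restrict (\<lambda>w. G w a) (carrier P0)"
    have fc: "?f \<in> carrier (ring_dual B P1)"
      by (rule RD.dot_closed) (use \<rho>c[OF a] \<gamma> in \<open>simp_all del: ring_dual_simps\<close>)
    have g': "?g \<in> carrier (ring_dual B P0)"
      using lin_restrict_mhom[OF kP0 lin_comp[OF G ev1[OF a]]] by simp
    have "?f w = ?g (d w)" if w: "w \<in> carrier P1" for w
    proof -
      obtain z where z: "z \<in> carrier Q2" "w = dot P1 Sr z qq" using qq(4)[OF w] by blast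
      have "d w = dot ?K Sr z (\<lambda>r. d (qq r))"
        unfolding z(2) by (rule lin_dot[OF kP1 kK dl fin_Sr]) (use Q2_car(1)[OF z(1)] qq(1) in simp_all)
      also have "\<dots> = dot ?K Sr z \<kappa>" by (rule K.dot_cong) (use Q2_car(1)[OF z(1)] qq(3) \<kappa> in simp_all)
      also have "\<dots> = dot P0 Sa (D2 z) p" using Kdot[OF Q2_car(1)[OF z(1)]] \<kappa>dot[OF Q2_car(1)[OF z(1)]] by simp
      finally have "G (d w) = D2 z" "d w \<in> carrier P0"
        using G0(2)[OF linD(1)[OF D2_lin z(1)]] pd[OF linD(1)[OF D2_lin z(1)]] by simp_all
      then show ?thesis
        using \<gamma>dot[of "\<rho> a" w] \<rho>c[OF a] w H0(2)[OF z(1)] z(2) D2_val[OF Q2_car(1)[OF z(1)]] a by simp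
    qed
    then have "?f = compose (carrier P1) ?g d"
      using fc by (auto simp: compose_def fun_eq_iff mhom_iff extensional_def)
    then have "?f \<in> a_kernel (ring_dual B P1) X q" unfolding q(3) using g' by blast
    then show "dot X Sr (\<rho> a) g = \<zero>\<^bsub>X\<^esub>" using dotX[of "\<rho> a"] \<rho>c[OF a] by (simp add: a_kernel_eq)
  qed
qed

end

section \<open>Endomorphisms of T act on \<open>\<tau>\<^sub>2\<^sup>-P\<close> by scalars\<close>

text \<open>The elements \<open>g\<^sub>r\<close> generate the summand \<open>\<tau>\<^sub>2\<^sup>-P\<close> of \<open>T\<close>, with the relations \<open>\<Sum>\<^sub>r r\<^sub>a g\<^sub>r = 0\<close>; the
  summand \<open>P'\<close> is free on \<open>p = 1 - e\<^sub>i\<close>, and \<open>pr\<close> is the projection onto it.\<close>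

locale apr_tilt = apr_mod A ei Sa Sr \<epsilon>a \<epsilon>r \<alpha> \<rho> N P \<pi>
  for A :: "('k::field, 'a) module" (structure) and ei Sa and Sr :: "'r set" and \<epsilon>a :: "'e \<Rightarrow> 'a" and \<epsilon>r \<alpha> \<rho> N
    and P :: "('a, 'p) module" and \<pi> +
  fixes T :: "('a, 't) module" and g :: "'r \<Rightarrow> 't" and p :: 't and pr :: "'t \<Rightarrow> 'a"
  assumes kT: "kmod A T"
    and inj2: "inj_dim A P = 2" and ext1: "Ext_zero A 1 (D_reg A) P" and Sr_ne: "Sr \<noteq> {}"
    and g: "\<And>r. r \<in> Sr \<Longrightarrow> g r \<in> carrier T" "\<And>r. r \<in> Sr \<Longrightarrow> \<epsilon>r r \<odot>\<^bsub>T\<^esub> g r = g r"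
    and p: "p \<in> carrier T" "(\<one> \<ominus> ei) \<odot>\<^bsub>T\<^esub> p = p"
    and pr: "lin A T (reg_mod A) pr" "pr p = \<one> \<ominus> ei" "\<And>r. r \<in> Sr \<Longrightarrow> pr (g r) = \<zero>"
      "\<And>t. t \<in> carrier T \<Longrightarrow> pr t \<otimes> (\<one> \<ominus> ei) = pr t"
    and T_span: "\<And>t. t \<in> carrier T \<Longrightarrow> pr t = \<zero> \<Longrightarrow> \<exists>l\<in>carrier (fam A Sr \<epsilon>r). t = dot T Sr l g"
    and T_rel: "\<And>l. l \<in> carrier (fam A Sr \<epsilon>r) \<Longrightarrow> dot T Sr l g = \<zero>\<^bsub>T\<^esub> \<Longrightarrow>
        \<exists>y\<in>carrier (fam A Sa \<epsilon>a). \<forall>r\<in>Sr. l r = (\<Oplus>a\<in>Sa. y a \<otimes> \<rho> a r)"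
    and T_rel0: "\<And>a. a \<in> Sa \<Longrightarrow> dot T Sr (\<rho> a) g = \<zero>\<^bsub>T\<^esub>"
begin

sublocale T: kmod A T by (rule kT)

abbreviation f where "f \<equiv> \<one> \<ominus> ei"
abbreviation dA where "dA S x y \<equiv> dot (reg_mod A) S x y"

lemma f: "f \<in> carrier A" "f \<otimes> f = f"
  using ei by (simp_all add: minus_eq l_distr r_distr l_minus r_minus a_ac r_neg)

lemma dA_eq: "dA S x y = (\<Oplus>s\<in>S. x s \<otimes> y s)" by (simp add: dot_def)

lemma prc: "t \<in> carrier T \<Longrightarrow> pr t \<in> carrier A"
  using linD(1)[OF pr(1)] by simp

text \<open>In matrix form: if \<open>F(g) = \<Phi> g\<close> then \<open>\<rho> \<Phi> = \<Gamma> \<rho>\<close>, so \<open>\<alpha> \<Gamma> \<rho> = 0\<close> and \<open>\<alpha> \<Gamma> = c \<alpha>\<close>; hence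
  \<open>\<Gamma> - c = \<rho> H\<close> by exactness, and \<open>\<rho> (\<Phi> - c - H \<rho>) = 0\<close> gives \<open>\<Phi> = c + H \<rho>\<close>.\<close>

lemma End_scalar:
  assumes F: "lin A T T F"
  shows "\<exists>c. \<forall>r\<in>Sr. F (g r) = ks A T c (g r)"
proof -
  interpret R: kmod A "reg_mod A" by (rule reg_kmod)
  have Fc: "F t \<in> carrier T" if "t \<in> carrier T" for t using linD(1)[OF F that] .
  have prF: "lin A T (reg_mod A) (\<lambda>t. pr (F t))" by (rule lin_comp[OF F pr(1)])
  \<comment> \<open>The component in P' vanishes: by \<open>T_rel0\<close> the column of the
    elements pr (F (g r)) is annihilated by \<rho>.\<close>
  have pr0: "pr (F (g r)) = \<zero>" if r: "r \<in> Sr" for r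
  proof (rule \<rho>_injective[OF inj2 _ _ _ r])
    fix r assume r: "r \<in> Sr"
    show "pr (F (g r)) \<in> carrier A" using prc Fc g(1)[OF r] by blast
    show "\<epsilon>r r \<otimes> pr (F (g r)) = pr (F (g r))"
      using linD(3)[OF prF \<epsilon>rc[OF r] g(1)[OF r]] g(2)[OF r] by simp
  next
    fix a assume a: "a \<in> Sa"
    have "pr (F (dot T Sr (\<rho> a) g)) = dA Sr (\<rho> a) (\<lambda>r. pr (F (g r)))"
      by (rule lin_dot[OF kT reg_kmod prF fin_Sr]) (use \<rho>c[OF a] g(1) in simp_all)
    then show "(\<Oplus>r\<in>Sr. \<rho> a r \<otimes> pr (F (g r))) = \<zero>"
      using T_rel0[OF a] lin_zero[OF kT reg_kmod prF] by (simp add: dA_eq)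
  qed
  \<comment> \<open>Row r of the matrix \<Phi>, called \<open>Fm\<close> below. Multiplication by
    \<open>\<epsilon>r r\<close> from the left normalises its entries on both sides.\<close>
  have "\<exists>l. (\<forall>s\<in>Sr. l s \<in> carrier A \<and> l s \<otimes> \<epsilon>r s = l s \<and> \<epsilon>r r \<otimes> l s = l s) \<and> F (g r) = dot T Sr l g"
    if r: "r \<in> Sr" for r
  proof -
    obtain l where l: "l \<in> carrier (fam A Sr \<epsilon>r)" "F (g r) = dot T Sr l g"
      using T_span[OF Fc[OF g(1)[OF r]] pr0[OF r]] by blast
    have lc: "l s \<in> carrier A" "l s \<otimes> \<epsilon>r s = l s" if "s \<in> Sr" for s using l(1) that by auto
    have "F (g r) = \<epsilon>r r \<odot>\<^bsub>T\<^esub> F (g r)" using linD(3)[OF F \<epsilon>rc[OF r] g(1)[OF r]] g(2)[OF r] by simp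
    also have "\<dots> = dot T Sr (\<lambda>s. \<epsilon>r r \<otimes> l s) g"
      unfolding l(2) by (rule T.dot_smult[OF fin_Sr \<epsilon>rc[OF r]]) (use lc g(1) in simp_all)
    finally show ?thesis
      using lc \<epsilon>rc r idemD(2)[OF idem_r r]
      by (intro exI[of _ "\<lambda>s. \<epsilon>r r \<otimes> l s"]) (simp add: m_assoc m_assoc[symmetric, of "\<epsilon>r r" "\<epsilon>r r"])
  qed
  then obtain Fm where Fm: "\<And>r s. r \<in> Sr \<Longrightarrow> s \<in> Sr \<Longrightarrow> Fm r s \<in> carrier A"
    "\<And>r s. r \<in> Sr \<Longrightarrow> s \<in> Sr \<Longrightarrow> Fm r s \<otimes> \<epsilon>r s = Fm r s" "\<And>r s. r \<in> Sr \<Longrightarrow> s \<in> Sr \<Longrightarrow> \<epsilon>r r \<otimes> Fm r s = Fm r s"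
    "\<And>r. r \<in> Sr \<Longrightarrow> F (g r) = dot T Sr (Fm r) g" by metis
  \<comment> \<open>The matrix \<rho> \<Phi>. As F preserves the relations, its rows are relations
    among the \<open>g r\<close>, hence combinations of the rows of \<rho>; the coefficients form
    the matrix \<Gamma>, called \<open>G\<close> below.\<close>
  define rF where "rF a s = dA Sr (\<rho> a) (\<lambda>r. Fm r s)" for a s
  have rFc: "rF a s \<in> carrier A" if "a \<in> Sa" "s \<in> Sr" for a s
    unfolding rF_def using R.dot_closed[of Sr "\<rho> a" "\<lambda>r. Fm r s"] \<rho>c Fm(1) that by simp
  have rF\<epsilon>: "rF a s \<otimes> \<epsilon>r s = rF a s" "\<epsilon>a a \<otimes> rF a s = rF a s" if a: "a \<in> Sa" and s: "s \<in> Sr" for a s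
  proof -
    have "rF a s \<otimes> \<epsilon>r s = dA Sr (\<rho> a) (\<lambda>r. Fm r s \<otimes> \<epsilon>r s)"
      unfolding rF_def using lin_dot[OF reg_kmod reg_kmod R.lin_smult_right[of "\<epsilon>r s"] fin_Sr, of "\<rho> a" "\<lambda>r. Fm r s"]
        \<rho>c[OF a] Fm(1)[OF _ s] \<epsilon>rc[OF s] by simp
    also have "\<dots> = rF a s" unfolding rF_def by (rule R.dot_cong) (use Fm(1,2)[OF _ s] \<rho>c[OF a] in simp_all)
    finally show "rF a s \<otimes> \<epsilon>r s = rF a s" .
    have "\<epsilon>a a \<otimes> rF a s = dA Sr (\<lambda>r. \<epsilon>a a \<otimes> \<rho> a r) (\<lambda>r. Fm r s)"
      unfolding rF_def using R.dot_smult[OF fin_Sr, of "\<epsilon>a a" "\<rho> a" "\<lambda>r. Fm r s"] \<epsilon>ac[OF a] \<rho>c[OF a] Fm(1)[OF _ s] by simp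
    also have "\<dots> = rF a s" unfolding rF_def by (rule R.dot_cong) (use Fm(1)[OF _ s] \<rho>(2)[OF a] \<rho>c[OF a] in simp_all)
    finally show "\<epsilon>a a \<otimes> rF a s = rF a s" .
  qed
  have exG: "\<forall>a\<in>Sa. \<exists>G. (\<forall>b\<in>Sa. G b \<in> carrier A \<and> G b \<otimes> \<epsilon>a b = G b \<and> \<epsilon>a a \<otimes> G b = G b) \<and>
      (\<forall>s\<in>Sr. rF a s = dA Sa G (\<lambda>b. \<rho> b s))"
  proof
    fix a assume a: "a \<in> Sa"
    let ?l = "restrict (rF a) Sr"
    have lf: "?l \<in> carrier (fam A Sr \<epsilon>r)" using rFc[OF a] rF\<epsilon>(1)[OF a] by auto
    have "dot T Sr ?l g = dot T Sr (\<lambda>s. dA Sr (\<rho> a) (\<lambda>r. Fm r s)) g"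
      by (rule T.dot_cong) (use rFc[OF a] g(1) in \<open>simp_all add: rF_def\<close>)
    also have "\<dots> = dot T Sr (\<rho> a) (\<lambda>r. dot T Sr (Fm r) g)"
      by (rule T.dot_assoc[OF fin_Sr fin_Sr]) (use \<rho>c[OF a] Fm(1) g(1) in simp_all)
    also have "\<dots> = dot T Sr (\<rho> a) (\<lambda>r. F (g r))"
      by (rule T.dot_cong) (use \<rho>c[OF a] Fc g(1) in \<open>simp_all add: Fm(4)[symmetric]\<close>)
    also have "\<dots> = F (dot T Sr (\<rho> a) g)"
      by (rule lin_dot[OF kT kT F fin_Sr, symmetric]) (use \<rho>c[OF a] g(1) in simp_all)
    also have "\<dots> = \<zero>\<^bsub>T\<^esub>" using T_rel0[OF a] lin_zero[OF kT kT F] by simp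
    finally obtain y where y: "y \<in> carrier (fam A Sa \<epsilon>a)" "\<And>r. r \<in> Sr \<Longrightarrow> ?l r = (\<Oplus>a\<in>Sa. y a \<otimes> \<rho> a r)"
      using T_rel[OF lf] by blast
    have yc: "y b \<in> carrier A" "y b \<otimes> \<epsilon>a b = y b" if "b \<in> Sa" for b using y(1) that by auto
    have "rF a s = dA Sa (\<lambda>b. \<epsilon>a a \<otimes> y b) (\<lambda>b. \<rho> b s)" if s: "s \<in> Sr" for s
    proof -
      have "rF a s = \<epsilon>a a \<otimes> dA Sa y (\<lambda>b. \<rho> b s)" using rF\<epsilon>(2)[OF a s] y(2)[OF s] s by (simp add: dA_eq)
      then show ?thesis
        using R.dot_smult[OF fin_Sa, of "\<epsilon>a a" y "\<lambda>b. \<rho> b s"] \<epsilon>ac[OF a] yc(1) \<rho>c[OF _ s] by simp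
    qed
    then show "\<exists>G. (\<forall>b\<in>Sa. G b \<in> carrier A \<and> G b \<otimes> \<epsilon>a b = G b \<and> \<epsilon>a a \<otimes> G b = G b) \<and>
        (\<forall>s\<in>Sr. rF a s = dA Sa G (\<lambda>b. \<rho> b s))"
      using yc \<epsilon>ac a idemD(2)[OF idem_a a]
      by (intro exI[of _ "\<lambda>b. \<epsilon>a a \<otimes> y b"]) (simp add: m_assoc m_assoc[symmetric, of "\<epsilon>a a" "\<epsilon>a a"])
  qed
  obtain G where G0: "\<forall>a\<in>Sa. (\<forall>b\<in>Sa. G a b \<in> carrier A \<and> G a b \<otimes> \<epsilon>a b = G a b \<and> \<epsilon>a a \<otimes> G a b = G a b) \<and>
      (\<forall>s\<in>Sr. rF a s = dA Sa (G a) (\<lambda>b. \<rho> b s))"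
    using bchoice[OF exG] by blast
  then have G: "\<And>a b. a \<in> Sa \<Longrightarrow> b \<in> Sa \<Longrightarrow> G a b \<in> carrier A"
    "\<And>a b. a \<in> Sa \<Longrightarrow> b \<in> Sa \<Longrightarrow> G a b \<otimes> \<epsilon>a b = G a b" "\<And>a b. a \<in> Sa \<Longrightarrow> b \<in> Sa \<Longrightarrow> \<epsilon>a a \<otimes> G a b = G a b"
    "\<And>a s. a \<in> Sa \<Longrightarrow> s \<in> Sr \<Longrightarrow> rF a s = dA Sa (G a) (\<lambda>b. \<rho> b s)" by blast+
  \<comment> \<open>The row \<alpha> \<Gamma>. It satisfies y \<rho> = \<alpha> \<rho> \<Phi> =
    0.\<close>
  define y where "y b = dA Sa \<alpha> (\<lambda>a. G a b)" for b
  have yc: "y b \<in> carrier A" if "b \<in> Sa" for b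
    unfolding y_def using R.dot_closed[of Sa \<alpha> "\<lambda>a. G a b"] \<alpha>c G(1) that by simp
  have y\<epsilon>: "y b \<otimes> \<epsilon>a b = y b" if b: "b \<in> Sa" for b
  proof -
    have "y b \<otimes> \<epsilon>a b = dA Sa \<alpha> (\<lambda>a. G a b \<otimes> \<epsilon>a b)"
      unfolding y_def using lin_dot[OF reg_kmod reg_kmod R.lin_smult_right[of "\<epsilon>a b"] fin_Sa, of \<alpha> "\<lambda>a. G a b"]
        \<alpha>c G(1)[OF _ b] \<epsilon>ac[OF b] by simp
    also have "\<dots> = y b" unfolding y_def by (rule R.dot_cong) (use G(1,2)[OF _ b] \<alpha>c in simp_all)
    finally show ?thesis .
  qed
  have "(\<Oplus>b\<in>Sa. y b \<otimes> \<rho> b s) = \<zero>" if s: "s \<in> Sr" for s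
  proof -
    have "dA Sa y (\<lambda>b. \<rho> b s) = dA Sa \<alpha> (\<lambda>a. dA Sa (G a) (\<lambda>b. \<rho> b s))"
      unfolding y_def by (rule R.dot_assoc[OF fin_Sa fin_Sa]) (use \<alpha>c G(1) \<rho>c[OF _ s] in simp_all)
    also have "\<dots> = dA Sa \<alpha> (\<lambda>a. dA Sr (\<rho> a) (\<lambda>r. Fm r s))"
      by (rule R.dot_cong) (use \<alpha>c G(4)[OF _ s] rFc[OF _ s] in \<open>simp_all add: rF_def[symmetric]\<close>)
    also have "\<dots> = dA Sr (\<lambda>r. dA Sa \<alpha> (\<lambda>a. \<rho> a r)) (\<lambda>r. Fm r s)"
      by (rule R.dot_assoc[OF fin_Sr fin_Sa, symmetric]) (use \<alpha>c Fm(1)[OF _ s] \<rho>c in simp_all)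
    also have "\<dots> = \<zero>\<^bsub>reg_mod A\<^esub>"
      by (rule R.dot_zero_l) (use \<alpha>\<rho> Fm(1)[OF _ s] in \<open>simp_all add: dA_eq\<close>)
    finally show ?thesis by (simp add: dA_eq)
  qed
  then obtain c where c: "\<And>b. b \<in> Sa \<Longrightarrow> y b = c \<odot> \<alpha> b"
    using Ext1_zero_kernel[OF ext1, of y] yc y\<epsilon> by blast
  \<comment> \<open>The scalar matrix c, with the idempotents instead of \<one> on the diagonal;
    \<open>dr\<close> is its counterpart for the relations. Exactness is applied to the columns of x
    = \<Gamma> - c.\<close>
  define dl where "dl a b = (if a = b then c \<odot> \<epsilon>a b else \<zero>)" for a b
  have dlc: "dl a b \<in> carrier A" if "a \<in> Sa" "b \<in> Sa" for a b using that \<epsilon>ac by (simp add: dl_def)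
  define x where "x a b = G a b \<ominus> dl a b" for a b
  have xc: "x a b \<in> carrier A" if "a \<in> Sa" "b \<in> Sa" for a b using G(1)[OF that] dlc[OF that] by (simp add: x_def)
  have Gx: "G a b = x a b \<oplus> dl a b" if "a \<in> Sa" "b \<in> Sa" for a b
    using R.M_diff_add[of "G a b" "dl a b"] G(1)[OF that] dlc[OF that] by (simp add: x_def)
  have "\<exists>z. (\<forall>r\<in>Sr. z r \<in> carrier A \<and> \<epsilon>r r \<otimes> z r = z r) \<and> (\<forall>a\<in>Sa. x a b = (\<Oplus>r\<in>Sr. \<rho> a r \<otimes> z r))"
    if b: "b \<in> Sa" for b
  proof (rule exact)
    fix a assume a: "a \<in> Sa"
    show "x a b \<in> carrier A" using xc a b by blast
    have "\<epsilon>a a \<otimes> dl a b = dl a b"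
      using a b \<epsilon>ac idemD(2)[OF idem_a] by (auto simp: dl_def scal_mult_r)
    then show "\<epsilon>a a \<otimes> x a b = x a b"
      using R.smult_diff_r[of "\<epsilon>a a" "G a b" "dl a b"] G(1,3)[OF a b] dlc[OF a b] \<epsilon>ac[OF a] by (simp add: x_def)
  next
    have "y b = dA Sa \<alpha> (\<lambda>a. x a b \<oplus>\<^bsub>reg_mod A\<^esub> dl a b)"
      unfolding y_def by (rule R.dot_cong) (use Gx b \<alpha>c xc dlc in simp_all)
    also have "\<dots> = dA Sa \<alpha> (\<lambda>a. x a b) \<oplus> dA Sa \<alpha> (\<lambda>a. dl a b)"
      using R.dot_add_r[of Sa \<alpha> "\<lambda>a. x a b" "\<lambda>a. dl a b"] \<alpha>c xc[OF _ b] dlc[OF _ b] by simp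
    also have "dA Sa \<alpha> (\<lambda>a. dl a b) = (\<Oplus>a\<in>Sa. if b = a then \<alpha> a \<otimes> (c \<odot> \<epsilon>a b) else \<zero>)"
      unfolding dA_eq by (rule finsum_cong') (use \<alpha>c b \<epsilon>ac in \<open>auto simp: dl_def\<close>)
    also have "\<dots> = \<alpha> b \<otimes> (c \<odot> \<epsilon>a b)" by (rule finsum_singleton) (use fin_Sa \<alpha>c b \<epsilon>ac in auto)
    also have "\<dots> = c \<odot> \<alpha> b" using \<alpha>(3)[OF b] \<alpha>c[OF b] \<epsilon>ac[OF b] by (simp add: scal_mult_r)
    finally have "c \<odot> \<alpha> b = dA Sa \<alpha> (\<lambda>a. x a b) \<oplus> c \<odot> \<alpha> b" using c[OF b] by simp
    moreover have "dA Sa \<alpha> (\<lambda>a. x a b) \<in> carrier A"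
      using R.dot_closed[of Sa \<alpha> "\<lambda>a. x a b"] \<alpha>c xc[OF _ b] by simp
    ultimately show "(\<Oplus>a\<in>Sa. \<alpha> a \<otimes> x a b) = \<zero>" using \<alpha>c[OF b] by (simp add: dA_eq)
  qed
  then obtain H0 where H0: "\<And>b. b \<in> Sa \<Longrightarrow> (\<forall>r\<in>Sr. H0 b r \<in> carrier A \<and> \<epsilon>r r \<otimes> H0 b r = H0 b r) \<and>
      (\<forall>a\<in>Sa. x a b = (\<Oplus>r\<in>Sr. \<rho> a r \<otimes> H0 b r))" by metis
  define H where "H r b = H0 b r" for r b
  have H: "H r b \<in> carrier A" "\<epsilon>r r \<otimes> H r b = H r b" if "r \<in> Sr" "b \<in> Sa" for r b
    using H0 that by (simp_all add: H_def)
  have Hx: "x a b = dA Sr (\<rho> a) (\<lambda>r. H r b)" if "a \<in> Sa" "b \<in> Sa" for a b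
    using H0 that by (simp add: H_def dA_eq)
  define dr where "dr r s = (if s = r then c \<odot> \<epsilon>r r else \<zero>)" for r s
  have drc: "dr r s \<in> carrier A" if "r \<in> Sr" "s \<in> Sr" for r s using that \<epsilon>rc by (simp add: dr_def)
  define K where "K r s = dA Sa (H r) (\<lambda>b. \<rho> b s)" for r s
  have Kc: "K r s \<in> carrier A" if "r \<in> Sr" "s \<in> Sr" for r s
    unfolding K_def using R.dot_closed[of Sa "H r" "\<lambda>b. \<rho> b s"] H(1) \<rho>c that by simp
  \<comment> \<open>The candidate c + H \<rho> for \<Phi>. Both have the same product with \<rho>
    from the left, and by \<open>\<rho>_injective\<close> this factor can be cancelled.\<close>
  define W where "W r s = dr r s \<oplus> K r s" for r s
  have Wc: "W r s \<in> carrier A" if "r \<in> Sr" "s \<in> Sr" for r s using drc[OF that] Kc[OF that] by (simp add: W_def)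
  have FW: "Fm r s = W r s" if r: "r \<in> Sr" and s: "s \<in> Sr" for r s
  proof -
    have "Fm r s \<ominus> W r s = \<zero>"
    proof (rule \<rho>_injective[OF inj2, of "\<lambda>r. Fm r s \<ominus> W r s"])
      fix r assume r: "r \<in> Sr"
      show "Fm r s \<ominus> W r s \<in> carrier A" using Fm(1)[OF r s] Wc[OF r s] by simp
      have "\<epsilon>r r \<otimes> K r s = K r s"
      proof -
        have "\<epsilon>r r \<otimes> K r s = dA Sa (\<lambda>b. \<epsilon>r r \<otimes> H r b) (\<lambda>b. \<rho> b s)"
          unfolding K_def using R.dot_smult[OF fin_Sa, of "\<epsilon>r r" "H r" "\<lambda>b. \<rho> b s"] \<epsilon>rc[OF r] H(1)[OF r] \<rho>c[OF _ s] by simp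
        also have "\<dots> = K r s" unfolding K_def by (rule R.dot_cong) (use H[OF r] \<rho>c[OF _ s] in simp_all)
        finally show ?thesis .
      qed
      moreover have "\<epsilon>r r \<otimes> dr r s = dr r s" using \<epsilon>rc[OF r] idemD(2)[OF idem_r r] by (simp add: dr_def scal_mult_r)
      ultimately show "\<epsilon>r r \<otimes> (Fm r s \<ominus> W r s) = Fm r s \<ominus> W r s"
        using R.smult_diff_r[of "\<epsilon>r r" "Fm r s" "W r s"] Fm(1,3)[OF r s] Wc[OF r s] \<epsilon>rc[OF r] drc[OF r s] Kc[OF r s]
        by (simp add: W_def r_distr)
    next
      fix a assume a: "a \<in> Sa"
      have "rF a s = dA Sr (\<rho> a) (\<lambda>r. (Fm r s \<ominus> W r s) \<oplus>\<^bsub>reg_mod A\<^esub> W r s)"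
        unfolding rF_def
      proof (rule R.dot_cong)
        fix r assume r: "r \<in> Sr"
        show "Fm r s = (Fm r s \<ominus> W r s) \<oplus>\<^bsub>reg_mod A\<^esub> W r s"
          using R.M_diff_add[of "Fm r s" "W r s"] Fm(1)[OF r s] Wc[OF r s] by simp
      qed (use \<rho>c[OF a] Fm(1)[OF _ s] Wc[OF _ s] in simp_all)
      also have "\<dots> = dA Sr (\<rho> a) (\<lambda>r. Fm r s \<ominus> W r s) \<oplus> dA Sr (\<rho> a) (\<lambda>r. W r s)"
        using R.dot_add_r[of Sr "\<rho> a" "\<lambda>r. Fm r s \<ominus> W r s" "\<lambda>r. W r s"] \<rho>c[OF a] Fm(1)[OF _ s] Wc[OF _ s] by simp
      finally have e1: "rF a s = dA Sr (\<rho> a) (\<lambda>r. Fm r s \<ominus> W r s) \<oplus> dA Sr (\<rho> a) (\<lambda>r. W r s)" .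
      have "dA Sr (\<rho> a) (\<lambda>r. W r s) = dA Sr (\<rho> a) (\<lambda>r. dr r s) \<oplus> dA Sr (\<rho> a) (\<lambda>r. K r s)"
        unfolding W_def using R.dot_add_r[of Sr "\<rho> a" "\<lambda>r. dr r s" "\<lambda>r. K r s"] \<rho>c[OF a] drc[OF _ s] Kc[OF _ s] by simp
      also have "dA Sr (\<rho> a) (\<lambda>r. dr r s) = (\<Oplus>r\<in>Sr. if s = r then \<rho> a r \<otimes> (c \<odot> \<epsilon>r r) else \<zero>)"
        unfolding dA_eq by (rule finsum_cong') (use \<rho>c[OF a] \<epsilon>rc in \<open>auto simp: dr_def\<close>)
      also have "\<dots> = \<rho> a s \<otimes> (c \<odot> \<epsilon>r s)" by (rule finsum_singleton) (use fin_Sr \<rho>c[OF a] s \<epsilon>rc in auto)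
      also have "\<dots> = c \<odot> \<rho> a s" using \<rho>(3)[OF a s] \<rho>c[OF a s] \<epsilon>rc[OF s] by (simp add: scal_mult_r)
      also have "dA Sr (\<rho> a) (\<lambda>r. K r s) = dA Sa (\<lambda>b. dA Sr (\<rho> a) (\<lambda>r. H r b)) (\<lambda>b. \<rho> b s)"
        unfolding K_def by (rule R.dot_assoc[OF fin_Sa fin_Sr, symmetric]) (use \<rho>c[OF a] \<rho>c[OF _ s] H(1) in simp_all)
      also have "\<dots> = dA Sa (x a) (\<lambda>b. \<rho> b s)"
        by (rule R.dot_cong) (use Hx[OF a] xc[OF a] \<rho>c[OF _ s] in simp_all)
      finally have e2: "dA Sr (\<rho> a) (\<lambda>r. W r s) = c \<odot> \<rho> a s \<oplus> dA Sa (x a) (\<lambda>b. \<rho> b s)" .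
      have "rF a s = dA Sa (\<lambda>b. x a b \<oplus> dl a b) (\<lambda>b. \<rho> b s)"
        unfolding G(4)[OF a s] by (rule R.dot_cong) (use Gx[OF a] xc[OF a] dlc[OF a] \<rho>c[OF _ s] in simp_all)
      also have "\<dots> = dA Sa (x a) (\<lambda>b. \<rho> b s) \<oplus> dA Sa (dl a) (\<lambda>b. \<rho> b s)"
        using R.dot_add_l[of Sa "x a" "dl a" "\<lambda>b. \<rho> b s"] xc[OF a] dlc[OF a] \<rho>c[OF _ s] by simp
      also have "dA Sa (dl a) (\<lambda>b. \<rho> b s) = (\<Oplus>b\<in>Sa. if a = b then (c \<odot> \<epsilon>a b) \<otimes> \<rho> b s else \<zero>)"
        unfolding dA_eq by (rule finsum_cong') (use \<rho>c[OF _ s] a \<epsilon>ac in \<open>auto simp: dl_def\<close>)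
      also have "\<dots> = (c \<odot> \<epsilon>a a) \<otimes> \<rho> a s" by (rule finsum_singleton) (use fin_Sa \<rho>c[OF _ s] a \<epsilon>ac in auto)
      also have "\<dots> = c \<odot> \<rho> a s" using \<rho>(2)[OF a s] \<rho>c[OF a s] \<epsilon>ac[OF a] by (simp add: scal_mult_l)
      finally have e3: "rF a s = dA Sr (\<rho> a) (\<lambda>r. W r s)"
        unfolding e2 using R.dot_closed[of Sa "x a" "\<lambda>b. \<rho> b s"] xc[OF a] \<rho>c[OF _ s] a s by (simp add: a_comm)
      have "dA Sr (\<rho> a) (\<lambda>r. Fm r s \<ominus> W r s) \<in> carrier A"
        using R.dot_closed[of Sr "\<rho> a" "\<lambda>r. Fm r s \<ominus> W r s"] \<rho>c[OF a] Fm(1)[OF _ s] Wc[OF _ s] by simp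
      then have "dA Sr (\<rho> a) (\<lambda>r. Fm r s \<ominus> W r s) = \<zero>"
        using e1 rFc[OF a s] unfolding e3[symmetric] by simp
      then show "(\<Oplus>r\<in>Sr. \<rho> a r \<otimes> (Fm r s \<ominus> W r s)) = \<zero>" by (simp add: dA_eq)
    qed (rule r)
    then show ?thesis using R.M_eqI[of "Fm r s" "W r s"] Fm(1)[OF r s] Wc[OF r s] by simp
  qed
  \<comment> \<open>The part H \<rho> contributes nothing, since \<rho> annihilates the column g by
    \<open>T_rel0\<close>.\<close>
  have "F (g r) = ks A T c (g r)" if r: "r \<in> Sr" for r
  proof -
    have "F (g r) = dot T Sr (W r) g"
      unfolding Fm(4)[OF r] by (rule T.dot_cong) (use FW[OF r] Wc[OF r] g(1) in simp_all)
    also have "\<dots> = dot T Sr (dr r) g \<oplus>\<^bsub>T\<^esub> dot T Sr (K r) g"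
      unfolding W_def by (rule T.dot_add_l) (use drc[OF r] Kc[OF r] g(1) in simp_all)
    also have "dot T Sr (dr r) g = (c \<odot> \<epsilon>r r) \<odot>\<^bsub>T\<^esub> g r"
      unfolding dr_def by (rule T.dot_single[OF fin_Sr r]) (use \<epsilon>rc[OF r] g(1) in simp_all)
    also have "\<dots> = ks A T c (g r)" using T.ks_smult_l[OF \<epsilon>rc[OF r] g(1)[OF r]] g(2)[OF r] by simp
    also have "dot T Sr (K r) g = dot T Sa (H r) (\<lambda>b. dot T Sr (\<rho> b) g)"
      unfolding K_def by (rule T.dot_assoc[OF fin_Sr fin_Sa]) (use H(1)[OF r] \<rho>c g(1) in simp_all)
    also have "\<dots> = \<zero>\<^bsub>T\<^esub>" by (rule T.dot_zero_r) (use T_rel0 H(1)[OF r] in simp_all)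
    finally show ?thesis using g(1)[OF r] by simp
  qed
  then show ?thesis by blast
qed

text \<open>The element t - (pr t) p has no component in P', so it is a combination of the
  \<open>g r\<close>, on which F is multiplication by c; on (pr t) p the map F is determined by F
  p.\<close>

lemma End_form:
  assumes F: "lin A T T F"
  shows "\<exists>c. \<forall>t\<in>carrier T. F t = ks A T c t \<oplus>\<^bsub>T\<^esub> pr t \<odot>\<^bsub>T\<^esub> (F p \<ominus>\<^bsub>T\<^esub> ks A T c p)"
proof -
  obtain c where c: "\<And>r. r \<in> Sr \<Longrightarrow> F (g r) = ks A T c (g r)" using End_scalar[OF F] by blast
  have "F t = ks A T c t \<oplus>\<^bsub>T\<^esub> pr t \<odot>\<^bsub>T\<^esub> (F p \<ominus>\<^bsub>T\<^esub> ks A T c p)" if t: "t \<in> carrier T" for t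
  proof -
    note P = prc[OF t] p(1)
    have pp: "pr t \<odot>\<^bsub>T\<^esub> p \<in> carrier T" using P by simp
    let ?u = "t \<ominus>\<^bsub>T\<^esub> pr t \<odot>\<^bsub>T\<^esub> p"
    have u: "?u \<in> carrier T" using t pp by simp
    have "pr ?u = pr t \<ominus> pr t \<otimes> pr p"
      using lin_diff[OF kT reg_kmod pr(1) t pp] linD(3)[OF pr(1) P] by simp
    also have "\<dots> = \<zero>" using pr(2) pr(4)[OF t] P(1) by (simp add: minus_eq r_neg)
    finally obtain l where l: "l \<in> carrier (fam A Sr \<epsilon>r)" "?u = dot T Sr l g" using T_span[OF u] by blast
    have lc: "l s \<in> carrier A" if "s \<in> Sr" for s using l(1) that by auto
    have "F ?u = dot T Sr l (\<lambda>r. F (g r))" unfolding l(2) by (rule lin_dot[OF kT kT F fin_Sr]) (use lc g(1) in simp_all)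
    also have "\<dots> = dot T Sr l (\<lambda>r. ks A T c (g r))" by (rule T.dot_cong) (use c lc g(1) in simp_all)
    also have "\<dots> = ks A T c ?u" unfolding l(2) by (rule T.dot_ks(1)[OF fin_Sr]) (use lc g(1) in simp_all)
    finally have Fu: "F ?u = ks A T c ?u" .
    have "t = ?u \<oplus>\<^bsub>T\<^esub> pr t \<odot>\<^bsub>T\<^esub> p" using T.M_diff_add[OF t pp] by simp
    then have "F t = F ?u \<oplus>\<^bsub>T\<^esub> pr t \<odot>\<^bsub>T\<^esub> F p" using linD(2)[OF F u pp] linD(3)[OF F P] by simp
    also have "F ?u = ks A T c t \<ominus>\<^bsub>T\<^esub> pr t \<odot>\<^bsub>T\<^esub> ks A T c p"
      unfolding Fu using t pp P by (simp add: T.M.minus_eq T.ks_r_distr T.ks_minus_r T.ks_smult_r)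
    finally show ?thesis
      using t P linD(1)[OF F p(1)] by (simp add: T.M.minus_eq T.smult_r_distr T.smult_minus_r T.M.a_ac)
  qed
  then show ?thesis by blast
qed

text \<open>Otherwise the unit row at r would be a relation, so \<open>\<epsilon>r r\<close> would
  be a combination of entries of \<rho> and lie in \<open>N 1\<close>.\<close>

lemma g_nonzero: "r \<in> Sr \<Longrightarrow> g r \<noteq> \<zero>\<^bsub>T\<^esub>"
proof
  assume r: "r \<in> Sr" and 0: "g r = \<zero>\<^bsub>T\<^esub>"
  have uQ: "fam_unit A Sr \<epsilon>r r \<in> carrier (fam A Sr \<epsilon>r)" by (rule fam_unit_closed[OF idem_r r])
  have "dot T Sr (fam_unit A Sr \<epsilon>r r) g = dot T Sr (\<lambda>t. if t = r then \<epsilon>r r else \<zero>) g"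
    by (rule T.dot_cong) (use g(1) \<epsilon>rc[OF r] in \<open>auto simp: fam_unit_def\<close>)
  also have "\<dots> = \<epsilon>r r \<odot>\<^bsub>T\<^esub> g r" by (rule T.dot_single[OF fin_Sr r]) (use \<epsilon>rc[OF r] g(1) in simp_all)
  also have "\<dots> = \<zero>\<^bsub>T\<^esub>" using 0 \<epsilon>rc[OF r] by simp
  finally obtain y where y: "y \<in> carrier (fam A Sa \<epsilon>a)" "\<forall>s\<in>Sr. fam_unit A Sr \<epsilon>r r s = (\<Oplus>a\<in>Sa. y a \<otimes> \<rho> a s)"
    using T_rel[OF uQ] by blast
  have "\<epsilon>r r = (\<Oplus>a\<in>Sa. y a \<otimes> \<rho> a r)" using bspec[OF y(2) r] r by (simp add: fam_unit_def)
  also have "\<dots> \<in> N 1" using y(1) N_mult_l[OF _ \<rho>(1)] r by (intro N_finsum fin_Sa) auto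
  finally show False using \<epsilon>r_notin[OF r] by simp
qed

end

section \<open>The two summands of T\<close>

lemma mod_iso_inverse:
  assumes "kmod A M" "mod_iso A M N"
  obtains h h' where "lin A M N h" "lin A N M h'" "\<And>x. x \<in> carrier M \<Longrightarrow> h' (h x) = x"
    "\<And>y. y \<in> carrier N \<Longrightarrow> h (h' y) = y"
proof -
  interpret M: kmod A M by fact
  obtain h where "h \<in> mhom A M N" and b: "bij_betw h (carrier M) (carrier N)"
    using assms(2) by (auto simp: mod_iso_def)
  then have h: "lin A M N h" by (simp add: mhom_iff)
  let ?h = "inv_into (carrier M) h"
  have inv: "?h y \<in> carrier M" "h (?h y) = y" if "y \<in> carrier N" for y
    using b that by (auto simp: bij_betw_def inv_into_into f_inv_into_f)
  have inv': "?h (h x) = x" if "x \<in> carrier M" for x using b that by (simp add: bij_betw_def)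
  have "lin A N M ?h"
  proof (rule linI)
    fix x y assume xy: "x \<in> carrier N" "y \<in> carrier N"
    have "?h (x \<oplus>\<^bsub>N\<^esub> y) = ?h (h (?h x \<oplus>\<^bsub>M\<^esub> ?h y))" using linD(2)[OF h] inv xy by simp
    then show "?h (x \<oplus>\<^bsub>N\<^esub> y) = ?h x \<oplus>\<^bsub>M\<^esub> ?h y" using inv' inv(1) xy by simp
  next
    fix a x assume ax: "a \<in> carrier A" "x \<in> carrier N"
    have "?h (a \<odot>\<^bsub>N\<^esub> x) = ?h (h (a \<odot>\<^bsub>M\<^esub> ?h x))" using linD(3)[OF h] inv ax by simp
    then show "?h (a \<odot>\<^bsub>N\<^esub> x) = a \<odot>\<^bsub>M\<^esub> ?h x" using inv' inv(1) ax by simp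
  qed (use inv in simp)
  then show thesis using that h inv inv' by blast
qed

lemma dsum_simps [simp]:
  "carrier (dsum M N) = carrier M \<times> carrier N" "\<zero>\<^bsub>dsum M N\<^esub> = (\<zero>\<^bsub>M\<^esub>, \<zero>\<^bsub>N\<^esub>)"
  "(x, y) \<oplus>\<^bsub>dsum M N\<^esub> (x', y') = (x \<oplus>\<^bsub>M\<^esub> x', y \<oplus>\<^bsub>N\<^esub> y')"
  "a \<odot>\<^bsub>dsum M N\<^esub> (x, y) = (a \<odot>\<^bsub>M\<^esub> x, a \<odot>\<^bsub>N\<^esub> y)"
  by (simp_all add: dsum_def)

lemma dsum_lin:
  "lin A (dsum M N) M fst" "lin A (dsum M N) N snd"
  "kmod A M \<Longrightarrow> kmod A N \<Longrightarrow> lin A M (dsum M N) (\<lambda>x. (x, \<zero>\<^bsub>N\<^esub>))"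
  "kmod A M \<Longrightarrow> kmod A N \<Longrightarrow> lin A N (dsum M N) (\<lambda>y. (\<zero>\<^bsub>M\<^esub>, y))"
proof -
  show "lin A (dsum M N) M fst" "lin A (dsum M N) N snd" by (auto simp: lin_def)
  assume "kmod A M" "kmod A N"
  then interpret M: kmod A M + N: kmod A N .
  show "lin A M (dsum M N) (\<lambda>x. (x, \<zero>\<^bsub>N\<^esub>))" "lin A N (dsum M N) (\<lambda>y. (\<zero>\<^bsub>M\<^esub>, y))"
    by (auto simp: lin_def)
qed

context apr_mod
begin

text \<open>The complement P' is given only through some isomorphism h from A to the sum of P and
  P', and is identified with A (1 - ei) directly. The first component of h (1 - ei) is zero, because
  1 - ei kills P; its second component p' becomes the generator p, and \<open>in2\<close> embeds P'
  into A with image in A (1 - ei).\<close>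

lemma tilting_structure:
  assumes T: "is_2APR_module A P T" and apr: "gives_2APR A P"
  obtains g p pr where "apr_tilt A ei Sa Sr \<epsilon>a \<epsilon>r \<alpha> \<rho> N P \<pi> T g p pr"
proof -
  let ?f = "\<one> \<ominus> ei"
  have f: "?f \<in> carrier A" "?f \<otimes> ?f = ?f"
    using ei by (simp_all add: minus_eq l_distr r_distr l_minus r_minus a_ac r_neg)
  obtain P' X :: "('a, nat \<Rightarrow> 'k) module" where fT: "fdmod A T" and fP': "fdmod A P'"
    and iA: "mod_iso A (reg_mod A) (dsum P P')" and tau: "is_tau2_minus A P X" and iT: "mod_iso A T (dsum X P')"
    using T by (auto simp: is_2APR_module_def)
  have kT: "kmod A T" and kP': "kmod A P'" using fT fP' fdmod_kmod by blast+
  have kX: "kmod A X" using tau fdmod_kmod by (auto simp: is_tau2_minus_def is_transpose_def)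
  interpret T: kmod A T by (rule kT)
  interpret P': kmod A P' by (rule kP')
  interpret X: kmod A X by (rule kX)
  obtain h h' where h: "lin A (reg_mod A) (dsum P P') h" "lin A (dsum P P') (reg_mod A) h'"
    "\<And>x. x \<in> carrier A \<Longrightarrow> h' (h x) = x" "\<And>y. y \<in> carrier P \<times> carrier P' \<Longrightarrow> h (h' y) = y"
    using mod_iso_inverse[OF reg_kmod iA] by (metis dsum_simps(1) reg_mod_simps(1))
  obtain j j' where j: "lin A T (dsum X P') j" "lin A (dsum X P') T j'"
    "\<And>x. x \<in> carrier T \<Longrightarrow> j' (j x) = x" "\<And>y. y \<in> carrier X \<times> carrier P' \<Longrightarrow> j (j' y) = y"
    using mod_iso_inverse[OF kT iT] by (metis dsum_simps(1))
  define h1 where "h1 x = fst (h x)" for x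
  have h1: "lin A (reg_mod A) P h1" unfolding h1_def by (rule lin_comp[OF h(1) dsum_lin(1)])
  have h1a: "h1 a = a \<odot>\<^bsub>P\<^esub> h1 \<one>" if "a \<in> carrier A" for a using linD(3)[OF h1, of a \<one>] that by simp
  have h1c: "h1 x \<in> carrier P" if "x \<in> carrier A" for x using linD(1)[OF h1, of x] that by simp
  have f_kills: "?f \<odot>\<^bsub>P\<^esub> q = \<zero>\<^bsub>P\<^esub>" if q: "q \<in> carrier P" for q
  proof -
    have "ei \<odot>\<^bsub>P\<^esub> q = q" using P_span[OF q] \<pi> ei by (auto simp: P.ks_smult_r)
    then show ?thesis using P.smult_diff_l[of \<one> ei q] ei q by simp
  qed
  have h1f: "h1 ?f = \<zero>\<^bsub>P\<^esub>" using h1a[OF f(1)] f_kills[OF h1c] by simp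
  have one: "ei \<oplus> ?f = \<one>" using kmod.M_diff_add[OF reg_kmod, of \<one> ei] ei
    a_comm[OF ei(1) f(1)] by simp
  \<comment> \<open>Otherwise the first component of h would vanish at \<open>ei\<close> and at 1 -
    ei, hence everywhere, although h reaches \<pi>.\<close>
  have h1e: "h1 ei \<noteq> \<zero>\<^bsub>P\<^esub>"
  proof
    assume 0: "h1 ei = \<zero>\<^bsub>P\<^esub>"
    have "h1 \<one> = h1 ei \<oplus>\<^bsub>P\<^esub> h1 ?f" using linD(2)[OF h1, of ei ?f] ei f one by simp
    then have "h1 \<one> = \<zero>\<^bsub>P\<^esub>" using 0 h1f by simp
    moreover have "h' (\<pi>, \<zero>\<^bsub>P'\<^esub>) \<in> carrier A" using linD(1)[OF h(2), of "(\<pi>, \<zero>\<^bsub>P'\<^esub>)"] \<pi> by simp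
    ultimately have "h1 (h' (\<pi>, \<zero>\<^bsub>P'\<^esub>)) = \<zero>\<^bsub>P\<^esub>" using h1a[of "h' (\<pi>, \<zero>\<^bsub>P'\<^esub>)"] by simp
    then show False using h(4)[of "(\<pi>, \<zero>\<^bsub>P'\<^esub>)"] \<pi> by (simp add: h1_def)
  qed
  define p' where "p' = snd (h ?f)"
  have hf: "h ?f = (\<zero>\<^bsub>P\<^esub>, p')" using h1f by (simp add: p'_def h1_def prod_eq_iff)
  have p': "p' \<in> carrier P'" using linD(1)[OF h(1), of ?f] f hf by simp
  have fp': "?f \<odot>\<^bsub>P'\<^esub> p' = p'" using linD(3)[OF h(1), of ?f ?f] f hf by simp
  define in2 where "in2 y = h' (\<zero>\<^bsub>P\<^esub>, y)" for y
  have in2: "lin A P' (reg_mod A) in2" unfolding in2_def by (rule lin_comp[OF dsum_lin(4)[OF kP kP'] h(2)])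
  have in2p: "in2 p' = ?f" using h(3)[OF f(1)] hf by (simp add: in2_def)
  \<comment> \<open>The element \<open>in2 y\<close> has first component zero under h. Its part in A
    \<open>ei\<close> is a multiple of \<open>ei\<close>, whose first component is nonzero; so the
    factor is zero.\<close>
  have in2f: "in2 y \<otimes> ?f = in2 y" if y: "y \<in> carrier P'" for y
  proof -
    let ?l = "in2 y"
    have l: "?l \<in> carrier A" using linD(1)[OF in2 y] by simp
    have 0: "h1 ?l = \<zero>\<^bsub>P\<^esub>" using h(4)[of "(\<zero>\<^bsub>P\<^esub>, y)"] y by (simp add: h1_def in2_def)
    have lf: "?l = ?l \<otimes> ei \<oplus> ?l \<otimes> ?f" using l ei f one r_distr[of ei ?f ?l] by simp
    have "h1 ?l = h1 (?l \<otimes> ei) \<oplus>\<^bsub>P\<^esub> h1 (?l \<otimes> ?f)"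
      using linD(2)[OF h1, of "?l \<otimes> ei" "?l \<otimes> ?f"] l ei f lf by simp
    also have "h1 (?l \<otimes> ?f) = \<zero>\<^bsub>P\<^esub>" using linD(3)[OF h1, of ?l ?f] l f h1f by simp
    also have "h1 (?l \<otimes> ei) = ks A P (co ?l) (h1 ei)"
      using co[OF l] lin_ks[OF reg_kmod h1, of ei "co ?l"] ei by simp
    finally have "ks A P (co ?l) (h1 ei) = \<zero>\<^bsub>P\<^esub>" using 0 h1c[OF ei(1)] by simp
    then have "co ?l = 0" using P.ks_eq_zero[OF h1c[OF ei(1)]] h1e by blast
    then have "?l \<otimes> ei = \<zero>" using co[OF l] ei by simp
    then show ?thesis using lf l f by simp
  qed
  obtain gX where gX: "\<And>r. r \<in> Sr \<Longrightarrow> gX r \<in> carrier X" "\<And>r. r \<in> Sr \<Longrightarrow> \<epsilon>r r \<odot>\<^bsub>X\<^esub> gX r = gX r"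
    "\<And>x. x \<in> carrier X \<Longrightarrow> \<exists>l\<in>carrier (fam A Sr \<epsilon>r). x = dot X Sr l gX"
    "\<And>l. l \<in> carrier (fam A Sr \<epsilon>r) \<Longrightarrow> dot X Sr l gX = \<zero>\<^bsub>X\<^esub> \<Longrightarrow>
      \<exists>y\<in>carrier (fam A Sa \<epsilon>a). \<forall>r\<in>Sr. l r = (\<Oplus>a\<in>Sa. y a \<otimes> \<rho> a r)"
    "\<And>a. a \<in> Sa \<Longrightarrow> dot X Sr (\<rho> a) gX = \<zero>\<^bsub>X\<^esub>"
  proof (rule tau2_structure[OF tau])
  qed (rule that)
  define jX where "jX x = j' (x, \<zero>\<^bsub>P'\<^esub>)" for x
  have jX: "lin A X T jX" unfolding jX_def by (rule lin_comp[OF dsum_lin(3)[OF kX kP'] j(2)])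
  define g where "g r = jX (gX r)" for r
  define p where "p = j' (\<zero>\<^bsub>X\<^esub>, p')"
  define pr where "pr t = in2 (snd (j t))" for t
  have jjX: "j (jX x) = (x, \<zero>\<^bsub>P'\<^esub>)" if "x \<in> carrier X" for x using j(4)[of "(x, \<zero>\<^bsub>P'\<^esub>)"] that by (simp add: jX_def)
  have jp: "j p = (\<zero>\<^bsub>X\<^esub>, p')" using j(4)[of "(\<zero>\<^bsub>X\<^esub>, p')"] p' by (simp add: p_def)
  have jXinj: "x = \<zero>\<^bsub>X\<^esub>" if "x \<in> carrier X" "jX x = \<zero>\<^bsub>T\<^esub>" for x
    using jjX[OF that(1)] that(2) linD(3)[OF j(1), of \<zero> "\<zero>\<^bsub>T\<^esub>"] jjX[of "\<zero>\<^bsub>X\<^esub>"] lin_zero[OF kX kT jX] by simp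
  have in20: "in2 \<zero>\<^bsub>P'\<^esub> = \<zero>" using lin_zero[OF kP' reg_kmod in2] by simp
  have gdot: "dot T Sr l g = jX (dot X Sr l gX)" if "\<And>r. r \<in> Sr \<Longrightarrow> l r \<in> carrier A" for l
    unfolding g_def by (rule lin_dot[OF kX kT jX fin_Sr, symmetric]) (use that gX(1) in simp_all)
  have "apr_tilt A ei Sa Sr \<epsilon>a \<epsilon>r \<alpha> \<rho> N P \<pi> T g p pr"
  proof (intro apr_tilt.intro apr_tilt_axioms.intro)
    show "apr_mod A ei Sa Sr \<epsilon>a \<epsilon>r \<alpha> \<rho> N P \<pi>" ..
    show "kmod A T" by (rule kT)
    show "inj_dim A P = 2" "Ext_zero A 1 (D_reg A) P" using apr by (simp_all add: gives_2APR_def)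
    show "Sr \<noteq> {}" by (rule Sr_nonempty[OF apr])
    show "g r \<in> carrier T" if "r \<in> Sr" for r unfolding g_def by (rule linD(1)[OF jX gX(1)[OF that]])
    show "\<epsilon>r r \<odot>\<^bsub>T\<^esub> g r = g r" if "r \<in> Sr" for r
      unfolding g_def using linD(3)[OF jX \<epsilon>rc[OF that] gX(1)[OF that]] gX(2)[OF that] by simp
    show "p \<in> carrier T" using linD(1)[OF j(2), of "(\<zero>\<^bsub>X\<^esub>, p')"] p' by (simp add: p_def)
    show "?f \<odot>\<^bsub>T\<^esub> p = p" using linD(3)[OF j(2) f(1), of "(\<zero>\<^bsub>X\<^esub>, p')"] p' fp' f by (simp add: p_def)
    show "lin A T (reg_mod A) pr" unfolding pr_def by (rule lin_comp[OF lin_comp[OF j(1) dsum_lin(2)] in2])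
    show "pr p = ?f" using jp in2p by (simp add: pr_def)
    show "pr (g r) = \<zero>" if "r \<in> Sr" for r using jjX[OF gX(1)[OF that]] in20 by (simp add: pr_def g_def)
    show "pr t \<otimes> ?f = pr t" if "t \<in> carrier T" for t
      unfolding pr_def by (rule in2f) (use linD(1)[OF j(1) that] in auto)
    show "\<exists>l\<in>carrier (fam A Sr \<epsilon>r). t = dot T Sr l g" if t: "t \<in> carrier T" "pr t = \<zero>" for t
    proof -
      obtain x y where xy: "j t = (x, y)" "x \<in> carrier X" "y \<in> carrier P'" using linD(1)[OF j(1) t(1)] by auto
      have "h' (\<zero>\<^bsub>P\<^esub>, y) = \<zero>" using t(2) xy by (simp add: pr_def in2_def)
      then have "(\<zero>\<^bsub>P\<^esub>, y) = h \<zero>" using h(4)[of "(\<zero>\<^bsub>P\<^esub>, y)"] xy by simp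
      moreover have "h \<zero> = (\<zero>\<^bsub>P\<^esub>, \<zero>\<^bsub>P'\<^esub>)" using h(4)[of "(\<zero>\<^bsub>P\<^esub>, \<zero>\<^bsub>P'\<^esub>)"] in20 by (simp add: in2_def)
      ultimately have "y = \<zero>\<^bsub>P'\<^esub>" by simp
      then have tx: "t = jX x" using j(3)[OF t(1)] xy(1) by (simp add: jX_def)
      obtain l where l: "l \<in> carrier (fam A Sr \<epsilon>r)" "x = dot X Sr l gX" using gX(3)[OF xy(2)] by blast
      have "t = dot T Sr l g" unfolding tx l(2) by (rule gdot[symmetric]) (use l(1) in auto)
      then show ?thesis using l(1) by blast
    qed
    show "\<exists>y\<in>carrier (fam A Sa \<epsilon>a). \<forall>r\<in>Sr. l r = (\<Oplus>a\<in>Sa. y a \<otimes> \<rho> a r)"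
      if l: "l \<in> carrier (fam A Sr \<epsilon>r)" "dot T Sr l g = \<zero>\<^bsub>T\<^esub>" for l
    proof (rule gX(4)[OF l(1)])
      have lc: "l r \<in> carrier A" if "r \<in> Sr" for r using l(1) that by auto
      show "dot X Sr l gX = \<zero>\<^bsub>X\<^esub>"
        by (rule jXinj) (use gdot[of l] lc l(2) gX(1) in \<open>auto intro: X.dot_closed\<close>)
    qed
    show "dot T Sr (\<rho> a) g = \<zero>\<^bsub>T\<^esub>" if a: "a \<in> Sa" for a
      using gdot[of "\<rho> a"] \<rho>c[OF a] gX(5)[OF a] lin_zero[OF kX kT jX] by simp
  qed
  then show thesis by (rule that)
qed

end

section \<open>Endomorphisms of T as pairs of a scalar and an element\<close>

context apr_tilt
begin

text \<open>The endomorphism that is multiplication by \<open>c\<close> on \<open>\<tau>\<^sub>2\<^sup>-P\<close> and maps \<open>p\<close> to \<open>q\<close>.\<close>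

definition Phi :: "'k \<Rightarrow> 't \<Rightarrow> 't \<Rightarrow> 't" where
  "Phi c q = (\<lambda>t\<in>carrier T. ks A T c t \<oplus>\<^bsub>T\<^esub> pr t \<odot>\<^bsub>T\<^esub> (q \<ominus>\<^bsub>T\<^esub> ks A T c p))"

lemma Phi_val: "t \<in> carrier T \<Longrightarrow> Phi c q t = ks A T c t \<oplus>\<^bsub>T\<^esub> pr t \<odot>\<^bsub>T\<^esub> (q \<ominus>\<^bsub>T\<^esub> ks A T c p)"
  by (simp add: Phi_def)

lemma Phi_lin: assumes q: "q \<in> carrier T" shows "lin A T T (Phi c q)"
proof (rule linI)
  let ?d = "q \<ominus>\<^bsub>T\<^esub> ks A T c p"
  have d: "?d \<in> carrier T" using q p by simp
  show "Phi c q t \<in> carrier T" if "t \<in> carrier T" for t using that d prc by (simp add: Phi_val)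
  show "Phi c q (t \<oplus>\<^bsub>T\<^esub> t') = Phi c q t \<oplus>\<^bsub>T\<^esub> Phi c q t'" if t: "t \<in> carrier T" "t' \<in> carrier T" for t t'
  proof -
    have "pr (t \<oplus>\<^bsub>T\<^esub> t') = pr t \<oplus> pr t'" using linD(2)[OF pr(1) t] by simp
    then show ?thesis using t d prc[OF t(1)] prc[OF t(2)]
      by (simp add: Phi_val T.ks_r_distr T.smult_l_distr T.M.a_ac del: T.M.minus_closed)
  qed
  show "Phi c q (a \<odot>\<^bsub>T\<^esub> t) = a \<odot>\<^bsub>T\<^esub> Phi c q t" if a: "a \<in> carrier A" "t \<in> carrier T" for a t
  proof -
    have "pr (a \<odot>\<^bsub>T\<^esub> t) = a \<otimes> pr t" using linD(3)[OF pr(1) a] by simp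
    then show ?thesis using a d prc[OF a(2)]
      by (simp add: Phi_val T.ks_smult_r T.smult_r_distr T.smult_assoc)
  qed
qed

lemma Phi_mhom: "q \<in> carrier T \<Longrightarrow> Phi c q \<in> mhom A T T"
  using Phi_lin by (simp add: mhom_iff Phi_def)

lemma Phi_g: "q \<in> carrier T \<Longrightarrow> r \<in> Sr \<Longrightarrow> Phi c q (g r) = ks A T c (g r)"
  using g p pr(3) by (simp add: Phi_val)

lemma Phi_p: assumes "q \<in> carrier T" "f \<odot>\<^bsub>T\<^esub> q = q" shows "Phi c q p = q"
proof -
  have k: "ks A T c p \<in> carrier T" using p by simp
  have "f \<odot>\<^bsub>T\<^esub> (q \<ominus>\<^bsub>T\<^esub> ks A T c p) = q \<ominus>\<^bsub>T\<^esub> ks A T c p"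
    using T.smult_diff_r[OF f(1) assms(1) k] assms(2) p f by (simp add: T.ks_smult_r)
  then have "Phi c q p = ks A T c p \<oplus>\<^bsub>T\<^esub> (q \<ominus>\<^bsub>T\<^esub> ks A T c p)" using p pr(2) by (simp add: Phi_val)
  also have "\<dots> = q" using T.M_diff_add[OF assms(1) k] assms(1) k by (simp add: T.M.a_comm)
  finally show ?thesis .
qed

text \<open>The element q is the image of p, and c can be read off at any of the nonzero elements
  \<open>g r\<close>; here the existence of a relation starting in i is used.\<close>

lemma Phi_inj:
  assumes q: "q \<in> carrier T" "f \<odot>\<^bsub>T\<^esub> q = q" "q' \<in> carrier T" "f \<odot>\<^bsub>T\<^esub> q' = q'" and eq: "Phi c q = Phi c' q'"
  shows "c = c'" "q = q'"
proof -
  show "q = q'" using Phi_p[OF q(1,2), of c] Phi_p[OF q(3,4), of c'] eq by simp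
  obtain r where r: "r \<in> Sr" using Sr_ne by blast
  have "ks A T c (g r) = ks A T c' (g r)" using Phi_g[OF q(1) r, of c] Phi_g[OF q(3) r, of c'] eq by simp
  then have "ks A T (c - c') (g r) = \<zero>\<^bsub>T\<^esub>" using T.ks_diff_l[OF g(1)[OF r], of c c'] g(1)[OF r] by simp
  then show "c = c'" using T.ks_eq_zero[of "g r" "c - c'"] g(1)[OF r] g_nonzero[OF r] by auto
qed

lemma Phi_surj:
  assumes "F \<in> mhom A T T"
  obtains c q where "q \<in> carrier T" "f \<odot>\<^bsub>T\<^esub> q = q" "F = Phi c q"
proof -
  have F: "lin A T T F" "F \<in> extensional (carrier T)" using assms by (auto simp: mhom_iff)
  obtain c where c: "\<And>t. t \<in> carrier T \<Longrightarrow> F t = ks A T c t \<oplus>\<^bsub>T\<^esub> pr t \<odot>\<^bsub>T\<^esub> (F p \<ominus>\<^bsub>T\<^esub> ks A T c p)"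
    using End_form[OF F(1)] by blast
  have "F = Phi c (F p)" using F(2) c by (intro extensionalityI[of _ "carrier T"]) (auto simp: Phi_def)
  moreover have "f \<odot>\<^bsub>T\<^esub> F p = F p" using linD(3)[OF F(1) f(1) p(1)] p(2) by simp
  ultimately show thesis using that linD(1)[OF F(1) p(1)] by blast
qed

lemma Phi_add:
  assumes q: "q \<in> carrier T" "q' \<in> carrier T" and t: "t \<in> carrier T"
  shows "Phi (c + c') (q \<oplus>\<^bsub>T\<^esub> q') t = Phi c q t \<oplus>\<^bsub>T\<^esub> Phi c' q' t"
  using q t p prc[OF t]
  by (simp add: Phi_val T.ks_l_distr T.M.minus_eq T.smult_r_distr T.M.minus_add T.M.a_ac)

lemma Phi_scal:
  assumes q: "q \<in> carrier T" and t: "t \<in> carrier T"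
  shows "Phi (e * c) (ks A T e q) t = ks A T e (Phi c q t)"
  using q t p prc[OF t]
  by (simp add: Phi_val T.ks_assoc T.M.minus_eq T.ks_r_distr T.ks_minus_r T.ks_smult_r T.smult_r_distr T.smult_minus_r)

text \<open>The element q splits into o' p and q - o' p. The latter is killed by \<open>pr\<close>,
  so the second endomorphism multiplies it by c', while p goes to q'. The product formula
  \<open>qv_mult\<close> has the same shape.\<close>

lemma Phi_comp:
  assumes q: "q \<in> carrier T" "q' \<in> carrier T" and o: "pr q = o'" and t: "t \<in> carrier T"
  shows "Phi c' q' (Phi c q t) = Phi (c * c') (ks A T c' (q \<ominus>\<^bsub>T\<^esub> o' \<odot>\<^bsub>T\<^esub> p) \<oplus>\<^bsub>T\<^esub> o' \<odot>\<^bsub>T\<^esub> q') t"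
proof -
  let ?d = "q \<ominus>\<^bsub>T\<^esub> ks A T c p" and ?d' = "q' \<ominus>\<^bsub>T\<^esub> ks A T c' p"
  have oc: "o' \<in> carrier A" using prc[OF q(1)] o by simp
  have d: "?d \<in> carrier T" "?d' \<in> carrier T" using q p by simp_all
  note P = prc[OF t]
  have u: "Phi c q t \<in> carrier T" using linD(1)[OF Phi_lin[OF q(1)] t] .
  have kp: "ks A T c p \<in> carrier T" using p by simp
  have "pr ?d = o' \<ominus> c \<odot> f"
    using lin_diff[OF kT reg_kmod pr(1) q(1) kp] lin_ks[OF kT pr(1) p(1), of c] pr(2) o f by simp
  then have "pr (Phi c q t) = c \<odot> pr t \<oplus> pr t \<otimes> (o' \<ominus> c \<odot> f)"
    using linD(2)[OF pr(1) T.ks_closed[OF t] T.smult_closed[OF P d(1)]] linD(3)[OF pr(1) P d(1)]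
      lin_ks[OF kT pr(1) t, of c] P t by (simp add: Phi_val)
  also have "pr t \<otimes> (o' \<ominus> c \<odot> f) = pr t \<otimes> o' \<ominus> c \<odot> pr t"
    using P oc f pr(4)[OF t] by (simp add: minus_eq r_distr r_minus scal_mult_r)
  also have "c \<odot> pr t \<oplus> (pr t \<otimes> o' \<ominus> c \<odot> pr t) = pr t \<otimes> o'"
    using P oc by (simp add: minus_eq a_lcomm[of "c \<odot> pr t"] r_neg)
  finally have pe: "pr (Phi c q t) = pr t \<otimes> o'" .
  have "Phi c' q' (Phi c q t) = ks A T c' (ks A T c t \<oplus>\<^bsub>T\<^esub> pr t \<odot>\<^bsub>T\<^esub> ?d) \<oplus>\<^bsub>T\<^esub> pr t \<odot>\<^bsub>T\<^esub> (o' \<odot>\<^bsub>T\<^esub> ?d')"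
    using u pe P oc d t by (simp add: Phi_val T.smult_assoc)
  also have "\<dots> = ks A T (c * c') t \<oplus>\<^bsub>T\<^esub> pr t \<odot>\<^bsub>T\<^esub> (ks A T c' ?d \<oplus>\<^bsub>T\<^esub> o' \<odot>\<^bsub>T\<^esub> ?d')"
    using P oc d t by (simp add: T.ks_r_distr T.ks_assoc[symmetric] mult.commute T.ks_smult_r T.smult_r_distr T.M.a_assoc
        del: T.M.minus_closed)
  also have "ks A T c' ?d \<oplus>\<^bsub>T\<^esub> o' \<odot>\<^bsub>T\<^esub> ?d' =
      (ks A T c' (q \<ominus>\<^bsub>T\<^esub> o' \<odot>\<^bsub>T\<^esub> p) \<oplus>\<^bsub>T\<^esub> o' \<odot>\<^bsub>T\<^esub> q') \<ominus>\<^bsub>T\<^esub> ks A T (c * c') p"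
    using q oc p by (simp add: T.M.minus_eq T.ks_r_distr T.ks_minus_r T.smult_r_distr T.smult_minus_r T.ks_smult_r
        T.ks_assoc[symmetric] mult.commute T.M.a_ac)
  finally show ?thesis using t by (simp add: Phi_val)
qed

end

subsection \<open>Path algebras\<close>

lemma path_end_append: "path_end Q (path_end Q (v, as), bs) = path_end Q (v, as @ bs)"
  by simp

lemma path_end_Cons: "path_end Q (v, a # as) = path_end Q (tgt Q a, as)"
  by simp

lemma is_path_append:
  "is_path Q (v, as @ bs) \<longleftrightarrow> is_path Q (v, as) \<and> is_path Q (path_end Q (v, as), bs)"
proof (induction as arbitrary: v)
  case Nil
  have "is_path Q (v, bs) \<Longrightarrow> v \<in> verts Q" by (cases bs) auto
  then show ?case by auto
next
  case (Cons a as)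
  have "is_path Q (v, a # as @ bs) \<longleftrightarrow> v \<in> verts Q \<and> a \<in> arrows Q \<and> src Q a = v \<and> is_path Q (tgt Q a, as @ bs)"
    by simp
  also have "\<dots> \<longleftrightarrow> is_path Q (v, a # as) \<and> is_path Q (path_end Q (v, a # as), bs)"
    unfolding Cons.IH path_end_Cons by auto
  finally show ?case by simp
qed

lemma is_path_src: "is_path Q (v, as) \<Longrightarrow> v \<in> verts Q"
  by (cases as) auto

lemma is_path_end: "finite_quiver Q \<Longrightarrow> is_path Q (v, as) \<Longrightarrow> path_end Q (v, as) \<in> verts Q"
proof (induction as arbitrary: v)
  case Nil then show ?case by simp
next
  case (Cons a as)
  then show ?case unfolding path_end_Cons by simp
qed

lemma pa_simps [simp]:
  "x \<in> carrier (path_algebra Q) \<longleftrightarrow> finite {p. x p \<noteq> 0} \<and> (\<forall>p. x p \<noteq> 0 \<longrightarrow> is_path Q p)"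
  "\<zero>\<^bsub>path_algebra Q\<^esub> = (\<lambda>_. 0)"
  "x \<oplus>\<^bsub>path_algebra Q\<^esub> y = (\<lambda>p. x p + y p)"
  "c \<odot>\<^bsub>path_algebra Q\<^esub> x = (\<lambda>p. c * x p)"
  by (simp_all add: path_algebra_def)

lemma pa_mult:
  "(x \<otimes>\<^bsub>path_algebra Q\<^esub> y) (v, as) =
    (\<Sum>n\<le>length as. x (v, take n as) * y (path_end Q (v, take n as), drop n as))"
  by (simp add: path_algebra_def)

text \<open>The sum of the trivial paths at the vertices in S. One notation covers the unit, the
  idempotents at single vertices and 1 - ei.\<close>

definition vx :: "'v set \<Rightarrow> ('v, 'e) path \<Rightarrow> 'k::field" where
  "vx S = (\<lambda>(v, as). if v \<in> S \<and> as = [] then 1 else 0)"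

lemma pa_one: "\<one>\<^bsub>path_algebra Q\<^esub> = vx (verts Q)"
  by (simp add: path_algebra_def vx_def)

lemma vx_single: "path_elt (u, []) = vx {u}"
  by (auto simp: path_elt_def vx_def)

lemma vx_mult_l: "(vx S \<otimes>\<^bsub>path_algebra Q\<^esub> x) (v, as) = (if v \<in> S then x (v, as) else 0)"
proof -
  have "(vx S \<otimes>\<^bsub>path_algebra Q\<^esub> x) (v, as) =
      (\<Sum>n\<le>length as. if n = 0 then (if v \<in> S then x (v, as) else 0) else 0)"
    unfolding pa_mult by (rule sum.cong) (auto simp: vx_def)
  then show ?thesis by simp
qed

lemma vx_mult_r: "(x \<otimes>\<^bsub>path_algebra Q\<^esub> vx S) (v, as) = (if path_end Q (v, as) \<in> S then x (v, as) else 0)"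
proof -
  have "(x \<otimes>\<^bsub>path_algebra Q\<^esub> vx S) (v, as) =
      (\<Sum>n\<le>length as. if n = length as then (if path_end Q (v, as) \<in> S then x (v, as) else 0) else 0)"
    unfolding pa_mult by (rule sum.cong) (auto simp: vx_def)
  then show ?thesis by simp
qed

text \<open>Both sides sum over all ways to cut a path at two places. On the left the second cut is
  summed over first, on the right the first one; the reindexing passes from two positions to the
  first position and the distance.\<close>

lemma pa_assoc:
  "(x \<otimes>\<^bsub>path_algebra Q\<^esub> y) \<otimes>\<^bsub>path_algebra Q\<^esub> z = x \<otimes>\<^bsub>path_algebra Q\<^esub> (y \<otimes>\<^bsub>path_algebra Q\<^esub> z)"
proof
  fix p :: "'a \<times> 'b list"
  obtain v as where p: "p = (v, as)" by (cases p)
  let ?L = "length as"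
  \<comment> \<open>The contribution of the cuts after m and after n arrows, for m \<le> n.\<close>
  define F where "F m n = x (v, take m as) * y (path_end Q (v, take m as), take (n - m) (drop m as)) *
      z (path_end Q (v, take n as), drop n as)" for m n
  have "((x \<otimes>\<^bsub>path_algebra Q\<^esub> y) \<otimes>\<^bsub>path_algebra Q\<^esub> z) (v, as) = (\<Sum>n\<le>?L. \<Sum>m\<le>n. F m n)"
    unfolding pa_mult sum_distrib_right
    by (intro sum.cong refl) (auto simp: F_def min_def drop_take)
  also have "\<dots> = (\<Sum>(n, m)\<in>(SIGMA n:{..?L}. {..n}). F m n)" by (rule sum.Sigma) auto
  also have "\<dots> = (\<Sum>(m, l)\<in>(SIGMA m:{..?L}. {..?L - m}). F m (m + l))"
    by (rule sum.reindex_bij_witness[where i = "\<lambda>(m, l). (m + l, m)" and j = "\<lambda>(n, m). (m, n - m)"]) auto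
  also have "\<dots> = (\<Sum>m\<le>?L. \<Sum>l\<le>?L - m. F m (m + l))" by (rule sum.Sigma[symmetric]) auto
  also have "\<dots> = (x \<otimes>\<^bsub>path_algebra Q\<^esub> (y \<otimes>\<^bsub>path_algebra Q\<^esub> z)) (v, as)"
    unfolding pa_mult sum_distrib_left
  proof (rule sum.cong[OF refl])
    fix m assume "m \<in> {..?L}"
    show "(\<Sum>l\<le>?L - m. F m (m + l)) = (\<Sum>n\<le>length (drop m as). x (v, take m as) *
        (y (path_end Q (v, take m as), take n (drop m as)) *
         z (path_end Q (path_end Q (v, take m as), take n (drop m as)), drop n (drop m as))))"
    proof (rule sum.cong)
      fix l
      show "F m (m + l) = x (v, take m as) * (y (path_end Q (v, take m as), take l (drop m as)) *
         z (path_end Q (path_end Q (v, take m as), take l (drop m as)), drop l (drop m as)))"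
        unfolding path_end_append take_add[symmetric] by (simp add: F_def add.commute)
    qed simp
  qed
  finally show "((x \<otimes>\<^bsub>path_algebra Q\<^esub> y) \<otimes>\<^bsub>path_algebra Q\<^esub> z) p = (x \<otimes>\<^bsub>path_algebra Q\<^esub> (y \<otimes>\<^bsub>path_algebra Q\<^esub> z)) p"
    unfolding p .
qed

lemma pa_mult_nonzero:
  assumes "(x \<otimes>\<^bsub>path_algebra Q\<^esub> y) (v, as) \<noteq> 0"
  obtains bs cs where "as = bs @ cs" "x (v, bs) \<noteq> 0" "y (path_end Q (v, bs), cs) \<noteq> 0"
proof -
  obtain n where "x (v, take n as) * y (path_end Q (v, take n as), drop n as) \<noteq> 0"
    using assms unfolding pa_mult by (meson sum.neutral)
  then show thesis using that[of "take n as" "drop n as"] by auto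
qed

lemma pa_mult_closed:
  assumes x: "x \<in> carrier (path_algebra Q)" and y: "y \<in> carrier (path_algebra Q)"
  shows "x \<otimes>\<^bsub>path_algebra Q\<^esub> y \<in> carrier (path_algebra Q)"
proof -
  let ?xy = "x \<otimes>\<^bsub>path_algebra Q\<^esub> y"
  let ?c = "\<lambda>((u, as), (w, bs)). (u, as @ bs)"
  have "{p. ?xy p \<noteq> 0} \<subseteq> ?c ` ({p. x p \<noteq> 0} \<times> {p. y p \<noteq> 0})"
  proof
    fix p assume "p \<in> {p. ?xy p \<noteq> 0}"
    then obtain v as where p: "p = (v, as)" "?xy (v, as) \<noteq> 0" by (cases p) auto
    obtain bs cs where bc: "as = bs @ cs" "x (v, bs) \<noteq> 0" "y (path_end Q (v, bs), cs) \<noteq> 0"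
      using pa_mult_nonzero[OF p(2)] by blast
    have "p = ?c ((v, bs), (path_end Q (v, bs), cs))" using p bc by simp
    then show "p \<in> ?c ` ({p. x p \<noteq> 0} \<times> {p. y p \<noteq> 0})" using bc by blast
  qed
  moreover have "finite (?c ` ({p. x p \<noteq> 0} \<times> {p. y p \<noteq> 0}))" using x y by simp
  ultimately have fin: "finite {p. ?xy p \<noteq> 0}" by (rule finite_subset)
  have "is_path Q (v, as)" if nz: "?xy (v, as) \<noteq> 0" for v as
  proof -
    obtain bs cs where bc: "as = bs @ cs" "x (v, bs) \<noteq> 0" "y (path_end Q (v, bs), cs) \<noteq> 0"
      using pa_mult_nonzero[OF nz] by blast
    then have "is_path Q (v, bs)" "is_path Q (path_end Q (v, bs), cs)" using x y by (simp_all del: path_end.simps)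
    then show ?thesis unfolding bc(1) is_path_append by blast
  qed
  then show ?thesis using fin by simp
qed

lemma vx_closed: "finite (verts Q) \<Longrightarrow> S \<subseteq> verts Q \<Longrightarrow> vx S \<in> carrier (path_algebra Q)"
proof -
  assume S: "finite (verts Q)" "S \<subseteq> verts Q"
  have "{p. vx S p \<noteq> 0} \<subseteq> (\<lambda>v. (v, [])) ` S" by (auto simp: vx_def split: if_splits)
  then have "finite {p. vx S p \<noteq> 0}" by (rule finite_subset) (use finite_subset[OF S(2,1)] in simp)
  then show ?thesis using S by (auto simp: vx_def split: if_splits)
qed

lemma pa_ring_laws:
  "(x \<oplus>\<^bsub>path_algebra Q\<^esub> y) \<otimes>\<^bsub>path_algebra Q\<^esub> z = x \<otimes>\<^bsub>path_algebra Q\<^esub> z \<oplus>\<^bsub>path_algebra Q\<^esub> y \<otimes>\<^bsub>path_algebra Q\<^esub> z"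
  "z \<otimes>\<^bsub>path_algebra Q\<^esub> (x \<oplus>\<^bsub>path_algebra Q\<^esub> y) = z \<otimes>\<^bsub>path_algebra Q\<^esub> x \<oplus>\<^bsub>path_algebra Q\<^esub> z \<otimes>\<^bsub>path_algebra Q\<^esub> y"
  "(c \<odot>\<^bsub>path_algebra Q\<^esub> x) \<otimes>\<^bsub>path_algebra Q\<^esub> y = c \<odot>\<^bsub>path_algebra Q\<^esub> (x \<otimes>\<^bsub>path_algebra Q\<^esub> y)"
  "x \<otimes>\<^bsub>path_algebra Q\<^esub> (c \<odot>\<^bsub>path_algebra Q\<^esub> y) = c \<odot>\<^bsub>path_algebra Q\<^esub> (x \<otimes>\<^bsub>path_algebra Q\<^esub> y)"
  by (auto simp: fun_eq_iff pa_mult distrib_left distrib_right sum.distrib sum_distrib_left mult_ac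
      simp del: path_end.simps)

lemma pa_kalg:
  assumes "finite_quiver Q"
  shows "kalg (path_algebra Q :: ('k::field, ('v, 'e) path \<Rightarrow> 'k) module)"
proof -
  let ?K = "path_algebra Q :: ('k, ('v, 'e) path \<Rightarrow> 'k) module"
  have fin: "finite (verts Q)" using assms by (simp add: finite_quiver_def)
  have add: "x \<oplus>\<^bsub>?K\<^esub> y \<in> carrier ?K" if "x \<in> carrier ?K" "y \<in> carrier ?K" for x y
  proof -
    have "{p. x p + y p \<noteq> 0} \<subseteq> {p. x p \<noteq> 0} \<union> {p. y p \<noteq> 0}" by auto
    then have "finite {p. x p + y p \<noteq> 0}" using that by (auto intro: finite_subset)
    moreover have "is_path Q p" if "x p + y p \<noteq> 0" for p
      using that \<open>x \<in> carrier ?K\<close> \<open>y \<in> carrier ?K\<close> by (cases p; cases "x p = 0") auto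
    ultimately show ?thesis by simp
  qed
  have sc: "c \<odot>\<^bsub>?K\<^esub> x \<in> carrier ?K" if "x \<in> carrier ?K" for c x
  proof -
    have "{p. c * x p \<noteq> 0} \<subseteq> {p. x p \<noteq> 0}" by auto
    then show ?thesis using that by (auto intro: finite_subset)
  qed
  have "ring ?K"
  proof (rule ringI)
    show "abelian_group ?K"
    proof (rule abelian_groupI)
      fix x assume "x \<in> carrier ?K"
      then show "\<exists>y\<in>carrier ?K. y \<oplus>\<^bsub>?K\<^esub> x = \<zero>\<^bsub>?K\<^esub>"
        using sc[of x "-1"] by (intro bexI[of _ "(-1) \<odot>\<^bsub>?K\<^esub> x"]) (auto simp: fun_eq_iff)
    qed (use add in \<open>auto simp: fun_eq_iff add_ac simp del: pa_simps(1)\<close>, simp)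
    show "monoid ?K"
    proof (rule monoidI)
      show "\<one>\<^bsub>?K\<^esub> \<in> carrier ?K" unfolding pa_one by (rule vx_closed[OF fin]) simp
      show "\<one>\<^bsub>?K\<^esub> \<otimes>\<^bsub>?K\<^esub> x = x" if x: "x \<in> carrier ?K" for x
      proof
        fix p show "(\<one>\<^bsub>?K\<^esub> \<otimes>\<^bsub>?K\<^esub> x) p = x p"
          using x is_path_src by (cases p) (fastforce simp: pa_one vx_mult_l)
      qed
      show "x \<otimes>\<^bsub>?K\<^esub> \<one>\<^bsub>?K\<^esub> = x" if x: "x \<in> carrier ?K" for x
      proof
        fix p show "(x \<otimes>\<^bsub>?K\<^esub> \<one>\<^bsub>?K\<^esub>) p = x p"
          using x is_path_end[OF assms] by (cases p) (fastforce simp: pa_one vx_mult_r simp del: path_end.simps)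
      qed
    qed (use pa_mult_closed pa_assoc in blast)+
  qed (use pa_ring_laws in blast)+
  then show ?thesis
    by (intro kalg.intro kalg_axioms.intro)
      (assumption | rule sc pa_ring_laws(3,4) | simp add: fun_eq_iff algebra_simps del: pa_simps(1))+
qed

lemma pa_finsum:
  fixes Q :: "('v, 'e) quiver" and h :: "'s \<Rightarrow> ('v, 'e) path \<Rightarrow> 'k::field"
  assumes "finite_quiver Q" "finite S" "\<And>s. s \<in> S \<Longrightarrow> h s \<in> carrier (path_algebra Q)"
  shows "(\<Oplus>\<^bsub>path_algebra Q\<^esub>s\<in>S. h s) = (\<lambda>p. \<Sum>s\<in>S. h s p)"
proof -
  interpret K: kalg "path_algebra Q :: ('k, ('v, 'e) path \<Rightarrow> 'k) module" by (rule pa_kalg[OF assms(1)])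
  show ?thesis using assms(2,3)
  proof (induction S rule: finite_induct)
    case empty then show ?case by (simp add: K.finsum_empty)
  next
    case (insert s S)
    then show ?case by (subst K.finsum_insert) (auto simp: Pi_def simp del: pa_simps(1))
  qed
qed

lemma pa_minus:
  fixes Q :: "('v, 'e) quiver" and x y :: "('v, 'e) path \<Rightarrow> 'k::field"
  assumes "finite_quiver Q" "x \<in> carrier (path_algebra Q)" "y \<in> carrier (path_algebra Q)"
  shows "x \<ominus>\<^bsub>path_algebra Q\<^esub> y = (\<lambda>p. x p - y p)"
proof -
  interpret K: kalg "path_algebra Q :: ('k, ('v, 'e) path \<Rightarrow> 'k) module" by (rule pa_kalg[OF assms(1)])
  interpret R: kmod "path_algebra Q" "reg_mod (path_algebra Q :: ('k, ('v, 'e) path \<Rightarrow> 'k) module)" by (rule K.reg_kmod)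
  have "(x \<ominus>\<^bsub>path_algebra Q\<^esub> y) \<oplus>\<^bsub>path_algebra Q\<^esub> y = x" using R.M_diff_add[of x y] assms by simp
  then show ?thesis by (auto simp: fun_eq_iff) (metis add_diff_cancel_right')
qed

text \<open>Closure under negatives follows from multiplication by \<ominus> \<one>.\<close>

lemma (in ring) ideal_intro:
  assumes "I \<subseteq> carrier R" "\<zero> \<in> I" "\<And>x y. x \<in> I \<Longrightarrow> y \<in> I \<Longrightarrow> x \<oplus> y \<in> I"
    "\<And>x y. x \<in> I \<Longrightarrow> y \<in> carrier R \<Longrightarrow> y \<otimes> x \<in> I" "\<And>x y. x \<in> I \<Longrightarrow> y \<in> carrier R \<Longrightarrow> x \<otimes> y \<in> I"
  shows "ideal I R"
proof (rule idealI)
  show "subgroup I (add_monoid R)"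
  proof (rule subgroup.intro)
    fix x assume x: "x \<in> I"
    have "inv\<^bsub>add_monoid R\<^esub> x = \<ominus> \<one> \<otimes> x" using x assms(1) l_minus[of \<one> x] by (auto simp: a_inv_def)
    then show "inv\<^bsub>add_monoid R\<^esub> x \<in> I" using assms(4)[OF x, of "\<ominus> \<one>"] by simp
  qed (use assms in auto)
qed (use assms ring_axioms in auto)

subsection \<open>Quotient algebras\<close>

locale alg_ideal = kalg A + ideal I A for A :: "('k::field, 'a) module" (structure) and I
begin

abbreviation "QA \<equiv> alg_quot A I"
abbreviation cl where "cl x \<equiv> I +> x"

lemma QA_simps [simp]:
  "carrier QA = carrier (A Quot I)" "mult QA = mult (A Quot I)" "one QA = one (A Quot I)"
  "zero QA = zero (A Quot I)" "add QA = add (A Quot I)"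
  by (simp_all add: alg_quot_def)

lemma I_scal: "x \<in> I \<Longrightarrow> c \<odot> x \<in> I"
  using I_l_closed[of x "c \<odot> \<one>"] Icarr[of x] by (simp add: scal_mult_l)

lemma cl_eq: "x \<in> carrier A \<Longrightarrow> y \<in> carrier A \<Longrightarrow> cl x = cl y \<longleftrightarrow> x \<ominus> y \<in> I"
  using quotient_eq_iff_same_a_r_cos[OF is_ideal] by simp

lemma QA_carrier: "X \<in> carrier QA \<longleftrightarrow> (\<exists>x\<in>carrier A. X = cl x)"
  by (auto simp: FactRing_def A_RCOSETS_def' )

lemma cl_closed [simp]: "x \<in> carrier A \<Longrightarrow> cl x \<in> carrier QA"
  using QA_carrier by blast

lemma cl_add: "x \<in> carrier A \<Longrightarrow> y \<in> carrier A \<Longrightarrow> cl (x \<oplus> y) = cl x \<oplus>\<^bsub>QA\<^esub> cl y"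
  using ring_hom_add[OF rcos_ring_hom] by simp

lemma cl_mult: "x \<in> carrier A \<Longrightarrow> y \<in> carrier A \<Longrightarrow> cl (x \<otimes> y) = cl x \<otimes>\<^bsub>QA\<^esub> cl y"
  using ring_hom_mult[OF rcos_ring_hom] by simp

lemma cl_one: "cl \<one> = \<one>\<^bsub>QA\<^esub>"
  using ring_hom_one[OF rcos_ring_hom] by simp

lemma cl_zero: "cl \<zero> = \<zero>\<^bsub>QA\<^esub>"
  by (simp add: FactRing_def a_r_coset_def r_coset_def)

lemma cl_eq_zero: "x \<in> carrier A \<Longrightarrow> cl x = \<zero>\<^bsub>QA\<^esub> \<longleftrightarrow> x \<in> I"
  using cl_eq[of x \<zero>] cl_zero by (simp add: minus_eq)

text \<open>In \<open>alg_quot\<close> a scalar acts on a coset by a union over its elements. All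
  cosets in that union coincide, since representatives differ by elements of I and I is closed under
  scalars.\<close>

lemma cl_scal: "x \<in> carrier A \<Longrightarrow> cl (c \<odot> x) = c \<odot>\<^bsub>QA\<^esub> cl x"
proof -
  assume x: "x \<in> carrier A"
  have eq: "cl (c \<odot> x') = cl (c \<odot> x)" if x': "x' \<in> cl x" for x'
  proof -
    obtain u where u: "u \<in> I" "x' = u \<oplus> x" using x' by (auto simp: a_r_coset_def r_coset_def)
    have uc: "u \<in> carrier A" using u(1) Icarr by blast
    have "c \<odot> x' \<ominus> c \<odot> x = c \<odot> u"
      unfolding u(2) using x uc by (simp add: scal_r_distr minus_eq a_assoc r_neg)
    then have "c \<odot> x' \<ominus> c \<odot> x \<in> I" using I_scal[OF u(1)] by simp
    then show ?thesis using cl_eq[of "c \<odot> x'" "c \<odot> x"] x uc u(2) by simp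
  qed
  have "x \<in> cl x" using a_rcos_self[OF x] .
  then have "(\<Union>x'\<in>cl x. cl (c \<odot> x')) = cl (c \<odot> x)" using eq by blast
  then show ?thesis by (simp add: alg_quot_def)
qed

lemma QA_kalg: "kalg QA"
proof -
  interpret F: ring "A Quot I" by (rule quotient_is_ring)
  have r: "ring QA"
  proof (rule ringI)
    show "abelian_group QA"
    proof (rule abelian_groupI)
      fix x assume "x \<in> carrier QA"
      then show "\<exists>y\<in>carrier QA. y \<oplus>\<^bsub>QA\<^esub> x = \<zero>\<^bsub>QA\<^esub>"
        using F.l_neg[of x] F.a_inv_closed[of x] by (intro bexI[of _ "\<ominus>\<^bsub>A Quot I\<^esub> x"]) simp_all
    qed (simp_all add: F.a_ac)
    show "monoid QA" by (rule monoidI) (simp_all add: F.m_assoc)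
  qed (simp_all add: F.l_distr F.r_distr)
  show ?thesis
  proof (intro kalg.intro kalg_axioms.intro r)
    fix x c d assume "x \<in> carrier QA"
    then obtain x' where x: "x' \<in> carrier A" "x = cl x'" using QA_carrier by blast
    show "c \<odot>\<^bsub>QA\<^esub> x \<in> carrier QA"
      unfolding x(2) cl_scal[OF x(1), symmetric] by (rule cl_closed[OF scal_closed[OF x(1)]])
    show "(c + d) \<odot>\<^bsub>QA\<^esub> x = c \<odot>\<^bsub>QA\<^esub> x \<oplus>\<^bsub>QA\<^esub> d \<odot>\<^bsub>QA\<^esub> x"
      unfolding x(2) cl_scal[OF x(1), symmetric] using x(1) by (simp only: scal_l_distr cl_add scal_closed)
    show "(c * d) \<odot>\<^bsub>QA\<^esub> x = c \<odot>\<^bsub>QA\<^esub> (d \<odot>\<^bsub>QA\<^esub> x)"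
      unfolding x(2) cl_scal[OF x(1), symmetric] cl_scal[OF scal_closed[OF x(1)], symmetric] using x(1) by (simp only: scal_assoc)
    show "1 \<odot>\<^bsub>QA\<^esub> x = x" unfolding x(2) cl_scal[OF x(1), symmetric] using x(1) by simp
  next
    fix x y c assume xy: "x \<in> carrier QA" "y \<in> carrier QA"
    obtain x' where x: "x' \<in> carrier A" "x = cl x'" using xy(1) QA_carrier by blast
    obtain y' where y: "y' \<in> carrier A" "y = cl y'" using xy(2) QA_carrier by blast
    note s = scal_closed[OF x(1), of c] scal_closed[OF y(1), of c]
    show "c \<odot>\<^bsub>QA\<^esub> (x \<oplus>\<^bsub>QA\<^esub> y) = c \<odot>\<^bsub>QA\<^esub> x \<oplus>\<^bsub>QA\<^esub> c \<odot>\<^bsub>QA\<^esub> y"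
      unfolding x(2) y(2) cl_add[OF x(1) y(1), symmetric] cl_scal[OF x(1), symmetric] cl_scal[OF y(1), symmetric]
        cl_scal[OF add.m_closed[OF x(1) y(1)], symmetric] cl_add[OF s, symmetric] scal_r_distr[OF x(1) y(1)] ..
    show "(c \<odot>\<^bsub>QA\<^esub> x) \<otimes>\<^bsub>QA\<^esub> y = c \<odot>\<^bsub>QA\<^esub> (x \<otimes>\<^bsub>QA\<^esub> y)"
      unfolding x(2) y(2) cl_mult[OF x(1) y(1), symmetric] cl_scal[OF x(1), symmetric]
        cl_scal[OF m_closed[OF x(1) y(1)], symmetric] cl_mult[OF s(1) y(1), symmetric] scal_mult_l[OF x(1) y(1)] ..
    show "x \<otimes>\<^bsub>QA\<^esub> (c \<odot>\<^bsub>QA\<^esub> y) = c \<odot>\<^bsub>QA\<^esub> (x \<otimes>\<^bsub>QA\<^esub> y)"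
      unfolding x(2) y(2) cl_mult[OF x(1) y(1), symmetric] cl_scal[OF y(1), symmetric]
        cl_scal[OF m_closed[OF x(1) y(1)], symmetric] cl_mult[OF x(1) s(2), symmetric] scal_mult_r[OF x(1) y(1)] ..
  qed
qed

lemma cl_finsum:
  assumes "finite S" "\<And>s. s \<in> S \<Longrightarrow> h s \<in> carrier A"
  shows "cl (\<Oplus>s\<in>S. h s) = (\<Oplus>\<^bsub>QA\<^esub>s\<in>S. cl (h s))"
proof -
  interpret F: kalg QA by (rule QA_kalg)
  show ?thesis using assms
  proof (induction S rule: finite_induct)
    case empty then show ?case by (simp only: finsum_empty F.finsum_empty cl_zero)
  next
    case (insert s S)
    have "cl (\<Oplus>s\<in>insert s S. h s) = cl (h s \<oplus> (\<Oplus>s\<in>S. h s))"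
      using insert by (subst finsum_insert) (auto simp: Pi_def)
    also have "\<dots> = cl (h s) \<oplus>\<^bsub>QA\<^esub> cl (\<Oplus>s\<in>S. h s)"
      using insert by (intro cl_add finsum_closed) (auto simp: Pi_def)
    also have "\<dots> = (\<Oplus>\<^bsub>QA\<^esub>s\<in>insert s S. cl (h s))"
      using insert by (subst F.finsum_insert) (auto simp: Pi_def simp del: QA_simps)
    finally show ?case .
  qed
qed

end

subsection \<open>The algebra of a bound quiver at a source\<close>

lemma is_path_arrows: "is_path Q (v, as) \<Longrightarrow> set as \<subseteq> arrows Q"
  by (induction as arbitrary: v) auto

definition arr :: "('v, 'e) quiver \<Rightarrow> 'e \<Rightarrow> ('v, 'e) path \<Rightarrow> 'k::field" where
  "arr Q a = path_elt (src Q a, [a])"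

lemma pa_mult_Cons:
  "(x \<otimes>\<^bsub>path_algebra Q\<^esub> y) (v, b # bs) = x (v, []) * y (v, b # bs) +
    (\<Sum>n\<le>length bs. x (v, b # take n bs) * y (path_end Q (v, b # take n bs), drop n bs))"
proof -
  have "path_end Q (v, []) = v" by simp
  then show ?thesis
    unfolding pa_mult
    using sum.atMost_Suc_shift[of "\<lambda>n. x (v, take n (b # bs)) * y (path_end Q (v, take n (b # bs)), drop n (b # bs))" "length bs"]
    by (simp del: path_end.simps sum.atMost_Suc)
qed

lemma arr_mult:
  "(arr Q a \<otimes>\<^bsub>path_algebra Q\<^esub> x) (v, []) = 0"
  "(arr Q a \<otimes>\<^bsub>path_algebra Q\<^esub> x) (v, b # bs) = (if b = a \<and> v = src Q a then x (tgt Q a, bs) else 0)"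
proof -
  show "(arr Q a \<otimes>\<^bsub>path_algebra Q\<^esub> x) (v, []) = 0" by (simp add: pa_mult arr_def path_elt_def)
  have "(arr Q a \<otimes>\<^bsub>path_algebra Q\<^esub> x) (v, b # bs) =
      (\<Sum>n\<le>length bs. arr Q a (v, b # take n bs) * x (path_end Q (v, b # take n bs), drop n bs))"
    unfolding pa_mult_Cons by (simp add: arr_def path_elt_def del: path_end.simps)
  also have "\<dots> = (\<Sum>n\<le>length bs. if n = 0 then (if b = a \<and> v = src Q a then x (tgt Q a, bs) else 0) else 0)"
    by (rule sum.cong) (auto simp: arr_def path_elt_def)
  finally show "(arr Q a \<otimes>\<^bsub>path_algebra Q\<^esub> x) (v, b # bs) = (if b = a \<and> v = src Q a then x (tgt Q a, bs) else 0)"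
    by simp
qed

lemma rel_comp_val: "rel_comp Q z a (v, as) = (if v = tgt Q a then z (src Q a, a # as) else 0)"
  by (simp add: rel_comp_def)

lemma rel_comp_closed:
  assumes "z \<in> carrier (path_algebra Q)" shows "rel_comp Q z a \<in> carrier (path_algebra Q)"
proof -
  have "{p. rel_comp Q z a p \<noteq> 0} \<subseteq> (\<lambda>(v, as). (tgt Q a, tl as)) ` {p. z p \<noteq> 0}"
  proof
    fix p assume "p \<in> {p. rel_comp Q z a p \<noteq> 0}"
    then have nz: "rel_comp Q z a p \<noteq> 0" by simp
    obtain v as where "p = (v, as)" by (cases p)
    then have "p = (tgt Q a, as)" "z (src Q a, a # as) \<noteq> 0"
      using nz by (auto simp: rel_comp_val split: if_splits)
    then show "p \<in> (\<lambda>(v, as). (tgt Q a, tl as)) ` {p. z p \<noteq> 0}" by force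
  qed
  then have "finite {p. rel_comp Q z a p \<noteq> 0}" by (rule finite_subset) (use assms in simp)
  moreover have "is_path Q p" if "rel_comp Q z a p \<noteq> 0" for p
  proof -
    obtain v as where va: "p = (v, as)" by (cases p)
    then have p: "p = (tgt Q a, as)" "z (src Q a, a # as) \<noteq> 0"
      using that by (auto simp: rel_comp_val split: if_splits)
    then have "is_path Q (src Q a, a # as)" using assms unfolding pa_simps by blast
    then show ?thesis using p(1) by simp
  qed
  ultimately show ?thesis by simp
qed

text \<open>A path that begins with a is cut either behind a, so that a belongs to the first factor,
  or in front of it, so that the first factor is the trivial path. This gives the two terms.\<close>

lemma rel_comp_mult:
  "rel_comp Q (x \<otimes>\<^bsub>path_algebra Q\<^esub> y) a = rel_comp Q x a \<otimes>\<^bsub>path_algebra Q\<^esub> y \<oplus>\<^bsub>path_algebra Q\<^esub>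
     x (src Q a, []) \<odot>\<^bsub>path_algebra Q\<^esub> rel_comp Q y a"
proof
  fix p :: "'a \<times> 'b list"
  obtain v as where p: "p = (v, as)" by (cases p)
  have "rel_comp Q (x \<otimes>\<^bsub>path_algebra Q\<^esub> y) a (v, as) =
      (rel_comp Q x a \<otimes>\<^bsub>path_algebra Q\<^esub> y) (v, as) + x (src Q a, []) * rel_comp Q y a (v, as)"
  proof (cases "v = tgt Q a")
    case True
    have "(x \<otimes>\<^bsub>path_algebra Q\<^esub> y) (src Q a, a # as) = x (src Q a, []) * y (src Q a, a # as) +
        (\<Sum>n\<le>length as. x (src Q a, a # take n as) * y (path_end Q (src Q a, a # take n as), drop n as))"
      by (rule pa_mult_Cons)
    moreover have "(rel_comp Q x a \<otimes>\<^bsub>path_algebra Q\<^esub> y) (v, as) =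
        (\<Sum>n\<le>length as. x (src Q a, a # take n as) * y (path_end Q (src Q a, a # take n as), drop n as))"
      unfolding pa_mult path_end_Cons by (intro sum.cong refl) (simp add: rel_comp_val True)
    ultimately show ?thesis using True by (simp add: rel_comp_val)
  next
    case False
    have "(rel_comp Q x a \<otimes>\<^bsub>path_algebra Q\<^esub> y) (v, as) = 0"
      unfolding pa_mult using False by (intro sum.neutral) (simp add: rel_comp_val)
    then show ?thesis using False by (simp add: rel_comp_val)
  qed
  then show "rel_comp Q (x \<otimes>\<^bsub>path_algebra Q\<^esub> y) a p = (rel_comp Q x a \<otimes>\<^bsub>path_algebra Q\<^esub> y \<oplus>\<^bsub>path_algebra Q\<^esub>
     x (src Q a, []) \<odot>\<^bsub>path_algebra Q\<^esub> rel_comp Q y a) p"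
    unfolding p by simp
qed

lemma finite_short_paths:
  assumes "finite_quiver Q" shows "finite {p. is_path Q p \<and> length (snd p) \<le> n}"
proof -
  have "{p. is_path Q p \<and> length (snd p) \<le> n} \<subseteq> verts Q \<times> {as. set as \<subseteq> arrows Q \<and> length as \<le> n}"
    using is_path_src is_path_arrows by fastforce
  moreover have "finite (verts Q \<times> {as. set as \<subseteq> arrows Q \<and> length as \<le> n})"
    using assms finite_lists_length_le by (auto simp: finite_quiver_def)
  ultimately show ?thesis by (rule finite_subset)
qed

lemma (in alg_ideal) I_finsum: "finite S \<Longrightarrow> (\<And>s. s \<in> S \<Longrightarrow> h s \<in> I) \<Longrightarrow> (\<Oplus>s\<in>S. h s) \<in> I"
proof (induction S rule: finite_induct)
  case empty then show ?case using zero_closed by (simp only: finsum_empty)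
next
  case (insert s S)
  then have "(\<Oplus>s\<in>insert s S. h s) = h s \<oplus> (\<Oplus>s\<in>S. h s)"
    by (intro finsum_insert) (auto simp: Pi_def intro: Icarr)
  then show ?case using insert a_closed by simp
qed

lemma (in alg_ideal) cl_sum_mult:
  assumes "finite S" "\<And>s. s \<in> S \<Longrightarrow> x s \<in> carrier A" "\<And>s. s \<in> S \<Longrightarrow> y s \<in> carrier A"
  shows "cl (\<Oplus>s\<in>S. x s \<otimes> y s) = (\<Oplus>\<^bsub>QA\<^esub>s\<in>S. cl (x s) \<otimes>\<^bsub>QA\<^esub> cl (y s))"
proof -
  interpret Q: kalg QA by (rule QA_kalg)
  have "cl (\<Oplus>s\<in>S. x s \<otimes> y s) = (\<Oplus>\<^bsub>QA\<^esub>s\<in>S. cl (x s \<otimes> y s))"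
    by (rule cl_finsum) (use assms in auto)
  also have "\<dots> = (\<Oplus>\<^bsub>QA\<^esub>s\<in>S. cl (x s) \<otimes>\<^bsub>QA\<^esub> cl (y s))"
    by (rule Q.finsum_cong'[OF refl]) (use assms cl_mult cl_closed Q.m_closed in blast)+
  finally show ?thesis .
qed

lemma (in alg_ideal) I_cancel: "x \<in> carrier A \<Longrightarrow> y \<in> I \<Longrightarrow> x \<oplus> y \<in> I \<Longrightarrow> x \<in> I"
proof -
  assume a: "x \<in> carrier A" "y \<in> I" "x \<oplus> y \<in> I"
  interpret Q: kalg QA by (rule QA_kalg)
  have y: "y \<in> carrier A" using a(2) by (rule Icarr)
  have "cl (x \<oplus> y) = cl x" using cl_add[OF a(1) y] cl_eq_zero[OF y] a(2) Q.r_zero[OF cl_closed[OF a(1)]] by simp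
  then show ?thesis using cl_eq_zero[OF a(1)] cl_eq_zero[OF add.m_closed[OF a(1) y]] a(3) by simp
qed

lemma (in kalg) scal_finsum:
  assumes "finite S" "h \<in> S \<rightarrow> carrier A" shows "c \<odot> (\<Oplus>s\<in>S. h s) = (\<Oplus>s\<in>S. c \<odot> h s)"
proof -
  have o: "c \<odot> \<one> \<in> carrier A" by simp
  have "c \<odot> (\<Oplus>s\<in>S. h s) = (c \<odot> \<one>) \<otimes> (\<Oplus>s\<in>S. h s)" using assms(2) by (simp add: scal_mult_l)
  also have "\<dots> = (\<Oplus>s\<in>S. (c \<odot> \<one>) \<otimes> h s)" by (rule finsum_rdistr[OF assms(1) o assms(2)])
  also have "\<dots> = (\<Oplus>s\<in>S. c \<odot> h s)" by (rule finsum_cong') (use assms(2) in \<open>auto simp: scal_mult_l Pi_iff\<close>)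
  finally show ?thesis .
qed

lemma (in kalg) additive_subgroup_intro:
  assumes "H \<subseteq> carrier A" "\<zero> \<in> H" "\<And>x y. x \<in> H \<Longrightarrow> y \<in> H \<Longrightarrow> x \<oplus> y \<in> H" "\<And>c x. x \<in> H \<Longrightarrow> c \<odot> x \<in> H"
  shows "additive_subgroup H A"
proof (intro additive_subgroup.intro subgroup.intro)
  fix x assume x: "x \<in> H"
  have xc: "x \<in> carrier A" using x assms(1) by blast
  have "(- 1) \<odot> x \<oplus> x = (- 1 + 1) \<odot> x" using scal_l_distr[OF xc, of "- 1" 1] scal_one[OF xc] by simp
  then have "(- 1) \<odot> x \<oplus> x = \<zero>" using scal_zero_l[OF xc] by simp
  then have "\<ominus> x = (- 1) \<odot> x" using minus_equality[of "(- 1) \<odot> x" x] xc scal_closed by simp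
  then show "inv\<^bsub>add_monoid A\<^esub> x \<in> H" using assms(4)[OF x, of "- 1"] by (simp add: a_inv_def)
qed (use assms in auto)

locale bq =
  fixes Q :: "('v, 'e) quiver" and R :: "(('v, 'e) path \<Rightarrow> 'k::field) set" and i :: 'v
  assumes bQ: "bound_quiver Q R" and minR: "minimal_relations Q R" and src_i: "is_source Q i"
begin

abbreviation K :: "('k, ('v, 'e) path \<Rightarrow> 'k) module" where "K \<equiv> path_algebra Q"
abbreviation mult_K (infixl "\<cdot>" 70) where "x \<cdot> y \<equiv> x \<otimes>\<^bsub>K\<^esub> y"
abbreviation I where "I \<equiv> Idl\<^bsub>K\<^esub> R"
abbreviation J :: "nat \<Rightarrow> (('v, 'e) path \<Rightarrow> 'k) set" where "J \<equiv> arrow_ideal_power Q"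
abbreviation Sa where "Sa \<equiv> {a \<in> arrows Q. src Q a = i}"
abbreviation Sr where "Sr \<equiv> rels_from R i"

lemma finQ: "finite_quiver Q" using bQ by (simp add: bound_quiver_def)
lemma finV: "finite (verts Q)" using finQ by (simp add: finite_quiver_def)
lemma iV: "i \<in> verts Q" using src_i by (simp add: is_source_def)
lemma tgtV: "a \<in> arrows Q \<Longrightarrow> tgt Q a \<in> verts Q" using finQ by (simp add: finite_quiver_def)
lemma tgt_ne: "a \<in> arrows Q \<Longrightarrow> tgt Q a \<noteq> i" using src_i by (simp add: is_source_def)
lemma RK: "r \<in> R \<Longrightarrow> r \<in> carrier K" using bQ by (auto simp: bound_quiver_def is_relation_def)
lemma RsubK: "R \<subseteq> carrier K" using RK by blast
lemma fin_Sa: "finite Sa" using finQ by (simp add: finite_quiver_def)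

sublocale K: kalg K by (rule pa_kalg[OF finQ])

lemma idealI: "ideal I K" by (rule K.genideal_ideal[OF RsubK])

sublocale PA: alg_ideal K I by (intro alg_ideal.intro K.is_kalg idealI)

lemma IJ: "I \<subseteq> J 2" and JnI: "\<exists>n. J n \<subseteq> I"
  using bQ by (auto simp: bound_quiver_def admissible_def)

lemma J_iff: "x \<in> J m \<longleftrightarrow> x \<in> carrier K \<and> (\<forall>p. x p \<noteq> 0 \<longrightarrow> m \<le> length (snd p))"
  by (simp add: arrow_ideal_power_def)

lemma J_K: "x \<in> J m \<Longrightarrow> x \<in> carrier K" by (simp add: J_iff del: pa_simps(1))

lemma J_mult: assumes "x \<in> J m" "y \<in> J n" shows "x \<cdot> y \<in> J (m + n)"
proof -
  have "m + n \<le> length as" if nz: "(x \<cdot> y) (v, as) \<noteq> 0" for v as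
  proof -
    obtain bs cs where bc: "as = bs @ cs" "x (v, bs) \<noteq> 0" "y (path_end Q (v, bs), cs) \<noteq> 0"
      using pa_mult_nonzero[OF nz] by blast
    then have "m \<le> length bs" "n \<le> length cs" using assms unfolding J_iff by fastforce+
    then show ?thesis using bc by simp
  qed
  then show ?thesis using K.m_closed[OF J_K[OF assms(1)] J_K[OF assms(2)]] by (auto simp: J_iff simp del: pa_simps(1))
qed

lemma J_add: "x \<in> J m \<Longrightarrow> y \<in> J m \<Longrightarrow> x \<oplus>\<^bsub>K\<^esub> y \<in> J m"
proof -
  assume a: "x \<in> J m" "y \<in> J m"
  have "m \<le> length (snd p)" if "x p + y p \<noteq> 0" for p using that a by (cases p; cases "x p = 0") (auto simp: J_iff)
  then show ?thesis using K.a_closed[OF J_K[OF a(1)] J_K[OF a(2)]] by (simp add: J_iff del: pa_simps(1))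
qed

lemma J_scal: "x \<in> J m \<Longrightarrow> c \<odot>\<^bsub>K\<^esub> x \<in> J m"
  using K.scal_closed[of x c] by (auto simp: J_iff simp del: pa_simps(1))

lemma J_zero: "\<zero>\<^bsub>K\<^esub> \<in> J m"
  using K.zero_closed by (simp add: J_iff del: pa_simps(1))

lemma path_to_i: "is_path Q (v, as) \<Longrightarrow> path_end Q (v, as) = i \<Longrightarrow> as = [] \<and> v = i"
proof -
  assume a: "is_path Q (v, as)" "path_end Q (v, as) = i"
  have "as = []"
  proof (rule ccontr)
    assume n: "as \<noteq> []"
    then have "last as \<in> arrows Q" using is_path_arrows[OF a(1)] last_in_set by blast
    then show False using tgt_ne a(2) n by simp
  qed
  then show ?thesis using a(2) by simp
qed

abbreviation E :: "('v, 'e) path \<Rightarrow> 'k" where "E \<equiv> vx {i}"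
abbreviation F :: "('v, 'e) path \<Rightarrow> 'k" where "F \<equiv> vx (verts Q - {i})"

lemma vxK: "S \<subseteq> verts Q \<Longrightarrow> vx S \<in> carrier K" by (rule vx_closed[OF finV])
lemma vxK1: "v \<in> verts Q \<Longrightarrow> vx {v} \<in> carrier K" by (rule vxK) simp
lemma EK: "E \<in> carrier K" by (rule vxK1[OF iV])
lemma FK: "F \<in> carrier K" by (rule vxK) simp

lemma vx_idem: "vx S \<cdot> vx S = vx S"
proof
  fix p :: "('v, 'e) path"
  obtain v as where p: "p = (v, as)" by (cases p)
  show "(vx S \<cdot> vx S) p = vx S p" unfolding p vx_mult_l by (simp add: vx_def)
qed

text \<open>The trivial path is the only path that ends in the source i.\<close>

lemma K_E: assumes "x \<in> carrier K" shows "x \<cdot> E = x (i, []) \<odot>\<^bsub>K\<^esub> E"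
proof
  fix p :: "('v, 'e) path"
  obtain v as where p: "p = (v, as)" by (cases p)
  have "x (v, as) = 0" if "path_end Q (v, as) = i" "\<not> (as = [] \<and> v = i)"
    using path_to_i[of v as] that assms by auto
  then show "(x \<cdot> E) p = (x (i, []) \<odot>\<^bsub>K\<^esub> E) p"
    unfolding p vx_mult_r by (auto simp: vx_def)
qed

text \<open>A path that does not start in i does not end in i either. As a consequence, x \<mapsto>
  F x is multiplicative.\<close>

lemma F_K_F: assumes "x \<in> carrier K" shows "F \<cdot> (x \<cdot> F) = F \<cdot> x"
proof
  fix p :: "('v, 'e) path"
  obtain v as where p: "p = (v, as)" by (cases p)
  have "x (v, as) = 0" if "v \<noteq> i" "path_end Q (v, as) \<notin> verts Q - {i}"
    using path_to_i[of v as] is_path_end[OF finQ, of v as] that assms by (auto simp del: path_end.simps)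
  then show "(F \<cdot> (x \<cdot> F)) p = (F \<cdot> x) p"
    unfolding p vx_mult_l vx_mult_r by auto
qed

lemma arrK: "a \<in> arrows Q \<Longrightarrow> arr Q a \<in> carrier K"
proof -
  assume a: "a \<in> arrows Q"
  have "{p. arr Q a p \<noteq> (0::'k)} \<subseteq> {(src Q a, [a])}" by (auto simp: arr_def path_elt_def split: if_splits)
  then have "finite {p. arr Q a p \<noteq> (0::'k)}" by (rule finite_subset) simp
  then show ?thesis using a finQ by (auto simp: arr_def path_elt_def finite_quiver_def)
qed

lemma arr_J: "a \<in> arrows Q \<Longrightarrow> arr Q a \<in> J 1"
  using arrK by (auto simp: J_iff arr_def path_elt_def simp del: pa_simps(1))

lemma arr_tgt: "arr Q a \<cdot> vx {tgt Q a} = arr Q a"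
  by (auto simp: fun_eq_iff vx_mult_r arr_def path_elt_def)

lemma arr_src: "vx {src Q a} \<cdot> arr Q a = arr Q a"
  by (auto simp: fun_eq_iff vx_mult_l arr_def path_elt_def)

lemma arr_F: "a \<in> arrows Q \<Longrightarrow> arr Q a \<cdot> F = arr Q a"
  using tgtV tgt_ne by (auto simp: fun_eq_iff vx_mult_r arr_def path_elt_def)

text \<open>The nontrivial paths starting in i are sorted by their first arrow.\<close>

lemma E_decomp:
  assumes z: "z \<in> carrier K"
  shows "E \<cdot> z = z (i, []) \<odot>\<^bsub>K\<^esub> E \<oplus>\<^bsub>K\<^esub> (\<Oplus>\<^bsub>K\<^esub>a\<in>Sa. arr Q a \<cdot> rel_comp Q z a)"
proof
  fix p :: "('v, 'e) path"
  obtain v as where p: "p = (v, as)" by (cases p)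
  have s: "(\<Oplus>\<^bsub>K\<^esub>a\<in>Sa. arr Q a \<cdot> rel_comp Q z a) = (\<lambda>p. \<Sum>a\<in>Sa. (arr Q a \<cdot> rel_comp Q z a) p)"
    by (rule pa_finsum[OF finQ fin_Sa]) (use arrK rel_comp_closed[OF z] in blast)
  show "(E \<cdot> z) p = (z (i, []) \<odot>\<^bsub>K\<^esub> E \<oplus>\<^bsub>K\<^esub> (\<Oplus>\<^bsub>K\<^esub>a\<in>Sa. arr Q a \<cdot> rel_comp Q z a)) p"
  proof (cases as)
    case Nil
    then show ?thesis unfolding p s pa_simps Nil vx_mult_l arr_mult by (simp add: vx_def)
  next
    case (Cons b bs)
    have "(\<Sum>a\<in>Sa. (arr Q a \<cdot> rel_comp Q z a) (v, b # bs)) =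
        (\<Sum>a\<in>Sa. if b = a then (if v = i then z (i, b # bs) else 0) else 0)"
      by (rule sum.cong) (auto simp: arr_mult rel_comp_val)
    also have "\<dots> = (if b \<in> Sa \<and> v = i then z (i, b # bs) else 0)" using fin_Sa by simp
    also have "\<dots> = (if v = i then z (i, b # bs) else 0)"
    proof -
      have "b \<in> Sa" if "z (i, b # bs) \<noteq> 0"
      proof -
        have "is_path Q (i, b # bs)" using z that unfolding pa_simps by blast
        then show ?thesis by simp
      qed
      then show ?thesis by auto
    qed
    finally show ?thesis unfolding p s pa_simps Cons vx_mult_l by (simp add: vx_def)
  qed
qed

text \<open>Zero lies in every ideal, so minimality excludes it. Start and end of a relation are
  therefore well defined.\<close>

lemma R_ne: assumes "r \<in> R" shows "\<exists>p. r p \<noteq> 0"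
proof (rule ccontr)
  assume "\<nexists>p. r p \<noteq> 0"
  then have "r = \<zero>\<^bsub>K\<^esub>" by (auto simp: fun_eq_iff)
  moreover have "ideal (Idl\<^bsub>K\<^esub> (R - {r})) K" by (rule K.genideal_ideal) (use RsubK in blast)
  ultimately have "r \<in> Idl\<^bsub>K\<^esub> (R - {r})"
    using additive_subgroup.zero_closed[OF ideal.axioms(1)] by blast
  then show False using minR assms by (simp add: minimal_relations_def)
qed

lemma rel:
  assumes r: "r \<in> R" "r p \<noteq> 0"
  shows "fst p = rel_src r" "path_end Q p = rel_tgt Q r" "2 \<le> length (snd p)" "is_path Q p"
proof -
  have "is_relation Q r" using bQ r(1) by (simp add: bound_quiver_def)
  then obtain u v where uv: "\<forall>p. r p \<noteq> 0 \<longrightarrow> 2 \<le> length (snd p) \<and> fst p = u \<and> path_end Q p = v"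
    unfolding is_relation_def by blast
  have "rel_src r = u" unfolding rel_src_def by (rule the_equality) (use uv r(2) in blast)+
  moreover have "rel_tgt Q r = v" unfolding rel_tgt_def by (rule the_equality) (use uv r(2) in blast)+
  ultimately show "fst p = rel_src r" "path_end Q p = rel_tgt Q r" "2 \<le> length (snd p)"
    using uv[rule_format, OF r(2)] by (simp_all only:)
  show "is_path Q p" using RK[OF r(1)] r(2) by (cases p) simp
qed

lemma rel_tgtV: assumes "r \<in> R" shows "rel_tgt Q r \<in> verts Q" "rel_tgt Q r \<noteq> i"
proof -
  obtain p where p: "r p \<noteq> 0" using R_ne[OF assms] by blast
  obtain v as where va: "p = (v, as)" by (cases p)
  note rp = rel[OF assms p, unfolded va]
  show "rel_tgt Q r \<in> verts Q" using is_path_end[OF finQ rp(4)] rp(2) by simp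
  show "rel_tgt Q r \<noteq> i"
  proof
    assume "rel_tgt Q r = i"
    then have "as = []" using path_to_i[OF rp(4) trans[OF rp(2)]] by blast
    then show False using rp(3) by simp
  qed
qed

lemma SrR: "r \<in> Sr \<Longrightarrow> r \<in> R" "r \<in> Sr \<Longrightarrow> rel_src r = i" by (simp_all add: rels_from_def)

lemma rel_J: "r \<in> R \<Longrightarrow> r \<in> J 2"
  using RK rel(3) by (simp add: J_iff del: pa_simps(1))

lemma rel_tgt_mult: assumes "r \<in> R" shows "r \<cdot> vx {rel_tgt Q r} = r"
proof
  fix p :: "('v, 'e) path"
  obtain v as where p: "p = (v, as)" by (cases p)
  show "(r \<cdot> vx {rel_tgt Q r}) p = r p"
    unfolding p vx_mult_r using rel(2)[OF assms, of "(v, as)"] by (auto simp del: path_end.simps)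
qed

lemma rel_src_mult: assumes "r \<in> R" shows "vx S \<cdot> r = (if rel_src r \<in> S then r else \<zero>\<^bsub>K\<^esub>)"
proof
  fix p :: "('v, 'e) path"
  obtain v as where p: "p = (v, as)" by (cases p)
  show "(vx S \<cdot> r) p = (if rel_src r \<in> S then r else \<zero>\<^bsub>K\<^esub>) p"
    unfolding p vx_mult_l using rel(1)[OF assms, of "(v, as)"] by (cases "r (v, as) = 0") simp_all
qed

lemma rel_decomp: assumes "r \<in> Sr" shows "r = (\<Oplus>\<^bsub>K\<^esub>a\<in>Sa. arr Q a \<cdot> rel_comp Q r a)"
proof -
  have "r (i, []) = 0" using rel(3)[OF SrR(1)[OF assms], of "(i, [])"] by auto
  moreover have "(\<Oplus>\<^bsub>K\<^esub>a\<in>Sa. arr Q a \<cdot> rel_comp Q r a) \<in> carrier K"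
    by (rule K.finsum_closed) (use arrK rel_comp_closed[OF RK[OF SrR(1)[OF assms]]] in blast)
  ultimately show ?thesis
    using E_decomp[OF RK[OF SrR(1)[OF assms]]] rel_src_mult[OF SrR(1)[OF assms], of "{i}"] SrR(2)[OF assms]
      K.scal_zero_l[OF EK]
    by (simp del: pa_simps)
qed

lemma rel_comp_J: "r \<in> R \<Longrightarrow> rel_comp Q r a \<in> J 1"
  using rel_comp_closed[OF RK] rel(3)
  by (fastforce simp: J_iff rel_comp_val split: if_splits simp del: pa_simps(1))

lemma rel_comp_src: "vx {tgt Q a} \<cdot> rel_comp Q z a = rel_comp Q z a"
  by (auto simp: fun_eq_iff vx_mult_l rel_comp_val)

lemma rel_comp_tgt: assumes "r \<in> R" shows "rel_comp Q r a \<cdot> vx {rel_tgt Q r} = rel_comp Q r a"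
proof
  fix p :: "('v, 'e) path"
  obtain v as where p: "p = (v, as)" by (cases p)
  show "(rel_comp Q r a \<cdot> vx {rel_tgt Q r}) p = rel_comp Q r a p"
    unfolding p vx_mult_r rel_comp_val
    using rel(2)[OF assms, of "(src Q a, a # as)"] path_end_Cons[of Q "src Q a" a as] by (auto simp del: path_end.simps)
qed

text \<open>Minimality of R is exploited through this ideal. For every s in \<open>Sr\<close> it
  lies in the ideal generated by R without s, and by \<open>arr_I\<close> it contains the product of
  any arrow with any element of I.\<close>

abbreviation I0 where "I0 \<equiv> Idl\<^bsub>K\<^esub> (R - Sr)"

lemma idealI0: "ideal I0 K" by (rule K.genideal_ideal) (use RsubK in blast)

sublocale I0: alg_ideal K I0 by (intro alg_ideal.intro K.is_kalg idealI0)

text \<open>The z with F z in \<open>I0\<close> form an ideal, because F (y x) = (F y) (F x). It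
  contains R: for a relation r starting in i the product F r is zero, and the others lie in
  \<open>I0\<close>.\<close>

lemma F_I: assumes "z \<in> I" shows "F \<cdot> z \<in> I0"
proof -
  let ?S = "{z \<in> carrier K. F \<cdot> z \<in> I0}"
  have "ideal ?S K"
  proof (rule K.ideal_intro)
    show "\<zero>\<^bsub>K\<^esub> \<in> ?S" using K.r_null[OF FK] I0.zero_closed by (simp del: pa_simps)
    show "x \<oplus>\<^bsub>K\<^esub> y \<in> ?S" if "x \<in> ?S" "y \<in> ?S" for x y
      using that K.r_distr[of x y F] FK I0.a_closed by (simp del: pa_simps)
    show "x \<cdot> y \<in> ?S" if "x \<in> ?S" "y \<in> carrier K" for x y
    proof -
      have "(F \<cdot> x) \<cdot> y \<in> I0" using that I0.I_r_closed[of "F \<cdot> x" y] by (simp del: pa_simps)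
      then have "F \<cdot> (x \<cdot> y) \<in> I0" by (simp only: pa_assoc)
      moreover have "x \<cdot> y \<in> carrier K" using that by (intro K.m_closed) blast+
      ultimately show ?thesis by (simp del: pa_simps)
    qed
    show "y \<cdot> x \<in> ?S" if x: "x \<in> ?S" "y \<in> carrier K" for x y
    proof -
      have "F \<cdot> (y \<cdot> x) = (F \<cdot> (y \<cdot> F)) \<cdot> x"
        unfolding F_K_F[OF x(2)] by (simp only: pa_assoc)
      also have "\<dots> = (F \<cdot> y) \<cdot> (F \<cdot> x)" by (simp only: pa_assoc)
      also have "\<dots> \<in> I0" using x K.m_closed[OF FK x(2)] I0.I_l_closed[of "F \<cdot> x" "F \<cdot> y"] by (simp del: pa_simps)
      finally have "F \<cdot> (y \<cdot> x) \<in> I0" .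
      moreover have "y \<cdot> x \<in> carrier K" using x by (intro K.m_closed) blast+
      ultimately show ?thesis by (simp del: pa_simps)
    qed
  qed blast
  moreover have "R \<subseteq> ?S"
  proof
    fix r assume r: "r \<in> R"
    have "F \<cdot> r \<in> I0"
    proof (cases "r \<in> Sr")
      case True then show ?thesis using rel_src_mult[OF r, of "verts Q - {i}"] SrR(2) I0.zero_closed by (simp del: pa_simps)
    next
      case False
      then have "r \<in> I0" using K.genideal_self[of "R - Sr"] RsubK r by blast
      then show ?thesis using I0.I_l_closed[OF _ FK] by blast
    qed
    then show "r \<in> ?S" using RK[OF r] by (simp del: pa_simps)
  qed
  ultimately have "I \<subseteq> ?S" by (rule K.genideal_minimal)
  then show ?thesis using assms by blast
qed

text \<open>No arrow ends in i, so y may be replaced by F y.\<close>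

lemma arr_I: assumes "a \<in> arrows Q" "y \<in> I" shows "arr Q a \<cdot> y \<in> I0"
proof -
  have "arr Q a \<cdot> y = arr Q a \<cdot> (F \<cdot> y)"
    using arr_F[OF assms(1)] pa_assoc[of Q "arr Q a" F y] by simp
  then show ?thesis using I0.I_l_closed[OF F_I[OF assms(2)] arrK[OF assms(1)]] by simp
qed

text \<open>Taking off the first arrow, which costs the one in \<open>Suc n\<close>, leaves a factor
  in J n and hence in I; an arrow times an element of I lies in \<open>I0\<close>.\<close>

lemma long_I0:
  assumes z: "z \<in> J (Suc n)" "E \<cdot> z = z" and n: "J n \<subseteq> I"
  shows "z \<in> I0"
proof -
  have zK: "z \<in> carrier K" by (rule J_K[OF z(1)])
  have "z (i, []) = 0" using z(1) unfolding J_iff by fastforce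
  moreover have sI: "(\<Oplus>\<^bsub>K\<^esub>a\<in>Sa. arr Q a \<cdot> rel_comp Q z a) \<in> I0"
  proof (rule I0.I_finsum[OF fin_Sa])
    fix a assume a: "a \<in> Sa"
    have "rel_comp Q z a \<in> J n"
      using rel_comp_closed[OF zK, of a] z(1)
      by (fastforce simp: J_iff rel_comp_val split: if_splits simp del: pa_simps(1))
    then show "arr Q a \<cdot> rel_comp Q z a \<in> I0" using arr_I[of a] a n by blast
  qed
  ultimately have "z = (\<Oplus>\<^bsub>K\<^esub>a\<in>Sa. arr Q a \<cdot> rel_comp Q z a)"
    using E_decomp[OF zK] z(2) K.scal_zero_l[OF EK] I0.Icarr[OF sI] by (simp del: pa_simps)
  then show ?thesis using sI by simp
qed

section \<open>Finiteness, exactness and minimality for the relations starting in i\<close>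

declare pa_simps [simp del] PA.QA_simps [simp del] I0.QA_simps [simp del] path_end.simps [simp del]

abbreviation L where "L \<equiv> PA.QA"
abbreviation mult_L (infixl "\<bullet>" 70) where "x \<bullet> y \<equiv> x \<otimes>\<^bsub>L\<^esub> y"
abbreviation cl where "cl \<equiv> PA.cl"

lemma J2_i: "x \<in> J 2 \<Longrightarrow> x (v, []) = 0"
  by (fastforce simp: J_iff)

lemma idealG: "ideal (Idl\<^bsub>K\<^esub> (R - {s})) K"
  by (rule K.genideal_ideal) (use RsubK in blast)

lemma algG: "alg_ideal K (Idl\<^bsub>K\<^esub> (R - {s}))"
  by (intro alg_ideal.intro K.is_kalg idealG)

lemma R_G: "r \<in> R \<Longrightarrow> r \<noteq> s \<Longrightarrow> r \<in> Idl\<^bsub>K\<^esub> (R - {s})"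
  using K.genideal_self[of "R - {s}"] RsubK by blast

lemma I0_G: assumes "s \<in> Sr" shows "I0 \<subseteq> Idl\<^bsub>K\<^esub> (R - {s})"
  by (rule K.genideal_minimal[OF idealG], rule subsetI, rule R_G) (use assms in auto)

lemma not_G: "s \<in> R \<Longrightarrow> s \<notin> Idl\<^bsub>K\<^esub> (R - {s})"
  using minR by (simp add: minimal_relations_def)

text \<open>The combination with coefficients u contains no path of length at most n, so it lies in
  \<open>I0\<close> by \<open>long_I0\<close>. Its terms other than the one for s lie in the ideal
  generated by R without s; if u s were nonzero, s would lie there too.\<close>

lemma Sr_short_independent:
  assumes S: "finite S" "S \<subseteq> Sr" and n: "J n \<subseteq> I"
    and z: "\<And>p. length (snd p) \<le> n \<Longrightarrow> (\<Sum>r\<in>S. u r * r p) = 0" and s: "s \<in> S"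
  shows "u s = 0"
proof (rule ccontr)
  assume us: "u s \<noteq> 0"
  let ?G = "Idl\<^bsub>K\<^esub> (R - {s})"
  interpret G: alg_ideal K ?G by (rule algG)
  have SR: "r \<in> R" "r \<in> carrier K" "rel_src r = i" if "r \<in> S" for r using that S SrR RK by blast+
  let ?z = "\<Oplus>\<^bsub>K\<^esub>r\<in>S. u r \<odot>\<^bsub>K\<^esub> r"
  have zv: "?z = (\<lambda>p. \<Sum>r\<in>S. u r * r p)"
    using pa_finsum[OF finQ S(1), of "\<lambda>r. u r \<odot>\<^bsub>K\<^esub> r"] K.scal_closed SR by (simp add: pa_simps(4))
  have zK: "?z \<in> carrier K" by (rule K.finsum_closed) (use K.scal_closed SR in blast)
  have "?z p \<noteq> 0 \<longrightarrow> Suc n \<le> length (snd p)" for p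
    unfolding zv using z[of p] by linarith
  then have "?z \<in> J (Suc n)" using zK unfolding J_iff by blast
  moreover have "E \<cdot> ?z = ?z"
  proof
    fix p :: "('v, 'e) path"
    obtain v as where p: "p = (v, as)" by (cases p)
    have "?z (v, as) = 0" if v: "v \<noteq> i"
    proof -
      have "r (v, as) = 0" if r: "r \<in> S" for r
        using rel(1)[OF SR(1)[OF r], of "(v, as)"] SR(3)[OF r] v by fastforce
      then show ?thesis unfolding zv by (intro sum.neutral) simp
    qed
    then show "(E \<cdot> ?z) p = ?z p" unfolding p vx_mult_l by (cases "v = i") simp_all
  qed
  ultimately have zG: "?z \<in> ?G" using long_I0[OF _ _ n] I0_G[of s] S s by blast
  have rest: "(\<Oplus>\<^bsub>K\<^esub>r\<in>S - {s}. u r \<odot>\<^bsub>K\<^esub> r) \<in> ?G"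
    by (rule G.I_finsum) (use S G.I_scal R_G SR in blast)+
  have "?z = u s \<odot>\<^bsub>K\<^esub> s \<oplus>\<^bsub>K\<^esub> (\<Oplus>\<^bsub>K\<^esub>r\<in>S - {s}. u r \<odot>\<^bsub>K\<^esub> r)"
  proof -
    have "insert s (S - {s}) = S" using s by blast
    then show ?thesis
      using K.finsum_insert[of "S - {s}" s "\<lambda>r. u r \<odot>\<^bsub>K\<^esub> r"] S(1) s SR K.scal_closed by auto
  qed
  then have "u s \<odot>\<^bsub>K\<^esub> s \<in> ?G"
    using G.I_cancel[OF K.scal_closed[OF SR(2)[OF s], of "u s"] rest] zG by simp
  then have "inverse (u s) \<odot>\<^bsub>K\<^esub> (u s \<odot>\<^bsub>K\<^esub> s) \<in> ?G" by (rule G.I_scal)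
  then have "s \<in> ?G" using us K.scal_one[OF SR(2)[OF s]] K.scal_assoc[OF SR(2)[OF s], of "inverse (u s)" "u s"] by simp
  then show False using not_G SR(1)[OF s] by blast
qed

text \<open>A dependency among the relations cut off at a length \<open>n\<close> with \<open>J\<^sup>n \<subseteq> I\<close> would make one of
  them redundant, and there are only finitely many paths of length at most \<open>n\<close>.\<close>

lemma fin_Sr: "finite Sr"
proof -
  obtain n where n: "J n \<subseteq> I" using JnI by blast
  define B where "B = {p. is_path Q p \<and> length (snd p) \<le> n}"
  have finB: "finite B" unfolding B_def by (rule finite_short_paths[OF finQ])
  define tr where "tr r = (\<lambda>p. if p \<in> B then r p else 0)" for r :: "('v, 'e) path \<Rightarrow> 'k"
  interpret V: vector_space "\<lambda>(c::'k) f (p::('v, 'e) path). c * f p"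
    by unfold_locales (auto simp: fun_eq_iff algebra_simps)
  have fs: "(\<Sum>x\<in>X. h x) p = (\<Sum>x\<in>X. h x p)" for X and h :: "'x \<Rightarrow> ('v, 'e) path \<Rightarrow> 'k" and p
    by (induction X rule: infinite_finite_induct) simp_all
  have ind: "u s = 0" if S: "finite S" "S \<subseteq> Sr" and z: "(\<Sum>r\<in>S. (\<lambda>p. u r * tr r p)) = 0" and s: "s \<in> S" for S u s
  proof (rule Sr_short_independent[OF S n _ s])
    fix p :: "('v, 'e) path" assume l: "length (snd p) \<le> n"
    have "(\<Sum>r\<in>S. u r * tr r p) = 0" using fun_cong[OF z, of p] unfolding fs by simp
    moreover have "tr r p = r p" if "r \<in> S" for r
    proof (cases "r p = 0")
      case False
      then have "is_path Q p" using rel(4)[of r p] SrR(1) that S(2) by blast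
      then show ?thesis using l by (simp add: tr_def B_def)
    qed (simp add: tr_def)
    ultimately show "(\<Sum>r\<in>S. u r * r p) = 0" by simp
  qed
  \<comment> \<open>Two relations with the same truncation would give a dependency with coefficients
    1 and -1.\<close>
  have inj: "inj_on tr Sr"
  proof (rule inj_onI, rule ccontr)
    fix r s assume rs: "r \<in> Sr" "s \<in> Sr" "tr r = tr s" "r \<noteq> s"
    define u where "u x = (if x = r then 1 else - 1 :: 'k)" for x
    have "(\<Sum>x\<in>{r, s}. (\<lambda>p. u x * tr x p)) = 0" using rs by (auto simp: u_def fun_eq_iff)
    then have "u r = 0" using rs by (intro ind[of "{r, s}" u r]) auto
    then show False by (simp add: u_def)
  qed
  have "V.independent (tr ` Sr)"
    unfolding V.independent_explicit_finite_subsets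
  proof (intro allI impI ballI)
    fix S' and u :: "(('v, 'e) path \<Rightarrow> 'k) \<Rightarrow> 'k" and v
    assume S': "S' \<subseteq> tr ` Sr" "finite S'" and z: "(\<Sum>v\<in>S'. (\<lambda>p. u v * v p)) = 0" and v: "v \<in> S'"
    obtain S where S: "S \<subseteq> Sr" "S' = tr ` S" "finite S" using finite_subset_image[OF S'(2,1)] by blast
    have "inj_on tr S" using inj S(1) by (rule inj_on_subset)
    then have "(\<Sum>r\<in>S. (\<lambda>p. u (tr r) * tr r p)) = 0" using z unfolding S(2) by (simp add: sum.reindex)
    then have "\<forall>s\<in>S. u (tr s) = 0" using ind[OF S(3,1), of "\<lambda>r. u (tr r)"] by blast
    then show "u v = 0" using v S(2) by blast
  qed
  moreover have "tr ` Sr \<subseteq> V.span (path_elt ` B)"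
  proof
    fix x assume "x \<in> tr ` Sr"
    then obtain r where r: "x = tr r" by blast
    have "x = (\<Sum>b\<in>B. (\<lambda>p. r b * path_elt b p))"
    proof
      fix p
      have "(\<Sum>b\<in>B. r b * path_elt b p) = (\<Sum>b\<in>B. if b = p then r p else 0)"
        by (rule sum.cong) (auto simp: path_elt_def)
      then show "x p = (\<Sum>b\<in>B. (\<lambda>p. r b * path_elt b p)) p" unfolding fs r tr_def using finB by simp
    qed
    also have "\<dots> \<in> V.span (path_elt ` B)"
      by (intro V.span_sum V.span_scale V.span_base) blast
    finally show "x \<in> V.span (path_elt ` B)" .
  qed
  ultimately have "finite (tr ` Sr)"
    using V.independent_span_bound[OF finite_imageI[OF finB, of path_elt]] by blast
  then show ?thesis using inj by (rule finite_imageD)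
qed

lemma rel_comp_finsum:
  assumes "finite S" "\<And>s. s \<in> S \<Longrightarrow> h s \<in> carrier K"
  shows "rel_comp Q (\<Oplus>\<^bsub>K\<^esub>s\<in>S. h s) a = (\<Oplus>\<^bsub>K\<^esub>s\<in>S. rel_comp Q (h s) a)"
proof -
  have "(\<Oplus>\<^bsub>K\<^esub>s\<in>S. h s) = (\<lambda>p. \<Sum>s\<in>S. h s p)" by (rule pa_finsum[OF finQ assms])
  moreover have "(\<Oplus>\<^bsub>K\<^esub>s\<in>S. rel_comp Q (h s) a) = (\<lambda>p. \<Sum>s\<in>S. rel_comp Q (h s) a p)"
    by (rule pa_finsum[OF finQ assms(1)], rule rel_comp_closed, rule assms(2))
  ultimately show ?thesis by (simp add: fun_eq_iff rel_comp_val)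
qed

lemma rel_comp_arr:
  assumes "a \<in> arrows Q" "b \<in> arrows Q" "vx {tgt Q a} \<cdot> y = y"
  shows "rel_comp Q (arr Q a \<cdot> y) b = (if a = b then y else \<zero>\<^bsub>K\<^esub>)"
proof
  fix p :: "('v, 'e) path"
  obtain v as where p: "p = (v, as)" by (cases p)
  have "y (v, as) = (if v \<in> {tgt Q a} then y (v, as) else 0)"
    using vx_mult_l[where Q = Q and S = "{tgt Q a}" and x = y and v = v and as = as] unfolding assms(3) .
  then show "rel_comp Q (arr Q a \<cdot> y) b p = (if a = b then y else \<zero>\<^bsub>K\<^esub>) p"
    unfolding p rel_comp_val arr_mult by (auto simp: pa_simps split: if_splits)
qed

sublocale L: kalg L by (rule PA.QA_kalg)

abbreviation rho where "rho a r \<equiv> cl (rel_comp Q r a)"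

lemma rhoL: "r \<in> Sr \<Longrightarrow> rho a r \<in> carrier L"
  by (rule PA.cl_closed[OF rel_comp_closed[OF RK[OF SrR(1)]]])

text \<open>The z in I whose components are, modulo I, combinations of the columns of \<rho> form an
  ideal that contains R. For multiplication from the left: the component of y x at a is a multiple
  of the component of x, plus a product with x, which lies in I.\<close>

lemma I_exact:
  assumes z: "z \<in> I"
  shows "\<exists>\<xi>. (\<forall>r\<in>Sr. \<xi> r \<in> carrier L) \<and> (\<forall>a\<in>Sa. cl (rel_comp Q z a) = (\<Oplus>\<^bsub>L\<^esub>r\<in>Sr. rho a r \<bullet> \<xi> r))"
proof -
  define ok where "ok z \<xi> \<longleftrightarrow> (\<forall>r\<in>Sr. \<xi> r \<in> carrier L) \<and> (\<forall>a\<in>Sa. cl (rel_comp Q z a) = (\<Oplus>\<^bsub>L\<^esub>r\<in>Sr. rho a r \<bullet> \<xi> r))" for z \<xi>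
  have IK: "x \<in> carrier K" if "x \<in> I" for x using that PA.Icarr by blast
  have Ii: "x (i, []) = 0" if "x \<in> I" for x using J2_i[OF subsetD[OF IJ that]] .
  let ?S = "{z \<in> I. \<exists>\<xi>. ok z \<xi>}"
  have ok0: "ok z (\<lambda>_. \<zero>\<^bsub>L\<^esub>)" if "\<And>a. a \<in> Sa \<Longrightarrow> cl (rel_comp Q z a) = \<zero>\<^bsub>L\<^esub>" for z
  proof -
    have "(\<Oplus>\<^bsub>L\<^esub>r\<in>Sr. rho a r \<bullet> \<zero>\<^bsub>L\<^esub>) = \<zero>\<^bsub>L\<^esub>" for a
      by (rule L.add.finprod_one_eqI) (simp add: rhoL L.r_null)
    then show ?thesis using that L.zero_closed by (simp add: ok_def)
  qed
  have "ideal ?S K"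
  proof (rule K.ideal_intro)
    show "?S \<subseteq> carrier K" using IK by blast
    have "rel_comp Q \<zero>\<^bsub>K\<^esub> a = \<zero>\<^bsub>K\<^esub>" for a by (auto simp: fun_eq_iff rel_comp_val pa_simps)
    then have "ok \<zero>\<^bsub>K\<^esub> (\<lambda>_. \<zero>\<^bsub>L\<^esub>)" using PA.cl_zero by (intro ok0) simp
    then show "\<zero>\<^bsub>K\<^esub> \<in> ?S" using PA.zero_closed by blast
  next
    fix x y assume "x \<in> ?S" "y \<in> ?S"
    then obtain \<xi> \<eta> where x: "x \<in> I" "ok x \<xi>" and y: "y \<in> I" "ok y \<eta>" by blast
    have "cl (rel_comp Q (x \<oplus>\<^bsub>K\<^esub> y) a) = (\<Oplus>\<^bsub>L\<^esub>r\<in>Sr. rho a r \<bullet> (\<xi> r \<oplus>\<^bsub>L\<^esub> \<eta> r))" if a: "a \<in> Sa" for a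
    proof -
      have c: "\<xi> r \<in> carrier L" "\<eta> r \<in> carrier L" if "r \<in> Sr" for r using x(2) y(2) that unfolding ok_def by blast+
      have "rel_comp Q (x \<oplus>\<^bsub>K\<^esub> y) a = rel_comp Q x a \<oplus>\<^bsub>K\<^esub> rel_comp Q y a"
        by (auto simp: fun_eq_iff rel_comp_val pa_simps)
      then have "cl (rel_comp Q (x \<oplus>\<^bsub>K\<^esub> y) a) = cl (rel_comp Q x a) \<oplus>\<^bsub>L\<^esub> cl (rel_comp Q y a)"
        using PA.cl_add[OF rel_comp_closed[OF IK[OF x(1)]] rel_comp_closed[OF IK[OF y(1)]]] by simp
      also have "\<dots> = (\<Oplus>\<^bsub>L\<^esub>r\<in>Sr. rho a r \<bullet> \<xi> r) \<oplus>\<^bsub>L\<^esub> (\<Oplus>\<^bsub>L\<^esub>r\<in>Sr. rho a r \<bullet> \<eta> r)"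
        using x(2) y(2) a unfolding ok_def by simp
      also have "\<dots> = (\<Oplus>\<^bsub>L\<^esub>r\<in>Sr. rho a r \<bullet> \<xi> r \<oplus>\<^bsub>L\<^esub> rho a r \<bullet> \<eta> r)"
        by (rule L.finsum_addf[symmetric]) (use rhoL c L.m_closed in blast)+
      also have "\<dots> = (\<Oplus>\<^bsub>L\<^esub>r\<in>Sr. rho a r \<bullet> (\<xi> r \<oplus>\<^bsub>L\<^esub> \<eta> r))"
        by (rule L.finsum_cong') (use rhoL c L.m_closed L.add.m_closed L.r_distr in \<open>simp_all add: Pi_def\<close>)
      finally show ?thesis .
    qed
    moreover have "\<forall>r\<in>Sr. \<xi> r \<oplus>\<^bsub>L\<^esub> \<eta> r \<in> carrier L" using x(2) y(2) L.add.m_closed unfolding ok_def by blast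
    ultimately have "ok (x \<oplus>\<^bsub>K\<^esub> y) (\<lambda>r. \<xi> r \<oplus>\<^bsub>L\<^esub> \<eta> r)" unfolding ok_def by blast
    then show "x \<oplus>\<^bsub>K\<^esub> y \<in> ?S" using PA.a_closed[OF x(1) y(1)] by blast
  next
    fix x y assume "x \<in> ?S" and y: "y \<in> carrier K"
    then obtain \<xi> where x: "x \<in> I" "ok x \<xi>" by blast
    have c: "\<xi> r \<in> carrier L" if "r \<in> Sr" for r using x(2) that unfolding ok_def by blast
    note rc = rel_comp_closed[OF IK[OF x(1)]]
    \<comment> \<open>Elements of I contain no trivial path, so the second term of
      \<open>rel_comp_mult\<close> is zero.\<close>
    have e: "rel_comp Q (x \<cdot> y) a = rel_comp Q x a \<cdot> y" if "a \<in> Sa" for a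
    proof -
      have "src Q a = i" using that by simp
      then show ?thesis unfolding rel_comp_mult Ii[OF x(1)] by (simp add: Ii[OF x(1)] pa_simps)
    qed
    have "cl (rel_comp Q (x \<cdot> y) a) = (\<Oplus>\<^bsub>L\<^esub>r\<in>Sr. rho a r \<bullet> (\<xi> r \<bullet> cl y))" if a: "a \<in> Sa" for a
    proof -
      have "cl (rel_comp Q (x \<cdot> y) a) = (\<Oplus>\<^bsub>L\<^esub>r\<in>Sr. rho a r \<bullet> \<xi> r) \<bullet> cl y"
        using e[OF a] PA.cl_mult[OF rc y] x(2) a unfolding ok_def by simp
      also have "\<dots> = (\<Oplus>\<^bsub>L\<^esub>r\<in>Sr. (rho a r \<bullet> \<xi> r) \<bullet> cl y)"
        by (rule L.finsum_ldistr[OF fin_Sr PA.cl_closed[OF y]]) (use rhoL c L.m_closed in blast)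
      also have "\<dots> = (\<Oplus>\<^bsub>L\<^esub>r\<in>Sr. rho a r \<bullet> (\<xi> r \<bullet> cl y))"
        by (rule L.finsum_cong') (use rhoL c L.m_closed PA.cl_closed[OF y] L.m_assoc in \<open>simp_all add: Pi_def\<close>)
      finally show ?thesis .
    qed
    moreover have "\<forall>r\<in>Sr. \<xi> r \<bullet> cl y \<in> carrier L" using c L.m_closed PA.cl_closed[OF y] by blast
    ultimately have "ok (x \<cdot> y) (\<lambda>r. \<xi> r \<bullet> cl y)" unfolding ok_def by blast
    then show "x \<cdot> y \<in> ?S" using PA.I_r_closed[OF x(1) y] by blast
    have "cl (rel_comp Q (y \<cdot> x) a) = (\<Oplus>\<^bsub>L\<^esub>r\<in>Sr. rho a r \<bullet> (y (i, []) \<odot>\<^bsub>L\<^esub> \<xi> r))" if a: "a \<in> Sa" for a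
    proof -
      have si: "src Q a = i" using a by simp
      have m: "rel_comp Q y a \<cdot> x \<in> I" by (rule PA.I_l_closed[OF x(1) rel_comp_closed[OF y]])
      have "cl (rel_comp Q (y \<cdot> x) a) = cl (rel_comp Q y a \<cdot> x) \<oplus>\<^bsub>L\<^esub> cl (y (i, []) \<odot>\<^bsub>K\<^esub> rel_comp Q x a)"
        unfolding rel_comp_mult si by (rule PA.cl_add[OF IK[OF m] K.scal_closed[OF rc]])
      also have "\<dots> = y (i, []) \<odot>\<^bsub>L\<^esub> cl (rel_comp Q x a)"
        using PA.cl_eq_zero[OF IK[OF m]] m PA.cl_scal[OF rc] L.l_zero[OF L.scal_closed[OF PA.cl_closed[OF rc]]] by simp
      also have "\<dots> = y (i, []) \<odot>\<^bsub>L\<^esub> (\<Oplus>\<^bsub>L\<^esub>r\<in>Sr. rho a r \<bullet> \<xi> r)" using x(2) a unfolding ok_def by simp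
      also have "\<dots> = (\<Oplus>\<^bsub>L\<^esub>r\<in>Sr. y (i, []) \<odot>\<^bsub>L\<^esub> (rho a r \<bullet> \<xi> r))"
        by (rule L.scal_finsum) (use fin_Sr rhoL c L.m_closed in blast)+
      also have "\<dots> = (\<Oplus>\<^bsub>L\<^esub>r\<in>Sr. rho a r \<bullet> (y (i, []) \<odot>\<^bsub>L\<^esub> \<xi> r))"
        by (rule L.finsum_cong') (use rhoL c L.m_closed L.scal_closed L.scal_mult_r in \<open>simp_all add: Pi_def\<close>)
      finally show ?thesis .
    qed
    moreover have "\<forall>r\<in>Sr. y (i, []) \<odot>\<^bsub>L\<^esub> \<xi> r \<in> carrier L" using c L.scal_closed by blast
    ultimately have "ok (y \<cdot> x) (\<lambda>r. y (i, []) \<odot>\<^bsub>L\<^esub> \<xi> r)" unfolding ok_def by blast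
    then show "y \<cdot> x \<in> ?S" using PA.I_l_closed[OF x(1) y] by blast
  qed
  moreover have "R \<subseteq> ?S"
  proof
    fix s assume s: "s \<in> R"
    have sI: "s \<in> I" using K.genideal_self[OF RsubK] s by blast
    have "\<exists>\<xi>. ok s \<xi>"
    proof (cases "s \<in> Sr")
      case True
      \<comment> \<open>The components of a relation starting in i form one of the columns of
        \<rho>, so a unit column serves as coefficients.\<close>
      let ?\<xi> = "\<lambda>r. if r = s then \<one>\<^bsub>L\<^esub> else \<zero>\<^bsub>L\<^esub>"
      have "(\<Oplus>\<^bsub>L\<^esub>r\<in>Sr. rho a r \<bullet> ?\<xi> r) = rho a s" for a
      proof -
        have "(\<Oplus>\<^bsub>L\<^esub>r\<in>Sr. rho a r \<bullet> ?\<xi> r) = (\<Oplus>\<^bsub>L\<^esub>r\<in>Sr. if s = r then rho a r else \<zero>\<^bsub>L\<^esub>)"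
          by (rule L.finsum_cong') (use rhoL L.zero_closed L.r_one L.r_null in \<open>auto simp: Pi_def\<close>)
        also have "\<dots> = rho a s" by (rule L.add.finprod_singleton[OF True fin_Sr]) (use rhoL in blast)
        finally show ?thesis .
      qed
      then have "ok s ?\<xi>" using L.one_closed L.zero_closed by (simp add: ok_def)
      then show ?thesis by blast
    next
      case False
      then have "rel_src s \<noteq> i" using s by (simp add: rels_from_def)
      then have "rel_comp Q s a = \<zero>\<^bsub>K\<^esub>" if "a \<in> Sa" for a
        using rel(1)[OF s] that by (fastforce simp: fun_eq_iff rel_comp_val pa_simps)
      then have "ok s (\<lambda>_. \<zero>\<^bsub>L\<^esub>)" using PA.cl_zero by (intro ok0) simp
      then show ?thesis by blast
    qed
    then show "s \<in> ?S" using sI by blast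
  qed
  ultimately have "I \<subseteq> ?S" by (rule K.genideal_minimal)
  then show ?thesis using z unfolding ok_def by blast
qed

text \<open>If x had a nonzero coefficient at the trivial path, rescaling it would give t in J 1
  with s t congruent to s modulo the ideal generated by R without s. Then s is congruent to s t^m
  for every m; for large m this lies in \<open>I0\<close>, hence in that ideal, against
  minimality.\<close>

lemma rel_xs_G:
  assumes s: "s \<in> Sr" and x: "x \<in> carrier K" "vx {rel_tgt Q s} \<cdot> x = x"
    and sx: "s \<cdot> x \<in> Idl\<^bsub>K\<^esub> (R - {s})"
  shows "x \<in> J 1"
proof -
  let ?u = "rel_tgt Q s"
  have sR: "s \<in> R" and sK: "s \<in> carrier K" using SrR(1)[OF s] RK by blast+
  have xu: "x (v, as) = 0" if "v \<noteq> ?u" for v as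
    using vx_mult_l[where Q = Q and S = "{?u}" and x = x and v = v and as = as] that unfolding x(2) by simp
  have "x (?u, []) = 0"
  proof (rule ccontr)
    assume c: "x (?u, []) \<noteq> 0"
    interpret G: alg_ideal K "Idl\<^bsub>K\<^esub> (R - {s})" by (rule algG)
    interpret QG: kalg G.QA by (rule G.QA_kalg)
    \<comment> \<open>Chosen so that the coefficient of t at the trivial path is 1 - 1 = 0.\<close>
    define d where "d = - inverse (x (?u, []))"
    define t where "t = vx {?u} \<oplus>\<^bsub>K\<^esub> d \<odot>\<^bsub>K\<^esub> x"
    have vK: "vx {?u} \<in> carrier K" using vxK1 rel_tgtV(1)[OF sR] by blast
    have dx: "d \<odot>\<^bsub>K\<^esub> x \<in> carrier K" by (rule K.scal_closed[OF x(1)])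
    have tK: "t \<in> carrier K" unfolding t_def by (rule K.add.m_closed[OF vK dx])
    have t1: "t \<in> J 1"
    proof -
      have "t (v, []) = 0" for v using xu[of v "[]"] c by (simp add: t_def pa_simps vx_def d_def)
      then have "1 \<le> length as" if "t (v, as) \<noteq> 0" for v as using that by (cases as) auto
      then show ?thesis using tK by (auto simp: J_iff)
    qed
    have st: "G.cl s \<otimes>\<^bsub>G.QA\<^esub> G.cl t = G.cl s"
    proof -
      have "s \<cdot> t = s \<oplus>\<^bsub>K\<^esub> d \<odot>\<^bsub>K\<^esub> (s \<cdot> x)"
        unfolding t_def K.r_distr[OF vK dx sK] rel_tgt_mult[OF sR] K.scal_mult_r[OF sK x(1)] ..
      then have "G.cl (s \<cdot> t) = G.cl s \<oplus>\<^bsub>G.QA\<^esub> G.cl (d \<odot>\<^bsub>K\<^esub> (s \<cdot> x))"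
        using G.cl_add[OF sK] G.Icarr[OF G.I_scal[OF sx]] by simp
      also have "G.cl (d \<odot>\<^bsub>K\<^esub> (s \<cdot> x)) = \<zero>\<^bsub>G.QA\<^esub>"
        using G.cl_eq_zero[OF G.Icarr[OF G.I_scal[OF sx]]] G.I_scal[OF sx] by blast
      also have "G.cl s \<oplus>\<^bsub>G.QA\<^esub> \<zero>\<^bsub>G.QA\<^esub> = G.cl s" by (rule QG.r_zero[OF G.cl_closed[OF sK]])
      finally show ?thesis using G.cl_mult[OF sK tK] by simp
    qed
    have "\<exists>y\<in>J m. G.cl s \<otimes>\<^bsub>G.QA\<^esub> G.cl y = G.cl s" for m
    proof (induction m)
      case 0
      have "\<one>\<^bsub>K\<^esub> \<in> J 0" using K.one_closed by (simp add: J_iff)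
      moreover have "G.cl s \<otimes>\<^bsub>G.QA\<^esub> G.cl \<one>\<^bsub>K\<^esub> = G.cl s"
        unfolding G.cl_one by (rule QG.r_one[OF G.cl_closed[OF sK]])
      ultimately show ?case by blast
    next
      case (Suc m)
      then obtain y where y: "y \<in> J m" "G.cl s \<otimes>\<^bsub>G.QA\<^esub> G.cl y = G.cl s" by blast
      have yK: "y \<in> carrier K" by (rule J_K[OF y(1)])
      have "G.cl s \<otimes>\<^bsub>G.QA\<^esub> G.cl (t \<cdot> y) = (G.cl s \<otimes>\<^bsub>G.QA\<^esub> G.cl t) \<otimes>\<^bsub>G.QA\<^esub> G.cl y"
        unfolding G.cl_mult[OF tK yK] by (rule QG.m_assoc[symmetric]) (rule G.cl_closed sK tK yK)+
      then have "G.cl s \<otimes>\<^bsub>G.QA\<^esub> G.cl (t \<cdot> y) = G.cl s" unfolding st y(2) .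
      moreover have "t \<cdot> y \<in> J (Suc m)" using J_mult[OF t1 y(1)] by simp
      ultimately show ?case by blast
    qed
    moreover obtain n where n: "J n \<subseteq> I" using JnI by blast
    ultimately obtain y where y: "y \<in> J n" "G.cl s \<otimes>\<^bsub>G.QA\<^esub> G.cl y = G.cl s" by blast
    have yK: "y \<in> carrier K" by (rule J_K[OF y(1)])
    have sy: "s \<cdot> y \<in> J (2 + n)" by (rule J_mult[OF rel_J[OF sR] y(1)])
    \<comment> \<open>The paths of s have length at least 2, one more than \<open>long_I0\<close>
      asks for.\<close>
    have "s \<cdot> y \<in> J (Suc n)" using sy by (fastforce simp: J_iff)
    moreover have "E \<cdot> (s \<cdot> y) = s \<cdot> y"
      unfolding pa_assoc[symmetric] rel_src_mult[OF sR] using SrR(2)[OF s] by simp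
    ultimately have "s \<cdot> y \<in> I0" by (rule long_I0[OF _ _ n])
    then have "s \<cdot> y \<in> Idl\<^bsub>K\<^esub> (R - {s})" using I0_G[OF s] by blast
    then have "G.cl (s \<cdot> y) = \<zero>\<^bsub>G.QA\<^esub>" using G.cl_eq_zero[OF K.m_closed[OF sK yK]] by blast
    then have "G.cl s = \<zero>\<^bsub>G.QA\<^esub>" using y(2) G.cl_mult[OF sK yK] by simp
    then show False using G.cl_eq_zero[OF sK] not_G[OF sR] by blast
  qed
  then have "1 \<le> length as" if "x (v, as) \<noteq> 0" for v as using that xu[of v as] by (cases "v = ?u"; cases as) auto
  then show ?thesis using x(1) by (auto simp: J_iff)
qed

text \<open>Lift the coefficients to elements x r of kQ and let w be the sum of the r (x r). Its
  component at a is the sum of the products of r_a and x r, an element of I by assumption; hence w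
  lies in \<open>I0\<close>. Removing the terms for the other relations leaves s (x s) in the ideal
  generated by R without s, and \<open>rel_xs_G\<close> applies.\<close>

lemma minim:
  assumes z: "\<And>r. r \<in> Sr \<Longrightarrow> z r \<in> carrier L" "\<And>r. r \<in> Sr \<Longrightarrow> cl (vx {rel_tgt Q r}) \<bullet> z r = z r"
    "\<And>a. a \<in> Sa \<Longrightarrow> (\<Oplus>\<^bsub>L\<^esub>r\<in>Sr. rho a r \<bullet> z r) = \<zero>\<^bsub>L\<^esub>" and s: "s \<in> Sr"
  shows "z s \<in> cl ` J 1"
proof -
  have "\<forall>r\<in>Sr. \<exists>x. x \<in> carrier K \<and> z r = cl x" using z(1) PA.QA_carrier by blast
  from bchoice[OF this] obtain rep where
    rep: "\<And>r. r \<in> Sr \<Longrightarrow> rep r \<in> carrier K" "\<And>r. r \<in> Sr \<Longrightarrow> z r = cl (rep r)" by blast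
  \<comment> \<open>Multiplied by the trivial path at the end of r, so that the condition of
    \<open>rel_xs_G\<close> on the start of x holds in kQ and not only modulo I.\<close>
  define x where "x r = vx {rel_tgt Q r} \<cdot> rep r" for r
  have SK: "r \<in> carrier K" if "r \<in> Sr" for r using RK SrR(1) that by blast
  have vK: "vx {rel_tgt Q r} \<in> carrier K" if "r \<in> Sr" for r using vxK1 rel_tgtV(1) SrR(1) that by blast
  have xK: "x r \<in> carrier K" if "r \<in> Sr" for r unfolding x_def by (rule K.m_closed[OF vK[OF that] rep(1)[OF that]])
  have clx: "cl (x r) = z r" if "r \<in> Sr" for r
    unfolding x_def PA.cl_mult[OF vK[OF that] rep(1)[OF that]] rep(2)[OF that, symmetric] by (rule z(2)[OF that])
  have xe: "vx {rel_tgt Q r} \<cdot> x r = x r" for r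
    unfolding x_def pa_assoc[symmetric] vx_idem ..
  have m: "r \<cdot> x r \<in> carrier K" if "r \<in> Sr" for r by (rule K.m_closed[OF SK[OF that] xK[OF that]])
  define w where "w = (\<Oplus>\<^bsub>K\<^esub>r\<in>Sr. r \<cdot> x r)"
  have wK: "w \<in> carrier K" unfolding w_def by (rule K.finsum_closed) (use m in blast)
  have mc: "rel_comp Q r a \<cdot> x r \<in> carrier K" if "r \<in> Sr" for r a
    by (rule K.m_closed[OF rel_comp_closed[OF SK[OF that]] xK[OF that]])
  have r0: "r (v, []) = 0" if "r \<in> Sr" for r v using J2_i[OF rel_J[OF SrR(1)[OF that]]] .
  have wc: "rel_comp Q w a = (\<Oplus>\<^bsub>K\<^esub>r\<in>Sr. rel_comp Q r a \<cdot> x r)" for a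
  proof -
    have e: "rel_comp Q (r \<cdot> x r) a = rel_comp Q r a \<cdot> x r" if "r \<in> Sr" for r
      unfolding rel_comp_mult r0[OF that] by (simp add: pa_simps)
    have "rel_comp Q w a = (\<Oplus>\<^bsub>K\<^esub>r\<in>Sr. rel_comp Q (r \<cdot> x r) a)"
      unfolding w_def by (rule rel_comp_finsum[OF fin_Sr]) (rule m)
    also have "\<dots> = (\<Oplus>\<^bsub>K\<^esub>r\<in>Sr. rel_comp Q r a \<cdot> x r)"
      by (rule K.finsum_cong'[OF refl]) (use mc in blast, rule e)
    finally show ?thesis .
  qed
  have wI: "rel_comp Q w a \<in> I" if a: "a \<in> Sa" for a
  proof -
    have "cl (rel_comp Q w a) = (\<Oplus>\<^bsub>L\<^esub>r\<in>Sr. rho a r \<bullet> cl (x r))"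
      unfolding wc by (rule PA.cl_sum_mult[OF fin_Sr rel_comp_closed[OF SK] xK])
    also have "\<dots> = (\<Oplus>\<^bsub>L\<^esub>r\<in>Sr. rho a r \<bullet> z r)"
      by (rule L.finsum_cong'[OF refl]) (use rhoL z(1) L.m_closed in blast, simp only: clx)
    finally show ?thesis using z(3)[OF a] PA.cl_eq_zero[OF rel_comp_closed[OF wK]] by simp
  qed
  have wE: "E \<cdot> w = w"
  proof -
    have "E \<cdot> w = (\<Oplus>\<^bsub>K\<^esub>r\<in>Sr. E \<cdot> (r \<cdot> x r))"
      unfolding w_def by (rule K.finsum_rdistr[OF fin_Sr EK]) (use m in blast)
    also have "\<dots> = w" unfolding w_def
    proof (rule K.finsum_cong'[OF refl])
      show "E \<cdot> (r \<cdot> x r) = r \<cdot> x r" if "r \<in> Sr" for r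
        unfolding pa_assoc[symmetric] rel_src_mult[OF SrR(1)[OF that]] using SrR(2)[OF that] by simp
    qed (use m in blast)
    finally show ?thesis .
  qed
  have wv: "w = (\<lambda>p. \<Sum>r\<in>Sr. (r \<cdot> x r) p)" unfolding w_def by (rule pa_finsum[OF finQ fin_Sr]) (rule m)
  have w0: "w (i, []) = 0" unfolding wv by (intro sum.neutral ballI) (simp add: pa_mult r0)
  have sI: "(\<Oplus>\<^bsub>K\<^esub>a\<in>Sa. arr Q a \<cdot> rel_comp Q w a) \<in> I0"
    by (rule I0.I_finsum[OF fin_Sa]) (use arr_I wI in blast)
  have "w = (\<Oplus>\<^bsub>K\<^esub>a\<in>Sa. arr Q a \<cdot> rel_comp Q w a)"
    using E_decomp[OF wK] unfolding wE w0 K.scal_zero_l[OF EK] K.l_zero[OF I0.Icarr[OF sI]] .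
  then have "w \<in> I0" using sI by simp
  then have wG: "w \<in> Idl\<^bsub>K\<^esub> (R - {s})" using I0_G[OF s] by blast
  interpret G: alg_ideal K "Idl\<^bsub>K\<^esub> (R - {s})" by (rule algG)
  have rest: "(\<Oplus>\<^bsub>K\<^esub>r\<in>Sr - {s}. r \<cdot> x r) \<in> Idl\<^bsub>K\<^esub> (R - {s})"
  proof (rule G.I_finsum)
    fix r assume r: "r \<in> Sr - {s}"
    then have "r \<in> Idl\<^bsub>K\<^esub> (R - {s})" using R_G SrR(1) by blast
    then show "r \<cdot> x r \<in> Idl\<^bsub>K\<^esub> (R - {s})" by (rule G.I_r_closed) (use r xK in blast)
  qed (use fin_Sr in simp)
  have "w = s \<cdot> x s \<oplus>\<^bsub>K\<^esub> (\<Oplus>\<^bsub>K\<^esub>r\<in>Sr - {s}. r \<cdot> x r)"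
  proof -
    have "insert s (Sr - {s}) = Sr" using s by blast
    then show ?thesis
      using K.finsum_insert[of "Sr - {s}" s "\<lambda>r. r \<cdot> x r"] fin_Sr m s by (auto simp: w_def)
  qed
  then have "s \<cdot> x s \<in> Idl\<^bsub>K\<^esub> (R - {s})" using G.I_cancel[OF m[OF s] rest] wG by simp
  then have "x s \<in> J 1" by (rule rel_xs_G[OF s xK[OF s] xe])
  then show ?thesis using clx[OF s] by blast
qed

text \<open>Elements of I contain no trivial path, so the coefficient at a trivial path is well
  defined modulo I: it is 1 for the idempotent and 0 on J 1.\<close>

lemma vx_notin: assumes "u \<in> verts Q" shows "cl (vx {u}) \<notin> cl ` J 1"
proof
  assume "cl (vx {u}) \<in> cl ` J 1"
  then obtain x where x: "x \<in> J 1" "cl (vx {u}) = cl x" by blast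
  have xK: "x \<in> carrier K" by (rule J_K[OF x(1)])
  have "vx {u} \<ominus>\<^bsub>K\<^esub> x \<in> I" using x(2) PA.cl_eq[OF vxK1[OF assms] xK] by simp
  then have "(vx {u} \<ominus>\<^bsub>K\<^esub> x) (u, []) = 0" using J2_i IJ by blast
  moreover have "x (u, []) = 0" using x(1) by (fastforce simp: J_iff)
  ultimately show False using pa_minus[OF finQ vxK1[OF assms] xK] by (simp add: vx_def)
qed

lemma nil_filt_L: "nil_filt L (\<lambda>m. cl ` J m)"
  unfolding nil_filt_def
proof (intro conjI allI ballI)
  have "J 0 = carrier K" by (auto simp: J_iff)
  then show "cl ` J 0 = carrier L" using PA.QA_carrier by blast
  show "additive_subgroup (cl ` J m) L" for m
  proof (rule L.additive_subgroup_intro)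
    show "cl ` J m \<subseteq> carrier L" using PA.cl_closed J_K by blast
    show "\<zero>\<^bsub>L\<^esub> \<in> cl ` J m" unfolding PA.cl_zero[symmetric] by (rule imageI[OF J_zero])
    show "x \<oplus>\<^bsub>L\<^esub> y \<in> cl ` J m" if xy: "x \<in> cl ` J m" "y \<in> cl ` J m" for x y
    proof -
      obtain x' y' where x: "x' \<in> J m" "x = cl x'" and y: "y' \<in> J m" "y = cl y'" using xy by blast
      show ?thesis unfolding x(2) y(2) PA.cl_add[OF J_K[OF x(1)] J_K[OF y(1)], symmetric]
        by (rule imageI[OF J_add[OF x(1) y(1)]])
    qed
    show "c \<odot>\<^bsub>L\<^esub> x \<in> cl ` J m" if "x \<in> cl ` J m" for c x
    proof -
      obtain x' where x: "x' \<in> J m" "x = cl x'" using \<open>x \<in> cl ` J m\<close> by blast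
      show ?thesis unfolding x(2) PA.cl_scal[OF J_K[OF x(1)], symmetric] by (rule imageI[OF J_scal[OF x(1)]])
    qed
  qed
  show "x \<bullet> y \<in> cl ` J (m + n)" if xy: "x \<in> cl ` J m" "y \<in> cl ` J n" for m n x y
  proof -
    obtain x' y' where x: "x' \<in> J m" "x = cl x'" and y: "y' \<in> J n" "y = cl y'" using xy by blast
    show ?thesis unfolding x(2) y(2) PA.cl_mult[OF J_K[OF x(1)] J_K[OF y(1)], symmetric]
      by (rule imageI[OF J_mult[OF x(1) y(1)]])
  qed
  obtain n where n: "J n \<subseteq> I" using JnI by blast
  have "cl ` J n \<subseteq> {\<zero>\<^bsub>L\<^esub>}" using n PA.cl_eq_zero[OF J_K] by blast
  moreover have "cl \<zero>\<^bsub>K\<^esub> \<in> cl ` J n" by (rule imageI[OF J_zero])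
  ultimately show "\<exists>n. cl ` J n = {\<zero>\<^bsub>L\<^esub>}" by blast
qed

text \<open>Lift each x a to an element y a of kQ whose paths start at the end of a. The sum z of
  the products a (y a) lies in I and has components y a, so \<open>I_exact\<close> gives the
  coefficients.\<close>

lemma exact_L:
  assumes x: "\<And>a. a \<in> Sa \<Longrightarrow> x a \<in> carrier L" "\<And>a. a \<in> Sa \<Longrightarrow> cl (vx {tgt Q a}) \<bullet> x a = x a"
    "(\<Oplus>\<^bsub>L\<^esub>a\<in>Sa. cl (arr Q a) \<bullet> x a) = \<zero>\<^bsub>L\<^esub>"
  shows "\<exists>z. (\<forall>r\<in>Sr. z r \<in> carrier L \<and> cl (vx {rel_tgt Q r}) \<bullet> z r = z r) \<and>
    (\<forall>a\<in>Sa. x a = (\<Oplus>\<^bsub>L\<^esub>r\<in>Sr. rho a r \<bullet> z r))"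
proof -
  have "\<forall>a\<in>Sa. \<exists>y. y \<in> carrier K \<and> x a = cl y" using x(1) PA.QA_carrier by blast
  from bchoice[OF this] obtain rep where
    rep: "\<And>a. a \<in> Sa \<Longrightarrow> rep a \<in> carrier K" "\<And>a. a \<in> Sa \<Longrightarrow> x a = cl (rep a)" by blast
  define y where "y a = vx {tgt Q a} \<cdot> rep a" for a
  have vK: "vx {tgt Q a} \<in> carrier K" if "a \<in> Sa" for a using vxK1 tgtV that by blast
  have aK: "arr Q a \<in> carrier K" if "a \<in> Sa" for a using arrK that by blast
  have yK: "y a \<in> carrier K" if "a \<in> Sa" for a unfolding y_def by (rule K.m_closed[OF vK[OF that] rep(1)[OF that]])
  have cly: "cl (y a) = x a" if "a \<in> Sa" for a
    unfolding y_def PA.cl_mult[OF vK[OF that] rep(1)[OF that]] rep(2)[OF that, symmetric] by (rule x(2)[OF that])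
  have ye: "vx {tgt Q a} \<cdot> y a = y a" for a
    unfolding y_def pa_assoc[symmetric] vx_idem ..
  have m: "arr Q a \<cdot> y a \<in> carrier K" if "a \<in> Sa" for a by (rule K.m_closed[OF aK[OF that] yK[OF that]])
  define z where "z = (\<Oplus>\<^bsub>K\<^esub>a\<in>Sa. arr Q a \<cdot> y a)"
  have zK: "z \<in> carrier K" unfolding z_def by (rule K.finsum_closed) (use m in blast)
  have "cl z = (\<Oplus>\<^bsub>L\<^esub>a\<in>Sa. cl (arr Q a) \<bullet> cl (y a))" unfolding z_def by (rule PA.cl_sum_mult[OF fin_Sa aK yK])
  also have "\<dots> = (\<Oplus>\<^bsub>L\<^esub>a\<in>Sa. cl (arr Q a) \<bullet> x a)"
    by (rule L.finsum_cong'[OF refl]) (use aK x(1) L.m_closed PA.cl_closed in blast, simp only: cly)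
  finally have "z \<in> I" using PA.cl_eq_zero[OF zK] x(3) by simp
  from I_exact[OF this] obtain \<xi> where \<xi>0: "(\<forall>r\<in>Sr. \<xi> r \<in> carrier L) \<and>
      (\<forall>a\<in>Sa. cl (rel_comp Q z a) = (\<Oplus>\<^bsub>L\<^esub>r\<in>Sr. rho a r \<bullet> \<xi> r))" ..
  have \<xi>: "\<xi> r \<in> carrier L" if "r \<in> Sr" for r using \<xi>0 that by blast
  have \<xi>s: "cl (rel_comp Q z a) = (\<Oplus>\<^bsub>L\<^esub>r\<in>Sr. rho a r \<bullet> \<xi> r)" if "a \<in> Sa" for a using \<xi>0 that by blast
  have zc: "rel_comp Q z b = y b" if b: "b \<in> Sa" for b
  proof -
    have "rel_comp Q z b = (\<Oplus>\<^bsub>K\<^esub>a\<in>Sa. if b = a then y a else \<zero>\<^bsub>K\<^esub>)"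
      unfolding z_def
    proof (rule trans[OF rel_comp_finsum[OF fin_Sa] K.finsum_cong'[OF refl]])
      show "arr Q a \<cdot> y a \<in> carrier K" if "a \<in> Sa" for a by (rule m[OF that])
      show "(\<lambda>a. if b = a then y a else \<zero>\<^bsub>K\<^esub>) \<in> Sa \<rightarrow> carrier K" using yK K.zero_closed by simp
      show "rel_comp Q (arr Q a \<cdot> y a) b = (if b = a then y a else \<zero>\<^bsub>K\<^esub>)" if "a \<in> Sa" for a
        using rel_comp_arr[OF _ _ ye, of a b] that b by auto
    qed
    also have "\<dots> = y b" by (rule K.add.finprod_singleton[OF b fin_Sa]) (use yK in blast)
    finally show ?thesis .
  qed
  let ?e = "\<lambda>r. cl (vx {rel_tgt Q r})"
  have eL: "?e r \<in> carrier L" if "r \<in> Sr" for r by (rule PA.cl_closed[OF vxK1[OF rel_tgtV(1)[OF SrR(1)[OF that]]]])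
  have ee: "?e r \<bullet> ?e r = ?e r" if "r \<in> Sr" for r
    using vxK1[OF rel_tgtV(1)[OF SrR(1)[OF that]]] by (simp add: PA.cl_mult[symmetric] vx_idem)
  have re: "rho a r \<bullet> ?e r = rho a r" if "r \<in> Sr" for a r
    using vxK1[OF rel_tgtV(1)[OF SrR(1)[OF that]]] rel_comp_closed[OF RK[OF SrR(1)[OF that]], of a]
    by (simp add: PA.cl_mult[symmetric] rel_comp_tgt[OF SrR(1)[OF that]])
  show ?thesis
  \<comment> \<open>The coefficients found need not be fixed by the idempotent at the end of r.
    Multiplying by it achieves this and does not change the sums, since it fixes r_a from the
    right.\<close>
  proof (intro exI[of _ "\<lambda>r. ?e r \<bullet> \<xi> r"] conjI ballI)
    fix r assume r: "r \<in> Sr"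
    show "?e r \<bullet> \<xi> r \<in> carrier L" by (rule L.m_closed[OF eL[OF r] \<xi>[OF r]])
    show "?e r \<bullet> (?e r \<bullet> \<xi> r) = ?e r \<bullet> \<xi> r"
      unfolding L.m_assoc[OF eL[OF r] eL[OF r] \<xi>[OF r], symmetric] ee[OF r] ..
  next
    fix a assume a: "a \<in> Sa"
    have "x a = (\<Oplus>\<^bsub>L\<^esub>r\<in>Sr. rho a r \<bullet> \<xi> r)" using \<xi>s[OF a] zc[OF a] cly[OF a] by simp
    also have "\<dots> = (\<Oplus>\<^bsub>L\<^esub>r\<in>Sr. rho a r \<bullet> (?e r \<bullet> \<xi> r))"
    proof (rule L.finsum_cong'[OF refl])
      show "(\<lambda>r. rho a r \<bullet> (?e r \<bullet> \<xi> r)) \<in> Sr \<rightarrow> carrier L" using eL \<xi> rhoL L.m_closed by blast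
      show "rho a r \<bullet> \<xi> r = rho a r \<bullet> (?e r \<bullet> \<xi> r)" if r: "r \<in> Sr" for r
        unfolding L.m_assoc[OF rhoL[OF r] eL[OF r] \<xi>[OF r], symmetric] re[OF r] ..
    qed
    finally show "x a = (\<Oplus>\<^bsub>L\<^esub>r\<in>Sr. rho a r \<bullet> (?e r \<bullet> \<xi> r))" .
  qed
qed

lemma rho_alpha:
  assumes r: "r \<in> Sr" shows "(\<Oplus>\<^bsub>L\<^esub>a\<in>Sa. cl (arr Q a) \<bullet> rho a r) = \<zero>\<^bsub>L\<^esub>"
proof -
  have rK: "r \<in> carrier K" by (rule RK[OF SrR(1)[OF r]])
  have "(\<Oplus>\<^bsub>L\<^esub>a\<in>Sa. cl (arr Q a) \<bullet> rho a r) = cl (\<Oplus>\<^bsub>K\<^esub>a\<in>Sa. arr Q a \<cdot> rel_comp Q r a)"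
    by (rule PA.cl_sum_mult[OF fin_Sa _ rel_comp_closed[OF rK], symmetric]) (use arrK in blast)
  also have "\<dots> = cl r" unfolding rel_decomp[OF r, symmetric] ..
  also have "\<dots> = \<zero>\<^bsub>L\<^esub>" using PA.cl_eq_zero[OF rK] K.genideal_self[OF RsubK] SrR(1)[OF r] by blast
  finally show ?thesis .
qed

lemma span_L:
  assumes x: "x \<in> carrier L" "cl E \<bullet> x = x"
  shows "\<exists>c y. (\<forall>a\<in>Sa. y a \<in> carrier L \<and> cl (vx {tgt Q a}) \<bullet> y a = y a) \<and>
    x = c \<odot>\<^bsub>L\<^esub> cl E \<oplus>\<^bsub>L\<^esub> (\<Oplus>\<^bsub>L\<^esub>a\<in>Sa. cl (arr Q a) \<bullet> y a)"
proof -
  obtain z where z: "z \<in> carrier K" "x = cl z" using x(1) PA.QA_carrier by blast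
  note rc = rel_comp_closed[OF z(1)]
  have m: "arr Q a \<cdot> rel_comp Q z a \<in> carrier K" if "a \<in> Sa" for a
    by (rule K.m_closed[OF _ rc]) (use arrK that in blast)
  have "x = cl (E \<cdot> z)" using x(2) z(2) PA.cl_mult[OF EK z(1)] by simp
  also have "\<dots> = cl (z (i, []) \<odot>\<^bsub>K\<^esub> E) \<oplus>\<^bsub>L\<^esub> cl (\<Oplus>\<^bsub>K\<^esub>a\<in>Sa. arr Q a \<cdot> rel_comp Q z a)"
    unfolding E_decomp[OF z(1)] by (rule PA.cl_add[OF K.scal_closed[OF EK] K.finsum_closed]) (use m in blast)
  also have "cl (z (i, []) \<odot>\<^bsub>K\<^esub> E) = z (i, []) \<odot>\<^bsub>L\<^esub> cl E" by (rule PA.cl_scal[OF EK])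
  also have "cl (\<Oplus>\<^bsub>K\<^esub>a\<in>Sa. arr Q a \<cdot> rel_comp Q z a) = (\<Oplus>\<^bsub>L\<^esub>a\<in>Sa. cl (arr Q a) \<bullet> cl (rel_comp Q z a))"
    by (rule PA.cl_sum_mult[OF fin_Sa _ rc]) (use arrK in blast)
  finally have eq: "x = z (i, []) \<odot>\<^bsub>L\<^esub> cl E \<oplus>\<^bsub>L\<^esub> (\<Oplus>\<^bsub>L\<^esub>a\<in>Sa. cl (arr Q a) \<bullet> cl (rel_comp Q z a))" .
  have "cl (vx {tgt Q a}) \<bullet> cl (rel_comp Q z a) = cl (rel_comp Q z a)" if "a \<in> Sa" for a
    using PA.cl_mult[OF vxK1[OF tgtV[of a]] rc[of a]] that rel_comp_src by simp
  then show ?thesis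
    by (intro exI[of _ "z (i, [])"] exI[of _ "\<lambda>a. cl (rel_comp Q z a)"] conjI ballI PA.cl_closed[OF rc] eq)
qed

text \<open>Applies the predicate X of a locale, \<open>apr\<close> or one built on it, to the data
  of kQ/(R).\<close>

abbreviation over_L where
  "over_L X \<equiv> X L (cl E) Sa Sr (\<lambda>a. cl (vx {tgt Q a})) (\<lambda>r. cl (vx {rel_tgt Q r})) (\<lambda>a. cl (arr Q a))
    (\<lambda>a r. cl (rel_comp Q r a)) (\<lambda>m. cl ` J m)"

lemma apr_L:
  assumes "fdmod L (reg_mod L)"
  shows "over_L apr"
proof (intro apr.intro apr_axioms.intro)
  show "kalg L" by (rule L.is_kalg)
  show "fdmod L (reg_mod L)" by fact
  show "nil_filt L (\<lambda>m. cl ` J m)" by (rule nil_filt_L)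
  show "finite Sa" by (rule fin_Sa)
  show "finite Sr" by (rule fin_Sr)
  show "cl E \<in> carrier L" by (rule PA.cl_closed[OF EK])
  show "cl E \<bullet> cl E = cl E" unfolding PA.cl_mult[OF EK EK, symmetric] vx_idem ..
  show "cl E \<notin> cl ` J 1" by (rule vx_notin[OF iV])
  show "\<exists>c. x \<bullet> cl E = c \<odot>\<^bsub>L\<^esub> cl E" if x: "x \<in> carrier L" for x
  proof -
    obtain z where z: "z \<in> carrier K" "x = cl z" using x PA.QA_carrier by blast
    show ?thesis unfolding z(2) PA.cl_mult[OF z(1) EK, symmetric] K_E[OF z(1)] PA.cl_scal[OF EK] by blast
  qed
  have id: "idem L S (\<lambda>s. cl (vx {h s}))" if "\<And>s. s \<in> S \<Longrightarrow> h s \<in> verts Q" for S and h :: "'x \<Rightarrow> 'v"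
    unfolding idem_def
  proof (intro ballI conjI)
    fix s assume "s \<in> S"
    then have v: "vx {h s} \<in> carrier K" by (intro vxK1 that)
    show "cl (vx {h s}) \<in> carrier L" by (rule PA.cl_closed[OF v])
    show "cl (vx {h s}) \<bullet> cl (vx {h s}) = cl (vx {h s})" unfolding PA.cl_mult[OF v v, symmetric] vx_idem ..
  qed
  show "idem L Sa (\<lambda>a. cl (vx {tgt Q a}))" by (rule id) (use tgtV in blast)
  show "idem L Sr (\<lambda>r. cl (vx {rel_tgt Q r}))" by (rule id) (use rel_tgtV(1) SrR(1) in blast)
  show "cl (vx {tgt Q a}) \<notin> cl ` J 1" if "a \<in> Sa" for a by (rule vx_notin) (use tgtV that in blast)
  show "cl (vx {rel_tgt Q r}) \<notin> cl ` J 1" if "r \<in> Sr" for r by (rule vx_notin[OF rel_tgtV(1)[OF SrR(1)[OF that]]])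
  show "cl (arr Q a) \<in> cl ` J 1" if "a \<in> Sa" for a by (rule imageI[OF arr_J]) (use that in blast)
  show "cl E \<bullet> cl (arr Q a) = cl (arr Q a)" if a: "a \<in> Sa" for a
    using PA.cl_mult[OF EK arrK[of a]] arr_src[of a] a by simp
  show "cl (arr Q a) \<bullet> cl (vx {tgt Q a}) = cl (arr Q a)" if a: "a \<in> Sa" for a
    using PA.cl_mult[OF arrK[of a] vxK1[OF tgtV[of a]]] arr_tgt[of a] a by simp
  show "rho a r \<in> cl ` J 1" if "r \<in> Sr" for a r by (rule imageI[OF rel_comp_J[OF SrR(1)[OF that]]])
  show "cl (vx {tgt Q a}) \<bullet> rho a r = rho a r" if "a \<in> Sa" "r \<in> Sr" for a r
    using PA.cl_mult[OF vxK1[OF tgtV[of a]] rel_comp_closed[OF RK[OF SrR(1)[OF that(2)]], of a]] that(1) rel_comp_src by simp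
  show "rho a r \<bullet> cl (vx {rel_tgt Q r}) = rho a r" if "a \<in> Sa" "r \<in> Sr" for a r
    using PA.cl_mult[OF rel_comp_closed[OF RK[OF SrR(1)[OF that(2)]], of a] vxK1[OF rel_tgtV(1)[OF SrR(1)[OF that(2)]]]]
      rel_comp_tgt[OF SrR(1)[OF that(2)]] by simp
qed (fact rho_alpha exact_L minim span_L)+

end

subsection \<open>The new quiver\<close>

context bq
begin

abbreviation Q' where "Q' \<equiv> new_quiver Q R i"
abbreviation K' where "K' \<equiv> path_algebra Q'"
abbreviation mult_K' (infixl "\<star>" 70) where "x \<star> y \<equiv> x \<otimes>\<^bsub>K'\<^esub> y"

lemma new_simps:
  "verts Q' = verts Q" "src Q' (Inl a) = src Q a" "src Q' (Inr r) = rel_tgt Q r"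
  "tgt Q' (Inl a) = tgt Q a" "tgt Q' (Inr r) = i"
  "Inl a \<in> arrows Q' \<longleftrightarrow> a \<in> arrows Q \<and> src Q a \<noteq> i" "Inr r \<in> arrows Q' \<longleftrightarrow> r \<in> Sr"
  by (auto simp: new_quiver_def)

lemma fin_new: "finite_quiver Q'"
proof -
  have "finite (arrows Q)" using finQ by (simp add: finite_quiver_def)
  then have "finite (arrows Q')" using fin_Sr by (simp add: new_quiver_def)
  moreover have "src Q' b \<in> verts Q \<and> tgt Q' b \<in> verts Q" if "b \<in> arrows Q'" for b
  proof (cases b)
    case (Inl a)
    then show ?thesis using that finQ by (simp add: new_simps finite_quiver_def)
  next
    case (Inr r)
    then have "r \<in> Sr" using that by (simp add: new_simps)
    then show ?thesis using rel_tgtV(1)[OF SrR(1)] iV Inr by (simp add: new_simps)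
  qed
  ultimately show ?thesis using finV by (simp add: finite_quiver_def new_simps)
qed

sublocale K': kalg K' by (rule pa_kalg[OF fin_new])

text \<open>The old arrows starting in i have been removed and no relation ends in i, so i is a sink
  of the new quiver.\<close>

lemma new_path_i: "is_path Q' (i, bs) \<longleftrightarrow> bs = []"
proof (cases bs)
  case (Cons b bs')
  then show ?thesis using rel_tgtV(2) SrR(1) by (cases b) (auto simp: new_simps)
qed (simp add: new_simps iV)

lemma new_path_old: "v \<noteq> i \<Longrightarrow> is_path Q' (v, map Inl as) \<longleftrightarrow> is_path Q (v, as)"
proof (induction as arbitrary: v)
  case (Cons a as)
  show ?case
  proof (cases "a \<in> arrows Q")
    case True
    then show ?thesis using Cons.IH[OF tgt_ne[OF True]] Cons.prems by (auto simp: new_simps)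
  qed (simp add: new_simps)
qed (simp add: new_simps)

text \<open>A new arrow leads into the sink i, so it can occur only as the last arrow of a
  path.\<close>

lemma new_path_cases:
  assumes "is_path Q' (v, bs)" "v \<noteq> i"
  shows "(\<exists>as. bs = map Inl as) \<or> (\<exists>as. \<exists>r\<in>Sr. bs = map Inl as @ [Inr r])"
  using assms
proof (induction bs arbitrary: v)
  case Nil
  show ?case by (intro disjI1 exI[of _ "[]"]) simp
next
  case (Cons b bs)
  have bp: "b \<in> arrows Q'" "is_path Q' (tgt Q' b, bs)" using Cons.prems by simp_all
  show ?case
  proof (cases b)
    case (Inl a)
    then have "tgt Q' b \<noteq> i" using bp(1) tgt_ne by (simp add: new_simps)
    from Cons.IH[OF bp(2) this] show ?thesis
    proof (elim disjE exE bexE)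
      fix as assume "bs = map Inl as"
      then have "b # bs = map Inl (a # as)" using Inl by simp
      then show ?thesis by (rule disjI1[OF exI])
    next
      fix as r assume r: "r \<in> Sr" "bs = map Inl as @ [Inr r]"
      then have "b # bs = map Inl (a # as) @ [Inr r]" using Inl by simp
      then show ?thesis by (intro disjI2 exI bexI[OF _ r(1)])
    qed
  next
    case (Inr r)
    then have "bs = []" "r \<in> Sr" using bp by (simp_all add: new_simps new_path_i)
    then have "b # bs = map Inl [] @ [Inr r]" using Inr by simp
    then show ?thesis by (intro disjI2 exI bexI[OF _ \<open>r \<in> Sr\<close>])
  qed
qed

lemma new_path_end: "path_end Q' (v, map Inl as) = path_end Q (v, as)"
  by (cases as rule: rev_cases) (simp_all add: path_end.simps new_simps)

lemma K'_path: "x \<in> carrier K' \<Longrightarrow> x p \<noteq> 0 \<Longrightarrow> is_path Q' p"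
  unfolding pa_simps by blast

text \<open>The components of an element of \<open>kQ'\<close> at \<open>e\<^sub>i\<close>, at the paths without new arrows, and at the
  paths ending with \<open>r\<^sup>*\<close>. Every new arrow ends in the sink \<open>i\<close>, so there are no other paths.\<close>

definition cm :: "(('v, ('v, 'e, 'k) new_arrow) path \<Rightarrow> 'k) \<Rightarrow> 'k" where
  "cm x = x (i, [])"
definition om :: "(('v, ('v, 'e, 'k) new_arrow) path \<Rightarrow> 'k) \<Rightarrow> ('v, 'e) path \<Rightarrow> 'k" where
  "om x = (\<lambda>(v, as). if v \<noteq> i then x (v, map Inl as) else 0)"
definition wm :: "(('v, ('v, 'e, 'k) new_arrow) path \<Rightarrow> 'k) \<Rightarrow> (('v, 'e) path \<Rightarrow> 'k) \<Rightarrow> ('v, 'e) path \<Rightarrow> 'k" where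
  "wm x r = (\<lambda>(v, as). x (v, map Inl as @ [Inr r]))"

lemma om_val: "om x (v, as) = (if v \<noteq> i then x (v, map Inl as) else 0)"
  by (simp add: om_def)
lemma wm_val: "wm x r (v, as) = x (v, map Inl as @ [Inr r])"
  by (simp add: wm_def)

lemma om_path: assumes "x \<in> carrier K'" "om x (v, as) \<noteq> 0" shows "v \<noteq> i" "is_path Q (v, as)"
proof -
  show v: "v \<noteq> i" using assms(2) by (auto simp: om_val)
  then have "is_path Q' (v, map Inl as)" using assms(2) by (intro K'_path[OF assms(1)]) (simp add: om_val)
  then show "is_path Q (v, as)" using new_path_old[OF v] by blast
qed

lemma wm_path:
  assumes "x \<in> carrier K'" "wm x r (v, as) \<noteq> 0"
  shows "v \<noteq> i" "is_path Q (v, as)" "path_end Q (v, as) = rel_tgt Q r"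
proof -
  have p: "is_path Q' (v, map Inl as @ [Inr r])" using K'_path[OF assms(1)] assms(2) by (simp add: wm_val)
  show v: "v \<noteq> i" using p new_path_i by fastforce
  note p' = p[unfolded is_path_append]
  show "is_path Q (v, as)" using p' new_path_old[OF v] by blast
  show "path_end Q (v, as) = rel_tgt Q r" using p' unfolding new_path_end by (simp add: new_simps)
qed

lemma om_closed: assumes "x \<in> carrier K'" shows "om x \<in> carrier K"
proof -
  have fin: "finite {p. x p \<noteq> 0}" using assms unfolding pa_simps by blast
  have "{p. om x p \<noteq> 0} \<subseteq> (\<lambda>(v, as). (v, map Inl as)) -` {p. x p \<noteq> 0}"
    by (auto simp: om_def split: if_splits)
  moreover have "inj (\<lambda>(v, as). (v, map Inl as) :: ('v, ('v, 'e, 'k) new_arrow) path)"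
    by (auto simp: inj_def dest!: map_injective)
  ultimately have "finite {p. om x p \<noteq> 0}" using finite_vimageI[OF fin] finite_subset by blast
  moreover have "is_path Q p" if "om x p \<noteq> 0" for p using om_path(2)[OF assms] that by (cases p) blast
  ultimately show ?thesis unfolding pa_simps by blast
qed

lemma wm_closed: assumes "x \<in> carrier K'" shows "wm x r \<in> carrier K"
proof -
  have fin: "finite {p. x p \<noteq> 0}" using assms unfolding pa_simps by blast
  have "{p. wm x r p \<noteq> 0} \<subseteq> (\<lambda>(v, as). (v, map Inl as @ [Inr r])) -` {p. x p \<noteq> 0}"
    by (auto simp: wm_def)
  moreover have "inj (\<lambda>(v, as). (v, map Inl as @ [Inr r]) :: ('v, ('v, 'e, 'k) new_arrow) path)"
    by (auto simp: inj_def dest!: map_injective)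
  ultimately have "finite {p. wm x r p \<noteq> 0}" using finite_vimageI[OF fin] finite_subset by blast
  moreover have "is_path Q p" if "wm x r p \<noteq> 0" for p using wm_path(2)[OF assms] that by (cases p) blast
  ultimately show ?thesis unfolding pa_simps by blast
qed

lemma F_mult_iff: assumes "x \<in> carrier K" shows "F \<cdot> x = x \<longleftrightarrow> (\<forall>as. x (i, as) = 0)"
proof
  assume "F \<cdot> x = x"
  then show "\<forall>as. x (i, as) = 0" using vx_mult_l[where Q = Q and S = "verts Q - {i}" and x = x and v = i] by simp
next
  assume x: "\<forall>as. x (i, as) = 0"
  show "F \<cdot> x = x"
  proof
    fix p :: "('v, 'e) path"
    obtain v as where p: "p = (v, as)" by (cases p)
    have "x (v, as) = 0" if "v \<notin> verts Q"
      using that is_path_src[of Q v as] assms unfolding pa_simps by blast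
    then show "(F \<cdot> x) p = x p" unfolding p vx_mult_l using x by auto
  qed
qed

lemma om_F: "x \<in> carrier K' \<Longrightarrow> F \<cdot> om x = om x"
  unfolding F_mult_iff[OF om_closed] by (simp add: om_val)

lemma wm_F: "x \<in> carrier K' \<Longrightarrow> F \<cdot> wm x r = wm x r"
  unfolding F_mult_iff[OF wm_closed] using wm_path(1) by blast

lemma wm_tgt: assumes "x \<in> carrier K'" shows "wm x r \<cdot> vx {rel_tgt Q r} = wm x r"
proof
  fix p :: "('v, 'e) path"
  obtain v as where p: "p = (v, as)" by (cases p)
  show "(wm x r \<cdot> vx {rel_tgt Q r}) p = wm x r p"
    unfolding p vx_mult_r using wm_path(3)[OF assms, of r v as] by auto
qed

lemma cm_simps:
  "cm (x \<oplus>\<^bsub>K'\<^esub> y) = cm x + cm y" "cm (c \<odot>\<^bsub>K'\<^esub> x) = c * cm x" "cm (x \<star> y) = cm x * cm y" "cm \<zero>\<^bsub>K'\<^esub> = 0"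
  by (simp_all add: cm_def pa_simps pa_mult path_end.simps)

lemma om_simps:
  "om (x \<oplus>\<^bsub>K'\<^esub> y) = om x \<oplus>\<^bsub>K\<^esub> om y" "om (c \<odot>\<^bsub>K'\<^esub> x) = c \<odot>\<^bsub>K\<^esub> om x" "om \<zero>\<^bsub>K'\<^esub> = \<zero>\<^bsub>K\<^esub>"
  by (auto simp: om_def pa_simps fun_eq_iff)

lemma wm_simps:
  "wm (x \<oplus>\<^bsub>K'\<^esub> y) r = wm x r \<oplus>\<^bsub>K\<^esub> wm y r" "wm (c \<odot>\<^bsub>K'\<^esub> x) r = c \<odot>\<^bsub>K\<^esub> wm x r" "wm \<zero>\<^bsub>K'\<^esub> r = \<zero>\<^bsub>K\<^esub>"
  by (auto simp: wm_def pa_simps fun_eq_iff)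

text \<open>When an old path not starting in i is cut, the second piece does not start in i either,
  as no old path from another vertex reaches the source; so \<open>om y\<close> retains its
  coefficient.\<close>

lemma om_mult:
  assumes x: "x \<in> carrier K'"
  shows "om (x \<star> y) = om x \<cdot> om y"
proof
  fix p :: "('v, 'e) path"
  obtain v as where p: "p = (v, as)" by (cases p)
  show "om (x \<star> y) p = (om x \<cdot> om y) p"
  proof (cases "v = i")
    case True
    then show ?thesis unfolding p om_val pa_mult by simp
  next
    case False
    have "x (v, map Inl (take n as)) * y (path_end Q (v, take n as), map Inl (drop n as)) =
        om x (v, take n as) * om y (path_end Q (v, take n as), drop n as)" for n
    proof (cases "om x (v, take n as) = 0")
      case False
      then have "path_end Q (v, take n as) \<noteq> i" using om_path[OF x False] path_to_i by blast
      then show ?thesis using \<open>v \<noteq> i\<close> by (simp add: om_val)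
    qed (use False in \<open>simp add: om_val\<close>)
    then have "(\<Sum>n\<le>length as. x (v, map Inl (take n as)) * y (path_end Q (v, take n as), map Inl (drop n as))) =
        (om x \<cdot> om y) (v, as)" unfolding pa_mult by (intro sum.cong refl)
    then show ?thesis unfolding p om_val pa_mult[where x = x] using False
      by (simp add: take_map drop_map new_path_end)
  qed
qed

text \<open>A path ending with a new arrow is cut either behind that arrow, where the trivial path
  at i is left for y, or in front of it, where the first piece is an old path. This gives the two
  terms.\<close>

lemma wm_mult:
  assumes x: "x \<in> carrier K'" and y: "y \<in> carrier K'"
  shows "wm (x \<star> y) r = cm y \<odot>\<^bsub>K\<^esub> wm x r \<oplus>\<^bsub>K\<^esub> om x \<cdot> wm y r"
proof
  fix p :: "('v, 'e) path"
  obtain v as where p: "p = (v, as)" by (cases p)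
  show "wm (x \<star> y) r p = (cm y \<odot>\<^bsub>K\<^esub> wm x r \<oplus>\<^bsub>K\<^esub> om x \<cdot> wm y r) p"
  proof (cases "v = i")
    case True
    have "wm (x \<star> y) r (i, as) = 0" using wm_path(1)[OF K'.m_closed[OF x y]] by blast
    moreover have "wm x r (i, as) = 0" using wm_path(1)[OF x] by blast
    moreover have "(om x \<cdot> wm y r) (i, as) = 0" unfolding pa_mult by (simp add: om_val)
    ultimately show ?thesis unfolding p True by (simp add: pa_simps)
  next
    case False
    let ?f = "\<lambda>n. x (v, take n (map Inl as @ [Inr r])) * y (path_end Q' (v, take n (map Inl as @ [Inr r])), drop n (map Inl as @ [Inr r]))"
    have "?f n = om x (v, take n as) * wm y r (path_end Q (v, take n as), drop n as)" if "n \<le> length as" for n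
      using that False by (simp add: take_map drop_map new_path_end om_val wm_val)
    then have "(\<Sum>n\<le>length as. ?f n) = (om x \<cdot> wm y r) (v, as)" unfolding pa_mult by (intro sum.cong) simp_all
    moreover have "?f (Suc (length as)) = cm y * wm x r (v, as)"
      by (simp add: path_end.simps new_simps cm_def wm_val)
    ultimately show ?thesis unfolding p wm_val pa_mult pa_simps by (simp add: wm_val pa_mult)
  qed
qed

lemma K'_ext:
  assumes x: "x \<in> carrier K'" and y: "y \<in> carrier K'" and "cm x = cm y" "om x = om y" "\<And>r. r \<in> Sr \<Longrightarrow> wm x r = wm y r"
  shows "x = y"
proof
  fix p :: "('v, ('v, 'e, 'k) new_arrow) path"
  obtain v bs where p: "p = (v, bs)" by (cases p)
  show "x p = y p"
  proof (cases "is_path Q' (v, bs)")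
    case False
    then show ?thesis using K'_path[OF x] K'_path[OF y] unfolding p by metis
  next
    case path: True
    show ?thesis
    proof (cases "v = i")
      case True
      then show ?thesis using path assms(3) unfolding p True new_path_i by (simp add: cm_def)
    next
      case v: False
      from new_path_cases[OF path v] show ?thesis
      proof (elim disjE exE bexE)
        fix as assume "bs = map Inl as"
        then show ?thesis using fun_cong[OF assms(4), of "(v, as)"] v unfolding p om_val by simp
      next
        fix as r assume r: "r \<in> Sr" "bs = map Inl as @ [Inr r]"
        then show ?thesis using fun_cong[OF assms(5)[OF r(1)], of "(v, as)"] unfolding p wm_val by simp
      qed
    qed
  qed
qed

lemma old_val: "old_elt y (v, map Inl as) = y (v, as)" "old_elt y (v, bs @ [Inr r]) = 0"
  by (simp_all add: old_elt_def o_def)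

lemma old_comp: assumes "y \<in> carrier K" "F \<cdot> y = y"
  shows "cm (old_elt y) = 0" "om (old_elt y) = y" "wm (old_elt y) r = \<zero>\<^bsub>K\<^esub>"
proof -
  have yi: "y (i, as) = 0" for as using assms F_mult_iff by blast
  show "cm (old_elt y) = 0" using old_val(1)[of y i "[]"] yi by (simp add: cm_def)
  show "om (old_elt y) = y" by (auto simp: fun_eq_iff om_val old_val yi)
  show "wm (old_elt y) r = \<zero>\<^bsub>K\<^esub>" by (auto simp: fun_eq_iff wm_val old_val pa_simps)
qed

lemma old_closed: assumes y: "y \<in> carrier K" "F \<cdot> y = y" shows "old_elt y \<in> carrier K'"
proof -
  have old: "\<exists>as. bs = map Inl as \<and> y (v, as) \<noteq> 0" if "old_elt y (v, bs) \<noteq> 0" for v bs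
  proof -
    have "\<forall>b\<in>set bs. isl b" "y (v, map projl bs) \<noteq> 0" using that by (auto simp: old_elt_def split: if_splits)
    moreover have "bs = map Inl (map projl bs)" using calculation(1) by (induction bs) auto
    ultimately show ?thesis by blast
  qed
  have "{p. old_elt y p \<noteq> 0} \<subseteq> (\<lambda>(v, as). (v, map Inl as)) ` {p. y p \<noteq> 0}"
  proof
    fix p assume "p \<in> {p. old_elt y p \<noteq> 0}"
    then obtain v bs where p: "p = (v, bs)" "old_elt y (v, bs) \<noteq> 0" by (cases p) blast
    from old[OF p(2)] obtain as where "bs = map Inl as" "y (v, as) \<noteq> 0" by blast
    then show "p \<in> (\<lambda>(v, as). (v, map Inl as)) ` {p. y p \<noteq> 0}" unfolding p(1) by force
  qed
  moreover have "finite {p. y p \<noteq> 0}" using y(1) unfolding pa_simps by blast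
  ultimately have "finite {p. old_elt y p \<noteq> 0}" using finite_subset finite_imageI by blast
  moreover have "is_path Q' (v, bs)" if nz: "old_elt y (v, bs) \<noteq> 0" for v bs
  proof -
    obtain as where as: "bs = map Inl as" "y (v, as) \<noteq> 0" using old[OF nz] by blast
    have "v \<noteq> i" using as(2) y F_mult_iff by blast
    moreover have "is_path Q (v, as)" using as(2) y(1) unfolding pa_simps by blast
    ultimately show ?thesis unfolding as(1) using new_path_old by blast
  qed
  ultimately show ?thesis unfolding pa_simps by (metis surj_pair)
qed

lemma old_add: "old_elt (x \<oplus>\<^bsub>K\<^esub> y) = old_elt x \<oplus>\<^bsub>K'\<^esub> old_elt y"
  by (auto simp: old_elt_def pa_simps fun_eq_iff)

lemma old_zero: "old_elt \<zero>\<^bsub>K\<^esub> = \<zero>\<^bsub>K'\<^esub>"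
  by (auto simp: old_elt_def pa_simps fun_eq_iff)

lemma F_mult: "F \<cdot> x = x \<Longrightarrow> F \<cdot> (x \<cdot> y) = x \<cdot> y"
  unfolding pa_assoc[symmetric] by simp

lemma old_mult:
  assumes x: "x \<in> carrier K" "F \<cdot> x = x" and y: "y \<in> carrier K" "F \<cdot> y = y"
  shows "old_elt (x \<cdot> y) = old_elt x \<star> old_elt y"
proof (rule K'_ext)
  note xy = K.m_closed[OF x(1) y(1)] F_mult[OF x(2)]
  note X = old_closed[OF x] and Y = old_closed[OF y]
  show "old_elt (x \<cdot> y) \<in> carrier K'" by (rule old_closed[OF xy])
  show "old_elt x \<star> old_elt y \<in> carrier K'" by (rule K'.m_closed[OF X Y])
  show "cm (old_elt (x \<cdot> y)) = cm (old_elt x \<star> old_elt y)"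
    unfolding cm_simps old_comp[OF xy] old_comp[OF x] by simp
  show "om (old_elt (x \<cdot> y)) = om (old_elt x \<star> old_elt y)"
    unfolding om_mult[OF X] old_comp[OF xy] old_comp[OF x] old_comp[OF y] ..
  show "wm (old_elt (x \<cdot> y)) r = wm (old_elt x \<star> old_elt y) r" for r
    unfolding wm_mult[OF X Y] old_comp[OF xy] old_comp[OF x] old_comp[OF y] K.r_null[OF x(1)]
    by (simp add: pa_simps)
qed

abbreviation nr :: "(('v, 'e) path \<Rightarrow> 'k) \<Rightarrow> ('v, ('v, 'e, 'k) new_arrow) path \<Rightarrow> 'k" where
  "nr r \<equiv> path_elt (rel_tgt Q r, [Inr r])"

lemma nr_comp:
  "cm (nr r) = 0" "om (nr r) = \<zero>\<^bsub>K\<^esub>" "wm (nr r) s = (if s = r then vx {rel_tgt Q r} else \<zero>\<^bsub>K\<^esub>)"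
  by (auto simp: cm_def om_def wm_def path_elt_def vx_def pa_simps fun_eq_iff Cons_eq_map_conv Cons_eq_append_conv)

lemma nr_closed: "r \<in> Sr \<Longrightarrow> nr r \<in> carrier K'"
proof -
  assume r: "r \<in> Sr"
  have "{p. nr r p \<noteq> 0} \<subseteq> {(rel_tgt Q r, [Inr r])}" by (auto simp: path_elt_def split: if_splits)
  then have "finite {p. nr r p \<noteq> 0}" by (rule finite_subset) simp
  moreover have "is_path Q' (rel_tgt Q r, [Inr r])"
    using r rel_tgtV(1)[OF SrR(1)[OF r]] iV by (simp add: new_simps)
  ultimately show ?thesis unfolding pa_simps by (auto simp: path_elt_def split: if_splits)
qed

lemma new_term:
  assumes y: "y \<in> carrier K" "F \<cdot> y = y" and r: "r \<in> Sr"
  shows "old_elt y \<star> nr r \<in> carrier K'" "cm (old_elt y \<star> nr r) = 0" "om (old_elt y \<star> nr r) = \<zero>\<^bsub>K\<^esub>"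
    "wm (old_elt y \<star> nr r) s = (if s = r then y \<cdot> vx {rel_tgt Q r} else \<zero>\<^bsub>K\<^esub>)"
proof -
  note Y = old_closed[OF y] and N = nr_closed[OF r]
  show "old_elt y \<star> nr r \<in> carrier K'" by (rule K'.m_closed[OF Y N])
  show "cm (old_elt y \<star> nr r) = 0" unfolding cm_simps nr_comp by simp
  show "om (old_elt y \<star> nr r) = \<zero>\<^bsub>K\<^esub>" unfolding om_mult[OF Y] nr_comp old_comp[OF y] by (rule K.r_null[OF y(1)])
  show "wm (old_elt y \<star> nr r) s = (if s = r then y \<cdot> vx {rel_tgt Q r} else \<zero>\<^bsub>K\<^esub>)"
    unfolding wm_mult[OF Y N] nr_comp old_comp[OF y] using K.r_null[OF y(1)] by (simp add: pa_simps)
qed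

lemma comp_finsum:
  assumes "finite S" "\<And>s. s \<in> S \<Longrightarrow> h s \<in> carrier K'"
  shows "cm (\<Oplus>\<^bsub>K'\<^esub>s\<in>S. h s) = (\<Sum>s\<in>S. cm (h s))" "om (\<Oplus>\<^bsub>K'\<^esub>s\<in>S. h s) = (\<Oplus>\<^bsub>K\<^esub>s\<in>S. om (h s))"
    "wm (\<Oplus>\<^bsub>K'\<^esub>s\<in>S. h s) r = (\<Oplus>\<^bsub>K\<^esub>s\<in>S. wm (h s) r)"
proof -
  have 1: "(\<Oplus>\<^bsub>K'\<^esub>s\<in>S. h s) = (\<lambda>p. \<Sum>s\<in>S. h s p)" by (rule pa_finsum[OF fin_new assms])
  have 2: "(\<Oplus>\<^bsub>K\<^esub>s\<in>S. om (h s)) = (\<lambda>p. \<Sum>s\<in>S. om (h s) p)"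
    by (rule pa_finsum[OF finQ assms(1)], rule om_closed, rule assms(2))
  have 3: "(\<Oplus>\<^bsub>K\<^esub>s\<in>S. wm (h s) r) = (\<lambda>p. \<Sum>s\<in>S. wm (h s) r p)"
    by (rule pa_finsum[OF finQ assms(1)], rule wm_closed, rule assms(2))
  show "cm (\<Oplus>\<^bsub>K'\<^esub>s\<in>S. h s) = (\<Sum>s\<in>S. cm (h s))" unfolding 1 by (simp add: cm_def)
  show "om (\<Oplus>\<^bsub>K'\<^esub>s\<in>S. h s) = (\<Oplus>\<^bsub>K\<^esub>s\<in>S. om (h s))" unfolding 1 2 by (auto simp: fun_eq_iff om_val)
  show "wm (\<Oplus>\<^bsub>K'\<^esub>s\<in>S. h s) r = (\<Oplus>\<^bsub>K\<^esub>s\<in>S. wm (h s) r)" unfolding 1 3 by (auto simp: fun_eq_iff wm_val)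
qed

text \<open>The components at the new arrows can be prescribed independently of each other, as long
  as their paths avoid i as start and end where the new arrow starts.\<close>

lemma new_sum:
  assumes u: "\<And>r. r \<in> Sr \<Longrightarrow> u r \<in> carrier K" "\<And>r. r \<in> Sr \<Longrightarrow> F \<cdot> u r = u r"
    "\<And>r. r \<in> Sr \<Longrightarrow> u r \<cdot> vx {rel_tgt Q r} = u r"
  defines "x \<equiv> \<Oplus>\<^bsub>K'\<^esub>r\<in>Sr. old_elt (u r) \<star> nr r"
  shows "x \<in> carrier K'" "cm x = 0" "om x = \<zero>\<^bsub>K\<^esub>" "r \<in> Sr \<Longrightarrow> wm x r = u r"
proof -
  have t: "old_elt (u s) \<star> nr s \<in> carrier K'" "cm (old_elt (u s) \<star> nr s) = 0"
    "om (old_elt (u s) \<star> nr s) = \<zero>\<^bsub>K\<^esub>" "wm (old_elt (u s) \<star> nr s) q = (if q = s then u s else \<zero>\<^bsub>K\<^esub>)"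
    if s: "s \<in> Sr" for s q
    using new_term[OF u(1)[OF s] u(2)[OF s] s] u(3)[OF s] by simp_all
  show "x \<in> carrier K'" unfolding x_def by (rule K'.finsum_closed) (use t(1) in blast)
  have "cm x = (\<Sum>s\<in>Sr. cm (old_elt (u s) \<star> nr s))" unfolding x_def by (rule comp_finsum(1)[OF fin_Sr]) (rule t(1))
  then show "cm x = 0" using t(2) by simp
  have "om x = (\<Oplus>\<^bsub>K\<^esub>s\<in>Sr. om (old_elt (u s) \<star> nr s))" unfolding x_def by (rule comp_finsum(2)[OF fin_Sr]) (rule t(1))
  also have "\<dots> = \<zero>\<^bsub>K\<^esub>" by (rule K.add.finprod_one_eqI) (rule t(3))
  finally show "om x = \<zero>\<^bsub>K\<^esub>" .
  assume r: "r \<in> Sr"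
  have "wm x r = (\<Oplus>\<^bsub>K\<^esub>s\<in>Sr. wm (old_elt (u s) \<star> nr s) r)" unfolding x_def by (rule comp_finsum(3)[OF fin_Sr]) (rule t(1))
  also have "\<dots> = (\<Oplus>\<^bsub>K\<^esub>s\<in>Sr. if r = s then u s else \<zero>\<^bsub>K\<^esub>)"
    by (rule K.finsum_cong'[OF refl]) (use u(1) K.zero_closed in simp, use t(4) in auto)
  also have "\<dots> = u r" by (rule K.add.finprod_singleton[OF r fin_Sr]) (use u(1) in blast)
  finally show "wm x r = u r" .
qed

end

section \<open>The ideal (R') in terms of components\<close>

context bq
begin

abbreviation R' where "R' \<equiv> new_relations Q R i"
abbreviation I' where "I' \<equiv> Idl\<^bsub>K'\<^esub> R'"

lemma F_rel: assumes "r \<in> R" "rel_src r \<noteq> i" shows "F \<cdot> r = r"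
  unfolding F_mult_iff[OF RK[OF assms(1)]] using rel(1)[OF assms(1)] assms(2) by fastforce

lemma F_rel_comp: "r \<in> R \<Longrightarrow> a \<in> arrows Q \<Longrightarrow> F \<cdot> rel_comp Q r a = rel_comp Q r a"
  unfolding F_mult_iff[OF rel_comp_closed[OF RK]] using tgt_ne[of a] by (auto simp: rel_comp_val)

text \<open>In components the new relation at a is row a of the matrix \<rho>, before passing to the
  quotient.\<close>

lemma star:
  assumes a: "a \<in> Sa"
  shows "star_rel Q R i a \<in> carrier K'" "cm (star_rel Q R i a) = 0" "om (star_rel Q R i a) = \<zero>\<^bsub>K\<^esub>"
    "r \<in> Sr \<Longrightarrow> wm (star_rel Q R i a) r = rel_comp Q r a"
proof -
  have aQ: "a \<in> arrows Q" using a by blast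
  have u: "rel_comp Q r a \<in> carrier K" "F \<cdot> rel_comp Q r a = rel_comp Q r a"
    "rel_comp Q r a \<cdot> vx {rel_tgt Q r} = rel_comp Q r a" if "r \<in> Sr" for r
    using rel_comp_closed[OF RK[OF SrR(1)[OF that]]] F_rel_comp[OF SrR(1)[OF that] aQ] rel_comp_tgt[OF SrR(1)[OF that]]
    by blast+
  show "star_rel Q R i a \<in> carrier K'" unfolding star_rel_def by (rule new_sum(1)) (rule u, assumption)+
  show "cm (star_rel Q R i a) = 0" unfolding star_rel_def by (rule new_sum(2)) (rule u, assumption)+
  show "om (star_rel Q R i a) = \<zero>\<^bsub>K\<^esub>" unfolding star_rel_def by (rule new_sum(3)) (rule u, assumption)+
  show "wm (star_rel Q R i a) r = rel_comp Q r a" if "r \<in> Sr"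
    unfolding star_rel_def by (rule new_sum(4)[OF _ _ _ that]) (rule u, assumption)+
qed

lemma R'_iff: "x \<in> R' \<longleftrightarrow> (\<exists>r\<in>R. rel_src r \<noteq> i \<and> x = old_elt r) \<or> (\<exists>a\<in>Sa. x = star_rel Q R i a)"
  unfolding new_relations_def by blast

lemma R'K: "R' \<subseteq> carrier K'"
proof
  fix x assume "x \<in> R'"
  then consider r where "r \<in> R" "rel_src r \<noteq> i" "x = old_elt r" | a where "a \<in> Sa" "x = star_rel Q R i a"
    unfolding R'_iff by blast
  then show "x \<in> carrier K'"
  proof cases
    case 1 show ?thesis unfolding 1(3) by (rule old_closed[OF RK[OF 1(1)] F_rel[OF 1(1,2)]])
  next
    case 2 show ?thesis unfolding 2(2) by (rule star(1)[OF 2(1)])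
  qed
qed

lemma idealI': "ideal I' K'" by (rule K'.genideal_ideal[OF R'K])

sublocale PA': alg_ideal K' I' by (intro alg_ideal.intro K'.is_kalg idealI')

declare PA'.QA_simps [simp del]

lemma R'_I': "x \<in> R' \<Longrightarrow> x \<in> I'" using K'.genideal_self[OF R'K] by blast

text \<open>As x \<mapsto> F x and \<open>old_elt\<close> are multiplicative, the z that are sent
  into (R') form an ideal. It contains R, because F r is zero or r itself is an old relation of
  R'.\<close>

lemma old_I: assumes "z \<in> I" shows "old_elt (F \<cdot> z) \<in> I'"
proof -
  let ?S = "{z \<in> carrier K. old_elt (F \<cdot> z) \<in> I'}"
  have FF: "F \<cdot> (F \<cdot> x) = F \<cdot> x" for x by (rule F_mult[OF vx_idem])
  have Fxy: "old_elt (F \<cdot> (x \<cdot> y)) = old_elt (F \<cdot> x) \<star> old_elt (F \<cdot> y)"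
    if x: "x \<in> carrier K" and y: "y \<in> carrier K" for x y
  proof -
    have "F \<cdot> (x \<cdot> y) = (F \<cdot> (x \<cdot> F)) \<cdot> y"
      unfolding F_K_F[OF x] by (simp only: pa_assoc)
    also have "\<dots> = (F \<cdot> x) \<cdot> (F \<cdot> y)" by (simp only: pa_assoc)
    finally show ?thesis using old_mult[OF K.m_closed[OF FK x] FF K.m_closed[OF FK y] FF] by simp
  qed
  have oc: "old_elt (F \<cdot> x) \<in> carrier K'" if "x \<in> carrier K" for x by (rule old_closed[OF K.m_closed[OF FK that] FF])
  have "ideal ?S K"
  proof (rule K.ideal_intro)
    show "\<zero>\<^bsub>K\<^esub> \<in> ?S" using K.r_null[OF FK] old_zero PA'.zero_closed by simp
    show "x \<oplus>\<^bsub>K\<^esub> y \<in> ?S" if xy: "x \<in> ?S" "y \<in> ?S" for x y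
    proof -
      have "old_elt (F \<cdot> (x \<oplus>\<^bsub>K\<^esub> y)) = old_elt (F \<cdot> x) \<oplus>\<^bsub>K'\<^esub> old_elt (F \<cdot> y)"
        using K.r_distr[of x y F] xy FK old_add by simp
      then show ?thesis using xy PA'.a_closed K.add.m_closed by simp
    qed
    show "x \<cdot> y \<in> ?S" if x: "x \<in> ?S" "y \<in> carrier K" for x y
      using x Fxy[of x y] PA'.I_r_closed[OF _ oc[OF x(2)]] K.m_closed by simp
    show "y \<cdot> x \<in> ?S" if x: "x \<in> ?S" "y \<in> carrier K" for x y
      using x Fxy[of y x] PA'.I_l_closed[OF _ oc[OF x(2)]] K.m_closed by simp
  qed blast
  moreover have "R \<subseteq> ?S"
  proof
    fix r assume r: "r \<in> R"
    have "old_elt (F \<cdot> r) \<in> I'"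
    proof (cases "rel_src r = i")
      case True
      then have "F \<cdot> r = \<zero>\<^bsub>K\<^esub>" using rel_src_mult[OF r, of "verts Q - {i}"] by simp
      then show ?thesis using old_zero PA'.zero_closed by simp
    next
      case False
      have "old_elt r \<in> R'" unfolding R'_iff using r False by blast
      then show ?thesis unfolding F_rel[OF r False] by (rule R'_I')
    qed
    then show "r \<in> ?S" using RK[OF r] by simp
  qed
  ultimately have "I \<subseteq> ?S" by (rule K.genideal_minimal)
  then show ?thesis using assms by blast
qed

text \<open>By \<open>K'_ext\<close> the element is the sum of its old part and of the products of
  \<open>wm x r\<close> with the new arrow of r; \<open>old_I\<close> puts each of these parts into
  (R').\<close>

lemma comp_I':
  assumes x: "x \<in> carrier K'" "cm x = 0" "om x \<in> I" "\<And>r. r \<in> Sr \<Longrightarrow> wm x r \<in> I"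
  shows "x \<in> I'"
proof -
  have o: "om x \<in> carrier K" "F \<cdot> om x = om x" using om_closed[OF x(1)] om_F[OF x(1)] by blast+
  have w: "wm x r \<in> carrier K" "F \<cdot> wm x r = wm x r" "wm x r \<cdot> vx {rel_tgt Q r} = wm x r" for r
    using wm_closed[OF x(1)] wm_F[OF x(1)] wm_tgt[OF x(1)] by blast+
  let ?s = "\<Oplus>\<^bsub>K'\<^esub>r\<in>Sr. old_elt (wm x r) \<star> nr r"
  have s: "?s \<in> carrier K'" "cm ?s = 0" "om ?s = \<zero>\<^bsub>K\<^esub>" "r \<in> Sr \<Longrightarrow> wm ?s r = wm x r" for r
    using new_sum[of "wm x"] w by blast+
  have eq: "x = old_elt (om x) \<oplus>\<^bsub>K'\<^esub> ?s"
  proof (rule K'_ext[OF x(1) K'.add.m_closed[OF old_closed[OF o] s(1)]])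
    show "cm x = cm (old_elt (om x) \<oplus>\<^bsub>K'\<^esub> ?s)" unfolding cm_simps s(2) old_comp[OF o] x(2) by simp
    show "om x = om (old_elt (om x) \<oplus>\<^bsub>K'\<^esub> ?s)" unfolding om_simps s(3) old_comp[OF o] by (simp add: pa_simps)
    show "wm x r = wm (old_elt (om x) \<oplus>\<^bsub>K'\<^esub> ?s) r" if "r \<in> Sr" for r
      unfolding wm_simps s(4)[OF that] old_comp[OF o] by (simp add: pa_simps)
  qed
  have oI: "old_elt (om x) \<in> I'" using old_I[OF x(3)] o(2) by simp
  have sI: "?s \<in> I'"
  proof (rule PA'.I_finsum[OF fin_Sr])
    fix r assume r: "r \<in> Sr"
    have "old_elt (wm x r) \<in> I'" using old_I[OF x(4)[OF r]] w(2) by simp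
    then show "old_elt (wm x r) \<star> nr r \<in> I'" by (rule PA'.I_r_closed[OF _ nr_closed[OF r]])
  qed
  show ?thesis by (subst eq) (rule PA'.a_closed[OF oI sI])
qed

text \<open>Subtracting the combination of the new relations with coefficients y leaves an element
  all of whose components lie in I, to which \<open>comp_I'\<close> applies.\<close>

lemma ker_I':
  assumes x: "x \<in> carrier K'" "cm x = 0" "om x \<in> I" and y: "\<And>a. a \<in> Sa \<Longrightarrow> y a \<in> carrier L"
    and xy: "\<And>r. r \<in> Sr \<Longrightarrow> cl (wm x r) = (\<Oplus>\<^bsub>L\<^esub>a\<in>Sa. y a \<bullet> rho a r)"
  shows "x \<in> I'"
proof -
  have "\<forall>a\<in>Sa. \<exists>z. z \<in> carrier K \<and> y a = cl z" using y PA.QA_carrier by blast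
  from bchoice[OF this] obtain Y where Y: "\<And>a. a \<in> Sa \<Longrightarrow> Y a \<in> carrier K" "\<And>a. a \<in> Sa \<Longrightarrow> y a = cl (Y a)" by blast
  \<comment> \<open>Only elements of F kQ can be moved to kQ' by \<open>old_elt\<close>. Replacing Y
    by F Y does not disturb the congruence, because \<open>wm x r\<close> is fixed by F.\<close>
  define Z where "Z a = F \<cdot> Y a" for a
  have Z: "Z a \<in> carrier K" "F \<cdot> Z a = Z a" if "a \<in> Sa" for a
    unfolding Z_def using K.m_closed[OF FK Y(1)[OF that]] F_mult[OF vx_idem] by blast+
  define s where "s = (\<Oplus>\<^bsub>K'\<^esub>a\<in>Sa. old_elt (Z a) \<star> star_rel Q R i a)"
  have t: "old_elt (Z a) \<star> star_rel Q R i a \<in> carrier K'" if "a \<in> Sa" for a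
    by (rule K'.m_closed[OF old_closed[OF Z[OF that]] star(1)[OF that]])
  have sI: "s \<in> I'" unfolding s_def
  proof (rule PA'.I_finsum[OF fin_Sa])
    fix a assume a: "a \<in> Sa"
    have "star_rel Q R i a \<in> I'" using a R'_I' R'_iff by blast
    then show "old_elt (Z a) \<star> star_rel Q R i a \<in> I'" by (rule PA'.I_l_closed[OF _ old_closed[OF Z[OF a]]])
  qed
  have sK: "s \<in> carrier K'" by (rule PA'.Icarr[OF sI])
  have "cm s = (\<Sum>a\<in>Sa. cm (old_elt (Z a) \<star> star_rel Q R i a))" unfolding s_def by (rule comp_finsum(1)[OF fin_Sa]) (rule t)
  also have "\<dots> = 0" by (rule sum.neutral) (simp add: cm_simps star(2))
  finally have cs: "cm s = 0" .
  have "om s = (\<Oplus>\<^bsub>K\<^esub>a\<in>Sa. om (old_elt (Z a) \<star> star_rel Q R i a))" unfolding s_def by (rule comp_finsum(2)[OF fin_Sa]) (rule t)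
  also have "\<dots> = \<zero>\<^bsub>K\<^esub>"
  proof (rule K.add.finprod_one_eqI)
    fix a assume a: "a \<in> Sa"
    show "om (old_elt (Z a) \<star> star_rel Q R i a) = \<zero>\<^bsub>K\<^esub>"
      unfolding om_mult[OF old_closed[OF Z[OF a]]] star(3)[OF a] by (rule K.r_null[OF om_closed[OF old_closed[OF Z[OF a]]]])
  qed
  finally have os: "om s = \<zero>\<^bsub>K\<^esub>" .
  have ws: "wm s r = (\<Oplus>\<^bsub>K\<^esub>a\<in>Sa. Z a \<cdot> rel_comp Q r a)" if r: "r \<in> Sr" for r
  proof -
    have m: "Z a \<cdot> rel_comp Q r a \<in> carrier K" if "a \<in> Sa" for a
      by (rule K.m_closed[OF Z(1)[OF that] rel_comp_closed[OF RK[OF SrR(1)[OF r]]]])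
    have "wm s r = (\<Oplus>\<^bsub>K\<^esub>a\<in>Sa. wm (old_elt (Z a) \<star> star_rel Q R i a) r)" unfolding s_def by (rule comp_finsum(3)[OF fin_Sa]) (rule t)
    also have "\<dots> = (\<Oplus>\<^bsub>K\<^esub>a\<in>Sa. Z a \<cdot> rel_comp Q r a)"
    proof (rule K.finsum_cong'[OF refl])
      fix a assume a: "a \<in> Sa"
      show "wm (old_elt (Z a) \<star> star_rel Q R i a) r = Z a \<cdot> rel_comp Q r a"
        unfolding wm_mult[OF old_closed[OF Z[OF a]] star(1)[OF a]] star(2)[OF a] star(4)[OF a r] old_comp[OF Z[OF a]]
        by (simp add: pa_simps)
    qed (use m in blast)
    finally show ?thesis .
  qed
  have clws: "cl (wm s r) = cl (wm x r)" if r: "r \<in> Sr" for r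
  proof -
    have rK: "rel_comp Q r a \<in> carrier K" for a by (rule rel_comp_closed[OF RK[OF SrR(1)[OF r]]])
    have rL: "cl F \<in> carrier L" by (rule PA.cl_closed[OF FK])
    have m: "Z a \<cdot> rel_comp Q r a \<in> carrier K" if "a \<in> Sa" for a by (rule K.m_closed[OF Z(1)[OF that] rK])
    have m': "y a \<bullet> rho a r \<in> carrier L" if "a \<in> Sa" for a by (rule L.m_closed[OF y[OF that] rhoL[OF r]])
    have "cl (wm s r) = (\<Oplus>\<^bsub>L\<^esub>a\<in>Sa. cl (Z a \<cdot> rel_comp Q r a))" unfolding ws[OF r] by (rule PA.cl_finsum[OF fin_Sa]) (rule m)
    also have "\<dots> = (\<Oplus>\<^bsub>L\<^esub>a\<in>Sa. cl F \<bullet> (y a \<bullet> rho a r))"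
    proof (rule L.finsum_cong'[OF refl])
      fix a assume a: "a \<in> Sa"
      show "cl (Z a \<cdot> rel_comp Q r a) = cl F \<bullet> (y a \<bullet> rho a r)"
        unfolding Z_def pa_assoc Y(2)[OF a] PA.cl_mult[OF FK K.m_closed[OF Y(1)[OF a] rK]] PA.cl_mult[OF Y(1)[OF a] rK] ..
    qed (use L.m_closed[OF rL m'] in blast)
    also have "\<dots> = cl F \<bullet> (\<Oplus>\<^bsub>L\<^esub>a\<in>Sa. y a \<bullet> rho a r)" by (rule L.finsum_rdistr[OF fin_Sa rL, symmetric]) (use m' in blast)
    also have "\<dots> = cl (F \<cdot> wm x r)" unfolding xy[OF r, symmetric] by (rule PA.cl_mult[OF FK wm_closed[OF x(1)], symmetric])
    finally show ?thesis unfolding wm_F[OF x(1)] .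
  qed
  let ?x = "x \<oplus>\<^bsub>K'\<^esub> (- 1) \<odot>\<^bsub>K'\<^esub> s"
  have "?x \<in> I'"
  proof (rule comp_I')
    show "?x \<in> carrier K'" by (rule K'.add.m_closed[OF x(1) K'.scal_closed[OF sK]])
    show "cm ?x = 0" unfolding cm_simps x(2) cs by simp
    show "om ?x \<in> I" using x(3) unfolding om_simps os by (simp add: pa_simps)
    show "wm ?x r \<in> I" if r: "r \<in> Sr" for r
    proof -
      note wx = wm_closed[OF x(1), of r] and wsc = wm_closed[OF sK, of r]
      have u: "cl (wm x r) \<in> carrier L" by (rule PA.cl_closed[OF wx])
      have "cl (wm ?x r) = cl (wm x r) \<oplus>\<^bsub>L\<^esub> (- 1) \<odot>\<^bsub>L\<^esub> cl (wm x r)"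
        unfolding wm_simps PA.cl_add[OF wx K.scal_closed[OF wsc]] PA.cl_scal[OF wsc] clws[OF r] ..
      also have "\<dots> = (1 + (- 1)) \<odot>\<^bsub>L\<^esub> cl (wm x r)" unfolding L.scal_l_distr[OF u] L.scal_one[OF u] ..
      also have "\<dots> = \<zero>\<^bsub>L\<^esub>" using L.scal_zero_l[OF u] by simp
      finally show ?thesis using PA.cl_eq_zero[OF wm_closed[OF K'.add.m_closed[OF x(1) K'.scal_closed[OF sK]]]] by blast
    qed
  qed
  then show ?thesis using PA'.I_cancel[OF x(1) PA'.I_scal[OF sI]] by blast
qed

lemma new_exists:
  assumes y: "y \<in> carrier K" "F \<cdot> y = y" and u: "\<And>r. r \<in> Sr \<Longrightarrow> u r \<in> carrier K" "\<And>r. r \<in> Sr \<Longrightarrow> F \<cdot> u r = u r"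
    "\<And>r. r \<in> Sr \<Longrightarrow> u r \<cdot> vx {rel_tgt Q r} = u r"
  obtains x where "x \<in> carrier K'" "cm x = c" "om x = y" "\<And>r. r \<in> Sr \<Longrightarrow> wm x r = u r"
proof -
  have e: "vx {i} \<in> carrier K'" by (rule vx_closed) (use finV iV in \<open>simp_all add: new_simps\<close>)
  have ec: "cm (vx {i}) = 1" "om (vx {i}) = \<zero>\<^bsub>K\<^esub>" "wm (vx {i}) r = \<zero>\<^bsub>K\<^esub>" for r
    by (auto simp: cm_def om_def wm_def vx_def pa_simps fun_eq_iff)
  let ?s = "\<Oplus>\<^bsub>K'\<^esub>r\<in>Sr. old_elt (u r) \<star> nr r"
  have s: "?s \<in> carrier K'" "cm ?s = 0" "om ?s = \<zero>\<^bsub>K\<^esub>" "r \<in> Sr \<Longrightarrow> wm ?s r = u r" for r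
    using new_sum[of u] u by blast+
  let ?x = "c \<odot>\<^bsub>K'\<^esub> vx {i} \<oplus>\<^bsub>K'\<^esub> (old_elt y \<oplus>\<^bsub>K'\<^esub> ?s)"
  show thesis
  proof (rule that)
    show "?x \<in> carrier K'" by (rule K'.add.m_closed[OF K'.scal_closed[OF e] K'.add.m_closed[OF old_closed[OF y] s(1)]])
    show "cm ?x = c" unfolding cm_simps ec s(2) old_comp[OF y] by simp
    show "om ?x = y" unfolding om_simps ec s(3) old_comp[OF y] by (simp add: pa_simps)
    show "wm ?x r = u r" if "r \<in> Sr" for r unfolding wm_simps ec s(4)[OF that] old_comp[OF y] by (simp add: pa_simps)
  qed
qed

end

subsection \<open>The endomorphism algebra\<close>

locale bq_tilt = bq Q R i for Q :: "('v, 'e) quiver" and R :: "(('v, 'e) path \<Rightarrow> 'k::field) set" and i +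
  fixes P :: "((('v, 'e) path \<Rightarrow> 'k) set, 'p) module" and \<pi> and T :: "((('v, 'e) path \<Rightarrow> 'k) set, 't) module"
    and g p pr
  assumes tilt: "over_L apr_tilt P \<pi> T g p pr"
begin

sublocale AT: apr_tilt L "cl E" Sa Sr "\<lambda>a. cl (vx {tgt Q a})" "\<lambda>r. cl (vx {rel_tgt Q r})" "\<lambda>a. cl (arr Q a)"
    "\<lambda>a r. cl (rel_comp Q r a)" "\<lambda>m. cl ` J m" P \<pi> T g p pr
  by (rule tilt)

text \<open>\<open>qv x\<close> will be the image of p under the endomorphism belonging to x;
  \<open>ov x\<close> is its value under \<open>pr\<close>, and \<open>wv x\<close> its part in the
  submodule generated by the \<open>g r\<close>.\<close>

definition ov where "ov x = cl (om x)"
definition wv where "wv x = dot T Sr (\<lambda>r. cl (wm x r)) g"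
definition qv where "qv x = wv x \<oplus>\<^bsub>T\<^esub> ov x \<odot>\<^bsub>T\<^esub> p"

lemma f_eq: "AT.f = cl F"
proof -
  have "\<one>\<^bsub>K\<^esub> = F \<oplus>\<^bsub>K\<^esub> E" using iV by (auto simp: pa_one pa_simps fun_eq_iff vx_def)
  then have "\<one>\<^bsub>L\<^esub> = cl F \<oplus>\<^bsub>L\<^esub> cl E" using PA.cl_one PA.cl_add[OF FK EK] by simp
  then show ?thesis using PA.cl_closed[OF FK] PA.cl_closed[OF EK] by (simp add: L.minus_eq L.a_assoc L.r_neg)
qed

lemma ov_closed: "x \<in> carrier K' \<Longrightarrow> ov x \<in> carrier L"
  unfolding ov_def by (rule PA.cl_closed[OF om_closed])

lemma f_ov: assumes "x \<in> carrier K'" shows "AT.f \<bullet> ov x = ov x" "ov x \<bullet> AT.f = ov x"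
proof -
  note o = om_closed[OF assms] and Fo = om_F[OF assms]
  show "AT.f \<bullet> ov x = ov x" unfolding f_eq ov_def PA.cl_mult[OF FK o, symmetric] Fo ..
  have "om x \<cdot> F = om x" using F_K_F[OF o] Fo by (simp add: pa_assoc[symmetric])
  then show "ov x \<bullet> AT.f = ov x" unfolding f_eq ov_def PA.cl_mult[OF o FK, symmetric] by simp
qed

lemma clw: assumes "x \<in> carrier K'" shows "cl (wm x r) \<in> carrier L" "AT.f \<bullet> cl (wm x r) = cl (wm x r)"
proof -
  note w = wm_closed[OF assms, of r]
  show "cl (wm x r) \<in> carrier L" by (rule PA.cl_closed[OF w])
  show "AT.f \<bullet> cl (wm x r) = cl (wm x r)" unfolding f_eq PA.cl_mult[OF FK w, symmetric] wm_F[OF assms] ..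
qed

lemma wv_closed: "x \<in> carrier K' \<Longrightarrow> wv x \<in> carrier T"
  unfolding wv_def by (rule AT.T.dot_closed[OF clw(1) AT.g(1)])

lemma ovp: "x \<in> carrier K' \<Longrightarrow> y \<in> carrier T \<Longrightarrow> ov x \<odot>\<^bsub>T\<^esub> y \<in> carrier T"
  by (rule AT.T.smult_closed[OF ov_closed])

lemma qv_closed: "x \<in> carrier K' \<Longrightarrow> qv x \<in> carrier T"
  unfolding qv_def by (rule AT.T.M.a_closed[OF wv_closed ovp[OF _ AT.p(1)]])

lemma f_qv: assumes x: "x \<in> carrier K'" shows "AT.f \<odot>\<^bsub>T\<^esub> qv x = qv x"
proof -
  have "AT.f \<odot>\<^bsub>T\<^esub> wv x = dot T Sr (\<lambda>r. AT.f \<bullet> cl (wm x r)) g"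
    unfolding wv_def by (rule AT.T.dot_smult[OF fin_Sr AT.f(1) clw(1)[OF x] AT.g(1)])
  also have "\<dots> = wv x" unfolding wv_def clw(2)[OF x] ..
  finally have "AT.f \<odot>\<^bsub>T\<^esub> wv x = wv x" .
  moreover have "AT.f \<odot>\<^bsub>T\<^esub> (ov x \<odot>\<^bsub>T\<^esub> p) = ov x \<odot>\<^bsub>T\<^esub> p"
    unfolding AT.T.smult_assoc[OF AT.f(1) ov_closed[OF x] AT.p(1), symmetric] f_ov[OF x] ..
  ultimately show ?thesis unfolding qv_def
    using AT.T.smult_r_distr[OF AT.f(1) wv_closed[OF x] ovp[OF x AT.p(1)]] by simp
qed

lemma pr_wv: assumes x: "x \<in> carrier K'" shows "pr (wv x) = \<zero>\<^bsub>L\<^esub>"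
proof -
  interpret RG: kmod L "reg_mod L" by (rule L.reg_kmod)
  have "pr (wv x) = dot (reg_mod L) Sr (\<lambda>r. cl (wm x r)) (\<lambda>r. pr (g r))"
    unfolding wv_def by (rule lin_dot[OF AT.kT L.reg_kmod AT.pr(1) fin_Sr clw(1)[OF x] AT.g(1)])
  also have "\<dots> = \<zero>\<^bsub>reg_mod L\<^esub>" by (rule RG.dot_zero_r) (use AT.pr(3) clw(1)[OF x] in simp_all)
  finally show ?thesis by simp
qed

lemma pr_qv: assumes x: "x \<in> carrier K'" shows "pr (qv x) = ov x"
proof -
  have "pr (ov x \<odot>\<^bsub>T\<^esub> p) = ov x \<bullet> AT.f" using linD(3)[OF AT.pr(1) ov_closed[OF x] AT.p(1)] AT.pr(2) by simp
  then show ?thesis unfolding qv_def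
    using linD(2)[OF AT.pr(1) wv_closed[OF x] ovp[OF x AT.p(1)]] pr_wv[OF x] f_ov(2)[OF x] ov_closed[OF x] by simp
qed

lemma ov_simps:
  assumes "x \<in> carrier K'" "y \<in> carrier K'"
  shows "ov (x \<oplus>\<^bsub>K'\<^esub> y) = ov x \<oplus>\<^bsub>L\<^esub> ov y" "ov (x \<star> y) = ov x \<bullet> ov y" "ov (c \<odot>\<^bsub>K'\<^esub> x) = c \<odot>\<^bsub>L\<^esub> ov x"
  unfolding ov_def om_simps om_mult[OF assms(1)]
  by (rule PA.cl_add PA.cl_mult PA.cl_scal, (rule om_closed, rule assms)+)+

lemma qv_add: assumes x: "x \<in> carrier K'" and y: "y \<in> carrier K'" shows "qv (x \<oplus>\<^bsub>K'\<^esub> y) = qv x \<oplus>\<^bsub>T\<^esub> qv y"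
proof -
  have "wv (x \<oplus>\<^bsub>K'\<^esub> y) = wv x \<oplus>\<^bsub>T\<^esub> wv y"
    unfolding wv_def wm_simps PA.cl_add[OF wm_closed[OF x] wm_closed[OF y]]
    by (rule AT.T.dot_add_l[OF clw(1)[OF x] clw(1)[OF y] AT.g(1)])
  then show ?thesis unfolding qv_def ov_simps[OF x y] AT.T.smult_l_distr[OF ov_closed[OF x] ov_closed[OF y] AT.p(1)]
    using wv_closed[OF x] wv_closed[OF y] ovp[OF x AT.p(1)] ovp[OF y AT.p(1)] by (simp add: AT.T.M.a_ac)
qed

lemma qv_scal: assumes x: "x \<in> carrier K'" shows "qv (c \<odot>\<^bsub>K'\<^esub> x) = ks L T c (qv x)"
proof -
  have "wv (c \<odot>\<^bsub>K'\<^esub> x) = ks L T c (wv x)"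
    unfolding wv_def wm_simps PA.cl_scal[OF wm_closed[OF x]]
    by (rule AT.T.dot_ks(2)[OF fin_Sr clw(1)[OF x] AT.g(1)])
  then show ?thesis unfolding qv_def ov_simps[OF x x] AT.T.ks_smult_l[OF ov_closed[OF x] AT.p(1)]
    using AT.T.ks_r_distr[OF wv_closed[OF x] ovp[OF x AT.p(1)]] by simp
qed

text \<open>The two terms of \<open>wm_mult\<close>, evaluated on the \<open>g r\<close>, together
  with multiplicativity of \<open>om\<close>. As \<open>wv x\<close> is the difference of
  \<open>qv x\<close> and (ov x) p, the result has the shape of \<open>Phi_comp\<close>.\<close>

lemma qv_mult:
  assumes x: "x \<in> carrier K'" and y: "y \<in> carrier K'"
  shows "qv (x \<star> y) = ks L T (cm y) (qv x \<ominus>\<^bsub>T\<^esub> ov x \<odot>\<^bsub>T\<^esub> p) \<oplus>\<^bsub>T\<^esub> ov x \<odot>\<^bsub>T\<^esub> qv y"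
proof -
  note wx = wv_closed[OF x] and wy = wv_closed[OF y] and px = ovp[OF x AT.p(1)] and py = ovp[OF y AT.p(1)]
  have o: "om x \<in> carrier K" by (rule om_closed[OF x])
  have e: "cl (wm (x \<star> y) r) = cm y \<odot>\<^bsub>L\<^esub> cl (wm x r) \<oplus>\<^bsub>L\<^esub> ov x \<bullet> cl (wm y r)" for r
    unfolding wm_mult[OF x y] ov_def PA.cl_add[OF K.scal_closed[OF wm_closed[OF x]] K.m_closed[OF o wm_closed[OF y]]]
      PA.cl_scal[OF wm_closed[OF x]] PA.cl_mult[OF o wm_closed[OF y]] ..
  have "wv (x \<star> y) = dot T Sr (\<lambda>r. cm y \<odot>\<^bsub>L\<^esub> cl (wm x r)) g \<oplus>\<^bsub>T\<^esub> dot T Sr (\<lambda>r. ov x \<bullet> cl (wm y r)) g"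
    unfolding wv_def e
    by (rule AT.T.dot_add_l[OF L.scal_closed[OF clw(1)[OF x]] L.m_closed[OF ov_closed[OF x] clw(1)[OF y]] AT.g(1)])
  also have "\<dots> = ks L T (cm y) (wv x) \<oplus>\<^bsub>T\<^esub> ov x \<odot>\<^bsub>T\<^esub> wv y"
    unfolding wv_def
    by (intro arg_cong2[where f = "add T"] AT.T.dot_ks(2) AT.T.dot_smult[symmetric] fin_Sr ov_closed[OF x] clw(1)[OF x] clw(1)[OF y] AT.g(1))
  finally have w: "wv (x \<star> y) = ks L T (cm y) (wv x) \<oplus>\<^bsub>T\<^esub> ov x \<odot>\<^bsub>T\<^esub> wv y" .
  have d: "qv x \<ominus>\<^bsub>T\<^esub> ov x \<odot>\<^bsub>T\<^esub> p = wv x"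
    unfolding qv_def using wx px by (simp add: AT.T.M.minus_eq AT.T.M.a_assoc AT.T.M.r_neg)
  have k: "ks L T (cm y) (wv x) \<in> carrier T" and ow: "ov x \<odot>\<^bsub>T\<^esub> wv y \<in> carrier T" and op: "ov x \<odot>\<^bsub>T\<^esub> (ov y \<odot>\<^bsub>T\<^esub> p) \<in> carrier T"
    using AT.T.ks_closed[OF wx] ovp[OF x wy] ovp[OF x py] by blast+
  show ?thesis unfolding d unfolding qv_def w ov_simps[OF x y] AT.T.smult_assoc[OF ov_closed[OF x] ov_closed[OF y] AT.p(1)]
      AT.T.smult_r_distr[OF ov_closed[OF x] wy py] by (rule AT.T.M.a_assoc[OF k ow op])
qed

text \<open>Applying \<open>pr\<close> gives ov x = 0. Then wv x = 0 is a relation among the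
  \<open>g r\<close>, by \<open>T_rel\<close> a combination of the rows of \<rho>, which is the
  situation of \<open>ker_I'\<close>.\<close>

lemma Z_I':
  assumes x: "x \<in> carrier K'" "cm x = 0" "qv x = \<zero>\<^bsub>T\<^esub>" shows "x \<in> I'"
proof -
  have o: "ov x = \<zero>\<^bsub>L\<^esub>" using pr_qv[OF x(1)] x(3) lin_zero[OF AT.kT L.reg_kmod AT.pr(1)] by simp
  then have oI: "om x \<in> I" using PA.cl_eq_zero[OF om_closed[OF x(1)]] by (simp add: ov_def)
  have "wv x = \<zero>\<^bsub>T\<^esub>"
    using x(3) wv_closed[OF x(1)] AT.p(1) unfolding qv_def o by simp
  moreover define l where "l = (\<lambda>r\<in>Sr. cl (wm x r))"
  have "dot T Sr l g = wv x" unfolding wv_def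
    by (rule AT.T.dot_cong) (use clw(1)[OF x(1)] AT.g(1) in \<open>simp_all add: l_def\<close>)
  moreover have "l \<in> carrier (fam L Sr (\<lambda>r. cl (vx {rel_tgt Q r})))"
  proof -
    have "cl (wm x r) \<bullet> cl (vx {rel_tgt Q r}) = cl (wm x r)" if "r \<in> Sr" for r
      unfolding PA.cl_mult[OF wm_closed[OF x(1)] vxK1[OF rel_tgtV(1)[OF SrR(1)[OF that]]], symmetric] wm_tgt[OF x(1)] ..
    then show ?thesis using clw(1)[OF x(1)] by (simp add: l_def)
  qed
  ultimately obtain y where y: "y \<in> carrier (fam L Sa (\<lambda>a. cl (vx {tgt Q a})))"
    "\<forall>r\<in>Sr. l r = (\<Oplus>\<^bsub>L\<^esub>a\<in>Sa. y a \<bullet> rho a r)" using AT.T_rel[of l] by force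
  show ?thesis
  proof (rule ker_I'[OF x(1,2) oI])
    show "y a \<in> carrier L" if "a \<in> Sa" for a using y(1) that by auto
    show "cl (wm x r) = (\<Oplus>\<^bsub>L\<^esub>a\<in>Sa. y a \<bullet> rho a r)" if r: "r \<in> Sr" for r
      using y(2)[rule_format, OF r] r by (simp add: l_def)
  qed
qed

text \<open>By the product formulas the common zeros of \<open>cm\<close> and \<open>qv\<close> form
  an ideal. An old relation vanishes in kQ/(R), and for the new relation at a the combination of the
  \<open>g r\<close> with coefficients r_a is zero by \<open>T_rel0\<close>.\<close>

lemma I'_Z:
  assumes "x \<in> I'" shows "cm x = 0" "qv x = \<zero>\<^bsub>T\<^esub>"
proof -
  let ?Z = "{x \<in> carrier K'. cm x = 0 \<and> qv x = \<zero>\<^bsub>T\<^esub>}"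
  have oz: "ov x = \<zero>\<^bsub>L\<^esub>" if "x \<in> carrier K'" "qv x = \<zero>\<^bsub>T\<^esub>" for x
    using pr_qv[OF that(1)] that(2) lin_zero[OF AT.kT L.reg_kmod AT.pr(1)] by simp
  have Zi: "qv x = \<zero>\<^bsub>T\<^esub>" if "\<And>r. r \<in> Sr \<Longrightarrow> cl (wm x r) = h r" "dot T Sr h g = \<zero>\<^bsub>T\<^esub>" "ov x = \<zero>\<^bsub>L\<^esub>" "x \<in> carrier K'" for x h
  proof -
    have "wv x = dot T Sr h g" unfolding wv_def
      by (rule AT.T.dot_cong) (use that(1) clw(1)[OF that(4)] AT.g(1) in \<open>simp_all flip: that(1)\<close>)
    then show ?thesis unfolding qv_def that(2,3) using AT.p(1) by simp
  qed
  have "ideal ?Z K'"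
  proof (rule K'.ideal_intro)
    have "qv \<zero>\<^bsub>K'\<^esub> = \<zero>\<^bsub>T\<^esub>"
    proof (rule Zi[of _ "\<lambda>_. \<zero>\<^bsub>L\<^esub>"])
      show "dot T Sr (\<lambda>_. \<zero>\<^bsub>L\<^esub>) g = \<zero>\<^bsub>T\<^esub>" by (rule AT.T.dot_zero_l) (use AT.g(1) in simp_all)
    qed (use PA.cl_zero in \<open>simp_all add: ov_def om_simps wm_simps\<close>)
    then show "\<zero>\<^bsub>K'\<^esub> \<in> ?Z" using cm_simps(4) by simp
    show "x \<oplus>\<^bsub>K'\<^esub> y \<in> ?Z" if "x \<in> ?Z" "y \<in> ?Z" for x y
      using that K'.add.m_closed by (simp add: cm_simps qv_add)
    show "x \<star> y \<in> ?Z" if xy: "x \<in> ?Z" "y \<in> carrier K'" for x y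
    proof -
      have x: "x \<in> carrier K'" "cm x = 0" "qv x = \<zero>\<^bsub>T\<^esub>" using xy by blast+
      have n0: "\<ominus>\<^bsub>T\<^esub> \<zero>\<^bsub>T\<^esub> = \<zero>\<^bsub>T\<^esub>" by (rule AT.T.M.minus_equality) simp_all
      have "qv (x \<star> y) = \<zero>\<^bsub>T\<^esub>"
        unfolding qv_mult[OF x(1) xy(2)] x(3) oz[OF x(1,3)] using AT.p(1) qv_closed[OF xy(2)] by (simp add: AT.T.M.minus_eq n0)
      then show ?thesis using x K'.m_closed[OF x(1) xy(2)] by (simp add: cm_simps)
    qed
    show "y \<star> x \<in> ?Z" if xy: "x \<in> ?Z" "y \<in> carrier K'" for x y
    proof -
      have x: "x \<in> carrier K'" "cm x = 0" "qv x = \<zero>\<^bsub>T\<^esub>" using xy by blast+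
      have "qv y \<ominus>\<^bsub>T\<^esub> ov y \<odot>\<^bsub>T\<^esub> p \<in> carrier T" by (rule AT.T.M.minus_closed[OF qv_closed[OF xy(2)] ovp[OF xy(2) AT.p(1)]])
      then have "qv (y \<star> x) = \<zero>\<^bsub>T\<^esub>"
        unfolding qv_mult[OF xy(2) x(1)] x(2,3) using ov_closed[OF xy(2)] by simp
      then show ?thesis using x K'.m_closed[OF xy(2) x(1)] by (simp add: cm_simps)
    qed
  qed blast
  moreover have "R' \<subseteq> ?Z"
  proof
    fix x assume x: "x \<in> R'"
    then have xK: "x \<in> carrier K'" using R'K by blast
    consider r where "r \<in> R" "rel_src r \<noteq> i" "x = old_elt r" | a where "a \<in> Sa" "x = star_rel Q R i a"
      using x unfolding R'_iff by blast
    then show "x \<in> ?Z"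
    proof cases
      case 1
      note o = old_comp[OF RK[OF 1(1)] F_rel[OF 1(1,2)], folded 1(3)]
      have "r \<in> I" using K.genideal_self[OF RsubK] 1(1) by blast
      then have "ov x = \<zero>\<^bsub>L\<^esub>" unfolding ov_def o using PA.cl_eq_zero[OF RK[OF 1(1)]] by blast
      moreover have "dot T Sr (\<lambda>_. \<zero>\<^bsub>L\<^esub>) g = \<zero>\<^bsub>T\<^esub>" by (rule AT.T.dot_zero_l) (use AT.g(1) in simp_all)
      ultimately have "qv x = \<zero>\<^bsub>T\<^esub>" using PA.cl_zero o(3) xK by (intro Zi[of x "\<lambda>_. \<zero>\<^bsub>L\<^esub>"]) simp_all
      then show ?thesis using xK o(1) by blast
    next
      case 2
      note s = star[OF 2(1), folded 2(2)]
      have "qv x = \<zero>\<^bsub>T\<^esub>"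
      proof (rule Zi[of x "\<lambda>r. rho a r"])
        show "cl (wm x r) = rho a r" if "r \<in> Sr" for r unfolding s(4)[OF that] ..
        show "dot T Sr (\<lambda>r. rho a r) g = \<zero>\<^bsub>T\<^esub>" by (rule AT.T_rel0[OF 2(1)])
        show "ov x = \<zero>\<^bsub>L\<^esub>" unfolding ov_def s(3) by (rule PA.cl_zero)
      qed (rule xK)
      then show ?thesis using xK s(2) by blast
    qed
  qed
  ultimately have "I' \<subseteq> ?Z" by (rule K'.genideal_minimal)
  then show "cm x = 0" "qv x = \<zero>\<^bsub>T\<^esub>" using assms by blast+
qed

text \<open>The difference of q and (pr q) p is a combination of the \<open>g r\<close>.
  Representatives in kQ of its coefficients and of pr q are multiplied by the idempotents that the
  components of an element of kQ' must respect; this does not affect q, which is fixed by 1 -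
  ei.\<close>

lemma qv_surj:
  assumes q: "q \<in> carrier T" "AT.f \<odot>\<^bsub>T\<^esub> q = q"
  obtains x where "x \<in> carrier K'" "cm x = c" "qv x = q"
proof -
  note fL = AT.f(1)
  have prq: "pr q \<in> carrier L" by (rule AT.prc[OF q(1)])
  have fpr: "AT.f \<bullet> pr q = pr q" using linD(3)[OF AT.pr(1) fL q(1)] q(2) by simp
  obtain z where z: "z \<in> carrier K" "pr q = cl z" using prq PA.QA_carrier by blast
  have y: "F \<cdot> z \<in> carrier K" "F \<cdot> (F \<cdot> z) = F \<cdot> z"
    using K.m_closed[OF FK z(1)] F_mult[OF vx_idem] by blast+
  have cly: "cl (F \<cdot> z) = pr q" using fpr unfolding f_eq z(2) PA.cl_mult[OF FK z(1)] .
  have pp: "pr q \<odot>\<^bsub>T\<^esub> p \<in> carrier T" by (rule AT.T.smult_closed[OF prq AT.p(1)])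
  have "pr (q \<ominus>\<^bsub>T\<^esub> pr q \<odot>\<^bsub>T\<^esub> p) = pr q \<ominus>\<^bsub>L\<^esub> pr q \<bullet> AT.f"
    using lin_diff[OF AT.kT L.reg_kmod AT.pr(1) q(1) pp] linD(3)[OF AT.pr(1) prq AT.p(1)] AT.pr(2) by simp
  also have "\<dots> = \<zero>\<^bsub>L\<^esub>" unfolding AT.pr(4)[OF q(1)] using prq by (simp add: L.minus_eq L.r_neg)
  finally obtain l where l: "l \<in> carrier (fam L Sr (\<lambda>r. cl (vx {rel_tgt Q r})))" "q \<ominus>\<^bsub>T\<^esub> pr q \<odot>\<^bsub>T\<^esub> p = dot T Sr l g"
    using AT.T_span[OF AT.T.M.minus_closed[OF q(1) pp]] by blast
  have lL: "l r \<in> carrier L" "l r \<bullet> cl (vx {rel_tgt Q r}) = l r" if "r \<in> Sr" for r using l(1) that by auto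
  have "\<forall>r\<in>Sr. \<exists>z. z \<in> carrier K \<and> l r = cl z" using lL(1) PA.QA_carrier by blast
  from bchoice[OF this] obtain m where m: "\<And>r. r \<in> Sr \<Longrightarrow> m r \<in> carrier K" "\<And>r. r \<in> Sr \<Longrightarrow> l r = cl (m r)" by blast
  have vK: "vx {rel_tgt Q r} \<in> carrier K" if "r \<in> Sr" for r using vxK1 rel_tgtV(1) SrR(1) that by blast
  define u where "u r = F \<cdot> (m r \<cdot> vx {rel_tgt Q r})" for r
  have mv: "m r \<cdot> vx {rel_tgt Q r} \<in> carrier K" if "r \<in> Sr" for r by (rule K.m_closed[OF m(1)[OF that] vK[OF that]])
  have u: "u r \<in> carrier K" "F \<cdot> u r = u r" "u r \<cdot> vx {rel_tgt Q r} = u r" if "r \<in> Sr" for r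
    unfolding u_def pa_assoc vx_idem using K.m_closed[OF FK mv[OF that]] F_mult[OF vx_idem] by blast+
  have clu: "cl (u r) = AT.f \<bullet> l r" if "r \<in> Sr" for r
    unfolding u_def PA.cl_mult[OF FK mv[OF that]] PA.cl_mult[OF m(1)[OF that] vK[OF that]] m(2)[OF that, symmetric] lL(2)[OF that] f_eq ..
  obtain x where x: "x \<in> carrier K'" "cm x = c" "om x = F \<cdot> z" "\<And>r. r \<in> Sr \<Longrightarrow> wm x r = u r"
    by (rule new_exists[OF y, of u c]) (assumption | rule u | rule that)+
  have ox: "ov x = pr q" unfolding ov_def x(3) cly ..
  have "wv x = dot T Sr (\<lambda>r. AT.f \<bullet> l r) g" unfolding wv_def
    by (rule AT.T.dot_cong) (use x(4) clu lL(1) L.m_closed[OF fL] AT.g(1) in simp_all)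
  also have "\<dots> = AT.f \<odot>\<^bsub>T\<^esub> dot T Sr l g" by (rule AT.T.dot_smult[OF fin_Sr fL lL(1) AT.g(1), symmetric])
  also have "\<dots> = AT.f \<odot>\<^bsub>T\<^esub> q \<ominus>\<^bsub>T\<^esub> AT.f \<odot>\<^bsub>T\<^esub> (pr q \<odot>\<^bsub>T\<^esub> p)"
    unfolding l(2)[symmetric] by (rule AT.T.smult_diff_r[OF fL q(1) pp])
  also have "\<dots> = q \<ominus>\<^bsub>T\<^esub> pr q \<odot>\<^bsub>T\<^esub> p"
    unfolding q(2) AT.T.smult_assoc[OF fL prq AT.p(1), symmetric] fpr ..
  finally have "qv x = q" unfolding qv_def ox using AT.T.M_diff_add[OF q(1) pp] by simp
  then show thesis using that x(1,2) by blast
qed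

definition Psi where "Psi x = AT.Phi (cm x) (qv x)"

lemma Psi_mhom: "x \<in> carrier K' \<Longrightarrow> Psi x \<in> mhom L T T"
  unfolding Psi_def by (rule AT.Phi_mhom[OF qv_closed])

lemma Psi_surj: assumes "u \<in> mhom L T T" obtains x where "x \<in> carrier K'" "u = Psi x"
proof -
  obtain c q where q: "q \<in> carrier T" "AT.f \<odot>\<^bsub>T\<^esub> q = q" "u = AT.Phi c q" by (rule AT.Phi_surj[OF assms])
  obtain x where "x \<in> carrier K'" "cm x = c" "qv x = q" by (rule qv_surj[OF q(1,2)])
  then show thesis using that q(3) by (simp add: Psi_def)
qed

lemma Psi_add: "x \<in> carrier K' \<Longrightarrow> y \<in> carrier K' \<Longrightarrow> t \<in> carrier T \<Longrightarrow> Psi (x \<oplus>\<^bsub>K'\<^esub> y) t = Psi x t \<oplus>\<^bsub>T\<^esub> Psi y t"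
  unfolding Psi_def cm_simps by (simp only: qv_add) (rule AT.Phi_add[OF qv_closed qv_closed])

lemma Psi_scal: "x \<in> carrier K' \<Longrightarrow> t \<in> carrier T \<Longrightarrow> Psi (c \<odot>\<^bsub>K'\<^esub> x) t = ks L T c (Psi x t)"
  unfolding Psi_def cm_simps by (simp only: qv_scal) (rule AT.Phi_scal[OF qv_closed])

text \<open>Products of paths are read from left to right while maps compose from right to left;
  hence the opposite algebra in the result.\<close>

lemma Psi_mult: "x \<in> carrier K' \<Longrightarrow> y \<in> carrier K' \<Longrightarrow> t \<in> carrier T \<Longrightarrow> Psi (x \<star> y) t = Psi y (Psi x t)"
  unfolding Psi_def cm_simps by (simp only: qv_mult) (rule AT.Phi_comp[OF qv_closed qv_closed pr_qv, symmetric])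

lemma Psi_one: assumes t: "t \<in> carrier T" shows "Psi \<one>\<^bsub>K'\<^esub> t = t"
proof -
  have one: "\<one>\<^bsub>K'\<^esub> \<in> carrier K'" by (rule K'.one_closed)
  have c: "cm \<one>\<^bsub>K'\<^esub> = 1" using iV by (simp add: cm_def pa_one vx_def new_simps)
  have "om \<one>\<^bsub>K'\<^esub> = F" by (auto simp: om_def pa_one vx_def new_simps fun_eq_iff)
  then have o: "ov \<one>\<^bsub>K'\<^esub> = AT.f" by (simp add: ov_def f_eq)
  have "wm \<one>\<^bsub>K'\<^esub> r = \<zero>\<^bsub>K\<^esub>" for r by (auto simp: wm_def pa_one vx_def pa_simps fun_eq_iff)
  then have "wv \<one>\<^bsub>K'\<^esub> = \<zero>\<^bsub>T\<^esub>" unfolding wv_def using PA.cl_zero AT.g(1) by (intro AT.T.dot_zero_l) simp_all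
  then have "qv \<one>\<^bsub>K'\<^esub> = p" unfolding qv_def o using AT.p by simp
  then show ?thesis unfolding Psi_def c AT.Phi_val[OF t] using t AT.p(1) AT.prc[OF t] by (simp add: AT.T.M.minus_eq AT.T.M.r_neg)
qed

text \<open>\<open>Phi_inj\<close> recovers \<open>cm\<close> and \<open>qv\<close> from the
  endomorphism. Both are additive, so only the difference matters, and for it \<open>Z_I'\<close>
  and \<open>I'_Z\<close> give the two directions.\<close>

lemma Psi_eq_iff: assumes x: "x \<in> carrier K'" and y: "y \<in> carrier K'" shows "Psi x = Psi y \<longleftrightarrow> x \<ominus>\<^bsub>K'\<^esub> y \<in> I'"
proof -
  let ?d = "x \<ominus>\<^bsub>K'\<^esub> y"
  have d: "?d \<in> carrier K'" by (rule K'.minus_closed[OF x y])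
  have dx: "?d \<oplus>\<^bsub>K'\<^esub> y = x" using x y by (simp add: K'.minus_eq K'.a_assoc K'.l_neg)
  have c: "cm x = cm ?d + cm y" using cm_simps(1)[of ?d y] dx by simp
  have q: "qv x = qv ?d \<oplus>\<^bsub>T\<^esub> qv y" using qv_add[OF d y] dx by simp
  show ?thesis
  proof
    assume "?d \<in> I'"
    then show "Psi x = Psi y" unfolding Psi_def c q using I'_Z qv_closed[OF y] by simp
  next
    assume "Psi x = Psi y"
    then have "cm x = cm y" "qv x = qv y"
      using AT.Phi_inj[OF qv_closed[OF x] f_qv[OF x] qv_closed[OF y] f_qv[OF y]] unfolding Psi_def by blast+
    then have "cm ?d = 0" "qv ?d \<oplus>\<^bsub>T\<^esub> qv y = \<zero>\<^bsub>T\<^esub> \<oplus>\<^bsub>T\<^esub> qv y" using c q qv_closed[OF y] by simp_all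
    then show "?d \<in> I'" using Z_I'[OF d] AT.T.M.add.r_cancel_one[OF qv_closed[OF y] qv_closed[OF d]] qv_closed[OF y] by simp
  qed
qed

text \<open>The isomorphism is the inverse of the map induced by \<open>Psi\<close>: an endomorphism
  goes to the class of any of its preimages. \<open>Psi_eq_iff\<close> says both that this class is
  well defined and that the map is injective.\<close>

lemma alg_iso_End: "alg_iso (opp (End_alg L T)) PA'.QA"
proof -
  define h where "h u = PA'.cl (SOME x. x \<in> carrier K' \<and> u = Psi x)" for u
  have h: "h (Psi x) = PA'.cl x" if x: "x \<in> carrier K'" for x
  proof -
    let ?y = "SOME y. y \<in> carrier K' \<and> Psi x = Psi y"
    have y: "?y \<in> carrier K' \<and> Psi x = Psi ?y" by (rule someI[of "\<lambda>y. y \<in> carrier K' \<and> Psi x = Psi y" x]) (use x in blast)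
    have "PA'.cl x = PA'.cl ?y" using PA'.cl_eq[OF x] Psi_eq_iff[OF x] y by blast
    then show ?thesis unfolding h_def by simp
  qed
  let ?A = "opp (End_alg L T)"
  have A: "carrier ?A = mhom L T T" "u \<otimes>\<^bsub>?A\<^esub> v = compose (carrier T) v u"
    "u \<oplus>\<^bsub>?A\<^esub> v = (\<lambda>t\<in>carrier T. u t \<oplus>\<^bsub>T\<^esub> v t)" "\<one>\<^bsub>?A\<^esub> = (\<lambda>t\<in>carrier T. t)"
    "c \<odot>\<^bsub>?A\<^esub> u = (\<lambda>t\<in>carrier T. ks L T c (u t))" for u v c
    by (simp_all add: opp_def End_alg_def ks_def)
  have ex: "\<exists>x. x \<in> carrier K' \<and> u = Psi x" if "u \<in> carrier ?A" for u
    using that unfolding A(1) by (elim Psi_surj) blast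
  have ext: "Psi x = (\<lambda>t\<in>carrier T. v t)" if "x \<in> carrier K'" "\<And>t. t \<in> carrier T \<Longrightarrow> Psi x t = v t" for x v
    by (rule extensionalityI[of _ "carrier T"]) (use Psi_mhom[OF that(1)] that(2) in \<open>auto simp: mhom_iff\<close>)
  have ops: "Psi x \<otimes>\<^bsub>?A\<^esub> Psi y = Psi (x \<star> y)" "Psi x \<oplus>\<^bsub>?A\<^esub> Psi y = Psi (x \<oplus>\<^bsub>K'\<^esub> y)"
    if x: "x \<in> carrier K'" and y: "y \<in> carrier K'" for x y
    unfolding A compose_def
    by (rule ext[symmetric], rule K'.m_closed[OF x y], rule Psi_mult[OF x y], assumption,
        rule ext[symmetric], rule K'.add.m_closed[OF x y], rule Psi_add[OF x y], assumption)
  have one: "\<one>\<^bsub>?A\<^esub> = Psi \<one>\<^bsub>K'\<^esub>" unfolding A by (rule ext[symmetric, OF K'.one_closed Psi_one])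
  have sc: "c \<odot>\<^bsub>?A\<^esub> Psi x = Psi (c \<odot>\<^bsub>K'\<^esub> x)" if x: "x \<in> carrier K'" for c x
    unfolding A by (rule ext[symmetric, OF K'.scal_closed[OF x] Psi_scal[OF x]])
  have "h \<in> ring_hom ?A PA'.QA"
  proof (rule ring_hom_memI)
    fix u assume "u \<in> carrier ?A"
    then obtain x where x: "x \<in> carrier K'" "u = Psi x" using ex by blast
    show "h u \<in> carrier PA'.QA" unfolding x(2) h[OF x(1)] by (rule PA'.cl_closed[OF x(1)])
    fix v assume "v \<in> carrier ?A"
    then obtain y where y: "y \<in> carrier K'" "v = Psi y" using ex by blast
    show "h (u \<otimes>\<^bsub>?A\<^esub> v) = h u \<otimes>\<^bsub>PA'.QA\<^esub> h v"
      unfolding x(2) y(2) ops[OF x(1) y(1)] h[OF x(1)] h[OF y(1)] h[OF K'.m_closed[OF x(1) y(1)]] by (rule PA'.cl_mult[OF x(1) y(1)])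
    show "h (u \<oplus>\<^bsub>?A\<^esub> v) = h u \<oplus>\<^bsub>PA'.QA\<^esub> h v"
      unfolding x(2) y(2) ops[OF x(1) y(1)] h[OF x(1)] h[OF y(1)] h[OF K'.add.m_closed[OF x(1) y(1)]] by (rule PA'.cl_add[OF x(1) y(1)])
  next
    show "h \<one>\<^bsub>?A\<^esub> = \<one>\<^bsub>PA'.QA\<^esub>" unfolding one h[OF K'.one_closed] by (rule PA'.cl_one)
  qed
  moreover have "bij_betw h (carrier ?A) (carrier PA'.QA)"
  proof (rule bij_betw_imageI)
    show "inj_on h (carrier ?A)"
    proof (rule inj_onI)
      fix u v assume u: "u \<in> carrier ?A" and v: "v \<in> carrier ?A" and eq: "h u = h v"
      obtain x where x: "x \<in> carrier K'" "u = Psi x" using ex[OF u] by blast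
      obtain y where y: "y \<in> carrier K'" "v = Psi y" using ex[OF v] by blast
      show "u = v" using eq unfolding x(2) y(2) h[OF x(1)] h[OF y(1)] PA'.cl_eq[OF x(1) y(1)] Psi_eq_iff[OF x(1) y(1)] .
    qed
    show "h ` carrier ?A = carrier PA'.QA"
    proof
      show "h ` carrier ?A \<subseteq> carrier PA'.QA"
      proof
        fix X assume "X \<in> h ` carrier ?A"
        then obtain u where u: "u \<in> mhom L T T" "X = h u" using A(1) by blast
        obtain x where x: "x \<in> carrier K'" "u = Psi x" using ex u(1) unfolding A(1) by blast
        show "X \<in> carrier PA'.QA" unfolding u(2) x(2) h[OF x(1)] by (rule PA'.cl_closed[OF x(1)])
      qed
      show "carrier PA'.QA \<subseteq> h ` carrier ?A"
      proof
        fix X assume "X \<in> carrier PA'.QA"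
        then obtain x where x: "x \<in> carrier K'" "X = PA'.cl x" using PA'.QA_carrier by blast
        show "X \<in> h ` carrier ?A" unfolding x(2) h[OF x(1), symmetric] A(1) by (rule imageI[OF Psi_mhom[OF x(1)]])
      qed
    qed
  qed
  ultimately have "h \<in> ring_iso ?A PA'.QA" unfolding ring_iso_def by blast
  moreover have "h (c \<odot>\<^bsub>?A\<^esub> u) = c \<odot>\<^bsub>PA'.QA\<^esub> h u" if u: "u \<in> carrier ?A" for c u
  proof -
    obtain x where x: "x \<in> carrier K'" "u = Psi x" using ex[OF u] by blast
    show ?thesis unfolding x(2) sc[OF x(1)] h[OF x(1)] h[OF K'.scal_closed[OF x(1)]] by (rule PA'.cl_scal[OF x(1)])
  qed
  ultimately show ?thesis unfolding alg_iso_def by blast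
qed

end

text \<open>The left ideal generated by the trivial path at i is spanned over k by the class of that
  path, the only one ending in the source; \<pi> is its image in P under an isomorphism.\<close>

lemma (in bq) apr_mod_L:
  assumes fd: "fdmod L (reg_mod L)" and P: "fdmod L P" "mod_iso L P (proj_at Q R i)"
  obtains \<pi> where "over_L apr_mod P \<pi>"
proof -
  interpret ap: apr L "cl E" Sa Sr "\<lambda>a. cl (vx {tgt Q a})" "\<lambda>r. cl (vx {rel_tgt Q r})" "\<lambda>a. cl (arr Q a)"
    "\<lambda>a r. cl (rel_comp Q r a)" "\<lambda>m. cl ` J m" by (rule apr_L[OF fd])
  have kP: "kmod L P" by (rule L.fdmod_kmod[OF P(1)])
  let ?M = "proj_at Q R i"
  have M: "carrier ?M = {x \<bullet> cl E | x. x \<in> carrier L}" "\<zero>\<^bsub>?M\<^esub> = \<zero>\<^bsub>L\<^esub>" "a \<odot>\<^bsub>?M\<^esub> x = a \<bullet> x" for a x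
    by (simp_all add: proj_at_def left_ideal_mod_def mk_module_def bound_path_algebra_def vx_single)
  obtain h h' where h: "lin L P ?M h" "lin L ?M P h'" "\<And>x. x \<in> carrier P \<Longrightarrow> h' (h x) = x" "\<And>y. y \<in> carrier ?M \<Longrightarrow> h (h' y) = y"
    by (rule mod_iso_inverse[OF kP P(2)], rule that) simp_all
  interpret P: kmod L P by (rule kP)
  have eM: "cl E \<in> carrier ?M" unfolding M(1) using ap.ei by (auto intro!: exI[of _ "cl E"])
  have \<pi>: "h' (cl E) \<in> carrier P" by (rule linD(1)[OF h(2) eM])
  show thesis
  proof (rule that, intro apr_mod.intro apr_mod_axioms.intro)
    show "over_L apr" by (rule apr_L[OF fd])
    show "fdmod L P" by (rule P(1))
    show "h' (cl E) \<in> carrier P" by (rule \<pi>)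
    show "cl E \<odot>\<^bsub>P\<^esub> h' (cl E) = h' (cl E)" using linD(3)[OF h(2) ap.ei(1) eM] ap.ei(2) M(3) by simp
    show "h' (cl E) \<noteq> \<zero>\<^bsub>P\<^esub>"
    proof
      assume z: "h' (cl E) = \<zero>\<^bsub>P\<^esub>"
      have "\<zero>\<^bsub>L\<^esub> \<odot>\<^bsub>P\<^esub> \<zero>\<^bsub>P\<^esub> = \<zero>\<^bsub>P\<^esub>" by simp
      then have "h \<zero>\<^bsub>P\<^esub> = \<zero>\<^bsub>L\<^esub> \<bullet> h \<zero>\<^bsub>P\<^esub>" using linD(3)[OF h(1) L.zero_closed P.M.zero_closed] M(3) by simp
      moreover have "h \<zero>\<^bsub>P\<^esub> = cl E" using h(4)[OF eM] z by simp
      ultimately show False using ap.ei_nz ap.ei(1) by simp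
    qed
    show "\<exists>c. x = ks L P c (h' (cl E))" if x: "x \<in> carrier P" for x
    proof -
      obtain y where y: "y \<in> carrier L" "h x = y \<bullet> cl E" using linD(1)[OF h(1) x] M(1) by blast
      obtain c where "y \<bullet> cl E = c \<odot>\<^bsub>L\<^esub> cl E" using ap.A_ei[OF y(1)] by blast
      then have "h x = (c \<odot>\<^bsub>L\<^esub> \<one>\<^bsub>L\<^esub>) \<odot>\<^bsub>?M\<^esub> cl E" using y(2) M(3) ap.ei(1) by (simp add: L.scal_mult_l)
      then have "x = h' ((c \<odot>\<^bsub>L\<^esub> \<one>\<^bsub>L\<^esub>) \<odot>\<^bsub>?M\<^esub> cl E)" using h(3)[OF x] by simp
      also have "\<dots> = ks L P c (h' (cl E))" unfolding ks_def by (rule linD(3)[OF h(2) _ eM]) simp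
      finally show ?thesis by blast
    qed
  qed
qed

theorem theorem3p11:
  fixes Q :: "('v, 'e) quiver"
    and R :: "(('v, 'e) path \<Rightarrow> 'k::field) set"
    and i :: 'v
    and P :: "((('v, 'e) path \<Rightarrow> 'k) set, 'p) module"
    and T :: "((('v, 'e) path \<Rightarrow> 'k) set, 't) module"
  defines "\<Lambda> \<equiv> bound_path_algebra Q R"
  assumes "bound_quiver Q R"
    and "fdmod \<Lambda> (reg_mod \<Lambda>)"
    and "minimal_relations Q R"
    and "is_source Q i"
    and "simple_mod \<Lambda> P"
    and "projective_mod \<Lambda> P"
    and "mod_iso \<Lambda> P (proj_at Q R i)"
    and "gives_2APR \<Lambda> P"
    and "is_2APR_module \<Lambda> P T"
  shows "alg_iso (opp (End_alg \<Lambda> T))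
           (bound_path_algebra (new_quiver Q R i) (new_relations Q R i))"
proof -
  interpret bq Q R i by (rule bq.intro) (fact assms)+
  have L: "\<Lambda> = L" unfolding \<Lambda>_def bound_path_algebra_def ..
  have fdP: "fdmod L P" using assms(6) unfolding L simple_mod_def by blast
  obtain \<pi> where \<pi>: "over_L apr_mod P \<pi>"
    by (rule apr_mod_L[OF assms(3)[unfolded L] fdP assms(8)[unfolded L]])
  obtain g p pr where "over_L apr_tilt P \<pi> T g p pr"
    by (rule apr_mod.tilting_structure[OF \<pi> assms(10)[unfolded L] assms(9)[unfolded L]])
  then interpret bq_tilt Q R i P \<pi> T g p pr
    by (intro bq_tilt.intro bq_tilt_axioms.intro bq_axioms)
  show ?thesis using alg_iso_End unfolding L bound_path_algebra_def .
qed

end
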